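(* Let $q\equiv 1 \bmod 6$ be a prime power and let $\epsilon>0$. For any $0<s<1$ with $s\neq\frac13$, $$\frac{1}{|\mathfrak{H}(3g)|}\sum_{\chi\in\mathfrak{H}(3g)}L(s,\chi)=M_q(s)+O_\epsilon\left(q^{\frac{3}{10}(1-6s+\epsilon)g}+q^{-\frac15(1+9s-15\epsilon)g+2-2s}+q^{(1-3s)g}E_s(g)\right),$$ where $$M_q(s)=\zeta_q(3s)\prod_P\left(1-\frac{1}{|P|^{3s}(|P|+1)}\right),\qquad E_s(g)=\begin{cases}1 & s<\frac23\\ g^2 & s=\frac23\\ g\,q^{\frac65(3s-2)g} & s>\frac23.\end{cases}$$ If $s=\frac13$, then $$\frac{1}{|\mathfrak{H}(3g)|}\sum_{\chi\in\mathfrak{H}(3g)}L(\tfrac13,\chi)=C_q\,(g+B_q)+O(1),$$ where the $O(1)$ is absolute (it does not depend on $q$ or $g$) as long as $g\ge 2$, $$C_q=\prod_P\left(1-\frac{1}{|P|(|P|+1)}\right),$$ and $$B_q=\frac23-\frac1{q-1}+\sum_P\frac{\deg P}{|P|^2+|P|-1}+\sum_P \deg P\,\frac{|P|+2}{|P|^3+2|P|^2-1}.$$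
   Context: Let $q$ be a prime power with $q\equiv1\bmod 6$. $\mathcal M$ is the set of monic polynomials in $\mathbb F_q[T]$; $|F|=q^{\deg F}$; $P$ always denotes a monic irreducible polynomial (prime), and products and sums over $P$ run over all of them. $\zeta_q(s)=(1-q^{1-s})^{-1}$. Cubic characters: fix an isomorphism $\Omega$ from the cube roots of unity in $\mathbb F_q^*$ to $\mu_3=\{1,\xi_3,\xi_3^2\}\subset\mathbb C^*$, $\xi_3=e^{2\pi i/3}$. For a prime $P$ and $a\in\mathbb F_q[T]$, put $\chi_P(a)=0$ if $P\mid a$, and otherwise $\chi_P(a)=\alpha\in\mu_3$ where $a^{(q^{\deg P}-1)/3}\equiv\Omega^{-1}(\alpha)\bmod P$. For monic $F=P_1^{e_1}\cdots P_k^{e_k}$ put $\chi_F(a)=\prod_i\chi_{P_i}(a)^{e_i}$; this is the cubic residue symbol $\left(\frac{\cdot}{F}\right)_3$. The genus of a primitive cubic character $\chi$ is $\deg\mathrm{cond}(\chi)-2+\delta_\chi$, where $\delta_\chi=0$ if $\chi$ is trivial on $\mathbb F_q^*$ (even) and $\delta_\chi=1$ otherwise (odd). $\mathfrak H(3g)$ is the set of characters $\chi_F$ of genus $3g$ with $F$ monic square-free; equivalently $\mathfrak H(3g)=\{\chi_F: F \text{ monic square-free},\ \deg F=3g+1\}$ (here $g$ is a positive integer). $L(s,\chi)=\sum_{F\in\mathcal M}\chi(F)|F|^{-s}$, which for nontrivial $\chi$ is a polynomial in $q^{-s}$ (grouping the terms by degree) and so is defined for all $s$. Convention: $s$ is fixed;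 implied constants do not depend on $q$ or $g$ (those in $O_\epsilon$ may depend on $\epsilon$ and on the fixed $s$). *)

theory Defs
  imports "HOL-Analysis.Infinite_Sum" "HOL-Algebra.Polynomial_Divisibility"
begin

text \<open>
  The finite field is an algebraic structure \<open>R\<close> with explicit carrier rather than a type: the
  implied constants have to be chosen before \<open>q\<close>, and a quantifier over finite fields of varying
  size can only range over structures on one fixed type. Any infinite type (for example
  \<open>nat\<close>) carries all finite fields up to isomorphism. A polynomial over \<open>R\<close> is the
  list of its coefficients with the leading one first; the empty list is the zero polynomial.
\<close>

definition monic_polys :: "'a ring \<Rightarrow> 'a list set" where
  "monic_polys R =
     {f \<in> carrier (poly_ring R). f \<noteq> [] \<and> Polynomials.lead_coeff f = \<one>\<^bsub>R\<^esub>}"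

definition monic_primes :: "'a ring \<Rightarrow> 'a list set" where
  "monic_primes R = {P \<in> monic_polys R. pirreducible\<^bsub>R\<^esub> (carrier R) P}"

definition poly_norm :: "'a ring \<Rightarrow> 'a list \<Rightarrow> real" where
  "poly_norm R f = real (card (carrier R)) ^ Polynomials.degree f"

definition squarefree_poly :: "'a ring \<Rightarrow> 'a list \<Rightarrow> bool" where
  "squarefree_poly R f \<longleftrightarrow>
     (\<forall>d \<in> carrier (poly_ring R).
        (d \<otimes>\<^bsub>poly_ring R\<^esub> d) pdivides\<^bsub>R\<^esub> f \<longrightarrow> d \<in> Units (poly_ring R))"

definition poly_cong :: "'a ring \<Rightarrow> 'a list \<Rightarrow> 'a list \<Rightarrow> 'a list \<Rightarrow> bool" where
  "poly_cong R N a b \<longleftrightarrow> N pdivides\<^bsub>R\<^esub> (a \<ominus>\<^bsub>poly_ring R\<^esub> b)"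

definition prime_exponent :: "'a ring \<Rightarrow> 'a list \<Rightarrow> 'a list \<Rightarrow> nat" where
  "prime_exponent R P f = (GREATEST e. (P [^]\<^bsub>poly_ring R\<^esub> e) pdivides\<^bsub>R\<^esub> f)"

definition cube_roots_of_unity :: "'a ring \<Rightarrow> 'a set" where
  "cube_roots_of_unity R = {x \<in> carrier R. x [^]\<^bsub>R\<^esub> (3::nat) = \<one>\<^bsub>R\<^esub>}"

definition mu3 :: "complex set" where
  "mu3 = (let \<xi> = exp (2 * complex_of_real pi * \<i> / 3) in {1, \<xi>, \<xi>\<^sup>2})"

definition cube_root_iso :: "'a ring \<Rightarrow> ('a \<Rightarrow> complex) \<Rightarrow> bool" where
  "cube_root_iso R \<Omega> \<longleftrightarrow>
     bij_betw \<Omega> (cube_roots_of_unity R) mu3 \<and>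
     (\<forall>x \<in> cube_roots_of_unity R. \<forall>y \<in> cube_roots_of_unity R.
        \<Omega> (x \<otimes>\<^bsub>R\<^esub> y) = \<Omega> x * \<Omega> y)"

definition cubic_residue_prime ::
    "'a ring \<Rightarrow> ('a \<Rightarrow> complex) \<Rightarrow> 'a list \<Rightarrow> 'a list \<Rightarrow> complex" where
  "cubic_residue_prime R \<Omega> P a =
     (if P pdivides\<^bsub>R\<^esub> a then 0
      else (THE \<alpha>. \<alpha> \<in> mu3 \<and>
        poly_cong R P
          (a [^]\<^bsub>poly_ring R\<^esub> ((card (carrier R) ^ Polynomials.degree P - 1) div 3))
          (ring.poly_of_const R (inv_into (cube_roots_of_unity R) \<Omega> \<alpha>))))"

definition cubic_char ::
    "'a ring \<Rightarrow> ('a \<Rightarrow> complex) \<Rightarrow> 'a list \<Rightarrow> 'a list \<Rightarrow> complex" where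
  "cubic_char R \<Omega> f a =
     (\<Prod>P | P \<in> monic_primes R \<and> P pdivides\<^bsub>R\<^esub> f.
        cubic_residue_prime R \<Omega> P a ^ prime_exponent R P f)"

text \<open>
  A Dirichlet character is a function on polynomials that vanishes exactly at the elements not
  coprime to its modulus. It is induced from modulus \<open>N\<close> if on its support it only depends
  on the residue class mod \<open>N\<close>; the conductor is the smallest such \<open>N\<close>.
\<close>

definition induced_modulus :: "'a ring \<Rightarrow> ('a list \<Rightarrow> complex) \<Rightarrow> 'a list \<Rightarrow> bool" where
  "induced_modulus R \<chi> N \<longleftrightarrow>
     (\<forall>a \<in> carrier (poly_ring R). \<forall>b \<in> carrier (poly_ring R).
        \<chi> a \<noteq> 0 \<and> \<chi> b \<noteq> 0 \<and> poly_cong R N a b \<longrightarrow> \<chi> a = \<chi> b)"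

definition conductor :: "'a ring \<Rightarrow> ('a list \<Rightarrow> complex) \<Rightarrow> 'a list" where
  "conductor R \<chi> =
     (ARG_MIN Polynomials.degree N. N \<in> monic_polys R \<and> induced_modulus R \<chi> N)"

definition even_char :: "'a ring \<Rightarrow> ('a list \<Rightarrow> complex) \<Rightarrow> bool" where
  "even_char R \<chi> \<longleftrightarrow>
     (\<forall>c \<in> carrier R - {\<zero>\<^bsub>R\<^esub>}. \<chi> (ring.poly_of_const R c) = 1)"

definition char_genus :: "'a ring \<Rightarrow> ('a list \<Rightarrow> complex) \<Rightarrow> int" where
  "char_genus R \<chi> =
     int (Polynomials.degree (conductor R \<chi>)) - 2 + (if even_char R \<chi> then 0 else 1)"

definition cubic_family ::
    "'a ring \<Rightarrow> ('a \<Rightarrow> complex) \<Rightarrow> nat \<Rightarrow> ('a list \<Rightarrow> complex) set" where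
  "cubic_family R \<Omega> n =
     {cubic_char R \<Omega> f | f. f \<in> monic_polys R \<and> squarefree_poly R f \<and>
        char_genus R (cubic_char R \<Omega> f) = int n}"

text \<open>
  Grouped by degree: for nontrivial \<open>\<chi>\<close> all but finitely many terms of the outer series
  vanish, so this is the polynomial in \<open>q powr (-s)\<close> also where the Dirichlet series over
  all monic polynomials does not converge.
\<close>

definition dirichlet_L :: "'a ring \<Rightarrow> real \<Rightarrow> ('a list \<Rightarrow> complex) \<Rightarrow> complex" where
  "dirichlet_L R s \<chi> =
     (\<Sum>n. \<Sum>f | f \<in> monic_polys R \<and> Polynomials.degree f = n.
        \<chi> f * complex_of_real (poly_norm R f powr (- s)))"

definition first_moment :: "'a ring \<Rightarrow> ('a \<Rightarrow> complex) \<Rightarrow> nat \<Rightarrow> real \<Rightarrow> complex" where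
  "first_moment R \<Omega> g s =
     (1 / of_nat (card (cubic_family R \<Omega> (3 * g)))) *
     (\<Sum>\<chi> \<in> cubic_family R \<Omega> (3 * g). dirichlet_L R s \<chi>)"

text \<open>The unordered infinite product, the multiplicative analogue of \<^const>\<open>infsum\<close>.\<close>

definition infprod_on :: "('b \<Rightarrow> real) \<Rightarrow> 'b set \<Rightarrow> real" where
  "infprod_on f A = Lim (finite_subsets_at_top A) (prod f)"

definition zeta_q :: "real \<Rightarrow> real \<Rightarrow> real" where
  "zeta_q q s = 1 / (1 - q powr (1 - s))"

definition M_main :: "'a ring \<Rightarrow> real \<Rightarrow> real" where
  "M_main R s = zeta_q (real (card (carrier R))) (3 * s) *
     infprod_on (\<lambda>P. 1 - 1 / (poly_norm R P powr (3 * s) * (poly_norm R P + 1)))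
       (monic_primes R)"

definition E_err :: "real \<Rightarrow> real \<Rightarrow> nat \<Rightarrow> real" where
  "E_err q s g =
     (if s < 2 / 3 then 1
      else if s = 2 / 3 then real g ^ 2
      else real g * q powr (6 / 5 * (3 * s - 2) * real g))"

definition C_const :: "'a ring \<Rightarrow> real" where
  "C_const R =
     infprod_on (\<lambda>P. 1 - 1 / (poly_norm R P * (poly_norm R P + 1))) (monic_primes R)"

definition B_const :: "'a ring \<Rightarrow> real" where
  "B_const R =
     2 / 3 - 1 / (real (card (carrier R)) - 1)
     + (\<Sum>\<^sub>\<infinity>P\<in>monic_primes R.
          real (Polynomials.degree P) / (poly_norm R P ^ 2 + poly_norm R P - 1))
     + (\<Sum>\<^sub>\<infinity>P\<in>monic_primes R.
          real (Polynomials.degree P) *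
            ((poly_norm R P + 2) / (poly_norm R P ^ 3 + 2 * poly_norm R P ^ 2 - 1)))"

end

theory Submission
  imports Defs "HOL-Algebra.Multiplicative_Group"
begin

text \<open>
  Let \<open>N = 3g + 1\<close> and \<open>m = 3g - n\<close>. The coefficient of \<open>q\<^sup>-\<^sup>n\<^sup>s\<close> in the average is the sum of \<open>\<chi>\<^sub>F(f)\<close> over squarefree
  \<open>F\<close> of degree \<open>N\<close> and monic \<open>f\<close> of degree \<open>n\<close>, divided by the number of \<open>F\<close>. Cubes \<open>f = h\<^sup>3\<close> only impose a
  coprimality condition on \<open>F\<close> and give the main term.

  For the other \<open>f\<close>, squarefreeness is detected by \<open>\<Sum> \<mu>(D)\<close> over \<open>D\<^sup>2\<close> dividing \<open>F\<close>. If \<open>2 deg D \<le> m + 1\<close>, the sum over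
  \<open>F\<close> runs over complete residue systems modulo \<open>f\<close> and vanishes. Otherwise Poisson summation, over \<open>f\<close>
  modulo \<open>F\<close> or, after cubic reciprocity, over \<open>F\<close> modulo \<open>f\<close>, leads to sums \<open>A\<^sub>k(N)\<close> of the cubic Gauss sums
  \<open>G(k,F)\<close> over all monic \<open>F\<close> of degree \<open>N\<close>, with local conditions at the primes dividing \<open>D\<close>.

  The theory of metaplectic Eisenstein series is replaced by an elementary functional equation. Inverting the
  residue classes in \<open>G(k,F)\<close> and using \<open>e(k a'/F) = e(-k F'/a) e(k/(aF))\<close>, where \<open>a a' + F F' = 1\<close>, one can sum over
  \<open>F\<close> first and express \<open>A\<^sub>k(N)\<close> by the \<open>A\<^sub>k(j)\<close> with \<open>j < N\<close>. Comparing \<open>N + 3\<close> with \<open>N\<close>, this improves the trivial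
  bound \<open>q\<^sup>3\<^sup>N\<^sup>/\<^sup>2\<close> to \<open>|A\<^sub>k(N)| \<le> C q\<^sup>4\<^sup>N\<^sup>/\<^sup>3 q\<^bsup>deg k/12 + 1/2\<^esup>\<close> for all \<open>N\<close>. The noncubes then contribute at most
  \<open>C (m + 1)\<^sup>6 q\<^bsup>g - 2m/3\<^esup>\<close> to the \<open>n\<close>-th coefficient.
\<close>

section \<open>Monic polynomials over a finite field\<close>

text \<open>The size \<open>q powr (g - 2 m / 3)\<close> is what the statement asks for: times
  \<open>q powr (- s n)\<close> it is q^((1-3s)g) q^((s-2/3)m), and the sum over m is the third
  error term up to powers of m. With the trivial bound q^(3N/2) for the sums of Gauss sums, neither
  Poisson summation reaches it when m is small against g.

  The exponent 4/3 comes from the recursion: A_k(N) / q^N gains a factor q in three steps, apart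
  from errors that decay. The functional equation requires deg k < 2N, and in the first three
  admissible steps the trivial bound leaves q^(N/6) with N at most deg k / 2 + 3. This is the factor
  q^(deg k / 12 + 1/2).

  Summing over D is the other difficulty. Each D of degree d has to save q^(-d) against the number
  of such D, so its local conditions cannot be estimated trivially; two estimates with overlapping
  ranges of d achieve this. A prime of D costs a factor of at most 6, and over all D of one degree
  this amounts to (m + 1)^5. All constants must be independent of q; the numerical inequalities rest
  on q >= 7, such as q^(-1/2) <= 1/2 and 7^5 > 2^12.\<close>

locale fin_field = field R for R :: "'a ring" (structure) +
  assumes fin: "finite (carrier R)"
begin

sublocale UP: principal_domain "poly_ring R"
  by (rule univ_poly_is_principal[OF carrier_is_subfield])

abbreviation "C \<equiv> carrier (poly_ring R)"
abbreviation padd (infixl "+." 65) where "a +. b \<equiv> a \<oplus>\<^bsub>poly_ring R\<^esub> b"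
abbreviation psub (infixl "-." 65) where "a -. b \<equiv> a \<ominus>\<^bsub>poly_ring R\<^esub> b"
abbreviation pneg ("-. _" [81] 80) where "-. b \<equiv> \<ominus>\<^bsub>poly_ring R\<^esub> b"
abbreviation pmul (infixl "*." 70) where "a *. b \<equiv> a \<otimes>\<^bsub>poly_ring R\<^esub> b"
abbreviation ppow (infixr "^." 75) where "a ^. n \<equiv> a [^]\<^bsub>poly_ring R\<^esub> (n::nat)"
abbreviation pone ("\<one>\<^sub>P") where "\<one>\<^sub>P \<equiv> \<one>\<^bsub>poly_ring R\<^esub>"

lemma pone_eq: "\<one>\<^sub>P = [\<one>]" by (rule univ_poly_one)
lemma pzero_eq: "\<zero>\<^bsub>poly_ring R\<^esub> = []" by (rule univ_poly_zero)

lemma zero_C [simp]: "[] \<in> C" by (rule univ_poly_zero_closed)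
lemma add_nil [simp]: "x \<in> C \<Longrightarrow> x +. [] = x" "x \<in> C \<Longrightarrow> [] +. x = x"
  using UP.r_zero UP.l_zero by (simp_all add: pzero_eq)
lemma mul_nil [simp]: "x \<in> C \<Longrightarrow> x *. [] = []" "x \<in> C \<Longrightarrow> [] *. x = []"
  using UP.r_null UP.l_null by (simp_all add: pzero_eq)
lemma neg_nil [simp]: "-. [] = []"
  using UP.minus_zero by (simp add: pzero_eq)
lemma sub_nil [simp]: "x \<in> C \<Longrightarrow> x -. [] = x" "x \<in> C \<Longrightarrow> x -. x = []"
  by (simp_all add: UP.minus_eq UP.r_neg pzero_eq)

lemma C_iff: "u \<in> C \<longleftrightarrow> u = [] \<or> (set u \<subseteq> carrier R \<and> hd u \<noteq> \<zero>)"
  by (simp add: univ_poly_carrier[symmetric] polynomial_def)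

lemma C_set: "u \<in> C \<Longrightarrow> set u \<subseteq> carrier R" by (auto simp: C_iff)
lemma hd_C [simp]: "u \<in> C \<Longrightarrow> u \<noteq> [] \<Longrightarrow> hd u \<in> carrier R" "u \<in> C \<Longrightarrow> u \<noteq> [] \<Longrightarrow> hd u \<noteq> \<zero>"
  by (auto simp: C_iff)

lemma mul_eq_nil [simp]: "u \<in> C \<Longrightarrow> v \<in> C \<Longrightarrow> u *. v = [] \<longleftrightarrow> u = [] \<or> v = []"
  using UP.integral_iff by (simp add: pzero_eq)

text \<open>Sizes are mostly measured by \<open>length\<close>: \<open>degree\<close> is 0 both for
  [] and for nonzero constants, while \<open>length\<close> is 0 only for the zero polynomial, so
  that bounds on it also detect vanishing.\<close>

lemma length_mul: 
  assumes "u \<in> C" "v \<in> C" "u \<noteq> []" "v \<noteq> []"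
  shows "length (u *. v) = length u + length v - 1"
proof -
  have "length (u *. v) - 1 = length u - 1 + (length v - 1)"
    using poly_mult_degree_eq[OF carrier_is_subring, of u v] assms
    by (simp add: univ_poly_mult univ_poly_carrier)
  moreover have "u *. v \<noteq> []" using assms by simp
  moreover have "length u > 0" "length v > 0" "length (u *. v) > 0" using assms calculation by auto
  ultimately show ?thesis by linarith
qed

lemma degree_mul: 
  assumes "u \<in> C" "v \<in> C" "u \<noteq> []" "v \<noteq> []"
  shows "degree (u *. v) = degree u + degree v"
proof -
  have "length u > 0" "length v > 0" using assms by auto
  then show ?thesis using length_mul[OF assms] by linarith
qed

lemma hd_mul: 
  assumes "u \<in> C" "v \<in> C" "u \<noteq> []" "v \<noteq> []"
  shows "hd (u *. v) = hd u \<otimes> hd v"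
  using poly_mult_lead_coeff[OF carrier_is_subring, of u v] assms
    by (simp add: univ_poly_mult univ_poly_carrier)

lemma length_add_le: "length (u +. v) \<le> max (length u) (length v)"
  using poly_add_length_le by (simp add: univ_poly_add)

lemma length_add_eq: 
  assumes "u \<in> C" "v \<in> C" "length v < length u"
  shows "length (u +. v) = length u"
  using poly_add_length_eq[OF carrier_is_subring, of u v] assms 
  by (simp add: univ_poly_add univ_poly_carrier max_def)

lemma coeff_add: 
  assumes "u \<in> C" "v \<in> C" 
  shows "coeff (u +. v) i = coeff u i \<oplus> coeff v i"
  using poly_add_coeff[of u v] assms C_set by (simp add: univ_poly_add)

lemma hd_coeff: "u \<noteq> [] \<Longrightarrow> hd u = coeff u (length u - 1)"
  by (cases u) auto

lemma hd_add_eq: 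
  assumes "u \<in> C" "v \<in> C" "length v < length u"
  shows "hd (u +. v) = hd u"
proof -
  have l: "length (u +. v) = length u" by (rule length_add_eq[OF assms])
  have ne: "u \<noteq> []" "u +. v \<noteq> []" using l assms(3) by auto
  have "hd (u +. v) = coeff u (length u - 1) \<oplus> coeff v (length u - 1)"
    using hd_coeff[OF ne(2)] l coeff_add[OF assms(1,2)] by simp
  also have "coeff v (length u - 1) = \<zero>" using assms(3) by (intro coeff_length) auto
  finally show ?thesis using ne assms hd_coeff[OF ne(1)] by (metis hd_C(1) r_zero)
qed

lemma length_neg [simp]: "u \<in> C \<Longrightarrow> length (-. u) = length u"
  by (rule univ_poly_a_inv_length[OF carrier_is_subring])
lemma hd_neg: "u \<in> C \<Longrightarrow> u \<noteq> [] \<Longrightarrow> hd (-. u) = \<ominus> hd u"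
  by (simp add: univ_poly_a_inv_def'[OF carrier_is_subring] hd_map)
lemma neg_eq_nil [simp]: "u \<in> C \<Longrightarrow> -. u = [] \<longleftrightarrow> u = []"
  using length_neg by (metis length_0_conv)

lemma length_sub_le: "u \<in> C \<Longrightarrow> v \<in> C \<Longrightarrow> length (u -. v) \<le> max (length u) (length v)"
  using length_add_le[of u "-. v"] by (simp add: UP.minus_eq)

lemma length_sub_less:
  assumes "u \<in> C" "v \<in> C" "length u = length v" "hd u = hd v" "u \<noteq> []"
  shows "length (u -. v) < length u"
proof (rule ccontr)
  assume "\<not> ?thesis"
  then have l: "length (u -. v) = length u"
    using length_sub_le[OF assms(1,2)] assms(3) by simp
  then have ne: "u -. v \<noteq> []" using assms(5) by auto
  have vn: "v \<noteq> []" using assms by auto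
  have "hd (u -. v) = coeff u (length u - 1) \<oplus> coeff (-. v) (length u - 1)"
    using hd_coeff[OF ne] l coeff_add[of u "-. v"] assms by (simp add: UP.minus_eq)
  also have "coeff u (length u - 1) = hd u" using assms hd_coeff by metis
  also have "coeff (-. v) (length u - 1) = \<ominus> hd v" 
    using assms hd_coeff[of "-. v"] vn by (simp add: hd_neg)
  finally have "hd (u -. v) = \<zero>" using assms vn by (simp add: r_neg)
  then show False using ne assms by (metis UP.minus_closed hd_C(2))
qed

lemma inv_nz: 
  assumes "c \<in> carrier R" "c \<noteq> \<zero>" 
  shows "inv c \<in> carrier R" "inv c \<noteq> \<zero>" "c \<otimes> inv c = \<one>" "inv c \<otimes> c = \<one>"
proof -
  have u: "c \<in> Units R" using assms by (simp add: field_Units)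
  show "inv c \<in> carrier R" "c \<otimes> inv c = \<one>" "inv c \<otimes> c = \<one>" using u by auto
  then show "inv c \<noteq> \<zero>" using assms by auto
qed
lemma const_C [simp]: "c \<in> carrier R \<Longrightarrow> c \<noteq> \<zero> \<Longrightarrow> [c] \<in> C"
  by (auto simp: C_iff)
lemma const_mul: "c \<in> carrier R \<Longrightarrow> d \<in> carrier R \<Longrightarrow> c \<noteq> \<zero> \<Longrightarrow> d \<noteq> \<zero> \<Longrightarrow> [c] *. [d] = [c \<otimes> d]"
  using poly_mult_const(1)[OF carrier_is_subring, of "[d]" c] by (auto simp: univ_poly_mult polynomial_def)
lemma length_const_mul [simp]:
  "c \<in> carrier R \<Longrightarrow> c \<noteq> \<zero> \<Longrightarrow> u \<in> C \<Longrightarrow> length ([c] *. u) = length u"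
  by (cases "u = []") (auto simp: length_mul)
lemma hd_const_mul:
  "c \<in> carrier R \<Longrightarrow> c \<noteq> \<zero> \<Longrightarrow> u \<in> C \<Longrightarrow> u \<noteq> [] \<Longrightarrow> hd ([c] *. u) = c \<otimes> hd u"
  by (simp add: hd_mul)

section \<open>Divisibility and division with remainder\<close>

lemma dvd_iff: "a pdivides b \<longleftrightarrow> (\<exists>c\<in>C. b = a *. c)"
  by (simp add: pdivides_def factor_def)
lemma dvdI: "c \<in> C \<Longrightarrow> b = a *. c \<Longrightarrow> a pdivides b" by (auto simp: dvd_iff)
lemma dvd_refl [simp]: "a \<in> C \<Longrightarrow> a pdivides a" by (rule dvdI[of "\<one>\<^sub>P"]) auto
lemma one_dvd [simp]: "a \<in> C \<Longrightarrow> \<one>\<^sub>P pdivides a" by (rule dvdI[of a]) auto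
lemma dvd_nil [simp]: "a \<in> C \<Longrightarrow> a pdivides []" by (rule dvdI[of "[]"]) auto
lemma nil_dvd [simp]: "a \<in> C \<Longrightarrow> [] pdivides a \<longleftrightarrow> a = []" by (auto simp: dvd_iff)
lemma dvd_trans: "a \<in> C \<Longrightarrow> a pdivides b \<Longrightarrow> b pdivides c \<Longrightarrow> a pdivides c"
  by (auto simp: dvd_iff UP.m_assoc intro!: UP.m_closed)
lemma dvd_mulI: "a \<in> C \<Longrightarrow> b \<in> C \<Longrightarrow> a pdivides b \<Longrightarrow> c \<in> C \<Longrightarrow> a pdivides (b *. c)"
  "a \<in> C \<Longrightarrow> b \<in> C \<Longrightarrow> a pdivides b \<Longrightarrow> c \<in> C \<Longrightarrow> a pdivides (c *. b)"
  unfolding dvd_iff by (metis UP.m_assoc UP.m_closed, metis UP.m_assoc UP.m_closed UP.m_comm)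
lemma dvd_addI: "a \<in> C \<Longrightarrow> a pdivides b \<Longrightarrow> a pdivides c \<Longrightarrow> a pdivides (b +. c)"
  by (auto simp: dvd_iff UP.r_distr[symmetric] intro!: UP.a_closed)
lemma dvd_negI: "a \<in> C \<Longrightarrow> a pdivides b \<Longrightarrow> a pdivides (-. b)"
  by (auto simp: dvd_iff UP.r_minus[symmetric] intro!: UP.a_inv_closed)
lemma dvd_subI: "a \<in> C \<Longrightarrow> a pdivides b \<Longrightarrow> a pdivides c \<Longrightarrow> a pdivides (b -. c)"
  by (auto simp: UP.minus_eq intro!: dvd_addI dvd_negI)
lemma dvd_mul_cancel: 
  "a \<in> C \<Longrightarrow> b \<in> C \<Longrightarrow> c \<in> C \<Longrightarrow> c \<noteq> [] \<Longrightarrow> (c *. a) pdivides (c *. b) \<longleftrightarrow> a pdivides b"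
  by (auto simp: dvd_iff UP.m_assoc UP.m_lcancel pzero_eq)
lemma dvd_length: 
  assumes "a \<in> C" "b \<noteq> []" "a pdivides b" shows "length a \<le> length b" "a \<noteq> []"
proof -
  obtain c where c: "c \<in> C" "b = a *. c" using assms by (auto simp: dvd_iff)
  then have n: "a \<noteq> []" "c \<noteq> []" using assms by auto
  then show "a \<noteq> []" by simp
  have "length c > 0" using n by simp
  then show "length a \<le> length b" unfolding c(2) using length_mul[OF assms(1) c(1) n] n by (cases c) auto
qed
lemma dvd_less_nil: "a \<in> C \<Longrightarrow> b \<in> C \<Longrightarrow> a pdivides b \<Longrightarrow> length b < length a \<Longrightarrow> b = []"
  using dvd_length(1)[of a b] by (cases "b = []") auto

lemma pmod_C [simp]: "u \<in> C \<Longrightarrow> F \<in> C \<Longrightarrow> u pmod F \<in> C"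
  by (rule long_division_closed(2)[OF carrier_is_subfield])
lemma pdiv_C [simp]: "u \<in> C \<Longrightarrow> F \<in> C \<Longrightarrow> u pdiv F \<in> C"
  by (rule long_division_closed(1)[OF carrier_is_subfield])
lemma pmod_eq: "u \<in> C \<Longrightarrow> F \<in> C \<Longrightarrow> u = F *. (u pdiv F) +. (u pmod F)"
  by (rule pdiv_pmod[OF carrier_is_subfield])
lemma pmod_length: "u \<in> C \<Longrightarrow> F \<in> C \<Longrightarrow> F \<noteq> [] \<Longrightarrow> length (u pmod F) < length F"
  using pmod_degree[OF carrier_is_subfield, of u F] by (cases F) force+
lemma pmod_small: "u \<in> C \<Longrightarrow> F \<in> C \<Longrightarrow> length u < length F \<Longrightarrow> u pmod F = u"
  using pmod_const(2)[OF carrier_is_subfield, of u F] long_division_zero(2)[OF carrier_is_subfield, of F]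
  by (cases "u = []") (auto simp: Suc_le_eq diff_less_mono)
lemma pmod_cong_iff: "a \<in> C \<Longrightarrow> b \<in> C \<Longrightarrow> F \<in> C \<Longrightarrow> a pmod F = b pmod F \<longleftrightarrow> F pdivides (a -. b)"
  by (rule same_pmod_iff_pdivides[OF carrier_is_subfield])
lemma pmod_add: "a \<in> C \<Longrightarrow> b \<in> C \<Longrightarrow> F \<in> C \<Longrightarrow> (a +. b) pmod F = (a pmod F) +. (b pmod F)"
  by (rule long_division_add(2)[OF carrier_is_subfield])
lemma pmod_nil_iff: "a \<in> C \<Longrightarrow> F \<in> C \<Longrightarrow> a pmod F = [] \<longleftrightarrow> F pdivides a"
  by (rule pmod_zero_iff_pdivides[OF carrier_is_subfield])
lemma pmod_cong_self: "a \<in> C \<Longrightarrow> F \<in> C \<Longrightarrow> F pdivides (a -. (a pmod F))"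
proof -
  assume a: "a \<in> C" "F \<in> C"
  have "a -. (a pmod F) = (F *. (a pdiv F) +. (a pmod F)) -. (a pmod F)"
    by (rule arg_cong[OF pmod_eq[OF a], of "\<lambda>x. x -. (a pmod F)"])
  also have "\<dots> = F *. (a pdiv F)" using a pdiv_C[OF a] pmod_C[OF a] by algebra
  finally have "a -. (a pmod F) = F *. (a pdiv F)" .
  then show ?thesis by (rule dvdI[OF pdiv_C[OF a]])
qed

section \<open>Monic polynomials and primes\<close>

abbreviation "M \<equiv> monic_polys R"
abbreviation "\<P> \<equiv> monic_primes R"

lemma M_C [simp]: "f \<in> M \<Longrightarrow> f \<in> C" unfolding monic_polys_def by blast
lemma M_ne [simp]: "f \<in> M \<Longrightarrow> f \<noteq> []" unfolding monic_polys_def by blast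
lemma nil_M [simp]: "[] \<notin> M" unfolding monic_polys_def by blast
lemma M_hd [simp]: "f \<in> M \<Longrightarrow> hd f = \<one>" unfolding monic_polys_def by blast
lemma M_I: "f \<in> C \<Longrightarrow> f \<noteq> [] \<Longrightarrow> hd f = \<one> \<Longrightarrow> f \<in> M" unfolding monic_polys_def by blast
lemma M_length: "f \<in> M \<Longrightarrow> length f = Suc (degree f)" by (cases f) (auto dest: M_ne)
lemma one_M [simp]: "\<one>\<^sub>P \<in> M" by (rule M_I) (simp_all add: pone_eq)
lemma mul_M [simp]: "f \<in> M \<Longrightarrow> g \<in> M \<Longrightarrow> f *. g \<in> M" by (rule M_I) (simp_all add: hd_mul)
lemma pow_M [simp]: "f \<in> M \<Longrightarrow> f ^. n \<in> M" by (induct n) auto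
lemma degree_M_mul: "f \<in> M \<Longrightarrow> g \<in> M \<Longrightarrow> degree (f *. g) = degree f + degree g" 
  by (rule degree_mul) auto
lemma length_one [simp]: "length \<one>\<^sub>P = Suc 0" by (simp add: pone_eq)
lemma degree_one: "degree \<one>\<^sub>P = 0" by simp
lemma degree_M_pow: "f \<in> M \<Longrightarrow> degree (f ^. n) = n * degree f"
proof (induct n)
  case (Suc n)
  have "degree (f ^. Suc n) = degree (f ^. n *. f)" by simp
  also have "\<dots> = degree (f ^. n) + degree f" by (rule degree_M_mul) (use Suc in auto)
  finally show ?case using Suc by (simp only: mult_Suc)
qed simp
lemma degree_0_M: "f \<in> M \<Longrightarrow> degree f = 0 \<longleftrightarrow> f = \<one>\<^sub>P"
proof
  assume "f \<in> M" "degree f = 0"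
  then have "length f = 1" "hd f = \<one>" using M_length[of f] by auto
  then show "f = \<one>\<^sub>P" by (cases f) (auto simp: pone_eq)
qed simp
lemma monic_split:
  assumes "u \<in> C" "u \<noteq> []"
  obtains c f where "c \<in> carrier R" "c \<noteq> \<zero>" "f \<in> M" "u = [c] *. f" "length f = length u" "c = hd u"
proof -
  let ?c = "hd u"
  have c: "?c \<in> carrier R" "?c \<noteq> \<zero>" using assms by auto
  have i: "inv ?c \<in> carrier R" "inv ?c \<noteq> \<zero>" "?c \<otimes> inv ?c = \<one>" "inv ?c \<otimes> ?c = \<one>"
    using inv_nz[OF c] by auto
  have "[inv ?c] *. u \<in> M" using assms c i by (intro M_I) (simp_all add: hd_mul)
  moreover have "u = [?c] *. ([inv ?c] *. u)"
    using assms c i by (simp add: UP.m_assoc[symmetric] const_mul pone_eq[symmetric])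
  moreover have "length ([inv ?c] *. u) = length u" using assms i by simp
  ultimately show ?thesis using that c by blast
qed
lemma const_mul_inj:
  assumes "c \<in> carrier R" "c \<noteq> \<zero>" "d \<in> carrier R" "d \<noteq> \<zero>" "f \<in> M" "g \<in> M" "[c] *. f = [d] *. g"
  shows "c = d \<and> f = g"
proof -
  have "hd ([c] *. f) = c" "hd ([d] *. g) = d" using assms(1-6) by (simp_all add: hd_mul)
  then have "c = d" using assms(7) by simp
  moreover have "[d] \<noteq> \<zero>\<^bsub>poly_ring R\<^esub>" by (simp add: pzero_eq)
  ultimately show ?thesis using assms UP.m_lcancel[of "[d]" f g] by auto
qed
lemma M_dvd_antisym:
  assumes "f \<in> M" "g \<in> M" "f pdivides g" "g pdivides f" shows "f = g"
proof -
  obtain c where c: "c \<in> C" "g = f *. c" using assms by (auto simp: dvd_iff)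
  then have "c \<noteq> []" using assms by auto
  then have cM: "c \<in> M" using c assms hd_mul[of f c] by (intro M_I) auto
  have "length g = length f" using assms dvd_length[of f g] dvd_length[of g f] by simp
  then have "degree c = 0" using degree_M_mul[OF assms(1) cM] c by simp
  then show ?thesis using degree_0_M[OF cM] c assms by simp
qed
lemma M_dvd_monic:
  assumes "f \<in> M" "g \<in> M" "f pdivides g" 
  obtains h where "h \<in> M" "g = f *. h"
proof -
  obtain c where c: "c \<in> C" "g = f *. c" using assms by (auto simp: dvd_iff)
  then have "c \<noteq> []" using assms by auto
  then have "c \<in> M" using c assms hd_mul[of f c] by (intro M_I) auto
  then show ?thesis using that c by blast
qed
lemma M_cancel: "f \<in> M \<Longrightarrow> g \<in> C \<Longrightarrow> h \<in> C \<Longrightarrow> f *. g = f *. h \<longleftrightarrow> g = h"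
  using UP.m_lcancel[of f g h] M_ne[of f] by (simp add: pzero_eq)

lemma prime_irr: "p \<in> \<P> \<Longrightarrow> pirreducible (carrier R) p" unfolding monic_primes_def by blast
lemma prime_I: "p \<in> M \<Longrightarrow> pirreducible (carrier R) p \<Longrightarrow> p \<in> \<P>" unfolding monic_primes_def by blast
lemma prime_M [simp]: "p \<in> \<P> \<Longrightarrow> p \<in> M" unfolding monic_primes_def by blast
lemma prime_C [simp]: "p \<in> \<P> \<Longrightarrow> p \<in> C" by simp
lemma prime_degree: "p \<in> \<P> \<Longrightarrow> degree p \<ge> 1"
  using pirreducible_degree[OF carrier_is_subfield _ prime_irr, of p] by simp
lemma prime_dvd_mul: 
  assumes "p \<in> \<P>" "a \<in> C" "b \<in> C" "p pdivides (a *. b)" shows "p pdivides a \<or> p pdivides b"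
proof -
  have "pprime (carrier R) p" using assms(1) pprime_iff_pirreducible[OF carrier_is_subfield, of p] prime_irr
    by simp
  then show ?thesis using pprimeE(3)[OF carrier_is_subfield _ _ assms(2,3)] assms by simp
qed
lemma prime_dvd_mul_iff: 
  assumes "p \<in> \<P>" "a \<in> C" "b \<in> C" shows "p pdivides (a *. b) \<longleftrightarrow> p pdivides a \<or> p pdivides b"
  using prime_dvd_mul[OF assms] assms dvd_mulI by auto
lemma prime_not_dvd_one: "p \<in> \<P> \<Longrightarrow> \<not> p pdivides \<one>\<^sub>P"
proof
  assume p: "p \<in> \<P>" "p pdivides \<one>\<^sub>P"
  then have "length p \<le> length \<one>\<^sub>P" using dvd_length[of p "\<one>\<^sub>P"] by auto
  then show False using prime_degree[OF p(1)] by (simp add: pone_eq)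
qed
lemma prime_dvd_pow: "p \<in> \<P> \<Longrightarrow> a \<in> C \<Longrightarrow> p pdivides (a ^. n) \<Longrightarrow> p pdivides a"
  by (induct n) (auto simp: prime_not_dvd_one dest: prime_dvd_mul)
lemma M_units: "f \<in> M \<Longrightarrow> f \<in> Units (poly_ring R) \<longleftrightarrow> f = \<one>\<^sub>P"
  using univ_poly_units'[OF carrier_is_subfield, of f] degree_0_M[of f] by auto
lemma units_iff: "u \<in> Units (poly_ring R) \<longleftrightarrow> u \<in> C \<and> u \<noteq> [] \<and> degree u = 0"
  by (rule univ_poly_units'[OF carrier_is_subfield])
text \<open>Every factor of \<open>f\<close> is a constant times a monic divisor, so minimality
  forces one of two factors to be constant.\<close>

lemma primeI_min:
  assumes f: "f \<in> M" "f \<noteq> \<one>\<^sub>P" and min: "\<And>g. g \<in> M \<Longrightarrow> g \<noteq> \<one>\<^sub>P \<Longrightarrow> g pdivides f \<Longrightarrow> degree f \<le> degree g"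
  shows "f \<in> \<P>"
proof -
  have "pirreducible (carrier R) f"
  proof (rule pirreducibleI[OF carrier_is_subring])
    show "f \<in> C" "f \<noteq> []" "f \<notin> Units (poly_ring R)" using f M_units by auto
    fix a b assume ab: "a \<in> C" "b \<in> C" "f = a *. b"
    then have ne: "a \<noteq> []" "b \<noteq> []" using f by auto
    obtain c g where g: "c \<in> carrier R" "c \<noteq> \<zero>" "g \<in> M" "a = [c] *. g" "length g = length a"
      using monic_split[OF ab(1) ne(1)] by metis
    have "g pdivides f" using ab g by (intro dvdI[of "[c] *. b"]) (auto simp: UP.m_ac)
    then have A: "g = \<one>\<^sub>P \<or> degree f \<le> degree g" using min g by blast
    have B: "degree f = degree g + degree b" using degree_mul[OF ab(1,2) ne] by (simp only: ab(3) g(5))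
    show "a \<in> Units (poly_ring R) \<or> b \<in> Units (poly_ring R)"
      using A
    proof
      assume "g = \<one>\<^sub>P"
      then have "degree a = 0" using g(5) by simp
      then show ?thesis using ab(1) ne(1) units_iff by blast
    next
      assume "degree f \<le> degree g"
      then have "degree b = 0" using B by linarith
      then show ?thesis using ab(2) ne(2) units_iff by blast
    qed
  qed
  then show ?thesis using f prime_I by blast
qed
lemma ex_prime_dvd:
  assumes "f \<in> M" "f \<noteq> \<one>\<^sub>P"
  obtains p where "p \<in> \<P>" "p pdivides f"
proof -
  define Q where "Q g \<longleftrightarrow> g \<in> M \<and> g \<noteq> \<one>\<^sub>P \<and> g pdivides f" for g
  have "Q f" using assms by (simp add: Q_def)
  then obtain g where g: "Q g" "\<And>h. Q h \<Longrightarrow> degree g \<le> degree h"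
    using exists_least_iff[of "\<lambda>n. \<exists>g. Q g \<and> degree g = n"] by (metis linorder_not_le)
  have gM: "g \<in> M" "g \<noteq> \<one>\<^sub>P" "g pdivides f" using g(1) by (auto simp: Q_def)
  have "g \<in> \<P>"
  proof (rule primeI_min[OF gM(1,2)])
    fix h assume "h \<in> M" "h \<noteq> \<one>\<^sub>P" "h pdivides g"
    then have "Q h" unfolding Q_def using dvd_trans[OF _ _ gM(3), of h] by simp
    then show "degree g \<le> degree h" by (rule g(2))
  qed
  then show ?thesis using that g by (auto simp: Q_def)
qed
text \<open>Strips off one prime at a time. This takes the place of unique factorization wherever a
  multiplicative statement, such as those on \<open>chi\<close>, is reduced to primes.\<close>

lemma monic_induct [consumes 1, case_names one mul]:
  assumes "f \<in> M" "Q \<one>\<^sub>P" "\<And>p g. p \<in> \<P> \<Longrightarrow> g \<in> M \<Longrightarrow> Q g \<Longrightarrow> Q (p *. g)"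
  shows "Q f"
  using assms(1)
proof (induct "degree f" arbitrary: f rule: less_induct)
  case less
  show ?case
  proof (cases "f = \<one>\<^sub>P")
    case False
    then obtain p where p: "p \<in> \<P>" "p pdivides f" using ex_prime_dvd less by blast
    then obtain g where g: "g \<in> M" "f = p *. g" using M_dvd_monic less by (metis prime_M)
    have "degree g < degree f" using degree_M_mul[of p g] prime_degree[OF p(1)] p g by simp
    then show ?thesis using less g p assms(3) by auto
  qed (use assms in simp)
qed

text \<open>Coprimality is encoded as a Bezout identity, so that products and congruences are
  handled by ring identities and inverses modulo F are read off from the witnesses. The description
  by common prime divisors is \<open>cop_iff_primes\<close>.\<close>

definition cop :: "'a list \<Rightarrow> 'a list \<Rightarrow> bool" where
  "cop a b \<longleftrightarrow> a \<in> C \<and> b \<in> C \<and> (\<exists>x\<in>C. \<exists>y\<in>C. a *. x +. b *. y = \<one>\<^sub>P)"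

lemma copI: "a \<in> C \<Longrightarrow> b \<in> C \<Longrightarrow> x \<in> C \<Longrightarrow> y \<in> C \<Longrightarrow> a *. x +. b *. y = \<one>\<^sub>P \<Longrightarrow> cop a b"
  unfolding cop_def by blast
lemma copE:
  assumes "cop a b"
  obtains x y where "a \<in> C" "b \<in> C" "x \<in> C" "y \<in> C" "a *. x +. b *. y = \<one>\<^sub>P"
  using assms unfolding cop_def by blast
lemma cop_C: "cop a b \<Longrightarrow> a \<in> C" "cop a b \<Longrightarrow> b \<in> C" by (auto elim: copE)
lemma cop_symI: assumes "cop a b" shows "cop b a"
proof -
  obtain x y where "a \<in> C" "b \<in> C" "x \<in> C" "y \<in> C" "a *. x +. b *. y = \<one>\<^sub>P"
    using assms by (rule copE)
  then show ?thesis by (intro copI[of b a y x]) (simp_all add: UP.a_comm)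
qed
lemma cop_sym: "cop a b \<longleftrightarrow> cop b a" using cop_symI by blast
lemma cop_dvd: assumes "cop a b" "d \<in> C" "d pdivides a" shows "cop d b"
proof -
  obtain x y where xy: "a \<in> C" "b \<in> C" "x \<in> C" "y \<in> C" "a *. x +. b *. y = \<one>\<^sub>P"
    using assms(1) by (rule copE)
  obtain c where c: "c \<in> C" "a = d *. c" using assms by (auto simp: dvd_iff)
  show ?thesis
  proof (rule copI[of d b "c *. x" y])
    show "d *. (c *. x) +. b *. y = \<one>\<^sub>P" 
      using xy(5) unfolding c(2) using c(1) xy assms(2) by (simp add: UP.m_assoc)
  qed (use c xy assms in simp_all)
qed
lemma cop_mul: assumes "cop a c" "cop b c" shows "cop (a *. b) c"
proof -
  obtain x y where xy: "a \<in> C" "c \<in> C" "x \<in> C" "y \<in> C" "a *. x +. c *. y = \<one>\<^sub>P" 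
    using assms(1) by (rule copE)
  obtain z w where zw: "b \<in> C" "c \<in> C" "z \<in> C" "w \<in> C" "b *. z +. c *. w = \<one>\<^sub>P" 
    using assms(2) by (rule copE)
  have "\<one>\<^sub>P = (a *. x +. c *. y) *. (b *. z +. c *. w)" using xy(5) zw(5) by simp
  also have "\<dots> = (a *. b) *. (x *. z) +. c *. (a *. x *. w +. y *. (b *. z +. c *. w))"
    using xy(1-4) zw(1-4) by algebra
  finally show ?thesis using xy(1-4) zw(1-4)
    by (intro copI[of "a *. b" c "x *. z" "a *. x *. w +. y *. (b *. z +. c *. w)"]) simp_all
qed
lemma cop_mul_iff: 
  assumes "a \<in> C" "b \<in> C" shows "cop (a *. b) c \<longleftrightarrow> cop a c \<and> cop b c"
proof
  assume *: "cop (a *. b) c"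
  show "cop a c \<and> cop b c"
    using cop_dvd[OF * assms(1) dvd_mulI(1)[OF assms(1) assms(1) dvd_refl assms(2)]] 
      cop_dvd[OF * assms(2) dvd_mulI(2)[OF assms(2) assms(2) dvd_refl assms(1)]] assms by simp
qed (use cop_mul in blast)
lemma cop_mul_iff': "a \<in> C \<Longrightarrow> b \<in> C \<Longrightarrow> cop c (a *. b) \<longleftrightarrow> cop c a \<and> cop c b"
  using cop_mul_iff cop_sym by blast
lemma cop_one_left [simp]: "a \<in> C \<Longrightarrow> cop \<one>\<^sub>P a"
  by (rule copI[of _ _ "\<one>\<^sub>P" "[]"]) simp_all
lemma cop_one_right [simp]: "a \<in> C \<Longrightarrow> cop a \<one>\<^sub>P"
  by (rule cop_symI) simp
lemma cop_const: 
  assumes c: "c \<in> carrier R" "c \<noteq> \<zero>" and a: "a \<in> C"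
  shows "cop [c] a"
  by (rule copI[of _ _ "[inv c]" "[]"]) (use a c inv_nz[OF c] in \<open>simp_all add: const_mul pone_eq\<close>)
lemma cop_cong: 
  assumes "cop a F" "b \<in> C" "F pdivides (a -. b)" shows "cop b F"
proof -
  obtain x y where xy: "a \<in> C" "F \<in> C" "x \<in> C" "y \<in> C" "a *. x +. F *. y = \<one>\<^sub>P" 
    using assms(1) by (rule copE)
  obtain c where c: "c \<in> C" "a -. b = F *. c" using assms by (auto simp: dvd_iff)
  have "b *. x +. F *. (c *. x +. y) = b *. x +. (F *. c) *. x +. F *. y"
    using xy(1-4) c(1) assms(2) by algebra
  also have "\<dots> = a *. x +. F *. y" unfolding c(2)[symmetric] using xy(1-4) assms(2) by algebra
  finally show ?thesis using xy c(1) assms(2) by (intro copI[of b F x "c *. x +. y"]) simp_all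
qed
lemma cop_pow: "cop a b \<Longrightarrow> cop (a ^. n) b" by (induct n) (auto simp: cop_C intro: cop_mul)
text \<open>In the ideal generated by \<open>a\<close> and \<open>p\<close>, a nonzero element of
  least length divides both generators; as \<open>p\<close> is irreducible and does not divide
  \<open>a\<close>, this element is a constant.\<close>

lemma bezout_prime:
  assumes "p \<in> \<P>" "a \<in> C" "\<not> p pdivides a" shows "cop a p"
proof -
  define I where "I = {a *. x +. p *. y | x y. x \<in> C \<and> y \<in> C}"
  have "p \<in> C" using assms by simp
  have IC: "I \<subseteq> C" using assms by (auto simp: I_def)
  have pI: "p \<in> I" unfolding I_def using assms 
    by (intro CollectI exI[of _ "[]"] exI[of _ "\<one>\<^sub>P"]) auto
  have aI: "a \<in> I" unfolding I_def using assms 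
    by (intro CollectI exI[of _ "\<one>\<^sub>P"] exI[of _ "[]"]) auto
  define Q where "Q d \<longleftrightarrow> d \<in> I \<and> d \<noteq> []" for d
  have "Q p" using pI assms by (auto simp: Q_def)
  then obtain d where d: "Q d" "\<And>h. Q h \<Longrightarrow> length d \<le> length h"
    using exists_least_iff[of "\<lambda>n. \<exists>g. Q g \<and> length g = n"] by (metis linorder_not_le)
  have dI: "d \<in> I" "d \<noteq> []" using d by (auto simp: Q_def)
  have dC: "d \<in> C" using dI IC by blast
  obtain x y where xy: "x \<in> C" "y \<in> C" "d = a *. x +. p *. y" using dI by (auto simp: I_def)
  have dv: "d pdivides u" if uI: "u \<in> I" for u
  proof -
    obtain z w where zw: "z \<in> C" "w \<in> C" "u = a *. z +. p *. w" using uI by (auto simp: I_def)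
    have uC: "u \<in> C" using uI IC by blast
    obtain t where t: "t \<in> C" "u -. (u pmod d) = d *. t" using pmod_cong_self[OF uC dC] by (auto simp: dvd_iff)
    have "u pmod d = u -. (u -. (u pmod d))" using uC dC pmod_C[OF uC dC] by algebra
    also have "\<dots> = u -. d *. t" using t by simp
    also have "\<dots> = a *. (z -. x *. t) +. p *. (w -. y *. t)"
      unfolding zw(3) xy(3) using zw(1,2) xy(1,2) t(1) assms(2) \<open>p \<in> C\<close> by algebra
    finally have "u pmod d \<in> I" unfolding I_def using zw(1,2) xy(1,2) t(1) by blast
    then have "u pmod d = []" using d(2)[of "u pmod d"] pmod_length[OF uC dC dI(2)] by (auto simp: Q_def)
    then show ?thesis using pmod_nil_iff[OF uC dC] by simp
  qed
  obtain c f where f: "c \<in> carrier R" "c \<noteq> \<zero>" "f \<in> M" "d = [c] *. f"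
    using monic_split[OF dC dI(2)] by metis
  have fd: "f pdivides d" using f by (intro dvdI[of "[c]"]) (auto simp: UP.m_ac)
  have fp: "f pdivides p" using dvd_trans[OF _ fd dv[OF pI]] f by simp
  have fa: "f pdivides a" using dvd_trans[OF _ fd dv[OF aI]] f by simp
  obtain h where h: "h \<in> M" "p = f *. h" using M_dvd_monic[OF f(3) _ fp] assms by auto
  have "f \<in> Units (poly_ring R) \<or> h \<in> Units (poly_ring R)"
    using assms(1) h f pirreducibleE(3)[OF carrier_is_subring _ prime_irr, of p f h] by auto
  moreover have "h \<noteq> \<one>\<^sub>P" using fa h f assms by auto
  ultimately have "f = \<one>\<^sub>P" using M_units f h by auto
  then have d1: "d = [c]" using f by simp
  have i: "inv c \<in> carrier R" "inv c \<noteq> \<zero>" "c \<otimes> inv c = \<one>" using f inv_nz by auto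
  have "a *. (x *. [inv c]) +. p *. (y *. [inv c]) = d *. [inv c]"
    unfolding xy(3) using xy(1,2) assms(2) \<open>p \<in> C\<close> const_C[OF i(1,2)] by algebra
  also have "\<dots> = \<one>\<^sub>P" using d1 f i by (simp add: const_mul pone_eq)
  finally show ?thesis using assms(2) \<open>p \<in> C\<close> xy(1,2) const_C[OF i(1,2)]
    by (intro copI[of a p "x *. [inv c]" "y *. [inv c]"]) simp_all
qed
lemma cop_prime_iff: 
  assumes p: "p \<in> \<P>" and a: "a \<in> C" shows "cop a p \<longleftrightarrow> \<not> p pdivides a"
proof
  assume ap: "cop a p"
  show "\<not> p pdivides a"
  proof
    assume "p pdivides a"
    then have "cop p p" using cop_dvd[OF ap] p by simp
    then obtain x y where "p \<in> C" "x \<in> C" "y \<in> C" "p *. x +. p *. y = \<one>\<^sub>P" by (rule copE)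
    then have "p pdivides \<one>\<^sub>P" by (intro dvdI[of "x +. y"]) (simp_all add: UP.r_distr)
    then show False using prime_not_dvd_one p by blast
  qed
qed (rule bezout_prime[OF p a])
lemma prime_dvd_prime: 
  assumes "p \<in> \<P>" "r \<in> \<P>" "p pdivides r" shows "p = r"
proof (rule ccontr)
  assume ne: "p \<noteq> r"
  have "\<not> r pdivides p" using M_dvd_antisym[of p r] assms ne by auto
  then have "cop p r" using cop_prime_iff[OF assms(2), of p] assms(1) by simp
  moreover have "cop p p" using cop_dvd[OF cop_symI[OF calculation] _ assms(3)] assms by simp
  ultimately show False using cop_prime_iff[OF assms(1), of p] assms(1) by simp
qed
lemma cop_iff_primes: 
  assumes "F \<in> M" "a \<in> C" shows "cop a F \<longleftrightarrow> (\<forall>p\<in>\<P>. p pdivides F \<longrightarrow> \<not> p pdivides a)"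
  using assms(1)
proof (induct F rule: monic_induct)
  case one then show ?case using assms prime_not_dvd_one by auto
next
  case (mul p g)
  have "cop a (p *. g) \<longleftrightarrow> cop a p \<and> cop a g" using mul by (intro cop_mul_iff') auto
  also have "\<dots> \<longleftrightarrow> \<not> p pdivides a \<and> (\<forall>r\<in>\<P>. r pdivides g \<longrightarrow> \<not> r pdivides a)"
    using mul cop_prime_iff[OF mul(1) assms(2)] by simp
  also have "\<dots> \<longleftrightarrow> (\<forall>r\<in>\<P>. r pdivides (p *. g) \<longrightarrow> \<not> r pdivides a)"
    using prime_dvd_mul_iff[of _ p g] mul(1,2) prime_dvd_prime[OF _ mul(1)] dvd_refl[of p] M_C prime_C by blast
  finally show ?case .
qed
lemma cop_dvd_mul: assumes "cop a b" "c \<in> C" "a pdivides (b *. c)" shows "a pdivides c"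
proof -
  obtain x y where xy: "a \<in> C" "b \<in> C" "x \<in> C" "y \<in> C" "a *. x +. b *. y = \<one>\<^sub>P" 
    using assms(1) by (rule copE)
  have "c = (a *. x +. b *. y) *. c" using xy(5) assms(2) by simp
  also have "\<dots> = a *. (x *. c) +. (b *. c) *. y" using xy(1-4) assms(2) by algebra
  also have "a pdivides \<dots>" 
    using dvd_addI[OF xy(1) dvdI[of "x *. c"] dvd_mulI(1)[OF xy(1) _ assms(3) xy(4)]] xy assms(2) by simp
  finally show ?thesis .
qed
lemma cop_dvd_both: assumes "cop a b" "c \<in> C" "a pdivides c" "b pdivides c" shows "(a *. b) pdivides c"
proof -
  obtain d where d: "d \<in> C" "c = b *. d" using assms by (auto simp: dvd_iff)
  then have "a pdivides d" using cop_dvd_mul[OF assms(1)] assms by simp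
  then obtain e where "e \<in> C" "d = a *. e" by (auto simp: dvd_iff)
  then show ?thesis using d cop_C[OF assms(1)] by (intro dvdI[of e]) (auto simp: UP.m_ac)
qed

section \<open>Residue classes\<close>

text \<open>\<open>degree\<close> abbreviates \<open>length f - 1\<close>; an opaque copy keeps this
  truncated subtraction out of sight of the simplifier.\<close>

definition deg :: "'a list \<Rightarrow> nat" where "deg f = degree f"
lemma M_len: "f \<in> M \<Longrightarrow> length f = Suc (deg f)" unfolding deg_def by (rule M_length)
lemma deg_mul [simp]: "f \<in> M \<Longrightarrow> g \<in> M \<Longrightarrow> deg (f *. g) = deg f + deg g"
  unfolding deg_def by (rule degree_M_mul)
lemma deg_pow [simp]: "f \<in> M \<Longrightarrow> deg (f ^. n) = n * deg f"
  unfolding deg_def by (rule degree_M_pow)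
lemma deg_one [simp]: "deg \<one>\<^sub>P = 0" unfolding deg_def by (rule degree_one)
lemma deg_0_M: "f \<in> M \<Longrightarrow> deg f = 0 \<longleftrightarrow> f = \<one>\<^sub>P"
  unfolding deg_def by (rule degree_0_M)
lemma deg_prime: "p \<in> \<P> \<Longrightarrow> deg p \<ge> 1" unfolding deg_def by (rule prime_degree)
lemma deg_prime_pos [simp]: "p \<in> \<P> \<Longrightarrow> 0 < deg p" using deg_prime by force

text \<open>\<open>Pl (deg F)\<close> is the system of remainders modulo F, zero included, and every
  \<open>Pl n\<close> is closed under addition and subtraction.\<close>

definition Pl :: "nat \<Rightarrow> 'a list set" where "Pl n = {u \<in> C. length u \<le> n}"
definition Mn :: "nat \<Rightarrow> 'a list set" where "Mn n = {f \<in> M. length f = Suc n}"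
abbreviation "qn \<equiv> card (carrier R)"
abbreviation "q \<equiv> real qn"
abbreviation "Fs \<equiv> carrier R - {\<zero>}"

lemma Pl_iff: "u \<in> Pl n \<longleftrightarrow> u \<in> C \<and> length u \<le> n" by (simp add: Pl_def)
lemma Mn_iff: "f \<in> Mn n \<longleftrightarrow> f \<in> M \<and> length f = Suc n" by (simp add: Mn_def)
lemma Pl_C [intro]: "u \<in> Pl n \<Longrightarrow> u \<in> C" by (simp add: Pl_iff)
lemma Mn_M [intro]: "f \<in> Mn n \<Longrightarrow> f \<in> M" by (simp add: Mn_iff)
lemma Mn_C [intro]: "f \<in> Mn n \<Longrightarrow> f \<in> C" using Mn_M M_C by blast
lemma Mn_deg: "f \<in> M \<Longrightarrow> f \<in> Mn n \<longleftrightarrow> deg f = n" 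
  using M_len[of f] by (auto simp: Mn_iff)
lemma Mn_deg_self: "f \<in> M \<Longrightarrow> f \<in> Mn (deg f)" by (simp only: Mn_deg)
lemma Mn_disjoint: "i \<noteq> j \<Longrightarrow> Mn i \<inter> Mn j = {}"
proof (rule equals0I)
  fix F assume "i \<noteq> j" "F \<in> Mn i \<inter> Mn j"
  moreover then have "F \<in> M" by (intro Mn_M[of F i]) simp
  ultimately show False using Mn_deg[of F i] Mn_deg[of F j] by simp
qed

lemma Mn_deg_eq: "F \<in> Mn n \<Longrightarrow> deg F = n" using Mn_deg[OF Mn_M, of F n n] by simp
lemma Pl_0 [simp]: "Pl 0 = {[]}" by (auto simp: Pl_iff)
lemma nil_Pl [simp]: "[] \<in> Pl n" by (simp add: Pl_iff)

lemma qn_gt1: "qn > 1"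
proof -
  have "{\<zero>, \<one>} \<subseteq> carrier R" by auto
  then have "card {\<zero>, \<one>} \<le> qn" using fin card_mono by blast
  then show ?thesis using one_not_zero by simp
qed
lemma q_gt1: "q > 1" using qn_gt1 by simp

lemma Mn_eq: "Mn n = (\<lambda>l. \<one> # l) ` {l. set l \<subseteq> carrier R \<and> length l = n}" (is "_ = ?B")
proof
  show "Mn n \<subseteq> ?B"
  proof
    fix f assume f: "f \<in> Mn n"
    then have "f = \<one> # tl f" using M_hd[of f] by (cases f) (auto simp: Mn_iff)
    moreover have "set (tl f) \<subseteq> carrier R" using f C_set[of f] by (cases f) (auto simp: Mn_iff)
    moreover have "length (tl f) = n" using f by (simp add: Mn_iff)
    ultimately show "f \<in> ?B" by blast
  qed
  show "?B \<subseteq> Mn n"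
  proof
    fix f assume "f \<in> ?B"
    then obtain l where l: "f = \<one> # l" "set l \<subseteq> carrier R" "length l = n" by blast
    then have "f \<in> C" by (auto simp: C_iff)
    then show "f \<in> Mn n" using l by (auto simp: Mn_iff intro!: M_I)
  qed
qed
lemma finite_Mn [simp]: "finite (Mn n)"
  by (simp add: Mn_eq finite_lists_length_eq[OF fin])
lemma card_Mn: "card (Mn n) = qn ^ n"
  using card_lists_length_eq[OF fin, of n] 
  by (simp add: Mn_eq card_image inj_on_def)

lemma Pl_eq: "Pl n = normalize ` {l. set l \<subseteq> carrier R \<and> length l = n}" (is "_ = ?B")
proof
  show "Pl n \<subseteq> ?B"
  proof
    fix u assume u: "u \<in> Pl n"
    let ?l = "replicate (n - length u) \<zero> @ u"
    have "normalize ?l = u"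
      using u normalize_replicate_zero normalize_polynomial[of "carrier R" u] by (simp add: Pl_iff univ_poly_carrier)
    moreover have "set ?l \<subseteq> carrier R" using u C_set by auto
    moreover have "length ?l = n" using u by (simp add: Pl_iff)
    ultimately show "u \<in> ?B" by (metis (mono_tags, lifting) image_eqI mem_Collect_eq)
  qed
  show "?B \<subseteq> Pl n"
    using normalize_length_le normalize_gives_polynomial[of _ "carrier R"] 
    by (auto simp: Pl_iff univ_poly_carrier[symmetric])
qed
lemma finite_Pl [simp]: "finite (Pl n)"
  by (simp add: Pl_eq finite_lists_length_eq[OF fin])
lemma card_Pl: "card (Pl n) = qn ^ n"
proof -
  have "inj_on normalize {l. set l \<subseteq> carrier R \<and> length l = n}"
    by (rule inj_onI) (metis (mono_tags, lifting) mem_Collect_eq normalize_trick)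
  then show ?thesis using card_lists_length_eq[OF fin, of n] by (simp add: Pl_eq card_image)
qed

lemma Pl_add: "u \<in> Pl n \<Longrightarrow> v \<in> Pl n \<Longrightarrow> u +. v \<in> Pl n"
  using order_trans[OF length_add_le[of u v], of n] by (simp add: Pl_iff)
lemma Pl_sub: "u \<in> Pl n \<Longrightarrow> v \<in> Pl n \<Longrightarrow> u -. v \<in> Pl n"
  using order_trans[OF length_sub_le[of u v], of n] by (simp add: Pl_iff)
lemma Pl_mono: "u \<in> Pl n \<Longrightarrow> n \<le> m \<Longrightarrow> u \<in> Pl m" by (simp add: Pl_iff)
lemma Pl_length_mul: 
  assumes "f \<in> M" "u \<in> Pl n" shows "f *. u \<in> Pl (n + deg f)"
proof (cases "u = []")
  case False
  then show ?thesis using assms length_mul[of f u] M_len[of f] by (simp add: Pl_iff) 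
qed (use assms in simp)
lemma pmod_Pl: "u \<in> C \<Longrightarrow> f \<in> M \<Longrightarrow> u pmod f \<in> Pl (deg f)"
  using pmod_length[of u f] M_len[of f] by (simp add: Pl_iff)
lemma pmod_Pl_id: "u \<in> Pl (deg f) \<Longrightarrow> f \<in> M \<Longrightarrow> u pmod f = u"
proof -
  assume u: "u \<in> Pl (deg f)" and f: "f \<in> M"
  show ?thesis using u f M_len[OF f] by (intro pmod_small) (auto simp: Pl_iff)
qed

lemma sub_eq_nil: "a \<in> C \<Longrightarrow> b \<in> C \<Longrightarrow> a -. b = [] \<longleftrightarrow> a = b"
  using UP.r_right_minus_eq[of a b] by (simp add: pzero_eq)

lemma Pl_cong_eq: 
  assumes "f \<in> M" "a \<in> Pl (deg f)" "b \<in> Pl (deg f)" "f pdivides (a -. b)" shows "a = b"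
  using assms pmod_cong_iff[of a b f] pmod_Pl_id[of a f] pmod_Pl_id[of b f] Pl_C[OF assms(2)] Pl_C[OF assms(3)] by simp

definition periodic :: "'a list \<Rightarrow> ('a list \<Rightarrow> 'b) \<Rightarrow> bool" where
  "periodic f \<phi> \<longleftrightarrow> (\<forall>a\<in>C. \<forall>b\<in>C. f pdivides (a -. b) \<longrightarrow> \<phi> a = \<phi> b)"

lemma periodicD: "periodic f \<phi> \<Longrightarrow> a \<in> C \<Longrightarrow> b \<in> C \<Longrightarrow> f pdivides (a -. b) \<Longrightarrow> \<phi> a = \<phi> b"
  by (simp add: periodic_def)
lemma periodic_pmod: "periodic f \<phi> \<Longrightarrow> f \<in> C \<Longrightarrow> a \<in> C \<Longrightarrow> \<phi> (a pmod f) = \<phi> a"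
  by (rule sym, rule periodicD[of f \<phi>]) (simp_all, rule pmod_cong_self)

text \<open>There are as many elements as residues and they are pairwise incongruent, so reduction
  modulo \<open>f\<close> is a bijection onto \<open>Pl (deg f)\<close>.\<close>

lemma sum_crs:
  fixes \<phi> :: "'a list \<Rightarrow> 'b::comm_monoid_add"
  assumes f: "f \<in> M" and per: "periodic f \<phi>" and A: "finite A" "g ` A \<subseteq> C"
    and card: "card A = qn ^ deg f"
    and inj: "\<And>a b. a \<in> A \<Longrightarrow> b \<in> A \<Longrightarrow> f pdivides (g a -. g b) \<Longrightarrow> a = b"
  shows "(\<Sum>a\<in>A. \<phi> (g a)) = (\<Sum>a\<in>Pl (deg f). \<phi> a)"
proof -
  let ?h = "\<lambda>a. g a pmod f"
  have fC: "f \<in> C" using f by simp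
  have "inj_on ?h A"
    using inj A(2) fC by (auto simp: inj_on_def pmod_cong_iff image_subset_iff)
  moreover have "?h ` A \<subseteq> Pl (deg f)" using A(2) f by (auto intro!: pmod_Pl)
  ultimately have "bij_betw ?h A (Pl (deg f))"
    using card A(1) by (simp add: bij_betw_def card_Pl card_image card_subset_eq)
  then have "(\<Sum>a\<in>Pl (deg f). \<phi> a) = (\<Sum>a\<in>A. \<phi> (?h a))"
    by (rule sum.reindex_bij_betw[symmetric])
  also have "\<dots> = (\<Sum>a\<in>A. \<phi> (g a))"
    using periodic_pmod[OF per fC] A(2) by (intro sum.cong) auto
  finally show ?thesis by simp
qed

lemma sum_unit_mult:
  fixes \<phi> :: "'a list \<Rightarrow> 'b::comm_monoid_add"
  assumes f: "f \<in> M" and per: "periodic f \<phi>" and u: "cop u f"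
  shows "(\<Sum>a\<in>Pl (deg f). \<phi> (a *. u)) = (\<Sum>a\<in>Pl (deg f). \<phi> a)"
proof (rule sum_crs[OF f per])
  have uC: "u \<in> C" using u cop_C by blast
  show "(\<lambda>a. a *. u) ` Pl (deg f) \<subseteq> C" using uC by auto
  fix a b assume ab: "a \<in> Pl (deg f)" "b \<in> Pl (deg f)" "f pdivides (a *. u -. b *. u)"
  have "a *. u -. b *. u = u *. (a -. b)" 
    using uC Pl_C[OF ab(1)] Pl_C[OF ab(2)] by algebra
  then have "f pdivides (a -. b)" using cop_dvd_mul[OF cop_symI[OF u], of "a -. b"] ab Pl_C[OF ab(1)] Pl_C[OF ab(2)] by simp
  then show "a = b" using Pl_cong_eq[OF f] ab by blast
qed (simp_all add: card_Pl)

lemma Pl_split_bij: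
  assumes f: "f \<in> M"
  shows "bij_betw (\<lambda>(y,r). f *. y +. r) (Pl n \<times> Pl (deg f)) (Pl (n + deg f))"
proof -
  let ?g = "\<lambda>(y,r). f *. y +. r"
  have fC: "f \<in> C" using f by simp
  have inj: "inj_on ?g (Pl n \<times> Pl (deg f))"
  proof (rule inj_onI, clarify)
    fix y r y' r' assume a: "y \<in> Pl n" "r \<in> Pl (deg f)" "y' \<in> Pl n" "r' \<in> Pl (deg f)"
      and e: "f *. y +. r = f *. y' +. r'"
    note c = Pl_C[OF a(1)] Pl_C[OF a(2)] Pl_C[OF a(3)] Pl_C[OF a(4)]
    have "r -. r' = (f *. y +. r) -. (f *. y +. r')" using c fC by algebra
    also have "\<dots> = (f *. y' +. r') -. (f *. y +. r')" by (simp only: e)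
    also have "\<dots> = f *. (y' -. y)" using c fC by algebra
    finally have "f pdivides (r -. r')" by (rule dvdI[rotated]) (use c in simp)
    then have r: "r = r'" using Pl_cong_eq[OF f a(2,4)] by blast
    then have "f *. y = f *. y'" using e c fC UP.add.right_cancel[of r' "f *. y" "f *. y'"] by simp
    then show "y = y' \<and> r = r'" using r M_cancel[OF f] c by simp
  qed
  have sub: "?g ` (Pl n \<times> Pl (deg f)) \<subseteq> Pl (n + deg f)"
  proof (clarify)
    fix y r assume a: "y \<in> Pl n" "r \<in> Pl (deg f)"
    show "f *. y +. r \<in> Pl (n + deg f)"
      using Pl_length_mul[OF f a(1)] Pl_mono[OF a(2), of "n + deg f"] by (intro Pl_add) auto
  qed
  show ?thesis
    unfolding bij_betw_def using inj card_subset_eq[OF finite_Pl sub] 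
    by (simp add: card_image card_Pl card_cartesian_product power_add)
qed

lemma Mn_split_bij:
  assumes f: "f \<in> M"
  shows "bij_betw (\<lambda>(y,r). f *. y +. r) (Mn n \<times> Pl (deg f)) (Mn (n + deg f))"
proof -
  let ?g = "\<lambda>(y,r). f *. y +. r"
  have fC: "f \<in> C" using f by simp
  have inj: "inj_on ?g (Mn n \<times> Pl (deg f))"
  proof -
    have "Mn n \<subseteq> Pl (Suc n)" by (auto simp: Mn_iff Pl_iff)
    then have "Mn n \<times> Pl (deg f) \<subseteq> Pl (Suc n) \<times> Pl (deg f)" by auto
    then show ?thesis using Pl_split_bij[OF f, of "Suc n"] inj_on_subset by (auto simp: bij_betw_def)
  qed
  have sub: "?g ` (Mn n \<times> Pl (deg f)) \<subseteq> Mn (n + deg f)"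
  proof (clarify)
    fix y r assume a: "y \<in> Mn n" "r \<in> Pl (deg f)"
    have l: "length (f *. y) = Suc (n + deg f)" 
      using length_mul[of f y] f a M_len[OF f] by (simp add: Mn_iff)
    have lr: "length r < length (f *. y)" using l a by (simp add: Pl_iff)
    note yr = Mn_M[OF a(1)] Pl_C[OF a(2)]
    have "hd (f *. y +. r) = \<one>" using yr hd_add_eq[of "f *. y" r] lr f a by (simp add: hd_mul)
    moreover have "length (f *. y +. r) = Suc (n + deg f)" using length_add_eq[of "f *. y" r] lr l f yr by simp
    moreover have "f *. y +. r \<in> C" using f yr by simp
    ultimately show "f *. y +. r \<in> Mn (n + deg f)" using f a
      by (auto simp: Mn_iff intro!: M_I)
  qed
  show ?thesis
    unfolding bij_betw_def using inj card_subset_eq[OF finite_Mn sub] 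
    by (simp add: card_image card_Pl card_Mn card_cartesian_product power_add)
qed

text \<open>By \<open>Mn_split_bij\<close> the monic polynomials of degree \<open>n\<close> meet
  every residue class modulo \<open>f\<close> equally often.\<close>

lemma sum_Mn_periodic:
  fixes \<phi> :: "'a list \<Rightarrow> 'b::comm_ring_1"
  assumes f: "f \<in> M" and per: "periodic f \<phi>" and n: "deg f \<le> n"
  shows "(\<Sum>a\<in>Mn n. \<phi> a) = of_nat (qn ^ (n - deg f)) * (\<Sum>a\<in>Pl (deg f). \<phi> a)"
proof -
  have b: "bij_betw (\<lambda>(y,r). f *. y +. r) (Mn (n - deg f) \<times> Pl (deg f)) (Mn n)"
    using Mn_split_bij[OF f, of "n - deg f"] n by simp
  have "(\<Sum>a\<in>Mn n. \<phi> a) = (\<Sum>z\<in>Mn (n - deg f) \<times> Pl (deg f). \<phi> (case z of (y,r) \<Rightarrow> f *. y +. r))"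
    by (rule sum.reindex_bij_betw[OF b, symmetric])
  also have "\<dots> = (\<Sum>z\<in>Mn (n - deg f) \<times> Pl (deg f). \<phi> (snd z))"
  proof (rule sum.cong[OF refl], clarify)
    fix y r assume a: "y \<in> Mn (n - deg f)" "r \<in> Pl (deg f)"
    have c: "y \<in> C" "r \<in> C" "f \<in> C" using Mn_C[OF a(1)] Pl_C[OF a(2)] f by auto
    have "(f *. y +. r) -. r = f *. y" using c by algebra
    then have "\<phi> (f *. y +. r) = \<phi> r" using c by (intro periodicD[OF per]) (simp_all add: dvdI)
    then show "\<phi> (f *. y +. r) = \<phi> (snd (y, r))" by simp
  qed
  also have "\<dots> = (\<Sum>y\<in>Mn (n - deg f). \<Sum>r\<in>Pl (deg f). \<phi> r)"
    unfolding sum.cartesian_product by (simp add: case_prod_unfold)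
  also have "\<dots> = of_nat (qn ^ (n - deg f)) * (\<Sum>a\<in>Pl (deg f). \<phi> a)"
    by (simp add: card_Mn)
  finally show ?thesis .
qed

lemma length_Suc_bij:
  "bij_betw (\<lambda>(f,c). [c] *. f) (Mn i \<times> Fs) {u \<in> C. length u = Suc i}"
  unfolding bij_betw_def
proof
  show "inj_on (\<lambda>(f,c). [c] *. f) (Mn i \<times> Fs)"
  proof (rule inj_onI)
    fix z z' assume z: "z \<in> Mn i \<times> Fs" "z' \<in> Mn i \<times> Fs" 
      and e: "(case z of (f, c) \<Rightarrow> [c] *. f) = (case z' of (f, c) \<Rightarrow> [c] *. f)"
    obtain f c f' c' where zz: "z = (f,c)" "z' = (f',c')" by (cases z, cases z') blast
    have "f \<in> M" "f' \<in> M" using z zz by auto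
    then show "z = z'" using const_mul_inj[of c c' f f'] z e unfolding zz by simp
  qed
  show "(\<lambda>(f,c). [c] *. f) ` (Mn i \<times> Fs) = {u \<in> C. length u = Suc i}"
  proof
    show "(\<lambda>(f,c). [c] *. f) ` (Mn i \<times> Fs) \<subseteq> {u \<in> C. length u = Suc i}" by (auto simp: Mn_iff)
    show "{u \<in> C. length u = Suc i} \<subseteq> (\<lambda>(f,c). [c] *. f) ` (Mn i \<times> Fs)"
    proof clarify
      fix u assume u: "u \<in> C" "length u = Suc i"
      then have "u \<noteq> []" by auto
      then obtain c f where "c \<in> carrier R" "c \<noteq> \<zero>" "f \<in> M" "u = [c] *. f" "length f = length u"
        using monic_split[OF u(1)] by metis
      then show "u \<in> (\<lambda>(f,c). [c] *. f) ` (Mn i \<times> Fs)"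
        using u(2) by (auto simp: Mn_iff intro!: image_eqI[of _ _ "(f,c)"])
    qed
  qed
qed

lemma sum_Pl_monic:
  fixes \<phi> :: "'a list \<Rightarrow> 'b::comm_monoid_add"
  shows "(\<Sum>u\<in>Pl n. \<phi> u) = \<phi> [] + (\<Sum>i<n. \<Sum>f\<in>Mn i. \<Sum>c\<in>Fs. \<phi> ([c] *. f))"
proof (induct n)
  case (Suc n)
  have e: "Pl (Suc n) = Pl n \<union> {u \<in> C. length u = Suc n}" by (auto simp: Pl_iff)
  have "finite {u \<in> C. length u = Suc n}" by (rule finite_subset[of _ "Pl (Suc n)"]) (auto simp: Pl_iff)
  then have "(\<Sum>u\<in>Pl (Suc n). \<phi> u) = (\<Sum>u\<in>Pl n. \<phi> u) + (\<Sum>u\<in>{u \<in> C. length u = Suc n}. \<phi> u)"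
    unfolding e by (intro sum.union_disjoint) (auto simp: Pl_iff)
  also have "(\<Sum>u\<in>{u \<in> C. length u = Suc n}. \<phi> u) = (\<Sum>z\<in>Mn n \<times> Fs. \<phi> (case z of (f,c) \<Rightarrow> [c] *. f))"
    by (rule sum.reindex_bij_betw[OF length_Suc_bij, symmetric])
  also have "\<dots> = (\<Sum>f\<in>Mn n. \<Sum>c\<in>Fs. \<phi> ([c] *. f))"
    unfolding sum.cartesian_product by (simp add: case_prod_unfold)
  finally show ?case using Suc by (simp add: add.assoc)
qed simp

section \<open>A nontrivial additive character\<close>

lemma nat_mult_order: "a \<in> carrier R \<Longrightarrow> [qn] \<cdot> a = \<zero>"
  using add.pow_order_eq_1[of a] fin by (simp add: order_def)

text \<open>The quotient of the additive group by a maximal proper subgroup \<open>H\<close> is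
  cyclic, generated by any \<open>a\<close> outside \<open>H\<close>. If \<open>n\<close> is the
  order of \<open>a\<close> in this quotient, \<open>h \<oplus> [i] \<cdot> a\<close> is sent to the
  i-th power of a primitive n-th root of unity.\<close>

lemma exists_additive_character:
  "\<exists>\<psi>::'a \<Rightarrow> complex. (\<forall>x\<in>carrier R. \<forall>y\<in>carrier R. \<psi> (x \<oplus> y) = \<psi> x * \<psi> y) \<and>
     (\<forall>x\<in>carrier R. norm (\<psi> x) = 1) \<and> (\<exists>x\<in>carrier R. \<psi> x \<noteq> 1)"
proof -
  \<comment> \<open>Closure under addition is enough for a subgroup here: the group is finite, so
    inverses are multiples.\<close>
  define sub where "sub H \<longleftrightarrow> H \<subseteq> carrier R \<and> \<zero> \<in> H \<and> (\<forall>x\<in>H. \<forall>y\<in>H. x \<oplus> y \<in> H)" for H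
  have inv: "\<ominus> x \<in> H" if H: "sub H" and x: "x \<in> H" for H x
  proof -
    have xc: "x \<in> carrier R" using H x by (auto simp: sub_def)
    have mem: "[n] \<cdot> x \<in> H" for n :: nat
      by (induct n) (use H x xc in \<open>auto simp: sub_def add.nat_pow_Suc\<close>)
    have "[(qn - 1)] \<cdot> x \<oplus> x = [qn] \<cdot> x" using xc qn_gt1 add.nat_pow_Suc[where x=x and n="qn - 1"] by simp
    then have "[(qn - 1)] \<cdot> x = \<ominus> x" using nat_mult_order[OF xc] xc by (metis minus_equality add.nat_pow_closed)
    then show ?thesis using mem by metis
  qed
  define S where "S = {H. sub H \<and> H \<noteq> carrier R}"
  have "S \<subseteq> Pow (carrier R)" by (auto simp: S_def sub_def)
  then have finS: "finite S" using fin finite_subset by blast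
  have "{\<zero>} \<noteq> carrier R" using one_not_zero one_closed by (metis singletonD)
  then have "{\<zero>} \<in> S" by (simp add: S_def sub_def)
  then obtain H where H: "H \<in> S" and max: "\<And>H'. H' \<in> S \<Longrightarrow> H \<subseteq> H' \<Longrightarrow> H' = H"
    using finite_has_maximal[OF finS] by blast
  have sH: "sub H" and neH: "H \<noteq> carrier R" using H by (auto simp: S_def)
  have HC: "H \<subseteq> carrier R" using sH by (simp add: sub_def)
  obtain a where a: "a \<in> carrier R" "a \<notin> H" using neH HC by blast
  define H' where "H' = {h \<oplus> [i] \<cdot> a | h i. h \<in> H \<and> (i::nat) \<in> UNIV}"
  have "sub H'" unfolding sub_def
  proof (intro conjI ballI)
    show "H' \<subseteq> carrier R" using HC a by (auto simp: H'_def)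
    show "\<zero> \<in> H'" unfolding H'_def using sH by (auto simp: sub_def intro!: exI[of _ \<zero>] exI[of _ "0::nat"])
    fix x y assume "x \<in> H'" "y \<in> H'"
    then obtain h h' and i i' :: nat where e: "x = h \<oplus> [i] \<cdot> a" "y = h' \<oplus> [i'] \<cdot> a" "h \<in> H" "h' \<in> H"
      by (auto simp: H'_def)
    have c: "h \<in> carrier R" "h' \<in> carrier R" using e HC by auto
    have "x \<oplus> y = (h \<oplus> h') \<oplus> ([i] \<cdot> a \<oplus> [i'] \<cdot> a)" unfolding e(1,2) using c a by (simp add: a_ac)
    also have "\<dots> = (h \<oplus> h') \<oplus> [(i + i')] \<cdot> a" using a by (simp add: add.nat_pow_mult)
    finally show "x \<oplus> y \<in> H'" unfolding H'_def using e(3,4) sH by (auto simp: sub_def)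
  qed
  moreover have "H \<subseteq> H'"
  proof
    fix h assume h: "h \<in> H"
    then have "h = h \<oplus> [(0::nat)] \<cdot> a" using HC by auto
    then show "h \<in> H'" unfolding H'_def using h by blast
  qed
  moreover have "a \<in> H'"
  proof -
    have "a = \<zero> \<oplus> [(1::nat)] \<cdot> a" using a by simp
    moreover have "\<zero> \<in> H" using sH by (simp add: sub_def)
    ultimately show ?thesis unfolding H'_def by blast
  qed
  \<comment> \<open>Adjoining \<open>a\<close> to the maximal \<open>H\<close> gives everything, so
    each element is in \<open>H\<close> up to a multiple of \<open>a\<close>.\<close>
  ultimately have H'c: "H' = carrier R" using max a by (auto simp: S_def)
  define T where "T n \<longleftrightarrow> 0 < n \<and> [n] \<cdot> a \<in> H" for n :: nat
  have "T qn" using nat_mult_order[OF a(1)] qn_gt1 sH by (simp add: T_def sub_def)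
  define n where "n = (LEAST n. T n)"
  have Tn: "T n" unfolding n_def using \<open>T qn\<close> by (rule LeastI)
  have leastn: "T m \<Longrightarrow> n \<le> m" for m unfolding n_def by (rule Least_le)
  have n0: "0 < n" "[n] \<cdot> a \<in> H" using Tn by (auto simp: T_def)
  have n1: "n > 1"
  proof (rule ccontr)
    assume "\<not> n > 1" then have "n = 1" using n0 by simp
    then show False using n0 a by simp
  qed
  have memH: "[(k * n)] \<cdot> a \<in> H" for k :: nat
  proof (induct k)
    case 0 then show ?case using sH by (simp add: sub_def)
  next
    case (Suc k)
    have "[(Suc k * n)] \<cdot> a = [n] \<cdot> a \<oplus> [(k * n)] \<cdot> a" using a by (simp add: add.nat_pow_mult)
    then show ?case using Suc n0 sH by (simp add: sub_def)
  qed
  have dvd: "n dvd m" if m: "[m] \<cdot> a \<in> H" for m :: nat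
  proof -
    have e: "[(m div n * n)] \<cdot> a \<oplus> [(m mod n)] \<cdot> a = [m] \<cdot> a" using add.nat_pow_mult[OF a(1)] by simp
    have "[(m mod n)] \<cdot> a = \<ominus> ([(m div n * n)] \<cdot> a) \<oplus> ([(m div n * n)] \<cdot> a \<oplus> [(m mod n)] \<cdot> a)" 
      using a(1) by (intro r_neg1[symmetric]) simp_all
    then have "[(m mod n)] \<cdot> a = \<ominus> ([(m div n * n)] \<cdot> a) \<oplus> [m] \<cdot> a" by (simp only: e)
    moreover have "\<ominus> ([(m div n * n)] \<cdot> a) \<oplus> [m] \<cdot> a \<in> H" 
      using inv[OF sH memH] m sH unfolding sub_def by blast
    ultimately have "[(m mod n)] \<cdot> a \<in> H" by (simp only:)
    then have "0 < m mod n \<Longrightarrow> n \<le> m mod n" using leastn[of "m mod n"] by (simp add: T_def)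
    moreover have "m mod n < n" using n0 by simp
    ultimately have "m mod n = 0" by linarith
    then show ?thesis by auto
  qed
  have wd: "i mod n = j mod n" if "h \<in> H" "h' \<in> H" "h \<oplus> [i] \<cdot> a = h' \<oplus> [j] \<cdot> a" "j \<le> i" for h h' and i j :: nat
  proof -
    have c: "h \<in> carrier R" "h' \<in> carrier R" using that HC by auto
    have "h \<oplus> [(i - j)] \<cdot> a \<oplus> [j] \<cdot> a = h' \<oplus> [j] \<cdot> a" 
      using that c a by (simp add: a_assoc add.nat_pow_mult)
    then have "h \<oplus> [(i - j)] \<cdot> a = h'" using c a by simp
    then have "[(i - j)] \<cdot> a = \<ominus> h \<oplus> h'" using c a by (metis add.nat_pow_closed r_neg1)
    moreover have "\<ominus> h \<oplus> h' \<in> H" using inv[OF sH that(1)] that(2) sH unfolding sub_def by blast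
    ultimately have "[(i - j)] \<cdot> a \<in> H" by (simp only:)
    then have "n dvd i - j" by (rule dvd)
    then show ?thesis using that(4) by (metis mod_eq_dvd_iff_nat)
  qed
  \<comment> \<open>An arbitrarily chosen exponent. By \<open>wd\<close> it is determined modulo
    \<open>n\<close>, so the value of \<open>\<psi>\<close> does not depend on the choice.\<close>
  define ex where "ex x = (SOME i::nat. \<exists>h\<in>H. x = h \<oplus> [i] \<cdot> a)" for x :: 'a
  have ex: "\<exists>h\<in>H. x = h \<oplus> [(ex x)] \<cdot> a" if "x \<in> carrier R" for x
  proof -
    have "x \<in> H'" using that H'c by blast
    then have "\<exists>i::nat. \<exists>h\<in>H. x = h \<oplus> [i] \<cdot> a" unfolding H'_def by blast
    then show ?thesis unfolding ex_def by (rule someI_ex)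
  qed
  define \<psi> where "\<psi> x = cis (2 * pi * real (ex x) / real n)" for x
  have cis_mod: "cis (2 * pi * real i / real n) = cis (2 * pi * real j / real n)" if e: "i mod n = j mod n" for i j :: nat
  proof -
    have red: "cis (2 * pi * real m / real n) = cis (2 * pi * real (m mod n) / real n)" for m :: nat
    proof -
      have "real m = real (m div n) * real n + real (m mod n)" by (metis div_mult_mod_eq of_nat_add of_nat_mult)
      then have "2 * pi * real m / real n = 2 * pi * real (m div n) + 2 * pi * real (m mod n) / real n"
        using n0 by (simp add: field_simps)
      then show ?thesis by (simp add: cis_mult[symmetric] cis_multiple_2pi)
    qed
    show ?thesis using red[of i] red[of j] e by simp
  qed
  have key: "\<psi> x = cis (2 * pi * real i / real n)" if xc: "x \<in> carrier R" and hh: "h \<in> H" and xe: "x = h \<oplus> [i] \<cdot> a" for x h and i :: nat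
  proof -
    obtain h' where h': "h' \<in> H" "x = h' \<oplus> [(ex x)] \<cdot> a" using ex[OF xc] by blast
    have "ex x mod n = i mod n"
      using wd[OF h'(1) hh, of "ex x" i] wd[OF hh h'(1), of i "ex x"] h'(2) xe by (metis nle_le)
    then show ?thesis unfolding \<psi>_def by (rule cis_mod)
  qed
  show ?thesis
  proof (intro exI[of _ \<psi>] conjI ballI)
    fix x y assume xy: "x \<in> carrier R" "y \<in> carrier R"
    obtain h h' where h: "h \<in> H" "x = h \<oplus> [(ex x)] \<cdot> a" "h' \<in> H" "y = h' \<oplus> [(ex y)] \<cdot> a" using ex xy by blast
    have c: "h \<in> carrier R" "h' \<in> carrier R" using h HC by auto
    have "x \<oplus> y = (h \<oplus> [(ex x)] \<cdot> a) \<oplus> (h' \<oplus> [(ex y)] \<cdot> a)" using h by metis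
    also have "\<dots> = (h \<oplus> h') \<oplus> ([(ex x)] \<cdot> a \<oplus> [(ex y)] \<cdot> a)" using c a by (simp add: a_ac)
    also have "\<dots> = (h \<oplus> h') \<oplus> [(ex x + ex y)] \<cdot> a" using a by (simp add: add.nat_pow_mult)
    finally have "x \<oplus> y = (h \<oplus> h') \<oplus> [(ex x + ex y)] \<cdot> a" .
    moreover have "h \<oplus> h' \<in> H" using h(1,3) sH unfolding sub_def by blast
    ultimately have "\<psi> (x \<oplus> y) = cis (2 * pi * real (ex x + ex y) / real n)"
      by (intro key[of _ "h \<oplus> h'"] a_closed xy)
    then show "\<psi> (x \<oplus> y) = \<psi> x * \<psi> y" by (simp add: \<psi>_def cis_mult add_divide_distrib distrib_left)
  next
    have "\<zero> \<in> H" using sH unfolding sub_def by blast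
    then have "\<psi> a = cis (2 * pi * real 1 / real n)" using a by (intro key[of _ \<zero>]) simp_all
    moreover have "cis (2 * pi * real 1 / real n) \<noteq> 1"
    proof
      assume "cis (2 * pi * real 1 / real n) = 1"
      then have s: "sin (2 * pi / real n) = 0" "cos (2 * pi / real n) = 1" by (auto simp: complex_eq_iff)
      obtain x :: int where x: "2 * pi / real n = real_of_int x * (2 * pi)" using s(2) cos_one_2pi_int by auto
      then have "1 = real_of_int x * real n" using n0 by (simp add: field_simps)
      then have "1 = x * int n" by (metis of_int_eq_iff of_int_mult of_int_of_nat_eq of_int_1)
      then have "int n dvd 1" by (metis dvd_triv_right)
      then show False using n1 by simp
    qed
    ultimately show "\<exists>x\<in>carrier R. \<psi> x \<noteq> 1" using a by metis
  qed (simp add: \<psi>_def)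
qed

lemma fermat: "c \<in> Fs \<Longrightarrow> c [^] (qn - 1) = \<one>"
proof -
  assume c: "c \<in> Fs"
  interpret G: group "Multiplicative_Group.mult_of R" by (rule field_mult_group)
  have "order (Multiplicative_Group.mult_of R) = qn - 1" using fin by (simp add: order_mult_of order_def)
  then show ?thesis using G.pow_order_eq_1[of c] c fin 
    by (simp add: mult_of_simps nat_pow_mult_of carrier_mult_of)
qed

end

section \<open>The cubic residue symbol\<close>

text \<open>Any nontrivial additive character \<open>\<psi>\<close> of the constant field will do; the first moment does not depend on it.\<close>

locale cubic_field = fin_field R for R :: "'a ring" (structure) +
  fixes \<Omega> :: "'a \<Rightarrow> complex" and \<psi> :: "'a \<Rightarrow> complex"
  assumes mod6: "card (carrier R) mod 6 = 1" and iso: "cube_root_iso R \<Omega>"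
    and psi_add: "x \<in> carrier R \<Longrightarrow> y \<in> carrier R \<Longrightarrow> \<psi> (x \<oplus> y) = \<psi> x * \<psi> y"
    and psi_norm: "x \<in> carrier R \<Longrightarrow> norm (\<psi> x) = 1"
    and psi_nontriv: "\<exists>x\<in>carrier R. \<psi> x \<noteq> 1"
begin

lemma qn_ge7: "qn \<ge> 7" using mod6 qn_gt1 by presburger
lemma q_ge7: "q \<ge> 7" using qn_ge7 by linarith
lemma qn_mod3: "qn mod 3 = 1" using mod6 by presburger

definition kk :: nat where "kk = (qn - 1) div 3"
lemma kk3: "3 * kk = qn - 1" unfolding kk_def using mod6 by presburger
lemma kk_even: "even kk" unfolding kk_def using mod6 by presburger
lemma kk_pos: "0 < kk" using kk3 qn_ge7 by linarith

lemma mu3_pow: "z \<in> mu3 \<Longrightarrow> z ^ 3 = 1"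
proof -
  have "exp (2 * complex_of_real pi * \<i> / 3) ^ 3 = exp (3 * (2 * complex_of_real pi * \<i> / 3))"
    by (simp add: exp_of_nat_mult[symmetric])
  also have "\<dots> = cis (2 * pi)" by (simp add: cis_conv_exp mult_ac)
  also have "\<dots> = 1" by simp
  finally have e: "exp (2 * complex_of_real pi * \<i> / 3) ^ 3 = 1" .
  assume "z \<in> mu3"
  then consider "z = 1" | "z = exp (2 * complex_of_real pi * \<i> / 3)" | "z = (exp (2 * complex_of_real pi * \<i> / 3))\<^sup>2"
    by (auto simp: mu3_def Let_def)
  then show "z ^ 3 = 1"
  proof cases
    case 3
    have "(exp (2 * complex_of_real pi * \<i> / 3))\<^sup>2 ^ 3 = (exp (2 * complex_of_real pi * \<i> / 3) ^ 3) ^ 2"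
      by (simp only: power_mult[symmetric] mult.commute)
    then show ?thesis using e 3 by simp
  qed (use e in simp_all)
qed

lemma Om_mult: "x \<in> cube_roots_of_unity R \<Longrightarrow> y \<in> cube_roots_of_unity R \<Longrightarrow> \<Omega> (x \<otimes> y) = \<Omega> x * \<Omega> y"
  using iso by (simp add: cube_root_iso_def)
lemma Om_bij: "bij_betw \<Omega> (cube_roots_of_unity R) mu3" using iso by (simp add: cube_root_iso_def)

definition om :: "'a \<Rightarrow> complex" where "om c = \<Omega> (c [^] kk)"

lemma kk_root: "c \<in> Fs \<Longrightarrow> c [^] kk \<in> cube_roots_of_unity R"
  using fermat[of c] kk3 by (simp add: cube_roots_of_unity_def nat_pow_pow mult.commute)
lemma om_mu3: "c \<in> Fs \<Longrightarrow> om c \<in> mu3"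
  using kk_root[of c] Om_bij by (auto simp: om_def bij_betw_def)
lemma om_cube: "c \<in> Fs \<Longrightarrow> om c ^ 3 = 1" using om_mu3 mu3_pow by blast
lemma om_nz: "c \<in> Fs \<Longrightarrow> om c \<noteq> 0" using om_cube[of c] by auto
lemma om_norm: "c \<in> Fs \<Longrightarrow> norm (om c) = 1"
proof -
  assume c: "c \<in> Fs"
  have "norm (om c) ^ 3 = 1 ^ 3" using arg_cong[OF om_cube[OF c], of norm] by (simp add: norm_power)
  then show ?thesis by (rule power_eq_imp_eq_base) simp_all
qed
lemma om_mult: "c \<in> Fs \<Longrightarrow> d \<in> Fs \<Longrightarrow> om (c \<otimes> d) = om c * om d"
  using kk_root[of c] kk_root[of d] by (simp add: om_def nat_pow_distrib Om_mult)
lemma one_Fs: "\<one> \<in> Fs" by simp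
lemma mult_Fs: "c \<in> Fs \<Longrightarrow> d \<in> Fs \<Longrightarrow> c \<otimes> d \<in> Fs" by (simp add: integral_iff)
lemma inv_Fs: "c \<in> Fs \<Longrightarrow> inv c \<in> Fs" using inv_nz by auto
lemma inv_inv: "c \<in> Fs \<Longrightarrow> inv (inv c) = c" using field_Units by (intro Units_inv_inv) simp
lemma neg_Fs: "c \<in> Fs \<Longrightarrow> \<ominus> c \<in> Fs" by (auto dest: add.inv_eq_1_iff[THEN iffD1, rotated])
lemma om_one: "om \<one> = 1" using om_mult[OF one_Fs one_Fs] om_nz[OF one_Fs] by simp
text \<open>As q is 1 modulo 6, \<open>kk\<close> is even and \<open>om\<close> does not see signs.
  This is why the reciprocity law below carries no sign.\<close>

lemma om_neg: "c \<in> Fs \<Longrightarrow> om (\<ominus> c) = om c"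
proof -
  assume c: "c \<in> Fs"
  have "(\<ominus> c) [^] (2::nat) = c [^] (2::nat)" using c 
    by (simp add: numeral_2_eq_2 l_minus r_minus)
  moreover obtain j where "kk = 2 * j" using kk_even by blast
  ultimately have "(\<ominus> c) [^] kk = c [^] kk" using c by (simp add: nat_pow_pow[symmetric])
  then show ?thesis by (simp add: om_def)
qed
lemma om_inv: "c \<in> Fs \<Longrightarrow> om (inv c) = cnj (om c)"
proof -
  assume c: "c \<in> Fs"
  have "om (inv c) * om c = 1" using om_mult[OF inv_Fs[OF c] c] om_one c inv_nz[of c] by simp
  moreover have "cnj (om c) * om c = 1" using om_norm[OF c] by (simp add: complex_norm_square[symmetric] mult.commute flip: complex_norm_square)
  ultimately show ?thesis using om_nz[OF c] by (metis mult_right_cancel)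
qed
text \<open>In a field the equation with exponent \<open>kk\<close> has at most \<open>kk\<close>
  solutions, fewer than the \<open>3 * kk\<close> nonzero constants.\<close>

lemma om_nontriv: "\<exists>c\<in>Fs. om c \<noteq> 1"
proof (rule ccontr)
  assume "\<not> ?thesis"
  then have a: "om c = 1" if "c \<in> Fs" for c using that by blast
  have "c [^] kk = \<one>" if "c \<in> Fs" for c
  proof -
    have "\<Omega> (c [^] kk) = \<Omega> (\<one> [^] kk)" using a[OF that] om_one by (simp add: om_def)
    then show ?thesis using kk_root[OF that] kk_root[OF one_Fs] Om_bij 
      by (simp add: bij_betw_def inj_on_def)
  qed
  then have "Fs \<subseteq> {x \<in> carrier R. x [^] kk = \<one>}" by auto
  then have "card Fs \<le> card {x \<in> carrier R. x [^] kk = \<one>}" using fin by (intro card_mono) auto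
  also have "\<dots> \<le> kk" using kk_pos by (intro num_roots_le_deg[OF fin]) simp
  also have "card Fs = qn - 1" using fin by (simp add: card_Diff_singleton)
  finally show False using kk3 kk_pos by linarith
qed
text \<open>The product is its own inverse, by replacing each c by its inverse, and it is a cube
  root of unity, so it is 1.\<close>

lemma prod_om: "(\<Prod>c\<in>Fs. om c) = 1"
proof -
  let ?X = "\<Prod>c\<in>Fs. om c"
  have b: "bij_betw (\<lambda>c. inv c) Fs Fs"
    by (rule bij_betwI[of _ _ _ "\<lambda>c. inv c"]) (simp_all add: inv_Fs[simplified] inv_inv[simplified])
  have "?X = (\<Prod>c\<in>Fs. om (inv c))" using prod.reindex_bij_betw[OF b, of om] by simp
  then have "?X * ?X = (\<Prod>c\<in>Fs. om c * om (inv c))" by (simp add: prod.distrib)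
  also have "\<dots> = (\<Prod>c\<in>Fs. 1)"
  proof (rule prod.cong[OF refl])
    fix c assume c: "c \<in> Fs"
    show "om c * om (inv c) = 1" using om_mult[OF c inv_Fs[OF c]] om_one c inv_nz[of c] by simp
  qed
  finally have 2: "?X ^ 2 = 1" by (simp add: power2_eq_square)
  have "?X ^ 3 = (\<Prod>c\<in>Fs. om c ^ 3)" by (simp add: prod_power_distrib)
  also have "\<dots> = 1" using om_cube by (intro prod.neutral) blast
  finally have "?X * ?X ^ 2 = 1" by (simp add: power3_eq_cube power2_eq_square mult.assoc)
  then show ?thesis using 2 by simp
qed

lemma om_pow_mod: "c \<in> Fs \<Longrightarrow> om c ^ n = om c ^ (n mod 3)"
proof -
  assume c: "c \<in> Fs"
  have "om c ^ n = om c ^ (3 * (n div 3) + n mod 3)" by simp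
  also have "\<dots> = om c ^ (n mod 3)" unfolding power_add power_mult using om_cube[OF c] by simp
  finally show ?thesis .
qed
lemma card_Fs: "card Fs = qn - 1" using fin by (simp add: card_Diff_singleton)
lemma finite_Fs [simp]: "finite Fs" using fin by simp
lemma sum_om_pow: "(\<Sum>c\<in>Fs. om c ^ n) = (if n mod 3 = 0 then of_nat (qn - 1) else 0)"
proof (cases "n mod 3 = 0")
  case True
  have "(\<Sum>c\<in>Fs. om c ^ n) = (\<Sum>c\<in>Fs. 1)"
    by (rule sum.cong[OF refl]) (metis True om_pow_mod power_0)
  then show ?thesis using True card_Fs by simp
next
  case False
  obtain d where d: "d \<in> Fs" "om d \<noteq> 1" using om_nontriv by blast
  have dn: "om d ^ n \<noteq> 1"
  proof
    assume "om d ^ n = 1"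
    then have e: "om d ^ (n mod 3) = 1" using om_pow_mod[OF d(1), of n] by simp
    have "n mod 3 < 3" by simp
    then have "n mod 3 = 1 \<or> n mod 3 = 2" using False by linarith
    then show False
    proof
      assume "n mod 3 = 1" then show False using e d by simp
    next
      assume "n mod 3 = 2" then have "om d ^ 2 = 1" using e by simp
      then have "om d * om d ^ 2 = om d" by simp
      moreover have "om d * om d ^ 2 = om d ^ 3" by (simp add: power3_eq_cube power2_eq_square)
      ultimately show False using om_cube[OF d(1)] d by simp
    qed
  qed
  have b: "bij_betw (\<lambda>c. d \<otimes> c) Fs Fs"
    by (rule bij_betwI[of _ _ _ "\<lambda>c. inv d \<otimes> c"]) (use d mult_Fs inv_Fs inv_nz[of d] in \<open>auto simp: m_assoc[symmetric]\<close>)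
  have "(\<Sum>c\<in>Fs. om c ^ n) = (\<Sum>c\<in>Fs. om (d \<otimes> c) ^ n)" by (rule sum.reindex_bij_betw[OF b, symmetric])
  also have "\<dots> = om d ^ n * (\<Sum>c\<in>Fs. om c ^ n)"
    unfolding sum_distrib_left by (intro sum.cong refl) (simp add: om_mult[OF d(1)] power_mult_distrib)
  finally have "(1 - om d ^ n) * (\<Sum>c\<in>Fs. om c ^ n) = 0" by (simp add: algebra_simps)
  then show ?thesis using dn False by simp
qed

definition Mr :: "'a list \<Rightarrow> 'a list set" where "Mr F = (\<Union>i<deg F. Mn i)"
text \<open>The analogue of the product of signs in Gauss's lemma; \<open>Mr F\<close> represents
  the nonzero residues up to constants. For a prime modulus this is the residue symbol
  (\<open>residue_prime_eq\<close>), but the formula makes sense for every \<open>F\<close>, which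
  allows reciprocity to be proved for all coprime monic pairs at once.\<close>

definition Gam :: "'a list \<Rightarrow> 'a list \<Rightarrow> complex" where
  "Gam F a = (\<Prod>r\<in>Mr F. om (hd ((a *. r) pmod F)))"

lemma finite_Mr [simp]: "finite (Mr F)" by (simp add: Mr_def)
lemma Mr_iff: "F \<in> M \<Longrightarrow> r \<in> Mr F \<longleftrightarrow> r \<in> M \<and> length r < length F"
  using M_len[of F] by (auto simp: Mr_def Mn_iff M_len)
lemma card_Mr: "card (Mr F) = (\<Sum>i<deg F. qn ^ i)"
  unfolding Mr_def by (subst card_UN_disjoint) (auto simp: card_Mn Mn_iff)

lemma small_cop_ne:
  assumes "F \<in> M" "cop a F" "r \<in> C" "r \<noteq> []" "length r < length F"
  shows "(a *. r) pmod F \<noteq> []"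
proof
  have aC: "a \<in> C" using assms cop_C by blast
  assume "(a *. r) pmod F = []"
  then have "F pdivides (a *. r)" using pmod_nil_iff[of "a *. r" F] assms aC by simp
  then have "F pdivides r" using cop_dvd_mul[OF cop_symI[OF assms(2)]] assms by simp
  then show False using dvd_less_nil[of F r] assms by simp
qed

lemma const_Fs: "c \<in> Fs \<Longrightarrow> [c] \<in> C" by simp
definition nrm :: "'a list \<Rightarrow> 'a list" where "nrm u = [inv (hd u)] *. u"
definition gr :: "'a list \<Rightarrow> 'a list \<Rightarrow> 'a list \<Rightarrow> 'a list" where "gr F a r = (a *. r) pmod F"

lemma nrm_props:
  assumes "u \<in> C" "u \<noteq> []"
  shows "nrm u \<in> M" "u = [hd u] *. nrm u" "length (nrm u) = length u" "hd u \<in> Fs"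
proof -
  have c: "hd u \<in> carrier R" "hd u \<noteq> \<zero>" using assms by auto
  note i = inv_nz[OF c]
  show "nrm u \<in> M" unfolding nrm_def using assms c i by (intro M_I) (simp_all add: hd_mul)
  show "u = [hd u] *. nrm u" unfolding nrm_def
    using assms c i by (simp add: UP.m_assoc[symmetric] const_mul pone_eq[symmetric])
  show "length (nrm u) = length u" unfolding nrm_def using assms i by simp
  show "hd u \<in> Fs" using c by simp
qed

lemma gr_props:
  assumes "F \<in> M" "cop a F" "r \<in> Mr F"
  shows "gr F a r \<in> C" "gr F a r \<noteq> []" "length (gr F a r) < length F" "F pdivides (a *. r -. gr F a r)"
    "hd (gr F a r) \<in> Fs" "nrm (gr F a r) \<in> Mr F"
proof -
  have r: "r \<in> M" "length r < length F" using assms Mr_iff by auto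
  have aC: "a \<in> C" using assms cop_C by blast
  show g: "gr F a r \<in> C" "gr F a r \<noteq> []" "length (gr F a r) < length F"
    unfolding gr_def using small_cop_ne[OF assms(1,2), of r] r assms aC pmod_length[of "a *. r" F] by auto
  show "F pdivides (a *. r -. gr F a r)" unfolding gr_def using r assms aC by (intro pmod_cong_self) auto
  show "hd (gr F a r) \<in> Fs" using nrm_props[OF g(1,2)] by simp
  show "nrm (gr F a r) \<in> Mr F" using nrm_props[OF g(1,2)] g(3) Mr_iff[OF assms(1)] by simp
qed

text \<open>If \<open>a *. r\<close> and \<open>a *. s\<close> are congruent to
  \<open>[c] *. f\<close> and \<open>[d] *. f\<close>, then \<open>[d] *. r -. [c] *. s\<close> is
  divisible by \<open>F\<close>, hence zero by its length, and r = s because both are monic.\<close>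

lemma gr_bij:
  assumes F: "F \<in> M" "cop a F"
  shows "inj_on (\<lambda>r. nrm (gr F a r)) (Mr F)" "(\<lambda>r. nrm (gr F a r)) ` Mr F = Mr F"
proof -
  have aC: "a \<in> C" using F cop_C by blast
  have FC: "F \<in> C" using F by simp
  show inj: "inj_on (\<lambda>r. nrm (gr F a r)) (Mr F)"
  proof (rule inj_onI)
    fix r s assume rs: "r \<in> Mr F" "s \<in> Mr F" and e: "nrm (gr F a r) = nrm (gr F a s)"
    have rM: "r \<in> M" "length r < length F" "s \<in> M" "length s < length F" using rs Mr_iff[OF F(1)] by auto
    have rC: "r \<in> C" "s \<in> C" using rM by auto
    note gp = gr_props[OF F rs(1)] and gs = gr_props[OF F rs(2)]
    define f where "f = nrm (gr F a r)"
    define c where "c = hd (gr F a r)"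
    define d where "d = hd (gr F a s)"
    have cd: "c \<in> Fs" "d \<in> Fs" using gp gs by (simp_all add: c_def d_def)
    have f: "f \<in> C" using nrm_props[OF gp(1,2)] by (simp add: f_def)
    have u: "gr F a r = [c] *. f" "gr F a s = [d] *. f"
      using nrm_props(2)[OF gp(1,2)] nrm_props(2)[OF gs(1,2)] e by (simp_all add: c_def d_def f_def)
    have cC: "[c] \<in> C" "[d] \<in> C" using cd by auto
    have "F pdivides ([d] *. (a *. r -. [c] *. f) -. [c] *. (a *. s -. [d] *. f))"
    proof (rule dvd_subI[OF FC])
      show "F pdivides ([d] *. (a *. r -. [c] *. f))"
        using gp(4) FC cC aC rC f unfolding u by (intro dvd_mulI(2)) simp_all
      show "F pdivides ([c] *. (a *. s -. [d] *. f))"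
        using gs(4) FC cC aC rC f unfolding u by (intro dvd_mulI(2)) simp_all
    qed
    also have "[d] *. (a *. r -. [c] *. f) -. [c] *. (a *. s -. [d] *. f) = a *. ([d] *. r -. [c] *. s)"
      using cC aC rC f by algebra
    finally have "F pdivides ([d] *. r -. [c] *. s)" 
      using cop_dvd_mul[OF cop_symI[OF F(2)]] cC rC by simp
    moreover have "length ([d] *. r -. [c] *. s) < length F"
      using length_sub_le[of "[d] *. r" "[c] *. s"] cd cC rC rM by simp
    ultimately have "[d] *. r -. [c] *. s = []" using dvd_less_nil[OF FC] cC rC by simp
    then have "[d] *. r = [c] *. s" using sub_eq_nil cC rC by simp
    then show "r = s" using const_mul_inj[of d c r s] cd rM by simp
  qed
  have "(\<lambda>r. nrm (gr F a r)) ` Mr F \<subseteq> Mr F" using gr_props(6)[OF F] by blast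
  then show "(\<lambda>r. nrm (gr F a r)) ` Mr F = Mr F" using inj by (intro endo_inj_surj) simp_all
qed

text \<open>Multiplication by \<open>a\<close> permutes the monic polynomials of degree less than \<open>deg P\<close> modulo \<open>P\<close> up to constants, and
  the product of these constants is congruent to a power of \<open>a\<close>.\<close>

lemma gauss_lemma:
  assumes P: "P \<in> \<P>" and a: "a \<in> C" "\<not> P pdivides a"
  shows "\<exists>c\<in>Fs. om c = Gam P a \<and> P pdivides (a ^. card (Mr P) -. [c])"
proof -
  have PM: "P \<in> M" "P \<in> C" using P by auto
  have cp: "cop a P" using bezout_prime P a by blast
  define fp where "fp f A = finprod (poly_ring R) f A" for f :: "'a list \<Rightarrow> 'a list" and A
  have MrM: "r \<in> M" if "r \<in> Mr P" for r using that Mr_iff[OF PM(1)] by blast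
  have gpM: "nrm (gr P a r) \<in> M" if "r \<in> Mr P" for r using gr_props(6)[OF PM(1) cp that] MrM by blast
  \<comment> \<open>Induction over subsets of \<open>Mr P\<close>: the congruences between
    \<open>a *. r\<close> and \<open>[d] *. f\<close> are multiplied, and the leading coefficients
    are collected in one constant.\<close>
  have step: "A \<subseteq> Mr P \<Longrightarrow> \<exists>c\<in>Fs. om c = (\<Prod>r\<in>A. om (hd (gr P a r))) \<and> 
      P pdivides (a ^. card A *. fp (\<lambda>r. r) A -. [c] *. fp (\<lambda>r. nrm (gr P a r)) A)" if "finite A" for A
    using that
  proof (induct A)
    case empty
    show ?case
      by (intro bexI[of _ \<one>]) (use PM in \<open>simp_all add: fp_def om_one pone_eq[symmetric]\<close>)
  next
    case (insert r A)
    then obtain c where c: "c \<in> Fs" "om c = (\<Prod>r\<in>A. om (hd (gr P a r)))"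
      "P pdivides (a ^. card A *. fp (\<lambda>r. r) A -. [c] *. fp (\<lambda>r. nrm (gr P a r)) A)" by blast
    have rP: "r \<in> Mr P" using insert by blast
    define d where "d = hd (gr P a r)"
    define f where "f = nrm (gr P a r)"
    note gp = gr_props[OF PM(1) cp rP]
    have d: "d \<in> Fs" "gr P a r = [d] *. f" "f \<in> C" "r \<in> C"
      using nrm_props[OF gp(1,2)] MrM[OF rP] by (simp_all add: d_def f_def)
    define Xa where "Xa = fp (\<lambda>r. r) A"
    define Ya where "Ya = fp (\<lambda>r. nrm (gr P a r)) A"
    have XaYa: "Xa \<in> C" "Ya \<in> C" unfolding Xa_def Ya_def fp_def
      using insert MrM gpM by (auto intro!: UP.finprod_closed)
    have i1: "fp (\<lambda>r. r) (insert r A) = r *. Xa" unfolding Xa_def fp_def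
      using insert MrM by (intro UP.finprod_insert) auto
    have i2: "fp (\<lambda>r. nrm (gr P a r)) (insert r A) = f *. Ya" unfolding Ya_def fp_def f_def
      using insert gpM by (intro UP.finprod_insert) auto
    define b where "b = a ^. card A"
    have bC: "b \<in> C" using a by (simp add: b_def)
    have cC: "[c] \<in> C" "[d] \<in> C" using c d by auto
    have "P pdivides ((a *. r -. [d] *. f) *. (b *. Xa) +. ([d] *. f) *. (b *. Xa -. [c] *. Ya))"
    proof (rule dvd_addI)
      show "P pdivides ((a *. r -. [d] *. f) *. (b *. Xa))"
        using gp(4) unfolding d(2) using PM a d(3,4) cC bC XaYa by (intro dvd_mulI(1)) simp_all
      show "P pdivides (([d] *. f) *. (b *. Xa -. [c] *. Ya))"
        using c(3) unfolding Xa_def[symmetric] Ya_def[symmetric] b_def[symmetric]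
        using PM a d(3,4) cC bC XaYa by (intro dvd_mulI(2)) simp_all
    qed (use PM in simp)
    also have "(a *. r -. [d] *. f) *. (b *. Xa) +. ([d] *. f) *. (b *. Xa -. [c] *. Ya)
       = (b *. a) *. (r *. Xa) -. ([c] *. [d]) *. (f *. Ya)"
      using a(1) d(3,4) cC bC XaYa by algebra
    finally have "P pdivides (a ^. card (insert r A) *. fp (\<lambda>r. r) (insert r A) -. [c \<otimes> d] *. fp (\<lambda>r. nrm (gr P a r)) (insert r A))"
      unfolding i1 i2 using insert c d by (simp add: b_def const_mul)
    moreover have "om (c \<otimes> d) = (\<Prod>r\<in>insert r A. om (hd (gr P a r)))"
      using insert om_mult[OF c(1) d(1)] c by (simp add: d_def mult.commute)
    ultimately show ?case using mult_Fs[OF c(1) d(1)] by blast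
  qed
  obtain c where c: "c \<in> Fs" "om c = Gam P a" 
      "P pdivides (a ^. card (Mr P) *. fp (\<lambda>r. r) (Mr P) -. [c] *. fp (\<lambda>r. nrm (gr P a r)) (Mr P))"
    using step[OF finite_Mr subset_refl] by (auto simp: Gam_def gr_def)
  \<comment> \<open>Since \<open>nrm (gr P a r)\<close> runs through a permutation of
    \<open>Mr P\<close>, both products are the same element; it is prime to \<open>P\<close> and
    cancels.\<close>
  have re: "fp (\<lambda>r. nrm (gr P a r)) (Mr P) = fp (\<lambda>r. r) (Mr P)"
    using UP.finprod_reindex[of "\<lambda>r. r" "\<lambda>r. nrm (gr P a r)" "Mr P"] gr_bij[OF PM(1) cp] MrM 
    by (auto simp: fp_def)
  have copA: "A \<subseteq> Mr P \<Longrightarrow> cop (fp (\<lambda>r. r) A) P" if "finite A" for A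
    using that
  proof (induct A)
    case empty then show ?case using PM by (simp add: fp_def)
  next
    case (insert r A)
    have "fp (\<lambda>r. r) (insert r A) = r *. fp (\<lambda>r. r) A" unfolding fp_def
      using insert MrM by (intro UP.finprod_insert) auto
    moreover have r: "r \<in> M" "length r < length P" using insert Mr_iff[OF PM(1)] by auto
    moreover have "\<not> P pdivides r" using dvd_less_nil[of P r] r PM by auto
    ultimately show ?case using insert bezout_prime[OF P, of r] cop_mul by simp
  qed
  define Za where "Za = fp (\<lambda>r. r) (Mr P)"
  have Za: "cop Za P" "Za \<in> C" using copA[OF finite_Mr subset_refl] cop_C by (auto simp: Za_def)
  have "P pdivides (a ^. card (Mr P) *. Za -. [c] *. Za)" using c(3) unfolding re Za_def[symmetric] .
  also have "a ^. card (Mr P) *. Za -. [c] *. Za = Za *. (a ^. card (Mr P) -. [c])"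
    using Za(2) const_Fs[OF c(1)] UP.nat_pow_closed[OF a(1), of "card (Mr P)"] by algebra
  finally have "P pdivides (a ^. card (Mr P) -. [c])"
    using cop_dvd_mul[OF cop_symI[OF Za(1)]] c(1) a by simp
  then show ?thesis using c by blast
qed

text \<open>The exponent in the residue symbol factors as \<open>card (Mr P)\<close> times
  \<open>kk\<close>: the first factor is the exponent in \<open>gauss_lemma\<close>, the second
  turns the constant found there into a cube root of unity.\<close>

lemma geom_qn: "(qn ^ d - 1) div 3 = (\<Sum>i<d. qn ^ i) * kk"
proof -
  have "qn ^ d - 1 = (qn - 1) * (\<Sum>i<d. qn ^ i)"
  proof (induct d)
    case (Suc d)
    have "qn ^ Suc d - 1 = (qn ^ d - 1) + (qn - 1) * qn ^ d"
      using qn_gt1 by (simp add: algebra_simps diff_mult_distrib)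
    then show ?case using Suc by (simp add: algebra_simps)
  qed simp
  also have "\<dots> = 3 * (kk * (\<Sum>i<d. qn ^ i))" using kk3 by simp
  finally show ?thesis by (simp add: mult.commute)
qed

lemma const_pow: "c \<in> Fs \<Longrightarrow> [c] ^. n = [c [^] n] \<and> c [^] n \<in> Fs"
proof (induct n)
  case 0 then show ?case by (simp add: pone_eq)
next
  case (Suc n)
  then show ?case using const_mul[of "c [^] n" c] mult_Fs[of "c [^] n" c] by simp
qed

lemma cong_pow: 
  assumes "F \<in> C" "a \<in> C" "b \<in> C" "F pdivides (a -. b)" shows "F pdivides (a ^. n -. b ^. n)"
proof (induct n)
  case 0 then show ?case using assms by simp
next
  case (Suc n)
  define x where "x = a ^. n" define y where "y = b ^. n"
  have c: "x \<in> C" "y \<in> C" using assms by (simp_all add: x_def y_def)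
  have "F pdivides ((x -. y) *. a +. y *. (a -. b))"
    using Suc unfolding x_def[symmetric] y_def[symmetric] using assms c by (intro dvd_addI dvd_mulI) simp_all
  also have "(x -. y) *. a +. y *. (a -. b) = x *. a -. y *. b" using assms c by algebra
  finally show ?case by (simp add: x_def y_def)
qed

lemma const_cong_eq:
  assumes "P \<in> \<P>" "c \<in> Fs" "d \<in> Fs" "P pdivides ([c] -. [d])" shows "c = d"
proof -
  have C: "[c] \<in> C" "[d] \<in> C" using assms by auto
  have "length P \<ge> 2" using deg_prime[OF assms(1)] M_len[of P] assms(1) by simp
  then have "length ([c] -. [d]) < length P" using length_sub_le[OF C] by simp
  then have "[c] -. [d] = []" using dvd_less_nil[of P "[c] -. [d]"] assms C by simp
  then show ?thesis using sub_eq_nil[OF C] by simp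
qed

lemma poly_of_const_eq: "c \<noteq> \<zero> \<Longrightarrow> poly_of_const c = [c]"
  by (simp add: poly_of_const_def)

lemma residue_prime_eq:
  assumes P: "P \<in> \<P>" and a: "a \<in> C" "\<not> P pdivides a"
  shows "cubic_residue_prime R \<Omega> P a = Gam P a"
proof -
  obtain c where c: "c \<in> Fs" "om c = Gam P a" "P pdivides (a ^. card (Mr P) -. [c])"
    using gauss_lemma[OF assms] by blast
  define n where "n = (qn ^ degree P - 1) div 3"
  have n: "n = card (Mr P) * kk" unfolding n_def card_Mr geom_qn by (simp add: deg_def)
  define e where "e = c [^] kk"
  have e: "e \<in> Fs" "e \<in> cube_roots_of_unity R" "[c] ^. kk = [e]" "\<Omega> e = om c"
    using const_pow[OF c(1), of kk] kk_root[OF c(1)] by (auto simp: e_def om_def)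
  have PC: "P \<in> C" using P by simp
  have cong: "P pdivides (a ^. n -. [e])"
    using cong_pow[OF PC _ _ c(3), of kk] a c(1) e(3) by (simp add: n UP.nat_pow_pow)
  have inv: "inv_into (cube_roots_of_unity R) \<Omega> (om c) = e"
    using e Om_bij inv_into_f_f[of \<Omega> "cube_roots_of_unity R" e] by (auto simp: bij_betw_def)
  have "(THE \<alpha>. \<alpha> \<in> mu3 \<and> poly_cong R P (a ^. n)
          (poly_of_const (inv_into (cube_roots_of_unity R) \<Omega> \<alpha>))) = om c"
  proof (rule the_equality)
    show "om c \<in> mu3 \<and> poly_cong R P (a ^. n) (poly_of_const (inv_into (cube_roots_of_unity R) \<Omega> (om c)))"
      using om_mu3[OF c(1)] cong e(1) by (simp add: inv poly_cong_def poly_of_const_eq)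
    fix \<alpha> assume al: "\<alpha> \<in> mu3 \<and> poly_cong R P (a ^. n) (poly_of_const (inv_into (cube_roots_of_unity R) \<Omega> \<alpha>))"
    define d where "d = inv_into (cube_roots_of_unity R) \<Omega> \<alpha>"
    have im: "\<alpha> \<in> \<Omega> ` cube_roots_of_unity R" using al Om_bij by (simp add: bij_betw_def)
    have d: "d \<in> cube_roots_of_unity R" "\<Omega> d = \<alpha>" unfolding d_def using im by (auto intro: inv_into_into f_inv_into_f)
    have dF: "d \<in> Fs" using d(1) by (auto simp: cube_roots_of_unity_def numeral_3_eq_3)
    have "P pdivides (a ^. n -. [d])" using al dF unfolding d_def[symmetric] by (simp add: poly_cong_def poly_of_const_eq)
    then have "P pdivides ((a ^. n -. [e]) -. (a ^. n -. [d]))" using cong by (rule dvd_subI[OF PC, rotated])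
    also have "(a ^. n -. [e]) -. (a ^. n -. [d]) = [d] -. [e]"
      using UP.nat_pow_closed[OF a(1), of n] const_Fs[OF dF] const_Fs[OF e(1)] by algebra
    finally have "d = e" using const_cong_eq[OF P dF e(1)] by simp
    then show "\<alpha> = om c" using d e by simp
  qed
  then show ?thesis using a(2) c(2) by (simp add: cubic_residue_prime_def n_def)
qed

section \<open>Cubic reciprocity\<close>

text \<open>In each degree every constant is leading coefficient equally often, and by
  \<open>prod_om\<close> the constants multiply to 1.\<close>

lemma prod_hd_om: "(\<Prod>u\<in>Pl n - {[]}. om (hd u)) = 1"
proof (induct n)
  case (Suc n)
  let ?L = "{u \<in> C. length u = Suc n}"
  have e: "Pl (Suc n) - {[]} = (Pl n - {[]}) \<union> ?L" by (auto simp: Pl_iff)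
  have fin: "finite ?L" by (rule finite_subset[of _ "Pl (Suc n)"]) (auto simp: Pl_iff)
  have "(\<Prod>u\<in>Pl (Suc n) - {[]}. om (hd u)) = (\<Prod>u\<in>Pl n - {[]}. om (hd u)) * (\<Prod>u\<in>?L. om (hd u))"
    unfolding e by (rule prod.union_disjoint) (use fin in \<open>auto simp: Pl_iff\<close>)
  also have "(\<Prod>u\<in>?L. om (hd u)) = (\<Prod>z\<in>Mn n \<times> Fs. om (hd (case z of (f,c) \<Rightarrow> [c] *. f)))"
    by (rule prod.reindex_bij_betw[OF length_Suc_bij, symmetric])
  also have "\<dots> = (\<Prod>z\<in>Mn n \<times> Fs. om (snd z))"
  proof (rule prod.cong[OF refl])
    fix z assume z: "z \<in> Mn n \<times> Fs"
    obtain f c where zz: "z = (f,c)" by (cases z)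
    have "f \<in> M" "c \<in> carrier R" "c \<noteq> \<zero>" using z zz by auto
    then show "om (hd (case z of (f,c) \<Rightarrow> [c] *. f)) = om (snd z)" by (simp add: zz hd_mul)
  qed
  also have "\<dots> = (\<Prod>f\<in>Mn n. \<Prod>c\<in>Fs. om c)"
    unfolding prod.cartesian_product by (simp add: case_prod_unfold)
  finally show ?case using Suc by (simp add: prod_om)
qed simp

text \<open>Let n <= N be the degrees of \<open>a\<close> and \<open>F\<close>. A monic
  \<open>r\<close> of degree N - n + t is written uniquely as \<open>r' s +. u\<close>, where s is
  monic of degree t, u is in \<open>Pl (N - n)\<close>, and \<open>r' s\<close> and
  \<open>rho s\<close> are quotient and remainder of \<open>F *. s\<close> by \<open>a\<close>.
  Modulo \<open>F\<close>, \<open>a *. r\<close> becomes \<open>a *. u -. rho s\<close>. For u = 0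
  its leading coefficient is that of \<open>rho s\<close> up to sign, which yields the factors of
  \<open>Gam a F\<close>; for the other u it is that of u, and these cancel by
  \<open>prod_hd_om\<close>. For degrees below N - n, \<open>a *. r\<close> is already reduced and
  monic and contributes 1.\<close>

lemma Gam_recip_le:
  assumes F: "F \<in> M" and a: "a \<in> M" and cop: "cop a F" and le: "deg a \<le> deg F"
  shows "Gam F a = Gam a F"
proof -
  define N where "N = deg F"
  define n where "n = deg a"
  have nN: "n \<le> N" using le by (simp add: n_def N_def)
  have lF: "length F = Suc N" and la: "length a = Suc n" using M_len F a by (auto simp: N_def n_def)
  have FC: "F \<in> C" and aC: "a \<in> C" using F a by auto
  define rho where "rho s = gr a F s" for s
  define r' where "r' s = (F *. s) pdiv a" for s
  have copFa: "cop F a" using cop cop_sym by blast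
  have main: "F *. s = a *. r' s +. rho s" "r' s \<in> Mn (N - n + t)" "rho s \<in> C" "rho s \<noteq> []" "length (rho s) \<le> n"
    if s: "s \<in> Mn t" and t: "t < n" for s t
  proof -
    have sM: "s \<in> M" "length s = Suc t" using s by (auto simp: Mn_iff)
    have sC: "s \<in> C" using sM by simp
    have "s \<in> Mr a" using sM t la a by (simp add: Mr_iff)
    note g = gr_props[OF a copFa this]
    show rho: "rho s \<in> C" "rho s \<noteq> []" "length (rho s) \<le> n" using g la by (auto simp: rho_def)
    show e: "F *. s = a *. r' s +. rho s" unfolding r'_def rho_def gr_def
      using pmod_eq[of "F *. s" a] FC aC sC by simp
    have rC: "r' s \<in> C" using FC aC sC by (simp add: r'_def)
    have "a *. r' s = F *. s -. rho s" unfolding e using aC rC rho(1) by algebra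
    also have "\<dots> = F *. s +. (-. rho s)" by (simp add: UP.minus_eq)
    finally have ar: "a *. r' s = F *. s +. (-. rho s)" .
    have lFs: "length (F *. s) = Suc (N + t)" using length_mul[of F s] F sM lF by simp
    have l: "length (a *. r' s) = Suc (N + t)" 
      unfolding ar using length_add_eq[of "F *. s" "-. rho s"] lFs rho nN FC sC by simp
    have h: "hd (a *. r' s) = \<one>"
      unfolding ar using hd_add_eq[of "F *. s" "-. rho s"] lFs rho nN F sM by (simp add: hd_mul)
    have rne: "r' s \<noteq> []" using l aC by (intro notI) simp
    have "length (r' s) = Suc (N - n + t)" using l length_mul[of a "r' s"] aC rC rne a la nN by simp
    moreover have "hd (r' s) = \<one>" using h hd_mul[of a "r' s"] a rC rne by simp
    ultimately show "r' s \<in> Mn (N - n + t)" using rC rne by (auto simp: Mn_iff intro!: M_I)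
  qed
  have gval: "gr F a (r' s +. u) = a *. u -. rho s" 
    if s: "s \<in> Mn t" and t: "t < n" and u: "u \<in> Pl (N - n)" for s t u
  proof -
    note m = main[OF s t]
    have c: "s \<in> C" "u \<in> C" "r' s \<in> C" using s u m(2) by auto
    have "length (a *. u) \<le> N" using Pl_length_mul[OF a u] nN by (simp add: Pl_iff n_def)
    then have l: "length (a *. u -. rho s) < length F" 
      using length_sub_le[of "a *. u" "rho s"] c aC m nN lF by simp
    have "a *. (r' s +. u) -. (a *. u -. rho s) = a *. r' s +. rho s" using c aC m(3) by algebra
    also have "\<dots> = F *. s" using m(1) by simp
    finally have "F pdivides (a *. (r' s +. u) -. (a *. u -. rho s))" by (rule dvdI[OF c(1)])
    then have "(a *. (r' s +. u)) pmod F = (a *. u -. rho s) pmod F" 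
      using pmod_cong_iff[of "a *. (r' s +. u)" "a *. u -. rho s" F] c aC m(3) FC by simp
    also have "\<dots> = a *. u -. rho s" using l c aC m(3) FC by (intro pmod_small) simp_all
    finally show ?thesis by (simp add: gr_def)
  qed
  have big: "(\<Prod>r\<in>Mn (N - n + t). om (hd (gr F a r))) = (\<Prod>s\<in>Mn t. om (hd (rho s)))" if t: "t < n" for t
  proof -
    have sub: "(\<lambda>(s,u). r' s +. u) ` (Mn t \<times> Pl (N - n)) \<subseteq> Mn (N - n + t)"
    proof clarify
      fix s u assume s: "s \<in> Mn t" and u: "u \<in> Pl (N - n)"
      note m = main[OF s t]
      have c: "u \<in> C" "r' s \<in> M" "length (r' s) = Suc (N - n + t)" "length u \<le> N - n" 
        using u m(2) by (auto simp: Pl_iff Mn_iff)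
      have "length (r' s +. u) = length (r' s)" "hd (r' s +. u) = hd (r' s)"
        using length_add_eq[of "r' s" u] hd_add_eq[of "r' s" u] c by simp_all
      moreover have "r' s +. u \<in> C" using c by simp
      ultimately show "r' s +. u \<in> Mn (N - n + t)" using c by (auto simp: Mn_iff intro!: M_I)
    qed
    have inj: "inj_on (\<lambda>(s,u). r' s +. u) (Mn t \<times> Pl (N - n))"
    proof (rule inj_onI)
      fix z z' assume z: "z \<in> Mn t \<times> Pl (N - n)" "z' \<in> Mn t \<times> Pl (N - n)"
        and e: "(case z of (s,u) \<Rightarrow> r' s +. u) = (case z' of (s,u) \<Rightarrow> r' s +. u)"
      obtain s u s2 u2 where zz: "z = (s,u)" "z' = (s2,u2)" by (cases z, cases z') blast
      have s: "s \<in> Mn t" "s2 \<in> Mn t" and u: "u \<in> Pl (N - n)" "u2 \<in> Pl (N - n)" using z zz by auto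
      note m = main[OF s(1) t] and m2 = main[OF s(2) t]
      have c: "s \<in> C" "s2 \<in> C" "u \<in> C" "u2 \<in> C" "r' s \<in> C" "r' s2 \<in> C" "rho s \<in> C" "rho s2 \<in> C" 
        using s u m(2,3) m2(2,3) by auto
      have e: "r' s +. u = r' s2 +. u2" using e zz by simp
      have "a *. u -. rho s = a *. u2 -. rho s2"
        using gval[OF s(1) t u(1)] gval[OF s(2) t u(2)] e by simp
      moreover have "F *. s = a *. (r' s +. u) -. (a *. u -. rho s)"
        unfolding m(1) using c aC by algebra
      moreover have "F *. s2 = a *. (r' s2 +. u2) -. (a *. u2 -. rho s2)"
        unfolding m2(1) using c aC by algebra
      ultimately have "F *. s = F *. s2" using e by simp
      then have ss: "s = s2" using M_cancel[OF F] c by simp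
      then have "u = u2" using e UP.add.l_cancel[of "r' s" u u2] c by simp
      then show "z = z'" using ss zz by simp
    qed
    have img: "(\<lambda>(s,u). r' s +. u) ` (Mn t \<times> Pl (N - n)) = Mn (N - n + t)"
      using card_subset_eq[OF finite_Mn sub] inj 
      by (simp add: card_image card_Mn card_Pl card_cartesian_product power_add mult.commute)
    have "(\<Prod>r\<in>Mn (N - n + t). om (hd (gr F a r))) = (\<Prod>z\<in>Mn t \<times> Pl (N - n). om (hd (gr F a (case z of (s,u) \<Rightarrow> r' s +. u))))"
      using prod.reindex_bij_betw[of "\<lambda>(s,u). r' s +. u" "Mn t \<times> Pl (N - n)" "Mn (N - n + t)" "\<lambda>r. om (hd (gr F a r))"] inj img
      by (simp add: bij_betw_def)
    also have "\<dots> = (\<Prod>s\<in>Mn t. \<Prod>u\<in>Pl (N - n). om (hd (gr F a (r' s +. u))))"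
      unfolding prod.cartesian_product by (simp add: case_prod_unfold)
    also have "\<dots> = (\<Prod>s\<in>Mn t. om (hd (rho s)))"
    proof (rule prod.cong[OF refl])
      fix s assume s: "s \<in> Mn t"
      note m = main[OF s t]
      have "(\<Prod>u\<in>Pl (N - n). om (hd (gr F a (r' s +. u)))) = (\<Prod>u\<in>Pl (N - n). om (hd (a *. u -. rho s)))"
        using gval[OF s t] by simp
      also have "\<dots> = om (hd (a *. [] -. rho s)) * (\<Prod>u\<in>Pl (N - n) - {[]}. om (hd (a *. u -. rho s)))"
        by (rule prod.remove) simp_all
      also have "hd (a *. [] -. rho s) = \<ominus> hd (rho s)"
        using m aC by (simp add: UP.minus_eq hd_neg)
      also have "om (\<ominus> hd (rho s)) = om (hd (rho s))" using nrm_props(4)[OF m(3,4)] by (rule om_neg)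
      also have "(\<Prod>u\<in>Pl (N - n) - {[]}. om (hd (a *. u -. rho s))) = (\<Prod>u\<in>Pl (N - n) - {[]}. om (hd u))"
      proof (rule prod.cong[OF refl])
        fix u assume u: "u \<in> Pl (N - n) - {[]}"
        have uC: "u \<in> C" "u \<noteq> []" "length u > 0" using u by auto
        have "length (a *. u) > n" using length_mul[of a u] uC a la by simp
        then have "hd (a *. u +. (-. rho s)) = hd (a *. u)" using m uC aC by (intro hd_add_eq) simp_all
        then show "om (hd (a *. u -. rho s)) = om (hd u)" using uC a by (simp add: UP.minus_eq hd_mul)
      qed
      finally show "(\<Prod>u\<in>Pl (N - n). om (hd (gr F a (r' s +. u)))) = om (hd (rho s))" by (simp add: prod_hd_om)
    qed
    finally show ?thesis .
  qed
  have small: "(\<Prod>r\<in>Mn i. om (hd (gr F a r))) = 1" if i: "i < N - n" for i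
  proof (rule prod.neutral, rule ballI)
    fix r assume r: "r \<in> Mn i"
    have "length (a *. r) < length F" using length_mul[of a r] r a la lF i by (auto simp: Mn_iff)
    then have "gr F a r = a *. r" unfolding gr_def using r aC FC by (intro pmod_small) auto
    moreover have "r \<in> M" using r by auto
    ultimately show "om (hd (gr F a r)) = 1" using a by (simp add: om_one)
  qed
  have disj: "i \<noteq> j \<Longrightarrow> Mn i \<inter> Mn j = {}" for i j by (auto simp: Mn_iff)
  have G1: "Gam F a = (\<Prod>i<N. \<Prod>r\<in>Mn i. om (hd (gr F a r)))"
    unfolding Gam_def Mr_def N_def gr_def using disj by (intro prod.UNION_disjoint) auto
  have G2: "Gam a F = (\<Prod>i<n. \<Prod>r\<in>Mn i. om (hd (rho r)))"
    unfolding Gam_def Mr_def n_def gr_def rho_def using disj by (intro prod.UNION_disjoint) auto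
  have split: "(\<Prod>i<k + l. f i) = (\<Prod>i<k. f i) * (\<Prod>t<l. f (k + t))" for f :: "nat \<Rightarrow> complex" and k l
    by (induct l) (simp_all add: mult.assoc)
  have "(\<Prod>i<N. \<Prod>r\<in>Mn i. om (hd (gr F a r))) = (\<Prod>i<N - n. \<Prod>r\<in>Mn i. om (hd (gr F a r))) *
     (\<Prod>t<n. \<Prod>r\<in>Mn (N - n + t). om (hd (gr F a r)))"
    using split[of "\<lambda>i. \<Prod>r\<in>Mn i. om (hd (gr F a r))" "N - n" n] nN by simp
  also have "(\<Prod>t<n. \<Prod>r\<in>Mn (N - n + t). om (hd (gr F a r))) = (\<Prod>t<n. \<Prod>s\<in>Mn t. om (hd (rho s)))" using big by simp
  finally show ?thesis using small by (simp add: G1 G2)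
qed

lemma Gam_recip:
  assumes "F \<in> M" "a \<in> M" "cop a F" shows "Gam F a = Gam a F"
  using Gam_recip_le[of F a] Gam_recip_le[of a F] assms cop_sym by (metis nle_le)

end

section \<open>Exponents of primes, cubes, and the Chinese remainder theorem\<close>

context fin_field begin
lemma prime_decomp:
  assumes "f \<in> M" "p \<in> \<P>"
  obtains e g where "g \<in> M" "f = p ^. e *. g" "\<not> p pdivides g"
proof -
  have "\<exists>e g. g \<in> M \<and> f = p ^. e *. g \<and> \<not> p pdivides g"
    using assms(1)
  proof (induct "deg f" arbitrary: f rule: less_induct)
    case less
    show ?case
    proof (cases "p pdivides f")
      case False
      then show ?thesis using less by (intro exI[of _ "0::nat"] exI[of _ f]) simp
    next
      case True
      then obtain h where h: "h \<in> M" "f = p *. h" using M_dvd_monic[OF _ less(2) True] assms by auto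
      have "deg h < deg f" using h assms deg_prime_pos[OF assms(2)] by simp
      then obtain e g where "g \<in> M" "h = p ^. e *. g" "\<not> p pdivides g" using less(1) h by blast
      moreover have "p *. (p ^. e *. g) = p ^. Suc e *. g" 
        using calculation(1) assms by (simp add: UP.m_ac)
      ultimately show ?thesis using h by metis
    qed
  qed
  then show ?thesis using that by blast
qed

lemma pow_dvd_iff:
  assumes "p \<in> \<P>" "g \<in> M" "\<not> p pdivides g"
  shows "(p ^. k) pdivides (p ^. e *. g) \<longleftrightarrow> k \<le> e"
proof
  have pC: "p \<in> C" "g \<in> C" using assms by auto
  show "k \<le> e" if "(p ^. k) pdivides (p ^. e *. g)"
  proof (rule ccontr)
    assume "\<not> k \<le> e"
    then obtain j where j: "k = e + Suc j" using less_iff_Suc_add by (metis add_Suc_right not_le)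
    have "p ^. k = p ^. e *. (p ^. Suc j)" using pC by (simp only: j UP.nat_pow_mult)
    moreover have "p ^. e \<noteq> []" using pow_M[of p e] assms by auto
    ultimately have "(p ^. Suc j) pdivides g" 
      using that dvd_mul_cancel[of "p ^. Suc j" g "p ^. e"] pC by (simp del: UP.nat_pow_Suc)
    moreover have "p pdivides (p ^. Suc j)" using pC by (intro dvdI[of "p ^. j"]) (simp_all add: UP.m_comm)
    ultimately show False using dvd_trans assms pC by blast
  qed
  show "(p ^. k) pdivides (p ^. e *. g)" if "k \<le> e"
  proof -
    have "p ^. e = p ^. k *. p ^. (e - k)" using that pC by (simp add: UP.nat_pow_mult)
    then show ?thesis using pC by (intro dvdI[of "p ^. (e - k) *. g"]) (simp_all add: UP.m_assoc)
  qed
qed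

definition pe :: "'a list \<Rightarrow> 'a list \<Rightarrow> nat" where "pe p f = prime_exponent R p f"

lemma pe_eq:
  assumes "p \<in> \<P>" "g \<in> M" "\<not> p pdivides g" 
  shows "pe p (p ^. e *. g) = e"
  unfolding pe_def prime_exponent_def using pow_dvd_iff[OF assms, of _ e] 
  by (intro Greatest_equality) auto

lemma pe_mul: 
  assumes "p \<in> \<P>" "f \<in> M" "g \<in> M" shows "pe p (f *. g) = pe p f + pe p g"
proof -
  obtain e h where h: "h \<in> M" "f = p ^. e *. h" "\<not> p pdivides h" using prime_decomp[OF assms(2,1)] by metis
  obtain d i where i: "i \<in> M" "g = p ^. d *. i" "\<not> p pdivides i" using prime_decomp[OF assms(3,1)] by metis
  have C: "p \<in> C" "h \<in> C" "i \<in> C" "p ^. e \<in> C" "p ^. d \<in> C" using assms h i by auto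
  have "f *. g = (p ^. e *. p ^. d) *. (h *. i)" unfolding h i using C by algebra
  also have "p ^. e *. p ^. d = p ^. (e + d)" using C by (simp add: UP.nat_pow_mult)
  finally have "f *. g = p ^. (e + d) *. (h *. i)" .
  moreover have "\<not> p pdivides (h *. i)" using prime_dvd_mul[OF assms(1)] C h i by blast
  ultimately have "pe p (f *. g) = e + d" using pe_eq[OF assms(1), of "h *. i"] h i by simp
  then show ?thesis using pe_eq[OF assms(1) h(1,3), of e] pe_eq[OF assms(1) i(1,3), of d] h i by simp
qed
lemma pe_0: "p \<in> \<P> \<Longrightarrow> f \<in> M \<Longrightarrow> \<not> p pdivides f \<Longrightarrow> pe p f = 0"
  using pe_eq[of p f 0] by simp
lemma pe_prime: "p \<in> \<P> \<Longrightarrow> r \<in> \<P> \<Longrightarrow> pe p r = (if p = r then 1 else 0)"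
proof -
  assume p: "p \<in> \<P>" "r \<in> \<P>"
  have "pe p p = 1" using pe_eq[of p "\<one>\<^sub>P" 1] p prime_not_dvd_one by simp
  then show ?thesis using pe_0[of p r] prime_dvd_prime[of p r] p by auto
qed
definition pd :: "'a list \<Rightarrow> 'a list set" where "pd f = {p \<in> \<P>. p pdivides f}"
lemma finite_pd: "f \<in> M \<Longrightarrow> finite (pd f)"
proof (rule finite_subset)
  assume f: "f \<in> M"
  show "pd f \<subseteq> (\<Union>i\<le>deg f. Mn i)"
  proof
    fix p assume p: "p \<in> pd f"
    then have pM: "p \<in> M" "p pdivides f" by (auto simp: pd_def)
    then have "length p \<le> length f" using dvd_length[of p f] f by simp
    then have "deg p \<le> deg f" using M_len pM f by simp
    then show "p \<in> (\<Union>i\<le>deg f. Mn i)" using pM Mn_deg by auto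
  qed
qed simp
lemma pd_subset: "pd f \<subseteq> \<P>" by (auto simp: pd_def)
lemma pd_mul: "f \<in> M \<Longrightarrow> g \<in> M \<Longrightarrow> pd (f *. g) = pd f \<union> pd g"
  using prime_dvd_mul_iff by (auto simp: pd_def)
lemma pd_one: "pd \<one>\<^sub>P = {}" using prime_not_dvd_one by (auto simp: pd_def)
lemma pd_prime: "p \<in> \<P> \<Longrightarrow> pd p = {p}" using prime_dvd_prime by (auto simp: pd_def)

text \<open>If all exponents are multiples of 3, splitting off one full prime power after another
  exhibits \<open>f\<close> as a cube.\<close>

lemma not_cube_prime:
  assumes "f \<in> M" "\<And>h. h \<in> M \<Longrightarrow> f \<noteq> h ^. 3"
  obtains p e g where "p \<in> \<P>" "g \<in> M" "\<not> p pdivides g" "f = p ^. e *. g" "e mod 3 \<noteq> 0"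
proof -
  have "(\<exists>h\<in>M. f = h ^. 3) \<or> (\<exists>p\<in>\<P>. pe p f mod 3 \<noteq> 0)"
    using assms(1)
  proof (induct "deg f" arbitrary: f rule: less_induct)
    case less
    show ?case
    proof (cases "f = \<one>\<^sub>P")
      case True
      then have "f = \<one>\<^sub>P ^. 3" by simp
      then show ?thesis using one_M by blast
    next
      case False
      then obtain p where p: "p \<in> \<P>" "p pdivides f" using ex_prime_dvd less by blast
      obtain e g where g: "g \<in> M" "f = p ^. e *. g" "\<not> p pdivides g" using prime_decomp[OF less(2) p(1)] by metis
      have pef: "pe p f = e" using pe_eq[OF p(1) g(1,3), of e] g(2) by simp
      have e0: "e \<noteq> 0" using p g by (intro notI) simp
      show ?thesis
      proof (cases "e mod 3 = 0")
        case False
        then show ?thesis using pef p(1) by blast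
      next
        case True
        have dg: "deg g < deg f" using g p e0 deg_prime_pos[OF p(1)] by simp
        from less(1)[OF dg g(1)] show ?thesis
        proof
          assume "\<exists>h\<in>M. g = h ^. 3"
          then obtain h where h: "h \<in> M" "g = h ^. 3" by blast
          have "e div 3 * 3 = e" using True by presburger
          then have "f = (p ^. (e div 3)) ^. 3 *. h ^. 3" using g(2) h p by (simp add: UP.nat_pow_pow)
          also have "\<dots> = (p ^. (e div 3) *. h) ^. 3" using h p by (simp add: UP.nat_pow_distrib)
          finally show ?thesis using h p by (metis mul_M pow_M prime_M)
        next
          assume "\<exists>r\<in>\<P>. pe r g mod 3 \<noteq> 0"
          then obtain r where r: "r \<in> \<P>" "pe r g mod 3 \<noteq> 0" by blast
          have "r \<noteq> p" using r pe_0[OF p(1) g(1,3)] by auto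
          then have "\<not> r pdivides (p ^. e)" using prime_dvd_pow[OF r(1), of p e] prime_dvd_prime[OF r(1) p(1)] p by auto
          then have "pe r f = pe r g" using pe_mul[OF r(1), of "p ^. e" g] pe_0[OF r(1)] g p by simp
          then show ?thesis using r by metis
        qed
      qed
    qed
  qed
  then obtain p where p: "p \<in> \<P>" "pe p f mod 3 \<noteq> 0" using assms(2) by blast
  obtain e g where g: "g \<in> M" "f = p ^. e *. g" "\<not> p pdivides g" using prime_decomp[OF assms(1) p(1)] by metis
  have "pe p f = e" using pe_eq[OF p(1) g(1,3), of e] g(2) by simp
  then show ?thesis using that p g by blast
qed

lemma crt:
  assumes "cop f g" "a \<in> C" "b \<in> C"
  obtains x where "x \<in> C" "f pdivides (x -. a)" "g pdivides (x -. b)"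
proof -
  obtain u v where uv: "f \<in> C" "g \<in> C" "u \<in> C" "v \<in> C" "f *. u +. g *. v = \<one>\<^sub>P" using assms(1) by (rule copE)
  define x where "x = a *. (g *. v) +. b *. (f *. u)"
  have gv: "g *. v = \<one>\<^sub>P -. f *. u" unfolding uv(5)[symmetric] using uv(1-4) by algebra
  have fu: "f *. u = \<one>\<^sub>P -. g *. v" unfolding uv(5)[symmetric] using uv(1-4) by algebra
  have "x -. a = f *. ((b -. a) *. u)"
  proof -
    have "x -. a = a *. (\<one>\<^sub>P -. f *. u) +. b *. (f *. u) -. a" by (simp add: x_def gv)
    also have "\<dots> = f *. ((b -. a) *. u)" using uv(1-4) assms(2,3) UP.one_closed by algebra
    finally show ?thesis .
  qed
  moreover have "x -. b = g *. ((a -. b) *. v)"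
  proof -
    have "x -. b = a *. (g *. v) +. b *. (\<one>\<^sub>P -. g *. v) -. b" by (simp add: x_def fu)
    also have "\<dots> = g *. ((a -. b) *. v)" using uv(1-4) assms(2,3) UP.one_closed by algebra
    finally show ?thesis .
  qed
  moreover have "x \<in> C" using uv(1-4) assms by (simp add: x_def)
  ultimately show ?thesis using that[of x] dvdI[of "(b -. a) *. u" "x -. a" f] 
      dvdI[of "(a -. b) *. v" "x -. b" g] uv(1-4) assms(2,3) by simp
qed
end

context cubic_field begin

text \<open>Otherwise all q^(deg P) - 1 = 3n nonzero elements of the residue field at
  \<open>P\<close> are n-th roots of unity, more than a field can have.\<close>

lemma exists_nonresidue:
  assumes P: "P \<in> \<P>" shows "\<exists>a\<in>C. \<not> P pdivides a \<and> Gam P a \<noteq> 1"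
proof (rule ccontr)
  assume "\<not> ?thesis"
  then have all: "Gam P a = 1" if "a \<in> C" "\<not> P pdivides a" for a using that by blast
  have PM: "P \<in> M" "P \<in> C" using P by auto
  define n where "n = card (Mr P) * kk"
  have n3: "3 * n = qn ^ deg P - 1"
  proof -
    have "qn ^ d = 1 + (qn - 1) * (\<Sum>i<d. qn ^ i)" for d
    proof (induct d)
      case (Suc d)
      have "qn ^ Suc d = qn ^ d + (qn - 1) * qn ^ d" using qn_gt1 by (simp add: algebra_simps)
      then show ?case using Suc by (simp add: algebra_simps)
    qed simp
    then have "qn ^ deg P - 1 = (qn - 1) * (\<Sum>i<deg P. qn ^ i)" by (metis add_diff_cancel_left')
    then show ?thesis using kk3 by (simp add: n_def card_Mr mult.commute mult.left_commute)
  qed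
  have npos: "n \<noteq> 0"
  proof -
    have "card (Mr P) \<noteq> 0" unfolding card_Mr using deg_prime_pos[OF P] qn_gt1 by (auto simp: sum_eq_0_iff intro!: exI[of _ "0::nat"])
    then show ?thesis using kk_pos by (simp add: n_def)
  qed
  have an: "P pdivides (a ^. n -. \<one>\<^sub>P)" if a: "a \<in> C" "\<not> P pdivides a" for a
  proof -
    obtain c where c: "c \<in> Fs" "om c = Gam P a" "P pdivides (a ^. card (Mr P) -. [c])"
      using gauss_lemma[OF P a] by blast
    have "\<Omega> (c [^] kk) = \<Omega> (\<one> [^] kk)" using all[OF a] c(2) om_one by (simp add: om_def)
    then have "c [^] kk = \<one>" using kk_root[OF c(1)] kk_root[OF one_Fs] Om_bij 
      by (simp add: bij_betw_def inj_on_def)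
    then show ?thesis
      using cong_pow[OF PM(2) _ _ c(3), of kk] a c(1) const_pow[OF c(1), of kk] by (simp add: n_def UP.nat_pow_pow pone_eq)
  qed
  define K where "K = Rupt (carrier R) P"
  define h where "h = rupture_surj (carrier R) P"
  have fK: "field K" unfolding K_def using rupture_is_field_iff_pirreducible[OF carrier_is_subfield PM(2)] prime_irr[OF P] by blast
  interpret K: field K by (rule fK)
  have hom: "h \<in> ring_hom (poly_ring R) K" unfolding h_def K_def by (rule rupture_surj_hom(1)[OF carrier_is_subring PM(2)])
  have hpm: "h x = h (x pmod P)" if "x \<in> C" for x
    unfolding h_def by (rule rupture_surj_composed_with_pmod[OF carrier_is_subfield PM(2) that])
  have im: "(\<lambda>x. x pmod P) ` C = Pl (deg P)"
    using pmod_image_characterization[OF carrier_is_subfield PM(2)] PM by (auto simp: Pl_def deg_def)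
  have carr: "h ` Pl (deg P) = carrier K"
    using rupture_carrier_as_pmod_image[OF carrier_is_subfield PM(2)] by (simp add: h_def K_def im)
  have inj: "inj_on h (Pl (deg P))"
    using rupture_surj_inj_on[OF carrier_is_subfield PM(2)] by (simp add: h_def im)
  have cardK: "card (carrier K) = qn ^ deg P" using card_image[OF inj] carr card_Pl by simp
  have finK: "finite (carrier K)" unfolding carr[symmetric] by simp
  have hpow: "h (a ^. j) = h a [^]\<^bsub>K\<^esub> j" if a: "a \<in> C" for a j
  proof (induct j)
    case 0 then show ?case using ring_hom_one[OF hom] by simp
  next
    case (Suc j) then show ?case using ring_hom_mult[OF hom, of "a ^. j" a] a by simp
  qed
  have "carrier K - {\<zero>\<^bsub>K\<^esub>} \<subseteq> {x \<in> carrier K. x [^]\<^bsub>K\<^esub> n = \<one>\<^bsub>K\<^esub>}"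
  proof
    fix x assume x: "x \<in> carrier K - {\<zero>\<^bsub>K\<^esub>}"
    then obtain u where u: "u \<in> Pl (deg P)" "x = h u" using carr by blast
    have uC: "u \<in> C" using u by auto
    have "h [] = \<zero>\<^bsub>K\<^esub>" using ring_hom_zero[OF hom UP.ring_axioms K.ring_axioms] by (simp add: pzero_eq)
    then have "u \<noteq> []" using x u by auto
    then have "\<not> P pdivides u" using dvd_less_nil[OF PM(2) uC] u M_len[OF PM(1)] by (auto simp: Pl_iff)
    then have "P pdivides (u ^. n -. \<one>\<^sub>P)" using an uC by blast
    then have "(u ^. n) pmod P = \<one>\<^sub>P pmod P" using pmod_cong_iff[of "u ^. n" "\<one>\<^sub>P" P] uC PM by simp
    then have "h (u ^. n) = h \<one>\<^sub>P" using hpm[of "u ^. n"] hpm[of "\<one>\<^sub>P"] uC by simp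
    then have "x [^]\<^bsub>K\<^esub> n = \<one>\<^bsub>K\<^esub>" using hpow[OF uC] ring_hom_one[OF hom] u by simp
    then show "x \<in> {x \<in> carrier K. x [^]\<^bsub>K\<^esub> n = \<one>\<^bsub>K\<^esub>}" using x by simp
  qed
  then have "card (carrier K - {\<zero>\<^bsub>K\<^esub>}) \<le> card {x \<in> carrier K. x [^]\<^bsub>K\<^esub> n = \<one>\<^bsub>K\<^esub>}"
    using finK by (intro card_mono) auto
  also have "\<dots> \<le> n" by (rule K.num_roots_le_deg[OF finK npos])
  finally have "qn ^ deg P - 1 \<le> n" using finK cardK by (simp add: card_Diff_singleton)
  then show False using n3 npos by linarith
qed

section \<open>Cubic characters\<close>

definition chi :: "'a list \<Rightarrow> 'a list \<Rightarrow> complex" where "chi = cubic_char R \<Omega>"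
definition cr :: "'a list \<Rightarrow> 'a list \<Rightarrow> complex" where "cr = cubic_residue_prime R \<Omega>"

lemma cr_eq: "P \<in> \<P> \<Longrightarrow> a \<in> C \<Longrightarrow> cr P a = (if P pdivides a then 0 else Gam P a)"
  using residue_prime_eq[of P a] by (simp add: cr_def cubic_residue_prime_def)

lemma cr_char:
  assumes P: "P \<in> \<P>" and a: "a \<in> C" "\<not> P pdivides a"
  obtains c where "c \<in> Fs" "om c = cr P a" "P pdivides (a ^. card (Mr P) -. [c])"
  using gauss_lemma[OF assms] cr_eq[OF P a(1)] a(2) by auto

lemma cr_unique:
  assumes P: "P \<in> \<P>" and a: "a \<in> C" "\<not> P pdivides a" and c: "c \<in> Fs" "P pdivides (a ^. card (Mr P) -. [c])"
  shows "cr P a = om c"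
proof -
  obtain d where d: "d \<in> Fs" "om d = cr P a" "P pdivides (a ^. card (Mr P) -. [d])" using cr_char[OF P a] by metis
  define x where "x = a ^. card (Mr P)"
  have C: "x \<in> C" "[c] \<in> C" "[d] \<in> C" using a c d by (simp_all add: x_def)
  have "P pdivides ((x -. [d]) -. (x -. [c]))" 
    using d(3) c(2) unfolding x_def by (rule dvd_subI[OF prime_C[OF P]])
  also have "(x -. [d]) -. (x -. [c]) = [c] -. [d]" using C by algebra
  finally show ?thesis using const_cong_eq[OF P c(1) d(1)] d by simp
qed

lemma cr_mult:
  assumes P: "P \<in> \<P>" and a: "a \<in> C" and b: "b \<in> C" shows "cr P (a *. b) = cr P a * cr P b"
proof (cases "P pdivides a \<or> P pdivides b")
  case True
  then show ?thesis using cr_eq[OF P] a b prime_dvd_mul_iff[OF P a b] by auto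
next
  case False
  obtain c where c: "c \<in> Fs" "om c = cr P a" "P pdivides (a ^. card (Mr P) -. [c])" using cr_char[OF P a] False by metis
  obtain d where d: "d \<in> Fs" "om d = cr P b" "P pdivides (b ^. card (Mr P) -. [d])" using cr_char[OF P b] False by metis
  define x where "x = a ^. card (Mr P)" define y where "y = b ^. card (Mr P)"
  have C: "x \<in> C" "y \<in> C" "[c] \<in> C" "[d] \<in> C" "P \<in> C" using a b c d P by (simp_all add: x_def y_def)
  have "P pdivides ((x -. [c]) *. y +. [c] *. (y -. [d]))"
  proof (rule dvd_addI[OF C(5)])
    show "P pdivides ((x -. [c]) *. y)" using c(3) C unfolding x_def[symmetric] by (intro dvd_mulI(1)) simp_all
    show "P pdivides ([c] *. (y -. [d]))" using d(3) C unfolding y_def[symmetric] by (intro dvd_mulI(2)) simp_all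
  qed
  also have "(x -. [c]) *. y +. [c] *. (y -. [d]) = x *. y -. [c] *. [d]" using C by algebra
  also have "\<dots> = (a *. b) ^. card (Mr P) -. [c \<otimes> d]" using c d a b by (simp add: const_mul x_def y_def UP.nat_pow_distrib)
  finally have "cr P (a *. b) = om (c \<otimes> d)"
    using a b False prime_dvd_mul_iff[OF P a b] mult_Fs[OF c(1) d(1)] by (intro cr_unique[OF P]) simp_all
  then show ?thesis using om_mult[OF c(1) d(1)] c d by simp
qed

lemma cr_cong:
  assumes P: "P \<in> \<P>" and a: "a \<in> C" and b: "b \<in> C" and ab: "P pdivides (a -. b)" shows "cr P a = cr P b"
proof -
  have "a pmod P = b pmod P" using pmod_cong_iff[of a b P] assms by simp
  then have d: "P pdivides a \<longleftrightarrow> P pdivides b" using pmod_nil_iff[of a P] pmod_nil_iff[of b P] assms by simp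
  show ?thesis
  proof (cases "P pdivides b")
    case True then show ?thesis using cr_eq[OF P] a b d by simp
  next
    case False
    obtain c where c: "c \<in> Fs" "om c = cr P b" "P pdivides (b ^. card (Mr P) -. [c])" using cr_char[OF P b False] by metis
    define x where "x = a ^. card (Mr P)" define y where "y = b ^. card (Mr P)"
    have C: "x \<in> C" "y \<in> C" "[c] \<in> C" "P \<in> C" using a b c P by (simp_all add: x_def y_def)
    have "P pdivides ((x -. y) +. (y -. [c]))"
      using cong_pow[OF C(4) a b ab, of "card (Mr P)"] c(3) C unfolding x_def y_def by (intro dvd_addI) simp_all
    also have "(x -. y) +. (y -. [c]) = x -. [c]" using C by algebra
    finally show ?thesis using cr_unique[OF P a _ c(1)] d False c(2) by (simp add: x_def)
  qed
qed

lemma cr_zero: "P \<in> \<P> \<Longrightarrow> a \<in> C \<Longrightarrow> cr P a = 0 \<longleftrightarrow> P pdivides a"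
  using cr_char[of P a] om_nz cr_eq[of P a] by metis
lemma cr_cube: "P \<in> \<P> \<Longrightarrow> a \<in> C \<Longrightarrow> \<not> P pdivides a \<Longrightarrow> cr P a ^ 3 = 1"
  using cr_char[of P a] om_cube by metis
text \<open>Since q is 1 modulo 3, \<open>card (Mr P)\<close>, a sum of deg P powers of q, is
  congruent to deg P modulo 3.\<close>

lemma cr_const: 
  assumes P: "P \<in> \<P>" and c: "c \<in> Fs" shows "cr P [c] = om c ^ deg P"
proof -
  have "length [c] < length P" using deg_prime[OF P] M_len[of P] P by simp
  then have nd: "\<not> P pdivides [c]" using dvd_less_nil[of P "[c]"] P c by auto
  have "om (c [^] n) = om c ^ n" for n
    by (induct n) (use c const_pow[OF c] in \<open>auto simp: om_one om_mult mult.commute\<close>)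
  then have "cr P [c] = om c ^ card (Mr P)"
    using const_pow[OF c, of "card (Mr P)"] P c nd by (subst cr_unique[OF P _ nd, of "c [^] card (Mr P)"]) auto
  also have "\<dots> = om c ^ (card (Mr P) mod 3)" by (rule om_pow_mod[OF c])
  also have "card (Mr P) mod 3 = deg P mod 3"
  proof -
    have "(\<Sum>i<d. qn ^ i) mod 3 = d mod 3" for d
    proof (induct d)
      case (Suc d)
      have "qn ^ d mod 3 = 1" using qn_mod3 by (metis power_mod power_one mod_less one_less_numeral_iff semiring_norm(77))
      then show ?case using Suc by (simp add: mod_add_eq[symmetric, of "sum _ _"]) presburger
    qed simp
    then show ?thesis by (simp add: card_Mr)
  qed
  also have "om c ^ (deg P mod 3) = om c ^ deg P" using om_pow_mod[OF c] by simp
  finally show ?thesis .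
qed
lemma cr_recip: "P \<in> \<P> \<Longrightarrow> Q \<in> \<P> \<Longrightarrow> cr P Q = cr Q P"
proof -
  assume P: "P \<in> \<P>" and Q: "Q \<in> \<P>"
  show ?thesis
  proof (cases "P = Q")
    case False
    then have "\<not> P pdivides Q" "\<not> Q pdivides P" using prime_dvd_prime P Q by blast+
    moreover then have "cop Q P" using bezout_prime[OF P] Q by simp
    ultimately show ?thesis using cr_eq[OF P, of Q] cr_eq[OF Q, of P] Gam_recip[of P Q] P Q by simp
  qed simp
qed

text \<open>A common larger set of primes lets characters of different moduli be multiplied factor
  by factor.\<close>

lemma chi_superset:
  assumes "f \<in> M" "finite S" "S \<subseteq> \<P>" "pd f \<subseteq> S"
  shows "chi f a = (\<Prod>P\<in>S. cr P a ^ pe P f)"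
proof -
  have "chi f a = (\<Prod>P\<in>pd f. cr P a ^ pe P f)" by (simp add: chi_def cubic_char_def cr_def pe_def pd_def)
  also have "\<dots> = (\<Prod>P\<in>S. cr P a ^ pe P f)"
  proof (rule prod.mono_neutral_left[OF assms(2,4)], rule ballI)
    fix P assume "P \<in> S - pd f"
    then have "pe P f = 0" using assms by (intro pe_0) (auto simp: pd_def)
    then show "cr P a ^ pe P f = 1" by simp
  qed
  finally show ?thesis .
qed
lemma chi_one: "chi \<one>\<^sub>P a = 1"
  using chi_superset[of "\<one>\<^sub>P" "{}" a] by (simp add: pd_one)
lemma chi_prime: "P \<in> \<P> \<Longrightarrow> chi P a = cr P a"
  using chi_superset[of P "{P}" a] by (simp add: pd_prime pe_prime)
lemma chi_mul: "f \<in> M \<Longrightarrow> g \<in> M \<Longrightarrow> chi (f *. g) a = chi f a * chi g a"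
proof -
  assume fg: "f \<in> M" "g \<in> M"
  let ?S = "pd f \<union> pd g"
  have S: "finite ?S" "?S \<subseteq> \<P>" using finite_pd fg pd_subset by auto
  have "chi (f *. g) a = (\<Prod>P\<in>?S. cr P a ^ pe P (f *. g))" using fg S by (intro chi_superset) (auto simp: pd_mul)
  also have "\<dots> = (\<Prod>P\<in>?S. cr P a ^ pe P f * cr P a ^ pe P g)"
    using fg S by (intro prod.cong refl) (auto simp: pe_mul power_add subset_iff)
  also have "\<dots> = chi f a * chi g a"
    using chi_superset[of f ?S a] chi_superset[of g ?S a] fg S by (simp add: prod.distrib)
  finally show ?thesis .
qed
lemma chi_pow: "f \<in> M \<Longrightarrow> chi (f ^. n) a = chi f a ^ n"
  by (induct n) (simp_all add: chi_one chi_mul)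
lemma chi_mult: "f \<in> M \<Longrightarrow> a \<in> C \<Longrightarrow> b \<in> C \<Longrightarrow> chi f (a *. b) = chi f a * chi f b"
  by (induct f rule: monic_induct) (simp_all add: chi_one chi_mul chi_prime cr_mult)
lemma chi_zero: "f \<in> M \<Longrightarrow> a \<in> C \<Longrightarrow> chi f a = 0 \<longleftrightarrow> \<not> cop a f"
  by (induct f rule: monic_induct) (simp_all add: chi_one chi_mul chi_prime cr_zero cop_mul_iff' cop_prime_iff)
lemma chi_cube: "f \<in> M \<Longrightarrow> cop a f \<Longrightarrow> chi f a ^ 3 = 1"
proof (induct f rule: monic_induct)
  case (mul p g)
  have aC: "a \<in> C" using mul cop_C by blast
  have "cop a p" "cop a g" using mul cop_mul_iff'[of p g a] by auto
  then show ?case using mul aC by (simp add: chi_mul power_mult_distrib chi_prime cr_cube cop_prime_iff)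
qed (simp add: chi_one)
lemma chi_norm: "f \<in> M \<Longrightarrow> cop a f \<Longrightarrow> norm (chi f a) = 1"
proof -
  assume a: "f \<in> M" "cop a f"
  have "norm (chi f a) ^ 3 = 1 ^ 3" using arg_cong[OF chi_cube[OF a], of norm] by (simp add: norm_power)
  then show ?thesis by (rule power_eq_imp_eq_base) simp_all
qed
lemma chi_norm_le: "f \<in> M \<Longrightarrow> a \<in> C \<Longrightarrow> norm (chi f a) \<le> 1"
  using chi_norm[of f a] chi_zero[of f a] by fastforce
lemma chi_cong: "f \<in> M \<Longrightarrow> a \<in> C \<Longrightarrow> b \<in> C \<Longrightarrow> f pdivides (a -. b) \<Longrightarrow> chi f a = chi f b"
proof (induct f rule: monic_induct)
  case (mul p g)
  have d: "p pdivides (p *. g)" "g pdivides (p *. g)" using mul by (auto intro: dvdI[of g] dvdI[of p] simp: UP.m_comm)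
  then have "p pdivides (a -. b)" "g pdivides (a -. b)" using dvd_trans[OF _ d(1) mul(6)] dvd_trans[OF _ d(2) mul(6)] mul by simp_all
  then show ?case using mul cr_cong[of p a b] by (simp add: chi_mul chi_prime)
qed (simp add: chi_one)
lemma chi_periodic: "f \<in> M \<Longrightarrow> periodic f (chi f)" unfolding periodic_def using chi_cong by blast
lemma chi_const: "f \<in> M \<Longrightarrow> c \<in> Fs \<Longrightarrow> chi f [c] = om c ^ deg f"
  by (induct f rule: monic_induct) (simp_all add: chi_one chi_mul chi_prime cr_const power_add)
lemma chi_recip_prime: "g \<in> M \<Longrightarrow> P \<in> \<P> \<Longrightarrow> chi P g = chi g P"
proof (induct g rule: monic_induct)
  case one
  have "cr P \<one>\<^sub>P = 1" using cr_mult[of P "\<one>\<^sub>P" "\<one>\<^sub>P"] cr_zero[of P "\<one>\<^sub>P"] prime_not_dvd_one[of P] one by simp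
  then show ?case using one by (simp add: chi_one chi_prime)
next
  case (mul r g)
  then show ?case using chi_mult[of P r g] by (simp add: chi_mul chi_prime cr_recip)
qed
lemma chi_recip: "f \<in> M \<Longrightarrow> g \<in> M \<Longrightarrow> chi f g = chi g f"
proof (induct f rule: monic_induct)
  case one
  have "chi g \<one>\<^sub>P = 1" using chi_mult[of g "\<one>\<^sub>P" "\<one>\<^sub>P"] chi_zero[of g "\<one>\<^sub>P"] one by simp
  then show ?case using one by (simp add: chi_one)
next
  case (mul p f)
  then show ?case using chi_mult[of g p f] chi_recip_prime[of g p] by (simp add: chi_mul)
qed
lemma chi_a_one: "f \<in> M \<Longrightarrow> chi f \<one>\<^sub>P = 1"
  using chi_recip[of f "\<one>\<^sub>P"] by (simp add: chi_one)

text \<open>Take a prime \<open>p\<close> whose exponent in \<open>f\<close> is not a multiple of 3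
  and, by the Chinese remainder theorem, an argument that is a nonresidue modulo \<open>p\<close>
  and 1 modulo the cofactor.\<close>

lemma chi_nontrivial:
  assumes f: "f \<in> M" and nc: "\<And>h. h \<in> M \<Longrightarrow> f \<noteq> h ^. 3"
  obtains a where "cop a f" "chi f a \<noteq> 1"
proof -
  obtain p e g where p: "p \<in> \<P>" "g \<in> M" "\<not> p pdivides g" "f = p ^. e *. g" "e mod 3 \<noteq> 0"
    using not_cube_prime[OF f nc] by metis
  obtain b where b: "b \<in> C" "\<not> p pdivides b" "cr p b \<noteq> 1" using exists_nonresidue[OF p(1)] cr_eq[OF p(1)] by auto
  have "cop g p" using bezout_prime p by simp
  then have "cop p g" by (rule cop_symI)
  then obtain x where x: "x \<in> C" "p pdivides (x -. b)" "g pdivides (x -. \<one>\<^sub>P)" using crt[of p g b "\<one>\<^sub>P"] b by auto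
  have cx: "cr p x = cr p b" using cr_cong[OF p(1) x(1) b(1) x(2)] .
  have gx: "chi g x = 1" using chi_cong[OF p(2) x(1) _ x(3)] chi_a_one p by simp
  have fx: "chi f x = cr p b ^ e" using p(4) p(1,2) cx gx by (simp add: chi_mul chi_pow chi_prime)
  have nz: "cr p b \<noteq> 0" using cr_zero[OF p(1) b(1)] b by simp
  then have "cop x f" using chi_zero[OF f x(1)] fx by simp
  moreover have "cr p b ^ e \<noteq> 1"
  proof
    assume e: "cr p b ^ e = 1"
    obtain c where c: "c \<in> Fs" "om c = cr p b" using cr_char[OF p(1) b(1,2)] by metis
    have e': "om c ^ (e mod 3) = 1" using om_pow_mod[OF c(1), of e] e c by simp
    have "e mod 3 < 3" by simp
    then have "e mod 3 = 1 \<or> e mod 3 = 2" using p(5) by linarith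
    then show False
    proof
      assume "e mod 3 = 1" then show False using e' b c by simp
    next
      assume "e mod 3 = 2"
      then have "om c * om c ^ 2 = om c" using e' by simp
      moreover have "om c * om c ^ 2 = om c ^ 3" by (simp add: power3_eq_cube power2_eq_square)
      ultimately show False using om_cube[OF c(1)] c b nz by auto
    qed
  qed
  ultimately show ?thesis using that fx by simp
qed

lemma sum_chi_zero:
  assumes f: "f \<in> M" and nc: "\<And>h. h \<in> M \<Longrightarrow> f \<noteq> h ^. 3"
  shows "(\<Sum>a\<in>Pl (deg f). chi f a) = 0"
proof -
  obtain u where u: "cop u f" "chi f u \<noteq> 1" using chi_nontrivial[OF assms] by metis
  have uC: "u \<in> C" using u cop_C by blast
  have "(\<Sum>a\<in>Pl (deg f). chi f a) = (\<Sum>a\<in>Pl (deg f). chi f (a *. u))"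
    by (rule sum_unit_mult[OF f chi_periodic[OF f] u(1), symmetric])
  also have "\<dots> = (\<Sum>a\<in>Pl (deg f). chi f a) * chi f u"
    unfolding sum_distrib_right using chi_mult[OF f _ uC] by (intro sum.cong refl) blast
  finally have "(\<Sum>a\<in>Pl (deg f). chi f a) * (1 - chi f u) = 0" by (simp add: algebra_simps)
  then show ?thesis using u by simp
qed

end

section \<open>Gauss sums and Poisson summation\<close>

context fin_field begin
lemma X_M: "X \<in> M" 
  by (rule M_I) (use var_closed[OF carrier_is_subring] in \<open>simp_all add: var_def\<close>)
lemma deg_X: "deg X = 1" by (simp add: deg_def var_def)
lemma Xpow_M [simp]: "X ^. n \<in> M" using X_M by simp
lemma Xpow_length: "length (X ^. n) = Suc n" using M_len[of "X ^. n"] deg_X X_M by simp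
lemma Pl_shift_bij: "u \<in> Pl n \<Longrightarrow> bij_betw (\<lambda>k. k +. u) (Pl n) (Pl n)"
proof (rule bij_betwI[of _ _ _ "\<lambda>k. k -. u"])
  assume u: "u \<in> Pl n"
  then have uC: "u \<in> C" by auto
  show "(\<lambda>k. k +. u) \<in> Pl n \<rightarrow> Pl n" using u by (auto intro!: Pl_add)
  show "(\<lambda>k. k -. u) \<in> Pl n \<rightarrow> Pl n" using u by (auto intro!: Pl_sub)
  show "x +. u -. u = x" if "x \<in> Pl n" for x using Pl_C[OF that] uC by algebra
  show "x -. u +. u = x" if "x \<in> Pl n" for x using Pl_C[OF that] uC by algebra
qed
lemma periodic_mult: "periodic f \<phi> \<Longrightarrow> periodic f \<phi>' \<Longrightarrow> periodic f (\<lambda>a. \<phi> a * \<phi>' a)"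
  unfolding periodic_def by metis
end

context cubic_field begin

lemma psi_zero: "\<psi> \<zero> = 1" 
  using psi_add[of \<zero> \<zero>] psi_norm[of \<zero>] by auto
lemma psi_neg: "x \<in> carrier R \<Longrightarrow> \<psi> (\<ominus> x) = cnj (\<psi> x)"
proof -
  assume x: "x \<in> carrier R"
  have "\<psi> x * \<psi> (\<ominus> x) = 1" using psi_add[of x "\<ominus> x"] x psi_zero by (simp add: r_neg)
  moreover have "\<psi> x * cnj (\<psi> x) = 1" using psi_norm[OF x] by (metis complex_norm_square of_real_1 power_one)
  moreover have "\<psi> x \<noteq> 0" using psi_norm[OF x] by auto
  ultimately show ?thesis by (metis mult_left_cancel)
qed
lemma psi_scale_nontriv: "d \<in> Fs \<Longrightarrow> \<exists>c\<in>Fs. \<psi> (c \<otimes> d) \<noteq> 1"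
proof -
  assume d: "d \<in> Fs"
  obtain x where x: "x \<in> carrier R" "\<psi> x \<noteq> 1" using psi_nontriv by blast
  then have xF: "x \<in> Fs" using psi_zero by auto
  have "(x \<otimes> inv d) \<otimes> d = x" using x d inv_nz[of d] by (simp add: m_assoc)
  then show ?thesis using x mult_Fs[OF xF inv_Fs[OF d]] by metis
qed
lemma sum_psi: "d \<in> Fs \<Longrightarrow> (\<Sum>c\<in>Fs. \<psi> (c \<otimes> d)) = -1"
proof -
  assume d: "d \<in> Fs"
  obtain c0 where c0: "c0 \<in> Fs" "\<psi> (c0 \<otimes> d) \<noteq> 1" using psi_scale_nontriv[OF d] by blast
  have b: "bij_betw (\<lambda>c. c \<oplus> c0) (carrier R) (carrier R)"
    by (rule bij_betwI[of _ _ _ "\<lambda>c. c \<ominus> c0"]) (use c0 in \<open>auto simp: a_minus_def a_assoc r_neg l_neg\<close>)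
  have "(\<Sum>c\<in>carrier R. \<psi> (c \<otimes> d)) = (\<Sum>c\<in>carrier R. \<psi> ((c \<oplus> c0) \<otimes> d))"
    by (rule sum.reindex_bij_betw[OF b, symmetric])
  also have "\<dots> = (\<Sum>c\<in>carrier R. \<psi> (c \<otimes> d)) * \<psi> (c0 \<otimes> d)"
    unfolding sum_distrib_right using c0 d by (intro sum.cong refl) (simp add: l_distr psi_add)
  finally have "(\<Sum>c\<in>carrier R. \<psi> (c \<otimes> d)) * (1 - \<psi> (c0 \<otimes> d)) = 0" by (simp add: algebra_simps)
  then have "(\<Sum>c\<in>carrier R. \<psi> (c \<otimes> d)) = 0" using c0 by simp
  moreover have "(\<Sum>c\<in>carrier R. \<psi> (c \<otimes> d)) = \<psi> (\<zero> \<otimes> d) + (\<Sum>c\<in>Fs. \<psi> (c \<otimes> d))"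
    using fin by (intro sum.remove) simp_all
  moreover have "\<psi> (\<zero> \<otimes> d) = 1" using d psi_zero by simp
  ultimately show ?thesis by (metis add_eq_0_iff)
qed

text \<open>The square of the absolute value equals q minus the sum of \<open>w\<close>. The
  hypothesis on the real part treats trivial and nontrivial \<open>w\<close> together.\<close>

lemma const_gauss_norm:
  fixes w :: "'a \<Rightarrow> complex"
  assumes mult: "\<And>c d. c \<in> Fs \<Longrightarrow> d \<in> Fs \<Longrightarrow> w (c \<otimes> d) = w c * w d" and norm: "\<And>c. c \<in> Fs \<Longrightarrow> norm (w c) = 1"
    and pos: "Re (\<Sum>c\<in>Fs. w c) \<ge> 0" 
  shows "norm (\<Sum>c\<in>Fs. \<psi> (\<ominus> c) * w c) \<le> sqrt q"
proof -
  let ?T = "\<Sum>c\<in>Fs. \<psi> (\<ominus> c) * w c"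
  have ww: "w d * cnj (w d) = 1" if "d \<in> Fs" for d using norm[OF that] by (metis complex_norm_square of_real_1 power_one)
  have "?T * cnj ?T = (\<Sum>d\<in>Fs. \<Sum>c\<in>Fs. (\<psi> (\<ominus> c) * w c) * cnj (\<psi> (\<ominus> d) * w d))"
    by (simp add: sum_distrib_left sum_distrib_right)
  also have "\<dots> = (\<Sum>d\<in>Fs. \<Sum>t\<in>Fs. w t * \<psi> (d \<otimes> (\<one> \<ominus> t)))"
  proof (rule sum.cong[OF refl])
    fix d assume d: "d \<in> Fs"
    have b: "bij_betw (\<lambda>t. t \<otimes> d) Fs Fs"
      by (rule bij_betwI[of _ _ _ "\<lambda>t. t \<otimes> inv d"]) (use d mult_Fs inv_Fs inv_nz[of d] in \<open>auto simp: m_assoc\<close>)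
    have "(\<Sum>c\<in>Fs. (\<psi> (\<ominus> c) * w c) * cnj (\<psi> (\<ominus> d) * w d)) = (\<Sum>t\<in>Fs. (\<psi> (\<ominus> (t \<otimes> d)) * w (t \<otimes> d)) * cnj (\<psi> (\<ominus> d) * w d))"
      by (rule sum.reindex_bij_betw[OF b, symmetric])
    also have "\<dots> = (\<Sum>t\<in>Fs. w t * \<psi> (d \<otimes> (\<one> \<ominus> t)))"
    proof (rule sum.cong[OF refl])
      fix t assume t: "t \<in> Fs"
      have "d \<otimes> (\<one> \<ominus> t) = \<ominus> (t \<otimes> d) \<oplus> \<ominus> (\<ominus> d)" using d t by (simp add: a_minus_def r_distr r_minus m_comm a_comm)
      then have "\<psi> (d \<otimes> (\<one> \<ominus> t)) = \<psi> (\<ominus> (t \<otimes> d)) * cnj (\<psi> (\<ominus> d))"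
        using d t psi_add[of "\<ominus> (t \<otimes> d)" "\<ominus> (\<ominus> d)"] psi_neg[of "\<ominus> d"] by simp
      moreover have "w (t \<otimes> d) * cnj (w d) = w t" using mult[OF t d] ww[OF d] by (simp add: mult.assoc)
      ultimately show "(\<psi> (\<ominus> (t \<otimes> d)) * w (t \<otimes> d)) * cnj (\<psi> (\<ominus> d) * w d) = w t * \<psi> (d \<otimes> (\<one> \<ominus> t))"
        by (simp add: mult_ac)
    qed
    finally show "(\<Sum>c\<in>Fs. (\<psi> (\<ominus> c) * w c) * cnj (\<psi> (\<ominus> d) * w d)) = (\<Sum>t\<in>Fs. w t * \<psi> (d \<otimes> (\<one> \<ominus> t)))" .
  qed
  also have "\<dots> = (\<Sum>t\<in>Fs. w t * (\<Sum>d\<in>Fs. \<psi> (d \<otimes> (\<one> \<ominus> t))))"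
    by (subst sum.swap) (simp add: sum_distrib_left)
  also have "\<dots> = (\<Sum>t\<in>Fs. w t * (if t = \<one> then of_nat qn - 1 else - 1))"
  proof (rule sum.cong[OF refl])
    fix t assume t: "t \<in> Fs"
    have "(\<Sum>d\<in>Fs. \<psi> (d \<otimes> (\<one> \<ominus> t))) = (if t = \<one> then of_nat qn - 1 else - 1)"
    proof (cases "t = \<one>")
      case True
      have "(\<Sum>d\<in>Fs. \<psi> (d \<otimes> (\<one> \<ominus> t))) = (\<Sum>d\<in>Fs. 1)"
        using True by (intro sum.cong refl) (simp add: a_minus_def r_neg psi_zero)
      then show ?thesis using True card_Fs qn_gt1 by (simp add: of_nat_diff)
    next
      case False
      then have "\<one> \<ominus> t \<in> Fs" using t r_right_minus_eq[of \<one> t] by auto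
      then show ?thesis using False sum_psi by simp
    qed
    then show "w t * (\<Sum>d\<in>Fs. \<psi> (d \<otimes> (\<one> \<ominus> t))) = w t * (if t = \<one> then of_nat qn - 1 else - 1)" by simp
  qed
  also have "\<dots> = (\<Sum>t\<in>Fs. (if t = \<one> then w t * of_nat qn else 0) - w t)"
    by (intro sum.cong refl) (simp add: algebra_simps)
  also have "\<dots> = w \<one> * of_nat qn - (\<Sum>t\<in>Fs. w t)"
    using one_Fs by (simp only: sum_subtractf sum.delta[OF finite_Fs] if_True)
  also have "w \<one> = 1"
  proof -
    have "w \<one> = w \<one> * w \<one>" using mult[OF one_Fs one_Fs] by simp
    then show ?thesis using norm[OF one_Fs] by auto
  qed
  finally have e: "?T * cnj ?T = of_nat qn - (\<Sum>t\<in>Fs. w t)" by simp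
  have "(norm ?T)\<^sup>2 = Re (?T * cnj ?T)" 
    using complex_norm_square[of ?T] by (metis Re_complex_of_real)
  also have "\<dots> \<le> q" unfolding e using pos by simp
  finally show ?thesis by (rule real_le_rsqrt)
qed

text \<open>\<open>tau\<close> and \<open>sgn0\<close> are the two sums over constants that Poisson
  summation produces: with the additive character a Gauss sum of absolute value at most sqrt q,
  without it the orthogonality relation \<open>sum_cnj_om_pow\<close>.\<close>

definition tau :: "nat \<Rightarrow> complex" where "tau n = (\<Sum>c\<in>Fs. \<psi> (\<ominus> c) * cnj (om c) ^ n)"
definition sgn0 :: "nat \<Rightarrow> complex" where "sgn0 n = (if n mod 3 = 0 then of_nat qn - 1 else 0)"

lemma sum_cnj_om_pow: "(\<Sum>c\<in>Fs. cnj (om c) ^ n) = sgn0 n"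
proof -
  have "(\<Sum>c\<in>Fs. cnj (om c) ^ n) = cnj (\<Sum>c\<in>Fs. om c ^ n)" by simp
  then show ?thesis using qn_gt1 by (simp add: sum_om_pow sgn0_def of_nat_diff)
qed
lemma tau_norm: "norm (tau n) \<le> sqrt q"
  unfolding tau_def
proof (rule const_gauss_norm)
  show "cnj (om (c \<otimes> d)) ^ n = cnj (om c) ^ n * cnj (om d) ^ n" if "c \<in> Fs" "d \<in> Fs" for c d
    using om_mult[OF that] by (simp add: power_mult_distrib)
  show "norm (cnj (om c) ^ n) = 1" if "c \<in> Fs" for c using om_norm[OF that] by (simp add: norm_power)
  show "0 \<le> Re (\<Sum>c\<in>Fs. cnj (om c) ^ n)" using qn_gt1 by (simp add: sum_cnj_om_pow sgn0_def)
qed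
lemma sgn0_norm: "norm (sgn0 n) \<le> q - 1"
proof (cases "n mod 3 = 0")
  case True
  then have "sgn0 n = complex_of_real (q - 1)" by (simp add: sgn0_def)
  then have "norm (sgn0 n) = \<bar>q - 1\<bar>" by (simp only: norm_of_real)
  then show ?thesis using q_gt1 by simp
qed (use q_gt1 in \<open>simp add: sgn0_def\<close>)

text \<open>\<open>ee u F\<close> is \<open>\<psi>\<close> of the coefficient of \<open>T\<^sup>-\<^sup>1\<close> in \<open>u/F\<close>.\<close>

definition ee :: "'a list \<Rightarrow> 'a list \<Rightarrow> complex" where
  "ee u F = \<psi> (coeff (u pmod F) (deg F - 1) \<otimes> inv (hd F))"

lemma coeff_C [simp]: "u \<in> C \<Longrightarrow> coeff u i \<in> carrier R" using C_set by simp
lemma inv_hd: "F \<in> C \<Longrightarrow> F \<noteq> [] \<Longrightarrow> inv (hd F) \<in> carrier R" using inv_nz by simp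

lemma ee_add: "u \<in> C \<Longrightarrow> v \<in> C \<Longrightarrow> F \<in> C \<Longrightarrow> F \<noteq> [] \<Longrightarrow> ee (u +. v) F = ee u F * ee v F"
  by (simp add: ee_def pmod_add coeff_add l_distr inv_hd psi_add)
lemma ee_norm: "u \<in> C \<Longrightarrow> F \<in> C \<Longrightarrow> F \<noteq> [] \<Longrightarrow> norm (ee u F) = 1"
  by (simp add: ee_def inv_hd psi_norm)
lemma ee_dvd: "u \<in> C \<Longrightarrow> F \<in> C \<Longrightarrow> F \<noteq> [] \<Longrightarrow> F pdivides u \<Longrightarrow> ee u F = 1"
  using pmod_nil_iff[of u F] by (simp add: ee_def inv_hd psi_zero)
lemma ee_nil [simp]: "F \<in> C \<Longrightarrow> F \<noteq> [] \<Longrightarrow> ee [] F = 1" by (simp add: ee_dvd)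
lemma ee_cong: "u \<in> C \<Longrightarrow> v \<in> C \<Longrightarrow> F \<in> C \<Longrightarrow> F pdivides (u -. v) \<Longrightarrow> ee u F = ee v F"
  using pmod_cong_iff[of u v F] by (simp add: ee_def)
lemma ee_neg: "u \<in> C \<Longrightarrow> F \<in> C \<Longrightarrow> F \<noteq> [] \<Longrightarrow> ee (-. u) F = cnj (ee u F)"
proof -
  assume u: "u \<in> C" "F \<in> C" "F \<noteq> []"
  have "ee u F * ee (-. u) F = 1" using ee_add[of u "-. u" F] u by (simp add: UP.r_neg pzero_eq)
  moreover have "ee u F * cnj (ee u F) = 1" using ee_norm[OF u] by (metis complex_norm_square of_real_1 power_one)
  moreover have "ee u F \<noteq> 0" using ee_norm[OF u] by auto
  ultimately show ?thesis by (metis mult_left_cancel)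
qed
lemma ee_sub: "u \<in> C \<Longrightarrow> v \<in> C \<Longrightarrow> F \<in> C \<Longrightarrow> F \<noteq> [] \<Longrightarrow> ee (u -. v) F = ee u F * cnj (ee v F)"
  by (simp add: UP.minus_eq ee_add ee_neg)
lemma len_deg: "F \<noteq> [] \<Longrightarrow> length F = Suc (deg F)" by (cases F) (auto simp: deg_def)
lemma ee_small: 
  assumes "u \<in> C" "F \<in> C" "F \<noteq> []" "length u < deg F" shows "ee u F = 1"
proof -
  have "u pmod F = u" using assms len_deg[of F] by (intro pmod_small) simp_all
  moreover have "coeff u (deg F - 1) = \<zero>" using assms by (intro coeff_length) simp
  ultimately show ?thesis using assms by (simp add: ee_def inv_hd psi_zero)
qed
lemma ee_top: 
  assumes "u \<in> C" "F \<in> C" "F \<noteq> []" "length u = deg F" "u \<noteq> []" shows "ee u F = \<psi> (hd u \<otimes> inv (hd F))"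
proof -
  have "u pmod F = u" using assms len_deg[of F] by (intro pmod_small) simp_all
  moreover have "coeff u (deg F - 1) = hd u" using assms hd_coeff[of u] by simp
  ultimately show ?thesis by (simp add: ee_def)
qed
text \<open>If r is the remainder of \<open>u\<close> modulo \<open>F\<close>, then
  \<open>r *. G\<close> is short enough to be the remainder of \<open>u *. G\<close> modulo
  \<open>F *. G\<close>, and the leading coefficient of \<open>G\<close> cancels.\<close>

lemma ee_cancel:
  assumes "u \<in> C" "F \<in> C" "F \<noteq> []" "G \<in> C" "G \<noteq> []" shows "ee (u *. G) (F *. G) = ee u F"
proof -
  define r where "r = u pmod F"
  have r: "r \<in> C" "length r < length F" using assms pmod_length by (simp_all add: r_def)
  have FG: "F *. G \<in> C" "F *. G \<noteq> []" using assms by simp_all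
  obtain t where t: "t \<in> C" "u -. r = F *. t" using pmod_cong_self[of u F] assms by (auto simp: dvd_iff r_def)
  have "u *. G -. r *. G = (u -. r) *. G" using assms r by algebra
  also have "\<dots> = (F *. G) *. t" unfolding t(2) using assms t by algebra
  finally have "(F *. G) pdivides (u *. G -. r *. G)" by (rule dvdI[OF t(1)])
  then have 1: "ee (u *. G) (F *. G) = ee (r *. G) (F *. G)" using assms r FG by (intro ee_cong) simp_all
  have 2: "ee u F = ee r F" using assms r pmod_cong_self[of u F] by (intro ee_cong) (simp_all add: r_def)
  have degs: "deg (F *. G) = deg F + deg G" unfolding deg_def using assms by (intro degree_mul)
  have lF: "length F = Suc (deg F)" and lG: "length G = Suc (deg G)" using assms len_deg by auto
  show ?thesis
  proof (cases "r = []")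
    case True then show ?thesis using 1 2 assms FG by simp
  next
    case rn: False
    have lr: "length (r *. G) = length r + deg G" using length_mul[of r G] assms r rn lG by simp
    show ?thesis
    proof (cases "length r = deg F")
      case True
      have "ee (r *. G) (F *. G) = \<psi> (hd (r *. G) \<otimes> inv (hd (F *. G)))"
        using lr True degs FG r rn assms by (intro ee_top) simp_all
      also have "hd (r *. G) \<otimes> inv (hd (F *. G)) = hd r \<otimes> inv (hd F)"
      proof -
        have U: "hd G \<in> Units R" "hd F \<in> Units R" using assms field_Units by auto
        have h: "hd r \<in> carrier R" using r rn by simp
        have "inv (hd F \<otimes> hd G) = inv (hd G) \<otimes> inv (hd F)"
        proof (rule comm_inv_char)
          have "(hd F \<otimes> hd G) \<otimes> (inv (hd G) \<otimes> inv (hd F)) = hd F \<otimes> (hd G \<otimes> inv (hd G)) \<otimes> inv (hd F)"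
            using U Units_closed Units_inv_closed by (simp add: m_assoc del: Units_r_inv)
          then show "(hd F \<otimes> hd G) \<otimes> (inv (hd G) \<otimes> inv (hd F)) = \<one>" using U Units_closed[OF U(2)] by simp
        qed (use U in auto)
        moreover have "hd r \<otimes> hd G \<otimes> (inv (hd G) \<otimes> inv (hd F)) = hd r \<otimes> (hd G \<otimes> inv (hd G)) \<otimes> inv (hd F)"
          using U h Units_closed Units_inv_closed by (simp add: m_assoc del: Units_r_inv)
        ultimately show ?thesis using assms r rn U h by (simp add: hd_mul)
      qed
      also have "\<psi> \<dots> = ee r F" using True r rn assms by (intro ee_top[symmetric]) simp_all
      finally show ?thesis using 1 2 by simp
    next
      case False
      then have "length r < deg F" using r lF by simp
      then have "ee r F = 1" "ee (r *. G) (F *. G) = 1" 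
        using ee_small[of r F] ee_small[of "r *. G" "F *. G"] r assms FG lr degs by simp_all
      then show ?thesis using 1 2 by simp
    qed
  qed
qed
lemma ee_periodic: "F \<in> C \<Longrightarrow> F \<noteq> [] \<Longrightarrow> k \<in> C \<Longrightarrow> periodic F (\<lambda>a. ee (a *. k) F)"
  unfolding periodic_def
proof (intro ballI impI)
  fix a b assume F: "F \<in> C" "F \<noteq> []" "k \<in> C" and ab: "a \<in> C" "b \<in> C" "F pdivides (a -. b)"
  have "a *. k -. b *. k = (a -. b) *. k" using F ab by algebra
  then have "F pdivides (a *. k -. b *. k)" using dvd_mulI(1)[OF F(1) _ ab(3) F(3)] ab by simp
  then show "ee (a *. k) F = ee (b *. k) F" using F ab by (intro ee_cong) simp_all
qed

text \<open>Either every product \<open>k *. b\<close> is too short to reach the coefficient that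
  \<open>ee\<close> reads, or some shift of \<open>k\<close> multiplies the sum by a number other
  than 1.\<close>

lemma orthogonality:
  assumes F: "F \<in> M" and L: "L \<le> deg F" and b: "b \<in> Pl (deg F)"
  shows "(\<Sum>k\<in>Pl L. ee (k *. b) F) = (if length b \<le> deg F - L then of_nat qn ^ L else 0)"
proof (cases "length b \<le> deg F - L")
  case True
  have "ee (k *. b) F = 1" if k: "k \<in> Pl L" for k
  proof (cases "k = [] \<or> b = []")
    case True then show ?thesis using F k b Pl_C by auto
  next
    case False
    have lk: "length k > 0" using False by simp
    have kb: "k \<in> C" "b \<in> C" "length k \<le> L" using k b by (auto simp: Pl_iff)
    have "length (k *. b) = length k + length b - 1" using length_mul[of k b] kb False by simp
    then have "length (k *. b) < deg F" using lk kb(3) True L by linarith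
    then show ?thesis using k b F Pl_C by (intro ee_small) auto
  qed
  then show ?thesis using True by (simp add: card_Pl)
next
  case False
  have bC: "b \<in> C" "b \<noteq> []" "length b \<le> deg F" using b False by (auto simp: Pl_iff)
  then have "hd b \<in> Fs" by simp
  then obtain c where c: "c \<in> Fs" "\<psi> (c \<otimes> hd b) \<noteq> 1" using psi_scale_nontriv by blast
  define t where "t = deg F - length b"
  \<comment> \<open>The degree \<open>t\<close> makes \<open>k0 *. b\<close> of length exactly deg
    F, which puts \<open>c \<otimes> hd b\<close> into the position read by
    \<open>ee\<close>.\<close>
  define k0 where "k0 = [c] *. (X ^. t)"
  have lb: "length b + t = deg F" "t < L" "length b > 0" using bC False L by (auto simp: t_def)
  have k0: "k0 \<in> C" "length k0 = Suc t" "k0 \<noteq> []" "hd k0 = c" using c Xpow_length[of t]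
    by (auto simp: k0_def hd_mul)
  then have k0P: "k0 \<in> Pl L" using lb by (simp add: Pl_iff)
  have "ee (k0 *. b) F = \<psi> (hd (k0 *. b) \<otimes> inv (hd F))"
    using length_mul[of k0 b] k0 bC lb F by (intro ee_top) simp_all
  also have "\<dots> = \<psi> (c \<otimes> hd b)" using k0 bC c F by (simp add: hd_mul)
  finally have ne: "ee (k0 *. b) F \<noteq> 1" using c by simp
  have "(\<Sum>k\<in>Pl L. ee (k *. b) F) = (\<Sum>k\<in>Pl L. ee ((k +. k0) *. b) F)"
    by (rule sum.reindex_bij_betw[OF Pl_shift_bij[OF k0P], symmetric])
  also have "\<dots> = (\<Sum>k\<in>Pl L. ee (k *. b) F) * ee (k0 *. b) F"
    unfolding sum_distrib_right
  proof (rule sum.cong[OF refl])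
    fix k assume "k \<in> Pl L"
    then have kC: "k \<in> C" by auto
    show "ee ((k +. k0) *. b) F = ee (k *. b) F * ee (k0 *. b) F"
      using kC k0 bC F by (simp add: UP.l_distr ee_add)
  qed
  finally have "(\<Sum>k\<in>Pl L. ee (k *. b) F) * (1 - ee (k0 *. b) F) = 0" by (simp add: algebra_simps)
  then show ?thesis using ne False by simp
qed

definition GS :: "'a list \<Rightarrow> 'a list \<Rightarrow> complex" where
  "GS k F = (\<Sum>a\<in>Pl (deg F). chi F a * ee (a *. k) F)"

text \<open>A residue a is monic of degree n if and only if \<open>a -. X ^. n\<close> has length at
  most n, and \<open>orthogonality\<close> with L = deg F - n detects this.\<close>

lemma poisson:
  assumes F: "F \<in> M" and n: "n < deg F" and per: "periodic F \<phi>"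
  shows "of_nat qn ^ (deg F - n) * (\<Sum>f\<in>Mn n. \<phi> f) =
    (\<Sum>k\<in>Pl (deg F - n). cnj (ee (k *. X ^. n) F) * (\<Sum>a\<in>Pl (deg F). \<phi> a * ee (a *. k) F))"
proof -
  let ?N = "deg F" let ?X = "X ^. n"
  have XP: "?X \<in> Pl ?N" "?X \<in> C" using Xpow_length[of n] n by (auto simp: Pl_iff)
  have "(\<Sum>k\<in>Pl (?N - n). cnj (ee (k *. ?X) F) * (\<Sum>a\<in>Pl ?N. \<phi> a * ee (a *. k) F))
     = (\<Sum>k\<in>Pl (?N - n). \<Sum>a\<in>Pl ?N. \<phi> a * ee (k *. (a -. ?X)) F)"
    unfolding sum_distrib_left
  proof (intro sum.cong refl)
    fix k a assume "k \<in> Pl (?N - n)" "a \<in> Pl ?N"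
    then have kC: "k \<in> C" "a \<in> C" by auto
    have "k *. (a -. ?X) = a *. k -. k *. ?X" using kC XP(2) by algebra
    then show "cnj (ee (k *. ?X) F) * (\<phi> a * ee (a *. k) F) = \<phi> a * ee (k *. (a -. ?X)) F"
      using kC XP F by (simp add: ee_sub)
  qed
  also have "\<dots> = (\<Sum>a\<in>Pl ?N. \<phi> a * (\<Sum>k\<in>Pl (?N - n). ee (k *. (a -. ?X)) F))"
    by (subst sum.swap) (simp add: sum_distrib_left)
  also have "\<dots> = (\<Sum>a\<in>Pl ?N. if a \<in> Mn n then \<phi> a * of_nat qn ^ (?N - n) else 0)"
  proof (intro sum.cong refl)
    fix a assume a: "a \<in> Pl ?N"
    have aC: "a \<in> C" using a by auto
    have "(\<Sum>k\<in>Pl (?N - n). ee (k *. (a -. ?X)) F) = (if length (a -. ?X) \<le> n then of_nat qn ^ (?N - n) else 0)"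
      using orthogonality[OF F, of "?N - n" "a -. ?X"] Pl_sub[OF a XP(1)] n by simp
    moreover have "length (a -. ?X) \<le> n \<longleftrightarrow> a \<in> Mn n"
    proof
      assume l: "length (a -. ?X) \<le> n"
      have e: "a = ?X +. (a -. ?X)" using aC XP(2) by algebra
      have "length a = Suc n" "hd a = \<one>"
        using length_add_eq[of ?X "a -. ?X"] hd_add_eq[of ?X "a -. ?X"] l Xpow_length[of n] aC XP(2) e by simp_all
      then show "a \<in> Mn n" using aC by (auto simp: Mn_iff intro!: M_I)
    next
      assume "a \<in> Mn n"
      then show "length (a -. ?X) \<le> n"
        using length_sub_less[of a ?X] Xpow_length[of n] XP by (auto simp: Mn_iff)
    qed
    ultimately show "\<phi> a * (\<Sum>k\<in>Pl (?N - n). ee (k *. (a -. ?X)) F) = (if a \<in> Mn n then \<phi> a * of_nat qn ^ (?N - n) else 0)" by simp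
  qed
  also have "\<dots> = (\<Sum>a\<in>Pl ?N \<inter> Mn n. \<phi> a * of_nat qn ^ (?N - n))"
    by (simp add: sum.inter_restrict)
  also have "Pl ?N \<inter> Mn n = Mn n" using n by (auto simp: Pl_iff Mn_iff)
  finally show ?thesis by (simp add: sum_distrib_right mult.commute)
qed

lemma GS_periodic: "F \<in> M \<Longrightarrow> k \<in> C \<Longrightarrow> periodic F (\<lambda>a. chi F a * ee (a *. k) F)"
  by (intro periodic_mult chi_periodic ee_periodic) simp_all

lemma GS_scale:
  assumes F: "F \<in> M" and k: "k \<in> C" and u: "cop u F"
  shows "GS (u *. k) F = cnj (chi F u) * GS k F"
proof -
  have uC: "u \<in> C" using u cop_C by blast
  have uu: "cnj (chi F u) * chi F u = 1" using chi_norm[OF F u] by (metis complex_norm_square mult.commute of_real_1 power_one)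
  have "GS k F = (\<Sum>a\<in>Pl (deg F). chi F (a *. u) * ee ((a *. u) *. k) F)"
    unfolding GS_def by (rule sum_unit_mult[OF F GS_periodic[OF F k] u, symmetric])
  also have "\<dots> = chi F u * GS (u *. k) F"
    unfolding GS_def sum_distrib_left
  proof (intro sum.cong refl)
    fix a assume "a \<in> Pl (deg F)"
    then have aC: "a \<in> C" by auto
    show "chi F (a *. u) * ee ((a *. u) *. k) F = chi F u * (chi F a * ee (a *. (u *. k)) F)"
      using aC uC k F by (simp add: chi_mult UP.m_assoc mult_ac)
  qed
  finally show ?thesis using uu by (simp add: mult.assoc[symmetric])
qed

lemma GS_const:
  "F \<in> M \<Longrightarrow> k \<in> C \<Longrightarrow> c \<in> Fs \<Longrightarrow> GS ([c] *. k) F = cnj (om c) ^ deg F * GS k F"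
  using GS_scale[of F k "[c]"] cop_const[of c F] chi_const[of F c] by simp

text \<open>The frequencies \<open>k \<noteq> 0\<close> are split as a constant times a monic polynomial. The constants sum to \<open>tau\<close> for the
  largest degree of \<open>k\<close> and to \<open>sgn0\<close> for the others.\<close>

lemma chi_poisson:
  assumes F: "F \<in> M" and n: "n < deg F"
  shows "of_nat qn ^ (deg F - n) * (\<Sum>f\<in>Mn n. chi F f) =
    GS [] F + sgn0 (deg F) * (\<Sum>i<deg F - n - 1. \<Sum>k\<in>Mn i. GS k F) + tau (deg F) * (\<Sum>k\<in>Mn (deg F - n - 1). GS k F)"
proof -
  let ?N = "deg F" let ?X = "X ^. n"
  have FC: "F \<in> C" "F \<noteq> []" using F by auto
  define h where "h k = cnj (ee (k *. ?X) F) * GS k F" for k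
  have inner: "(\<Sum>c\<in>Fs. h ([c] *. k)) = (if i < ?N - n - 1 then sgn0 ?N else tau ?N) * GS k F"
    if k: "k \<in> Mn i" and i: "i < ?N - n" for k i
  proof -
    have kC: "k \<in> C" "k \<in> M" "length k = Suc i" using k by (auto simp: Mn_iff)
    have l: "length (([c] *. k) *. ?X) = Suc (i + n)" "([c] *. k) *. ?X \<in> C" "hd (([c] *. k) *. ?X) = c" 
        "([c] *. k) *. ?X \<noteq> []" if c: "c \<in> Fs" for c
      using length_mul[of "[c] *. k" ?X] kC c Xpow_length[of n] Xpow_M[of n] by (simp_all add: hd_mul)
    have "(\<Sum>c\<in>Fs. h ([c] *. k)) = (\<Sum>c\<in>Fs. cnj (ee (([c] *. k) *. ?X) F) * cnj (om c) ^ ?N * GS k F)"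
      unfolding h_def using GS_const[OF F kC(1)] by (intro sum.cong refl) simp
    also have "\<dots> = (\<Sum>c\<in>Fs. cnj (ee (([c] *. k) *. ?X) F) * cnj (om c) ^ ?N) * GS k F"
      by (simp add: sum_distrib_right)
    \<comment> \<open>The product of \<open>[c] *. k\<close> and \<open>X ^. n\<close> has length i
      + n + 1, so only the largest degree i = deg F - n - 1 reaches the coefficient read by
      \<open>ee\<close>.\<close>
    also have "(\<Sum>c\<in>Fs. cnj (ee (([c] *. k) *. ?X) F) * cnj (om c) ^ ?N) = (if i < ?N - n - 1 then sgn0 ?N else tau ?N)"
    proof (cases "i < ?N - n - 1")
      case True
      have "ee (([c] *. k) *. ?X) F = 1" if c: "c \<in> Fs" for c
        using l[OF c] True FC by (intro ee_small) simp_all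
      then have "(\<Sum>c\<in>Fs. cnj (ee (([c] *. k) *. ?X) F) * cnj (om c) ^ ?N) = (\<Sum>c\<in>Fs. cnj (om c) ^ ?N)"
        by (intro sum.cong refl) simp
      then show ?thesis using True by (simp add: sum_cnj_om_pow)
    next
      case False
      have "ee (([c] *. k) *. ?X) F = \<psi> c" if c: "c \<in> Fs" for c
        using ee_top[OF l(2)[OF c] FC] l[OF c] False i F c by simp
      then have "(\<Sum>c\<in>Fs. cnj (ee (([c] *. k) *. ?X) F) * cnj (om c) ^ ?N) = tau ?N"
        unfolding tau_def by (intro sum.cong refl) (simp add: psi_neg)
      then show ?thesis using False by simp
    qed
    finally show ?thesis .
  qed
  have "of_nat qn ^ (?N - n) * (\<Sum>f\<in>Mn n. chi F f) = (\<Sum>k\<in>Pl (?N - n). h k)"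
    unfolding h_def GS_def by (rule poisson[OF F n chi_periodic[OF F]])
  also have "\<dots> = h [] + (\<Sum>i<?N - n. \<Sum>k\<in>Mn i. \<Sum>c\<in>Fs. h ([c] *. k))" by (rule sum_Pl_monic)
  also have "(\<Sum>i<?N - n. \<Sum>k\<in>Mn i. \<Sum>c\<in>Fs. h ([c] *. k)) = (\<Sum>i<?N - n. \<Sum>k\<in>Mn i. (if i < ?N - n - 1 then sgn0 ?N else tau ?N) * GS k F)"
    using inner by (intro sum.cong refl) simp
  also have "\<dots> = (\<Sum>i<Suc (?N - n - 1). (if i < ?N - n - 1 then sgn0 ?N else tau ?N) * (\<Sum>k\<in>Mn i. GS k F))"
  proof -
    have eN: "?N - n = Suc (?N - n - 1)" using n by simp
    show ?thesis by (subst (1) eN) (simp only: sum_distrib_left)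
  qed
  also have "\<dots> = sgn0 ?N * (\<Sum>i<?N - n - 1. \<Sum>k\<in>Mn i. GS k F) + tau ?N * (\<Sum>k\<in>Mn (?N - n - 1). GS k F)"
    by (simp add: sum_distrib_left)
  also have "h [] = GS [] F" unfolding h_def using FC by simp
  finally show ?thesis by (simp add: add.assoc)
qed

lemma chi_cnj: "f \<in> M \<Longrightarrow> cop a f \<Longrightarrow> cnj (chi f a) = (chi f a)\<^sup>2"
proof -
  assume a: "f \<in> M" "cop a f"
  have "chi f a * cnj (chi f a) = 1" using chi_norm[OF a] by (metis complex_norm_square of_real_1 power_one)
  moreover have "chi f a * (chi f a)\<^sup>2 = 1" using chi_cube[OF a] by (simp add: power3_eq_cube power2_eq_square mult.assoc)
  moreover have "chi f a \<noteq> 0" using chi_norm[OF a] by auto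
  ultimately show ?thesis by (metis mult_left_cancel)
qed

text \<open>The Chinese remainder theorem produces the factor \<open>chi F1 F2 * chi F2 F1\<close>.
  By reciprocity it is the square, hence the conjugate, of \<open>chi F2 F1\<close>, and scaling the
  frequency by \<open>F1\<close> absorbs it.\<close>

lemma GS_mult:
  assumes F: "F1 \<in> M" "F2 \<in> M" and cop: "cop F1 F2" and k: "k \<in> C"
  shows "GS k (F1 *. F2) = GS k F1 * GS (k *. F1) F2"
proof -
  have FC: "F1 \<in> C" "F2 \<in> C" "F1 \<noteq> []" "F2 \<noteq> []" using F by auto
  define \<phi> where "\<phi> a = chi (F1 *. F2) a * ee (a *. k) (F1 *. F2)" for a
  define g where "g z = fst z *. F2 +. snd z *. F1" for z
  let ?A = "Pl (deg F1) \<times> Pl (deg F2)"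
  have "GS k (F1 *. F2) = (\<Sum>z\<in>?A. \<phi> (g z))"
    unfolding GS_def \<phi>_def
  proof (rule sum_crs[symmetric])
    show "periodic (F1 *. F2) (\<lambda>a. chi (F1 *. F2) a * ee (a *. k) (F1 *. F2))"
      using F k by (intro GS_periodic) simp_all
    show "g ` ?A \<subseteq> C"
    proof
      fix x assume "x \<in> g ` ?A"
      then obtain a b where ab: "a \<in> Pl (deg F1)" "b \<in> Pl (deg F2)" "x = a *. F2 +. b *. F1" by (auto simp: g_def)
      show "x \<in> C" using Pl_C[OF ab(1)] Pl_C[OF ab(2)] FC by (simp add: ab(3))
    qed
    show "card ?A = qn ^ deg (F1 *. F2)" using F by (simp add: card_cartesian_product card_Pl power_add)
    fix z w assume zw: "z \<in> ?A" "w \<in> ?A" and d: "(F1 *. F2) pdivides (g z -. g w)"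
    obtain a b where ab: "z = (a,b)" "a \<in> Pl (deg F1)" "b \<in> Pl (deg F2)" using zw by auto
    obtain c e where ce: "w = (c,e)" "c \<in> Pl (deg F1)" "e \<in> Pl (deg F2)" using zw by auto
    have C: "a \<in> C" "b \<in> C" "c \<in> C" "e \<in> C" using ab ce by auto
    have e: "g z -. g w = F2 *. (a -. c) +. F1 *. (b -. e)" unfolding g_def ab ce fst_conv snd_conv using C FC(1,2) by algebra
    have d1: "F1 pdivides (F2 *. (a -. c) +. F1 *. (b -. e))"
      by (rule dvd_trans[OF FC(1) _ d[unfolded e]]) (rule dvdI[of F2], use FC in simp_all)
    have d2: "F2 pdivides (F2 *. (a -. c) +. F1 *. (b -. e))"
      by (rule dvd_trans[OF FC(2) _ d[unfolded e]]) (rule dvdI[of F1], use FC in \<open>simp_all add: UP.m_comm\<close>)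
    have "F1 pdivides ((F2 *. (a -. c) +. F1 *. (b -. e)) -. F1 *. (b -. e))"
      using d1 by (rule dvd_subI[OF FC(1)]) (rule dvdI[of "b -. e"], use C in simp_all)
    also have "(F2 *. (a -. c) +. F1 *. (b -. e)) -. F1 *. (b -. e) = F2 *. (a -. c)" using C FC(1,2) by algebra
    finally have "F1 pdivides (a -. c)" using cop_dvd_mul[OF cop, of "a -. c"] C by simp
    then have ac: "a = c" using Pl_cong_eq[OF F(1)] ab ce by blast
    have "F2 pdivides ((F2 *. (a -. c) +. F1 *. (b -. e)) -. F2 *. (a -. c))"
      using d2 by (rule dvd_subI[OF FC(2)]) (rule dvdI[of "a -. c"], use C in simp_all)
    also have "(F2 *. (a -. c) +. F1 *. (b -. e)) -. F2 *. (a -. c) = F1 *. (b -. e)" using C FC(1,2) by algebra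
    finally have "F2 pdivides (b -. e)" using cop_dvd_mul[OF cop_symI[OF cop], of "b -. e"] C by simp
    then have "b = e" using Pl_cong_eq[OF F(2)] ab ce by blast
    then show "z = w" using ac ab ce by simp
  qed (use F in simp_all)
  also have "\<dots> = (\<Sum>z\<in>?A. (chi F1 F2 * chi F2 F1) * ((chi F1 (fst z) * ee (fst z *. k) F1) * (chi F2 (snd z) * ee (snd z *. k) F2)))"
  proof (rule sum.cong[OF refl])
    fix z assume z: "z \<in> ?A"
    obtain a b where ab: "z = (a,b)" "a \<in> Pl (deg F1)" "b \<in> Pl (deg F2)" using z by auto
    have C: "a \<in> C" "b \<in> C" using ab by auto
    have g: "g z = a *. F2 +. b *. F1" "g z \<in> C" using C FC by (simp_all add: g_def ab)
    have "g z -. a *. F2 = F1 *. b" unfolding g using C FC(1,2) by algebra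
    then have "chi F1 (g z) = chi F1 (a *. F2)" using C FC F g by (intro chi_cong dvdI[of b]) simp_all
    then have c1: "chi F1 (g z) = chi F1 a * chi F1 F2" using chi_mult F C FC by simp
    have "g z -. b *. F1 = F2 *. a" unfolding g using C FC(1,2) by algebra
    then have "chi F2 (g z) = chi F2 (b *. F1)" using C FC F g by (intro chi_cong dvdI[of a]) simp_all
    then have c2: "chi F2 (g z) = chi F2 b * chi F2 F1" using chi_mult F C FC by simp
    have "g z *. k = (a *. k) *. F2 +. (b *. k) *. F1" unfolding g using C FC(1,2) k by algebra
    then have "ee (g z *. k) (F1 *. F2) = ee ((a *. k) *. F2) (F1 *. F2) * ee ((b *. k) *. F1) (F2 *. F1)"
      using C FC k by (simp add: ee_add UP.m_comm)
    also have "\<dots> = ee (a *. k) F1 * ee (b *. k) F2" using C FC k by (simp add: ee_cancel)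
    finally show "\<phi> (g z) = (chi F1 F2 * chi F2 F1) * ((chi F1 (fst z) * ee (fst z *. k) F1) * (chi F2 (snd z) * ee (snd z *. k) F2))"
      using c1 c2 F by (simp add: \<phi>_def chi_mul ab mult_ac)
  qed
  also have "\<dots> = (chi F1 F2 * chi F2 F1) * (\<Sum>z\<in>?A. (chi F1 (fst z) * ee (fst z *. k) F1) * (chi F2 (snd z) * ee (snd z *. k) F2))"
    by (simp only: sum_distrib_left)
  also have "(\<Sum>z\<in>?A. (chi F1 (fst z) * ee (fst z *. k) F1) * (chi F2 (snd z) * ee (snd z *. k) F2)) = GS k F1 * GS k F2"
    unfolding GS_def sum_product sum.cartesian_product by (simp only: case_prod_unfold)
  also have "chi F1 F2 * chi F2 F1 = cnj (chi F2 F1)" 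
    using chi_recip[OF F] chi_cnj[OF F(2) cop] by (simp add: power2_eq_square)
  also have "cnj (chi F2 F1) * (GS k F1 * GS k F2) = GS k F1 * GS (k *. F1) F2"
    using GS_scale[OF F(2) k cop] k FC by (simp add: UP.m_comm)
  finally show ?thesis .
qed

lemma GS_trivial: "F \<in> M \<Longrightarrow> k \<in> C \<Longrightarrow> norm (GS k F) \<le> q ^ deg F"
proof -
  assume F: "F \<in> M" and k: "k \<in> C"
  have "norm (GS k F) \<le> (\<Sum>a\<in>Pl (deg F). 1)"
    unfolding GS_def
  proof (rule sum_norm_le)
    fix a assume "a \<in> Pl (deg F)"
    then have "a \<in> C" by auto
    then show "norm (chi F a * ee (a *. k) F) \<le> 1"
      using chi_norm_le[of F a] ee_norm[of "a *. k" F] F k by (simp add: norm_mult)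
  qed
  then show ?thesis by (simp add: card_Pl)
qed

lemma GS_dvd_zero:
  assumes F: "F \<in> M" and nc: "\<And>h. h \<in> M \<Longrightarrow> F \<noteq> h ^. 3" and k: "k \<in> C" "F pdivides k"
  shows "GS k F = 0"
proof -
  have "GS k F = (\<Sum>a\<in>Pl (deg F). chi F a)"
    unfolding GS_def
  proof (rule sum.cong[OF refl])
    fix a assume "a \<in> Pl (deg F)"
    then have "a \<in> C" by auto
    then have "ee (a *. k) F = 1" using k F by (intro ee_dvd dvd_mulI(2)) simp_all
    then show "chi F a * ee (a *. k) F = chi F a" by simp
  qed
  then show ?thesis using sum_chi_zero[OF F nc] by simp
qed

lemma full_orthogonality:
  assumes F: "F \<in> M" and k: "k \<in> C"
  shows "(\<Sum>y\<in>Pl (deg F). ee (y *. k) F) = (if F pdivides k then of_nat qn ^ deg F else 0)"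
proof -
  define b where "b = k pmod F"
  have b: "b \<in> Pl (deg F)" "b \<in> C" unfolding b_def using pmod_Pl F k by auto
  have "(\<Sum>y\<in>Pl (deg F). ee (y *. k) F) = (\<Sum>y\<in>Pl (deg F). ee (y *. b) F)"
  proof (rule sum.cong[OF refl])
    fix y assume "y \<in> Pl (deg F)"
    then have yC: "y \<in> C" by auto
    have "y *. k -. y *. b = y *. (k -. b)" using yC k b(2) by algebra
    then have "F pdivides (y *. k -. y *. b)" 
      using pmod_cong_self[of k F] yC k b(2) F dvd_mulI(2)[of F "k -. b" y] by (simp add: b_def)
    then show "ee (y *. k) F = ee (y *. b) F" using yC k b(2) F by (intro ee_cong) simp_all
  qed
  also have "\<dots> = (if length b \<le> 0 then of_nat qn ^ deg F else 0)"
    using orthogonality[OF F order_refl b(1)] by simp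
  finally show ?thesis using pmod_nil_iff[of k F] k F by (simp add: b_def)
qed

definition Hs :: "'a list \<Rightarrow> nat \<Rightarrow> 'a list \<Rightarrow> complex" where
  "Hs P i k = (\<Sum>r\<in>Pl (deg P). cr P r ^ i * ee (r *. k) P)"

text \<open>Write a = P y + r. The character modulo a power of \<open>P\<close> depends on r alone,
  so the sum over y is a full orthogonality sum modulo \<open>P ^. i\<close>.\<close>

lemma GS_prime_power:
  assumes P: "P \<in> \<P>" and k: "k \<in> C"
  shows "GS k (P ^. Suc i) = (if (P ^. i) pdivides k then of_nat qn ^ (i * deg P) * (\<Sum>r\<in>Pl (deg P). cr P r ^ Suc i * ee (r *. k) (P ^. Suc i)) else 0)"
proof -
  have PM: "P \<in> M" "P \<in> C" using P by auto
  let ?F = "P ^. Suc i" let ?E = "P ^. i"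
  have FM: "?F \<in> M" "?E \<in> M" using PM by simp_all
  have FE: "?F = ?E *. P" by simp
  have "GS k ?F = (\<Sum>z\<in>Pl (i * deg P) \<times> Pl (deg P). chi ?F (case z of (y,r) \<Rightarrow> P *. y +. r) * ee ((case z of (y,r) \<Rightarrow> P *. y +. r) *. k) ?F)"
    unfolding GS_def 
    using sum.reindex_bij_betw[OF Pl_split_bij[OF PM(1), of "i * deg P"], of "\<lambda>a. chi ?F a * ee (a *. k) ?F"] PM 
    by (simp add: add.commute del: UP.nat_pow_Suc)
  also have "\<dots> = (\<Sum>z\<in>Pl (i * deg P) \<times> Pl (deg P). (cr P (snd z) ^ Suc i * ee (snd z *. k) ?F) * ee (fst z *. k) ?E)"
  proof (rule sum.cong[OF refl])
    fix z assume z: "z \<in> Pl (i * deg P) \<times> Pl (deg P)"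
    obtain y r where yr: "z = (y,r)" by (cases z)
    have C: "y \<in> C" "r \<in> C" using z yr by auto
    have "(P *. y +. r) -. r = P *. y" using C PM(2) by algebra
    then have "cr P (P *. y +. r) = cr P r" using C PM by (intro cr_cong[OF P] dvdI[of y]) simp_all
    then have 1: "chi ?F (P *. y +. r) = cr P r ^ Suc i" using chi_pow[OF PM(1), of "Suc i"] chi_prime[OF P] by (simp del: UP.nat_pow_Suc)
    have "(P *. y +. r) *. k = (y *. k) *. P +. r *. k" using C PM(2) k by algebra
    then have "ee ((P *. y +. r) *. k) ?F = ee ((y *. k) *. P) (?E *. P) * ee (r *. k) ?F"
      using C PM k FM ee_add[of "(y *. k) *. P" "r *. k" ?F] by simp
    also have "ee ((y *. k) *. P) (?E *. P) = ee (y *. k) ?E" using C PM k FM P by (intro ee_cancel) simp_all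
    finally show "chi ?F (case z of (y,r) \<Rightarrow> P *. y +. r) * ee ((case z of (y,r) \<Rightarrow> P *. y +. r) *. k) ?F = 
       (cr P (snd z) ^ Suc i * ee (snd z *. k) ?F) * ee (fst z *. k) ?E" using 1 yr by (simp del: UP.nat_pow_Suc power_Suc)
  qed
  also have "\<dots> = (\<Sum>r\<in>Pl (deg P). cr P r ^ Suc i * ee (r *. k) ?F) * (\<Sum>y\<in>Pl (i * deg P). ee (y *. k) ?E)"
    unfolding sum_product sum.cartesian_product 
    by (rule sum.reindex_bij_witness[of _ "\<lambda>z. (snd z, fst z)" "\<lambda>z. (snd z, fst z)"]) auto
  also have "(\<Sum>y\<in>Pl (i * deg P). ee (y *. k) ?E) = (if ?E pdivides k then of_nat qn ^ (i * deg P) else 0)"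
    using full_orthogonality[OF FM(2) k] PM by simp
  finally show ?thesis by (simp add: mult.commute del: UP.nat_pow_Suc power_Suc)
qed

lemma GS_prime_power_mul:
  assumes P: "P \<in> \<P>" and k: "k \<in> C"
  shows "GS (P ^. i *. k) (P ^. Suc i) = of_nat qn ^ (i * deg P) * Hs P (Suc i) k"
proof -
  have PM: "P \<in> M" "P \<in> C" using P by auto
  let ?E = "P ^. i"
  have E: "?E \<in> M" "?E \<in> C" "?E \<noteq> []" using pow_M[OF PM(1), of i] by (simp_all add: PM)
  have "(\<Sum>r\<in>Pl (deg P). cr P r ^ Suc i * ee (r *. (?E *. k)) (P ^. Suc i)) = Hs P (Suc i) k"
    unfolding Hs_def
  proof (rule sum.cong[OF refl])
    fix r assume "r \<in> Pl (deg P)"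
    then have rC: "r \<in> C" by auto
    have "P ^. Suc i = P *. ?E" using PM E by (simp add: UP.m_comm)
    moreover have "r *. (?E *. k) = (r *. k) *. ?E" using rC E(2) k by algebra
    ultimately show "cr P r ^ Suc i * ee (r *. (?E *. k)) (P ^. Suc i) = cr P r ^ Suc i * ee (r *. k) P"
      using ee_cancel[of "r *. k" P ?E] rC k PM E P by simp
  qed
  moreover have "?E pdivides (?E *. k)" using k by (rule dvdI) simp
  ultimately show ?thesis using GS_prime_power[OF P, of "?E *. k" i] E k by simp
qed

lemma GS_prime_power_zero:
  "P \<in> \<P> \<Longrightarrow> k \<in> C \<Longrightarrow> \<not> (P ^. i) pdivides k \<Longrightarrow> GS k (P ^. Suc i) = 0"
  using GS_prime_power[of P k i] by simp

text \<open>Scaling by units shows that all frequencies prime to \<open>P\<close> give the same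
  absolute value, so Parseval bounds each of them. This includes exponents divisible by 3, where the
  power of the residue symbol is the trivial character.\<close>

lemma Hs_norm:
  assumes P: "P \<in> \<P>" and k: "k \<in> C" "\<not> P pdivides k"
  shows "norm (Hs P (Suc i) k) \<le> sqrt (q ^ deg P)"
proof -
  have PM: "P \<in> M" "P \<in> C" "P \<noteq> []" using P by auto
  let ?N = "deg P" let ?i = "Suc i"
  define w where "w r = cr P r ^ ?i" for r
  have w_le: "norm (w r) \<le> 1" if "r \<in> C" for r
    unfolding w_def using chi_norm_le[OF PM(1) that] chi_prime[OF P] by (simp add: norm_power power_le_one del: power_Suc)
  have w0: "w [] = 0" using cr_zero[OF P, of "[]"] PM by (simp add: w_def)
  have wper: "periodic P (\<lambda>r. w r * ee (r *. x) P)" if "x \<in> C" for x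
  proof (rule periodic_mult)
    show "periodic P w" unfolding periodic_def w_def using cr_cong[OF P] by metis
    show "periodic P (\<lambda>r. ee (r *. x) P)" using ee_periodic[OF PM(2,3) that] .
  qed
  define H where "H x = Hs P ?i x" for x
  have Hx: "H x = (\<Sum>r\<in>Pl ?N. w r * ee (r *. x) P)" for x by (simp add: H_def Hs_def w_def)
  have scale: "norm (H (u *. x)) = norm (H x)" if u: "cop u P" and x: "x \<in> C" for u x
  proof -
    have uC: "u \<in> C" using u cop_C by blast
    have "H x = (\<Sum>r\<in>Pl ?N. w (r *. u) * ee ((r *. u) *. x) P)"
      unfolding Hx by (rule sum_unit_mult[OF PM(1) wper[OF x] u, symmetric])
    also have "\<dots> = w u * H (u *. x)"
      unfolding Hx sum_distrib_left
    proof (rule sum.cong[OF refl])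
      fix r assume "r \<in> Pl ?N"
      then have rC: "r \<in> C" by auto
      show "w (r *. u) * ee ((r *. u) *. x) P = w u * (w r * ee (r *. (u *. x)) P)"
        using rC uC x by (simp add: w_def cr_mult[OF P] power_mult_distrib UP.m_assoc mult_ac)
    qed
    finally have "norm (H x) = norm (w u) * norm (H (u *. x))" by (simp add: norm_mult)
    moreover have "norm (w u) = 1" unfolding w_def using chi_norm[OF PM(1) u] chi_prime[OF P] by (simp add: norm_power del: power_Suc)
    ultimately show ?thesis by simp
  qed
  have const: "norm (H x) = norm (H k)" if x: "x \<in> Pl ?N - {[]}" for x
  proof -
    have xC: "x \<in> C" "x \<noteq> []" "length x \<le> ?N" using x by (auto simp: Pl_iff)
    have "\<not> P pdivides x" using dvd_less_nil[OF PM(2) xC(1)] xC M_len[OF PM(1)] by auto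
    then have cx: "cop x P" using bezout_prime[OF P xC(1)] by blast
    have ck: "cop k P" using bezout_prime[OF P k] .
    show ?thesis using scale[OF ck xC(1)] scale[OF cx k(1)] xC k by (simp add: UP.m_comm)
  qed
  have parseval: "(\<Sum>x\<in>Pl ?N. H x * cnj (H x)) = of_nat qn ^ ?N * (\<Sum>r\<in>Pl ?N. w r * cnj (w r))"
  proof -
    have "(\<Sum>x\<in>Pl ?N. H x * cnj (H x)) = (\<Sum>x\<in>Pl ?N. \<Sum>s\<in>Pl ?N. \<Sum>r\<in>Pl ?N. w r * cnj (w s) * ee (x *. (r -. s)) P)"
    proof (rule sum.cong[OF refl])
      fix x assume "x \<in> Pl ?N"
      then have xC: "x \<in> C" by auto
      have "H x * cnj (H x) = (\<Sum>s\<in>Pl ?N. \<Sum>r\<in>Pl ?N. (w r * ee (r *. x) P) * cnj (w s * ee (s *. x) P))"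
        by (simp add: Hx sum_distrib_left sum_distrib_right)
      also have "\<dots> = (\<Sum>s\<in>Pl ?N. \<Sum>r\<in>Pl ?N. w r * cnj (w s) * ee (x *. (r -. s)) P)"
      proof (intro sum.cong refl)
        fix s r assume "s \<in> Pl ?N" "r \<in> Pl ?N"
        then have C: "s \<in> C" "r \<in> C" by auto
        have "x *. (r -. s) = r *. x -. s *. x" using C xC by algebra
        then show "(w r * ee (r *. x) P) * cnj (w s * ee (s *. x) P) = w r * cnj (w s) * ee (x *. (r -. s)) P"
          using C xC PM by (simp add: ee_sub mult_ac)
      qed
      finally show "H x * cnj (H x) = (\<Sum>s\<in>Pl ?N. \<Sum>r\<in>Pl ?N. w r * cnj (w s) * ee (x *. (r -. s)) P)" .
    qed
    also have "\<dots> = (\<Sum>s\<in>Pl ?N. \<Sum>r\<in>Pl ?N. \<Sum>x\<in>Pl ?N. w r * cnj (w s) * ee (x *. (r -. s)) P)"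
      by (subst sum.swap, rule sum.cong[OF refl], rule sum.swap)
    also have "\<dots> = (\<Sum>s\<in>Pl ?N. \<Sum>r\<in>Pl ?N. if r = s then of_nat qn ^ ?N * (w s * cnj (w s)) else 0)"
    proof (intro sum.cong refl)
      fix s r assume sr: "s \<in> Pl ?N" "r \<in> Pl ?N"
      then have C: "s \<in> C" "r \<in> C" by auto
      have "(\<Sum>x\<in>Pl ?N. w r * cnj (w s) * ee (x *. (r -. s)) P) = w r * cnj (w s) * (\<Sum>x\<in>Pl ?N. ee (x *. (r -. s)) P)"
        by (simp add: sum_distrib_left)
      also have "(\<Sum>x\<in>Pl ?N. ee (x *. (r -. s)) P) = (if P pdivides (r -. s) then of_nat qn ^ ?N else 0)"
        using C by (intro full_orthogonality[OF PM(1)]) simp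
      also have "P pdivides (r -. s) \<longleftrightarrow> r = s" using Pl_cong_eq[OF PM(1) sr(2,1)] C PM by auto
      finally show "(\<Sum>x\<in>Pl ?N. w r * cnj (w s) * ee (x *. (r -. s)) P) = (if r = s then of_nat qn ^ ?N * (w s * cnj (w s)) else 0)"
        by simp
    qed
    also have "\<dots> = (\<Sum>s\<in>Pl ?N. of_nat qn ^ ?N * (w s * cnj (w s)))" by simp
    finally show ?thesis by (simp add: sum_distrib_left)
  qed
  have nsq: "z * cnj z = complex_of_real ((norm z)\<^sup>2)" for z by (simp only: complex_norm_square)
  have "complex_of_real (\<Sum>x\<in>Pl ?N. (norm (H x))\<^sup>2) = complex_of_real (q ^ ?N * (\<Sum>r\<in>Pl ?N. (norm (w r))\<^sup>2))"
    using parseval by (simp add: nsq)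
  then have pr: "(\<Sum>x\<in>Pl ?N. (norm (H x))\<^sup>2) = q ^ ?N * (\<Sum>r\<in>Pl ?N. (norm (w r))\<^sup>2)" by (simp only: of_real_eq_iff)
  have card1: "card (Pl ?N - {[]}) = qn ^ ?N - 1" by (simp add: card_Diff_singleton card_Pl)
  have "(\<Sum>r\<in>Pl ?N. (norm (w r))\<^sup>2) = (norm (w []))\<^sup>2 + (\<Sum>r\<in>Pl ?N - {[]}. (norm (w r))\<^sup>2)" by (rule sum.remove) simp_all
  also have "(\<Sum>r\<in>Pl ?N - {[]}. (norm (w r))\<^sup>2) \<le> (\<Sum>r\<in>Pl ?N - {[]}. 1)"
  proof (rule sum_mono)
    fix r assume "r \<in> Pl ?N - {[]}"
    then have "r \<in> C" by auto
    then show "(norm (w r))\<^sup>2 \<le> 1" using w_le by (simp add: power_le_one)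
  qed
  finally have ws: "(\<Sum>r\<in>Pl ?N. (norm (w r))\<^sup>2) \<le> real (qn ^ ?N - 1)" using card1 by (simp add: w0)
  have "real (qn ^ ?N - 1) * (norm (H k))\<^sup>2 = (\<Sum>x\<in>Pl ?N - {[]}. (norm (H x))\<^sup>2)"
    using const card1 by simp
  also have "\<dots> \<le> (\<Sum>x\<in>Pl ?N. (norm (H x))\<^sup>2)" by (rule sum_mono2) auto
  also have "\<dots> \<le> q ^ ?N * real (qn ^ ?N - 1)" unfolding pr using ws by (intro mult_left_mono) simp_all
  finally have "real (qn ^ ?N - 1) * (norm (H k))\<^sup>2 \<le> real (qn ^ ?N - 1) * q ^ ?N" by (simp add: mult.commute)
  moreover have "real (qn ^ ?N - 1) > 0"
  proof -
    have "qn ^ 1 \<le> qn ^ ?N" using deg_prime[OF P] qn_gt1 by (intro power_increasing) simp_all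
    then have "qn ^ ?N - 1 > 0" using qn_gt1 by simp
    then show ?thesis by (simp only: of_nat_0_less_iff)
  qed
  ultimately have "(norm (H k))\<^sup>2 \<le> q ^ ?N" by (simp only: mult_le_cancel_left_pos)
  then show ?thesis unfolding H_def by (rule real_le_rsqrt)
qed

end

section \<open>Sums of Gauss sums\<close>

context fin_field begin

text \<open>\<open>S\<close> holds the primes of the sieve, \<open>S'\<close> the primes already
  split off: the local factor at a prime is separated by moving this prime into
  \<open>S'\<close>.\<close>

definition MS :: "'a list set \<Rightarrow> 'a list set \<Rightarrow> nat \<Rightarrow> 'a list set" where
  "MS S S' N = {F \<in> Mn N. (\<forall>Q\<in>S. (Q ^. 2) pdivides F) \<and> (\<forall>Q\<in>S'. \<not> Q pdivides F)}"
definition II :: "nat \<Rightarrow> 'a list \<Rightarrow> nat \<Rightarrow> nat set" where "II c P N = {i. c \<le> i \<and> i * deg P \<le> N}"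

lemma finite_MS [simp]: "finite (MS S S' N)" by (rule finite_subset[of _ "Mn N"]) (auto simp: MS_def)
lemma MS_Mn: "F \<in> MS S S' N \<Longrightarrow> F \<in> Mn N" by (simp add: MS_def)
lemma MS_M: "F \<in> MS S S' N \<Longrightarrow> F \<in> M" using MS_Mn by blast
lemma MS_deg: "F \<in> MS S S' N \<Longrightarrow> deg F = N" using MS_Mn MS_M Mn_deg by blast
lemma MS_sq: "F \<in> MS S S' N \<Longrightarrow> Q \<in> S \<Longrightarrow> (Q ^. 2) pdivides F" unfolding MS_def by blast
lemma MS_nd: "F \<in> MS S S' N \<Longrightarrow> Q \<in> S' \<Longrightarrow> \<not> Q pdivides F" unfolding MS_def by blast
lemma MS_I: "F \<in> Mn N \<Longrightarrow> (\<And>Q. Q \<in> S \<Longrightarrow> (Q ^. 2) pdivides F) \<Longrightarrow> (\<And>Q. Q \<in> S' \<Longrightarrow> \<not> Q pdivides F) \<Longrightarrow> F \<in> MS S S' N"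
  unfolding MS_def by blast
lemma II_subset: "P \<in> \<P> \<Longrightarrow> II c P N \<subseteq> {..N}"
proof
  fix i assume P: "P \<in> \<P>" and "i \<in> II c P N"
  then have "i * deg P \<le> N" by (simp add: II_def)
  moreover have "i * 1 \<le> i * deg P" by (rule mult_le_mono2[OF deg_prime[OF P]])
  ultimately have "i * 1 \<le> N" by linarith
  then show "i \<in> {..N}" by simp
qed
lemma finite_II [simp]: "P \<in> \<P> \<Longrightarrow> finite (II c P N)"
  by (rule finite_subset[OF II_subset]) simp_all

lemma prime_pow_cop: "p \<in> \<P> \<Longrightarrow> r \<in> \<P> \<Longrightarrow> p \<noteq> r \<Longrightarrow> cop (p ^. i) (r ^. j)"
proof -
  assume p: "p \<in> \<P>" "r \<in> \<P>" "p \<noteq> r"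
  then have "\<not> r pdivides p" using prime_dvd_prime by blast
  then have "cop p r" using bezout_prime[of r p] p by simp
  then have "cop (p ^. i) r" by (rule cop_pow)
  then have "cop r (p ^. i)" by (rule cop_symI)
  then have "cop (r ^. j) (p ^. i)" by (rule cop_pow)
  then show ?thesis by (rule cop_symI)
qed

text \<open>Splits off the exact power of \<open>P\<close>. With c = 0 there is no condition at
  \<open>P\<close>; with c = 2 the condition is that of a member of \<open>S\<close>.\<close>

lemma MS_split_bij:
  assumes P: "P \<in> \<P>" "P \<notin> S" "P \<notin> S'" and S: "S \<subseteq> \<P>" "S' \<subseteq> \<P>"
  shows "bij_betw (\<lambda>(i,F). P ^. i *. F) (SIGMA i:II c P N. MS S (insert P S') (N - i * deg P))
           {F \<in> MS S S' N. (P ^. c) pdivides F}"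
  unfolding bij_betw_def
proof
  let ?D = "SIGMA i:II c P N. MS S (insert P S') (N - i * deg P)"
  have PM: "P \<in> M" "P \<in> C" using P by auto
  have iffs: "(Q ^. 2) pdivides (P ^. i *. F) \<longleftrightarrow> (Q ^. 2) pdivides F" if Q: "Q \<in> S" and F: "F \<in> M" for Q i F
  proof -
    have QP: "Q \<in> \<P>" "Q \<noteq> P" "Q \<in> C" using Q S P by auto
    have "cop (Q ^. 2) (P ^. i)" using prime_pow_cop QP P by blast
    then show ?thesis using cop_dvd_mul[of "Q ^. 2" "P ^. i" F] dvd_mulI(2)[of "Q ^. 2" F "P ^. i"] F QP PM by auto
  qed
  have iffs': "Q pdivides (P ^. i *. F) \<longleftrightarrow> Q pdivides F" if Q: "Q \<in> S'" and F: "F \<in> M" for Q i F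
  proof -
    have QP: "Q \<in> \<P>" "Q \<noteq> P" "Q \<in> C" using Q S P by auto
    have "\<not> Q pdivides (P ^. i)" using prime_dvd_pow[OF QP(1) PM(2)] prime_dvd_prime[OF QP(1) P(1)] QP by blast
    then show ?thesis using prime_dvd_mul_iff[OF QP(1), of "P ^. i" F] F PM by simp
  qed
  show "inj_on (\<lambda>(i,F). P ^. i *. F) ?D"
  proof (rule inj_onI)
    fix z w assume z: "z \<in> ?D" "w \<in> ?D" and e: "(case z of (i,F) \<Rightarrow> P ^. i *. F) = (case w of (i,F) \<Rightarrow> P ^. i *. F)"
    obtain i F j G where zw: "z = (i,F)" "w = (j,G)" by (cases z, cases w) blast
    have "F \<in> MS S (insert P S') (N - i * deg P)" "G \<in> MS S (insert P S') (N - j * deg P)" using z unfolding zw by blast+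
    then have F: "F \<in> M" "\<not> P pdivides F" and G: "G \<in> M" "\<not> P pdivides G" using MS_M MS_nd by blast+
    have e: "P ^. i *. F = P ^. j *. G" using e by (simp add: zw)
    then have "i = j" using pe_eq[OF P(1) F, of i] pe_eq[OF P(1) G, of j] by simp
    moreover then have "F = G" using e M_cancel[of "P ^. i" F G] F G PM by simp
    ultimately show "z = w" by (simp add: zw)
  qed
  show "(\<lambda>(i,F). P ^. i *. F) ` ?D = {F \<in> MS S S' N. (P ^. c) pdivides F}"
  proof
    show "(\<lambda>(i,F). P ^. i *. F) ` ?D \<subseteq> {F \<in> MS S S' N. (P ^. c) pdivides F}"
    proof
      fix x assume "x \<in> (\<lambda>(i,F). P ^. i *. F) ` ?D"
      then obtain z where z: "z \<in> ?D" "x = (case z of (i,F) \<Rightarrow> P ^. i *. F)" by (rule imageE)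
      obtain i F where zz: "z = (i,F)" by (cases z)
      have iF: "i \<in> II c P N" "F \<in> MS S (insert P S') (N - i * deg P)" "x = P ^. i *. F"
        using z unfolding zz by (blast, blast, simp only: prod.case)
      have FM: "F \<in> M" "\<not> P pdivides F" "deg F = N - i * deg P" using MS_M[OF iF(2)] MS_nd[OF iF(2), of P] MS_deg[OF iF(2)] by blast+
      have "deg x = N" using FM iF PM by (simp add: II_def)
      then have "x \<in> Mn N" using Mn_deg[of x N] FM PM iF(3) by simp
      moreover have "(P ^. c) pdivides x" unfolding iF(3) using pow_dvd_iff[OF P(1) FM(1,2), of c i] iF(1) by (simp add: II_def)
      moreover have "(Q ^. 2) pdivides x" if "Q \<in> S" for Q using iffs[OF that FM(1)] MS_sq[OF iF(2) that] iF(3) by blast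
      moreover have "\<not> Q pdivides x" if "Q \<in> S'" for Q using iffs'[OF that FM(1)] MS_nd[OF iF(2), of Q] that iF(3) by blast
      ultimately show "x \<in> {F \<in> MS S S' N. (P ^. c) pdivides F}" using MS_I by blast
    qed
    show "{F \<in> MS S S' N. (P ^. c) pdivides F} \<subseteq> (\<lambda>(i,F). P ^. i *. F) ` ?D"
    proof
      fix x assume x: "x \<in> {F \<in> MS S S' N. (P ^. c) pdivides F}"
      then have xM: "x \<in> M" "deg x = N" using MS_M MS_Mn Mn_deg by blast+
      obtain i F where iF: "F \<in> M" "x = P ^. i *. F" "\<not> P pdivides F" using prime_decomp[OF xM(1) P(1)] by metis
      have dN: "i * deg P + deg F = N" using xM(2) iF PM by simp
      then have "F \<in> Mn (N - i * deg P)" using Mn_deg[OF iF(1)] by simp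
      moreover have "c \<le> i" using x pow_dvd_iff[OF P(1) iF(1,3), of c i] iF(2) by simp
      moreover have "(Q ^. 2) pdivides F" if "Q \<in> S" for Q using iffs[OF that iF(1)] MS_sq[of x S S' N, OF _ that] x iF(2) by blast
      moreover have "\<not> Q pdivides F" if "Q \<in> insert P S'" for Q using iffs'[OF _ iF(1)] MS_nd[of x S S' N Q] that x iF(2,3) by blast
      ultimately have "F \<in> MS S (insert P S') (N - i * deg P)" "i \<in> II c P N" using dN MS_I[of F "N - i * deg P" S "insert P S'"] by (simp_all add: II_def)
      then have "(i,F) \<in> ?D" by (rule SigmaI[rotated])
      then show "x \<in> (\<lambda>(i,F). P ^. i *. F) ` ?D" using iF(2) by (intro image_eqI[of _ _ "(i,F)"]) (simp only: prod.case)
    qed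
  qed
qed

lemma MS_split_sum:
  fixes \<phi> :: "'a list \<Rightarrow> 'b::comm_monoid_add"
  assumes P: "P \<in> \<P>" "P \<notin> S" "P \<notin> S'" and S: "S \<subseteq> \<P>" "S' \<subseteq> \<P>"
  shows "(\<Sum>F | F \<in> MS S S' N \<and> (P ^. c) pdivides F. \<phi> F) = 
    (\<Sum>i\<in>II c P N. \<Sum>F\<in>MS S (insert P S') (N - i * deg P). \<phi> (P ^. i *. F))"
proof -
  have "(\<Sum>F | F \<in> MS S S' N \<and> (P ^. c) pdivides F. \<phi> F) = 
    (\<Sum>z\<in>(SIGMA i:II c P N. MS S (insert P S') (N - i * deg P)). \<phi> (case z of (i,F) \<Rightarrow> P ^. i *. F))"
    by (rule sum.reindex_bij_betw[OF MS_split_bij[OF assms], symmetric])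
  also have "\<dots> = (\<Sum>i\<in>II c P N. \<Sum>F\<in>MS S (insert P S') (N - i * deg P). \<phi> (P ^. i *. F))"
    unfolding sum.Sigma[OF finite_II[OF P(1)] ballI[OF finite_MS]] by (rule sum.cong[OF refl]) (simp only: split_paired_all prod.case)
  finally show ?thesis .
qed
lemma MS_split_0: "P \<in> \<P> \<Longrightarrow> {F. F \<in> MS S S' N \<and> (P ^. (0::nat)) pdivides F} = MS S S' N"
  using MS_M by auto
lemma MS_split_2: "{F. F \<in> MS S S' N \<and> (P ^. (2::nat)) pdivides F} = MS (insert P S) S' N"
  by (auto simp: MS_def)

end

context cubic_field begin

definition AY :: "'a list set \<Rightarrow> 'a list set \<Rightarrow> 'a list \<Rightarrow> nat \<Rightarrow> complex" where
  "AY S S' k N = (\<Sum>F\<in>MS S S' N. GS k F)"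
definition aY :: "'a list set \<Rightarrow> 'a list \<Rightarrow> nat \<Rightarrow> real" where
  "aY S' k N = (\<Sum>F\<in>MS {} S' N. norm (GS k F))"

lemma GS_prime_split:
  assumes "P \<in> \<P>" "F \<in> M" "\<not> P pdivides F" "k \<in> C"
  shows "GS k (P ^. i *. F) = GS k (P ^. i) * GS (k *. P ^. i) F"
proof -
  have "cop F P" using bezout_prime[of P F] assms by simp
  then have "cop (P ^. i) F" using cop_pow cop_symI by blast
  then show ?thesis using assms by (intro GS_mult) simp_all
qed
lemma GS_unit_pow:
  assumes "P \<in> \<P>" "F \<in> M" "\<not> P pdivides F" "k \<in> C"
  shows "GS (k *. P ^. i) F = cnj (chi F P) ^ i * GS k F" "norm (chi F P) = 1" "chi F P ^ 3 = 1"
proof -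
  have "cop F P" using bezout_prime[of P F] assms by simp
  then have c: "cop P F" by (rule cop_symI)
  show "norm (chi F P) = 1" "chi F P ^ 3 = 1" using chi_norm[OF assms(2) c] chi_cube[OF assms(2) c] by auto
  show "GS (k *. P ^. i) F = cnj (chi F P) ^ i * GS k F"
  proof (induct i)
    case (Suc i)
    have "k *. P ^. Suc i = P *. (k *. P ^. i)" using assms by (simp add: UP.m_ac)
    then show ?case using GS_scale[OF assms(2) _ c, of "k *. P ^. i"] assms Suc by (simp del: UP.nat_pow_Suc)
  qed (use assms in simp)
qed

lemma AY_split:
  assumes P: "P \<in> \<P>" "P \<notin> S" "P \<notin> S'" and S: "S \<subseteq> \<P>" "S' \<subseteq> \<P>" and k: "k \<in> C"
  shows "(\<Sum>F | F \<in> MS S S' N \<and> (P ^. c) pdivides F. GS k F) = 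
    (\<Sum>i\<in>II c P N. GS k (P ^. i) * AY S (insert P S') (k *. P ^. i) (N - i * deg P))"
  unfolding MS_split_sum[OF P S] AY_def sum_distrib_left
proof (intro sum.cong refl)
  fix i F assume "F \<in> MS S (insert P S') (N - i * deg P)"
  then have "F \<in> M" "\<not> P pdivides F" using MS_M MS_nd by blast+
  then show "GS k (P ^. i *. F) = GS k (P ^. i) * GS (k *. P ^. i) F" using GS_prime_split P k by blast
qed
lemma AY_split0:
  assumes P: "P \<in> \<P>" "P \<notin> S" "P \<notin> S'" and S: "S \<subseteq> \<P>" "S' \<subseteq> \<P>" and k: "k \<in> C"
  shows "AY S S' k N = (\<Sum>i\<in>II 0 P N. GS k (P ^. i) * AY S (insert P S') (k *. P ^. i) (N - i * deg P))"
  using AY_split[OF assms, of N 0] MS_split_0[OF P(1), of S S' N] by (simp only: AY_def)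
lemma AY_split2:
  assumes P: "P \<in> \<P>" "P \<notin> S" "P \<notin> S'" and S: "S \<subseteq> \<P>" "S' \<subseteq> \<P>" and k: "k \<in> C"
  shows "AY (insert P S) S' k N = (\<Sum>i\<in>II 2 P N. GS k (P ^. i) * AY S (insert P S') (k *. P ^. i) (N - i * deg P))"
  using AY_split[OF assms, of N 2] MS_split_2[of S S' N P] by (simp only: AY_def)
text \<open>For F prime to \<open>P\<close>, scaling the frequency by \<open>P\<close> multiplies
  the Gauss sum by a cube root of unity.\<close>

lemma AY_reduce:
  assumes P: "P \<in> \<P>" "P \<in> S'" and k: "k \<in> C" shows "AY S S' (k *. P ^. i) N = AY S S' (k *. P ^. (i mod 3)) N"
  unfolding AY_def
proof (rule sum.cong[OF refl])
  fix F assume "F \<in> MS S S' N"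
  then have F: "F \<in> M" "\<not> P pdivides F" using MS_M MS_nd P(2) by blast+
  note g = GS_unit_pow[OF P(1) F k]
  have "cnj (chi F P) ^ i = cnj (chi F P) ^ (3 * (i div 3) + i mod 3)" by simp
  also have "\<dots> = cnj (chi F P) ^ (i mod 3)" unfolding power_add power_mult using g(3) by (simp flip: complex_cnj_power)
  finally show "GS (k *. P ^. i) F = GS (k *. P ^. (i mod 3)) F" using g(1) by simp
qed
lemma aY_split:
  assumes P: "P \<in> \<P>" "P \<notin> S'" and S: "S' \<subseteq> \<P>" and k: "k \<in> C"
  shows "aY S' k N = (\<Sum>i\<in>II 0 P N. norm (GS k (P ^. i)) * aY (insert P S') k (N - i * deg P))"
proof -
  have "aY S' k N = (\<Sum>i\<in>II 0 P N. \<Sum>F\<in>MS {} (insert P S') (N - i * deg P). norm (GS k (P ^. i *. F)))"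
    using MS_split_sum[of P "{}" S' "\<lambda>F. norm (GS k F)" N 0] MS_split_0[OF P(1), of "{}" S' N] P S by (simp add: aY_def del: UP.nat_pow_0)
  also have "\<dots> = (\<Sum>i\<in>II 0 P N. norm (GS k (P ^. i)) * aY (insert P S') k (N - i * deg P))"
    unfolding aY_def sum_distrib_left
  proof (intro sum.cong refl)
    fix i F assume "F \<in> MS {} (insert P S') (N - i * deg P)"
    then have F: "F \<in> M" "\<not> P pdivides F" using MS_M MS_nd by blast+
    show "norm (GS k (P ^. i *. F)) = norm (GS k (P ^. i)) * norm (GS k F)"
      using GS_prime_split[OF P(1) F k] GS_unit_pow[OF P(1) F k] by (simp add: norm_mult norm_power)
  qed
  finally show ?thesis .
qed

section \<open>Gauss sums modulo prime powers, and the trivial bound\<close>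

lemma GS_one: "k \<in> C \<Longrightarrow> GS k \<one>\<^sub>P = 1"
  by (simp add: GS_def chi_one)
text \<open>With \<open>P ^. j\<close> exactly dividing the frequency, the Gauss sum modulo
  \<open>P ^. i\<close> can be nonzero only for i = j + 1 and for the multiples i of 3 up to j. This
  lemma and the next three record the cases.\<close>

lemma GS_pp_big:
  assumes P: "P \<in> \<P>" and k: "k0 \<in> M" "\<not> P pdivides k0" and i: "j + 1 < i"
  shows "GS (P ^. j *. k0) (P ^. i) = 0"
proof -
  obtain l where l: "i = Suc l" "j < l" using i by (cases i) auto
  show ?thesis unfolding l using pow_dvd_iff[OF P k, of l j] l P k by (intro GS_prime_power_zero) simp_all
qed
lemma GS_pp_top:
  assumes P: "P \<in> \<P>" and k: "k0 \<in> M" "\<not> P pdivides k0"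
  shows "norm (GS (P ^. j *. k0) (P ^. Suc j)) \<le> q powr ((real j + 1/2) * deg P)"
proof -
  have "norm (GS (P ^. j *. k0) (P ^. Suc j)) = q ^ (j * deg P) * norm (Hs P (Suc j) k0)"
    using GS_prime_power_mul[OF P, of k0 j] k by (simp add: norm_mult norm_power)
  also have "\<dots> \<le> q ^ (j * deg P) * sqrt (q ^ deg P)"
    using Hs_norm[OF P, of k0 j] k q_gt1 by (intro mult_left_mono) simp_all
  also have "\<dots> = q powr (j * deg P) * q powr (deg P / 2)"
    using q_gt1 by (simp add: powr_realpow powr_half_sqrt[symmetric] powr_powr flip: powr_realpow)
  also have "\<dots> = q powr ((real j + 1/2) * deg P)" by (simp add: powr_add[symmetric] algebra_simps)
  finally show ?thesis .
qed
lemma GS_pp_mid: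
  assumes P: "P \<in> \<P>" and k: "k0 \<in> M" and i: "i \<le> j" "i mod 3 \<noteq> 0"
  shows "GS (P ^. j *. k0) (P ^. i) = 0"
proof (rule GS_dvd_zero)
  have PM: "P \<in> M" "P \<in> C" using P by auto
  show "P ^. i \<noteq> h ^. 3" if h: "h \<in> M" for h
  proof
    assume e: "P ^. i = h ^. 3"
    have "pe P (P ^. i) = i" using pe_eq[OF P one_M prime_not_dvd_one[OF P], of i] PM by simp
    moreover have "pe P (h ^. 3) = 3 * pe P h" using h pe_mul[OF P] by (simp add: numeral_3_eq_3)
    ultimately have "i = 3 * pe P h" using e by metis
    then show False using i(2) by (metis mod_mult_self1_is_0)
  qed
  have "P ^. j = P ^. i *. P ^. (j - i)" using PM i by (simp add: UP.nat_pow_mult)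
  then show "(P ^. i) pdivides (P ^. j *. k0)" using PM k by (intro dvdI[of "P ^. (j - i) *. k0"]) (simp_all add: UP.m_assoc)
qed (use P k in simp_all)
lemma GS_pp_trivial:
  assumes P: "P \<in> \<P>" and k: "k \<in> C" shows "norm (GS k (P ^. i)) \<le> q powr (i * deg P)"
  using GS_trivial[of "P ^. i" k] assms q_gt1 powr_realpow[of q "i * deg P"] by simp

text \<open>For frequency 1 the Gauss sums modulo higher powers of a prime vanish, and a simple
  prime contributes at most the square root of its norm.\<close>

lemma GS_1_norm: "F \<in> M \<Longrightarrow> norm (GS \<one>\<^sub>P F) \<le> q powr (deg F / 2)"
proof (induct "deg F" arbitrary: F rule: less_induct)
  case less
  show ?case
  proof (cases "F = \<one>\<^sub>P")
    case True then show ?thesis using q_gt1 by (simp add: GS_one)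
  next
    case False
    then obtain P where P: "P \<in> \<P>" "P pdivides F" using ex_prime_dvd less by blast
    obtain e g where g: "g \<in> M" "F = P ^. e *. g" "\<not> P pdivides g" using prime_decomp[OF less(2) P(1)] by metis
    have e0: "e \<noteq> 0" using P g by (intro notI) simp
    have dF: "deg F = e * deg P + deg g" using g P by simp
    have dg: "deg g < deg F" using dF e0 deg_prime_pos[OF P(1)] by simp
    have "GS \<one>\<^sub>P F = GS \<one>\<^sub>P (P ^. e) * GS (\<one>\<^sub>P *. P ^. e) g" unfolding g(2) by (rule GS_prime_split[OF P(1) g(1,3)]) simp
    then have n: "norm (GS \<one>\<^sub>P F) = norm (GS \<one>\<^sub>P (P ^. e)) * norm (GS \<one>\<^sub>P g)" 
      using GS_unit_pow[OF P(1) g(1,3), of "\<one>\<^sub>P"] by (simp add: norm_mult norm_power)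
    have "norm (GS \<one>\<^sub>P (P ^. e)) \<le> q powr (e * deg P / 2)"
    proof (cases "e = 1")
      case True
      then show ?thesis using GS_pp_top[OF P(1) one_M prime_not_dvd_one[OF P(1)], of 0] P by simp
    next
      case False
      then show ?thesis using GS_pp_big[OF P(1) one_M prime_not_dvd_one[OF P(1)], of 0 e] e0 P by simp
    qed
    then have "norm (GS \<one>\<^sub>P F) \<le> q powr (e * deg P / 2) * q powr (deg g / 2)"
      unfolding n using less(1)[OF dg g(1)] by (intro mult_mono) simp_all
    also have "\<dots> = q powr (deg F / 2)" by (simp add: dF powr_add[symmetric] add_divide_distrib)
    finally show ?thesis .
  qed
qed

lemma q_powr_pow: "(q powr a) ^ n = q powr (a * n)" using q_gt1 by (simp add: powr_power mult.commute)

lemma q_half: "q powr (-1/2) \<le> 1/2"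
proof -
  have "q powr (-1/2) \<le> 4 powr (-1/2)" using q_ge7 by (intro powr_mono2') simp_all
  also have "\<dots> = (1/2::real)" using powr_half_sqrt[of 4] by (simp add: powr_minus_divide real_sqrt_unique)
  finally show ?thesis .
qed

lemma q_powr_le: "a \<le> b \<Longrightarrow> q powr a \<le> q powr b" using q_gt1 by simp

lemma geom_le:
  fixes z :: real assumes "0 \<le> z" "z \<le> 1/2" shows "(\<Sum>i | i \<le> N \<and> c \<le> i. z ^ i) \<le> 2 * z ^ c"
proof -
  have "(\<Sum>i | i \<le> N \<and> c \<le> i. z ^ i) \<le> (\<Sum>i\<in>{c..<c + Suc N}. z ^ i)" using assms by (intro sum_mono2) auto
  also have "\<dots> = z ^ c * (\<Sum>i<Suc N. z ^ i)"
    using sum.shift_bounds_nat_ivl[of "\<lambda>i. z ^ i" 0 c "Suc N"]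
    by (simp only: add_0 add.commute[of c] sum_distrib_left power_add lessThan_atLeast0 mult.commute)
  also have "\<dots> \<le> z ^ c * 2"
  proof -
    have "(\<Sum>i<Suc N. z ^ i) \<le> (\<Sum>i. z ^ i)" using assms by (intro sum_le_suminf summable_geometric) auto
    also have "\<dots> = 1 / (1 - z)" using assms by (intro suminf_geometric) simp
    also have "\<dots> \<le> 2" using assms by (simp add: divide_le_eq)
    finally show ?thesis using assms by (intro mult_left_mono) simp_all
  qed
  finally show ?thesis by simp
qed

text \<open>Counting all monic polynomials of degree n instead of primes gives a geometric series of
  ratio q^(-1/2). The bound 1 makes products over the primes of a frequency uniform in that
  frequency.\<close>

lemma sum_primes_le:
  assumes Q: "finite Qs" "Qs \<subseteq> \<P>"
  shows "(\<Sum>P\<in>Qs. q powr (- 3/2 * deg P)) \<le> 1"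
proof -
  obtain L where L: "\<And>P. P \<in> Qs \<Longrightarrow> deg P \<le> L" using finite_nat_set_iff_bounded_le[of "deg ` Qs"] Q by blast
  have "(\<Sum>P\<in>Qs. q powr (- 3/2 * deg P)) \<le> (\<Sum>P\<in>(\<Union>n\<in>{i. i \<le> L \<and> 1 \<le> i}. Mn n). q powr (- 3/2 * deg P))"
  proof (rule sum_mono2)
    show "finite (\<Union>n\<in>{i. i \<le> L \<and> 1 \<le> i}. Mn n)" by simp
    show "Qs \<subseteq> (\<Union>n\<in>{i. i \<le> L \<and> 1 \<le> i}. Mn n)"
    proof
      fix P assume P: "P \<in> Qs"
      then have "P \<in> \<P>" using Q by blast
      then have "P \<in> Mn (deg P)" "1 \<le> deg P" using deg_prime[of P] Mn_deg_self[of P] prime_M[of P] by simp_all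
      moreover have "deg P \<in> {i. i \<le> L \<and> 1 \<le> i}" using L[OF P] calculation(2) by simp
      ultimately show "P \<in> (\<Union>n\<in>{i. i \<le> L \<and> 1 \<le> i}. Mn n)" by (intro UN_I)
    qed
  qed simp
  also have "\<dots> = (\<Sum>n | n \<le> L \<and> 1 \<le> n. \<Sum>P\<in>Mn n. q powr (- 3/2 * deg P))"
  proof (rule sum.UNION_disjoint)
    show "\<forall>i\<in>{i. i \<le> L \<and> 1 \<le> i}. \<forall>j\<in>{i. i \<le> L \<and> 1 \<le> i}. i \<noteq> j \<longrightarrow> Mn i \<inter> Mn j = {}"
      using Mn_disjoint by simp
  qed simp_all
  also have "\<dots> = (\<Sum>n | n \<le> L \<and> 1 \<le> n. (q powr (-1/2)) ^ n)"
  proof (rule sum.cong[OF refl])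
    fix n
    have "(\<Sum>P\<in>Mn n. q powr (- 3/2 * deg P)) = (\<Sum>P\<in>Mn n. q powr (- 3/2 * n))"
      by (intro sum.cong refl) (simp add: Mn_deg_eq)
    also have "\<dots> = q powr n * q powr (- 3/2 * n)" using q_gt1 by (simp add: powr_realpow card_Mn)
    also have "\<dots> = q powr (-1/2 * n)" by (simp add: powr_add[symmetric])
    also have "\<dots> = (q powr (-1/2)) ^ n" by (simp only: q_powr_pow)
    finally show "(\<Sum>P\<in>Mn n. q powr (- 3/2 * deg P)) = (q powr (-1/2)) ^ n" .
  qed
  also have "\<dots> \<le> 2 * (q powr (-1/2)) ^ 1" using q_half by (intro geom_le) simp_all
  also have "\<dots> \<le> 1" using q_half by simp
  finally show ?thesis .
qed

text \<open>Only primes dividing \<open>k\<close> get a weight: for the others the term \<open>i = 1\<close> would be as large as \<open>q\<^bsup>-deg P\<^esup>\<close>, which is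
  not summable.\<close>

lemma local_weight:
  assumes P: "P \<in> \<P>" and k: "k \<in> M" "P pdivides k"
  shows "(\<Sum>i\<in>II 0 P N. norm (GS k (P ^. i)) * q powr (-3/2 * (i * deg P))) \<le> 1 + 4 * q powr (- 3/2 * deg P)"
proof -
  \<comment> \<open>\<open>z ^ 3\<close> is the weight in the claim. A multiple i of 3 up to j
    contributes at most z^i by the trivial bound, and i = j + 1 at most z^(j+2), which is at most
    z^3 because j >= 1.\<close>
  define z where "z = q powr (-1/2 * deg P)"
  note q = q_gt1
  have zpow: "z ^ n = q powr (- (n / 2) * deg P)" for n by (simp only: z_def q_powr_pow) (simp add: mult_ac)
  have z: "0 \<le> z" "z \<le> 1/2"
  proof -
    have "z \<le> q powr (-1/2)" unfolding z_def using deg_prime[OF P] by (intro q_powr_le) simp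
    then show "z \<le> 1/2" using q_half by linarith
  qed (simp add: z_def)
  obtain j k0 where jk: "k0 \<in> M" "k = P ^. j *. k0" "\<not> P pdivides k0" using prime_decomp[OF k(1) P] by metis
  have j: "1 \<le> j" using jk k(2) by (cases j) simp_all
  have t: "norm (GS k (P ^. i)) * q powr (-3/2 * (i * deg P)) \<le> (if i = 0 then 1 else 0) + (if 3 \<le> i then z ^ i else 0) + (if i = j + 1 then z ^ 3 else 0)" for i
  proof -
    consider "i = 0" | "j + 1 < i" | "i = j + 1" | "1 \<le> i" "i \<le> j" "i mod 3 \<noteq> 0" | "3 \<le> i" "i mod 3 = 0" "i \<le> j"
    proof -
      have "i mod 3 = 0 \<Longrightarrow> i = 0 \<or> 3 \<le> i" by presburger
      then show thesis using that j by linarith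
    qed
    then show ?thesis
    proof cases
      case 1 then show ?thesis using k q by (simp add: GS_one Mn_C)
    next
      case 2 then show ?thesis using GS_pp_big[OF P jk(1,3) 2] z by (simp add: jk(2))
    next
      case 3
      have "norm (GS k (P ^. i)) * q powr (-3/2 * (i * deg P)) \<le> q powr ((real j + 1/2) * deg P) * q powr (-3/2 * (i * deg P))"
        using GS_pp_top[OF P jk(1,3), of j] 3 by (intro mult_right_mono) (simp_all add: jk(2) del: UP.nat_pow_Suc)
      also have "\<dots> = q powr (- (real j / 2 + 1) * deg P)" by (simp add: powr_add[symmetric] 3 algebra_simps)
      also have "\<dots> \<le> q powr (- (3 / 2) * deg P)" using j by (intro q_powr_le mult_right_mono) simp_all
      also have "\<dots> = z ^ 3" by (simp add: zpow)
      finally have A: "norm (GS k (P ^. i)) * q powr (-3/2 * (i * deg P)) \<le> z ^ 3" .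
      have e: "(if i = j + 1 then z ^ 3 else 0) = z ^ 3" using 3 by (rule if_P)
      have "0 \<le> (if i = 0 then 1 else 0 :: real)" "0 \<le> (if 3 \<le> i then z ^ i else 0)" using z by simp_all
      then show ?thesis unfolding e using A by linarith
    next
      case 4 then show ?thesis using GS_pp_mid[OF P jk(1) 4(2,3)] z by (simp add: jk(2))
    next
      case 5
      have "norm (GS k (P ^. i)) * q powr (-3/2 * (i * deg P)) \<le> q powr (i * deg P) * q powr (-3/2 * (i * deg P))"
        using GS_pp_trivial[OF P, of k i] k by (intro mult_right_mono) simp_all
      also have "\<dots> = z ^ i" by (simp add: powr_add[symmetric] zpow)
      finally show ?thesis using 5 z by simp
    qed
  qed
  have "(\<Sum>i\<in>II 0 P N. norm (GS k (P ^. i)) * q powr (-3/2 * (i * deg P)))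
     \<le> (\<Sum>i\<in>{..N}. norm (GS k (P ^. i)) * q powr (-3/2 * (i * deg P)))"
  proof (rule sum_mono2)
    show "II 0 P N \<subseteq> {..N}" by (rule II_subset[OF P])
  qed simp_all
  also have "\<dots> \<le> (\<Sum>i\<in>{..N}. (if i = 0 then 1 else 0) + (if 3 \<le> i then z ^ i else 0) + (if i = j + 1 then z ^ 3 else 0))"
    by (intro sum_mono t)
  also have "\<dots> = (\<Sum>i\<in>{..N}. if i = 0 then 1 else 0) + (\<Sum>i | i \<le> N \<and> 3 \<le> i. z ^ i) + (\<Sum>i\<in>{..N}. if i = j + 1 then z ^ 3 else 0)"
    by (simp only: sum.distrib sum.inter_filter[OF finite_atMost, symmetric] atMost_iff mem_Collect_eq conj_commute)
  also have "\<dots> \<le> 1 + 2 * z ^ 3 + z ^ 3" using geom_le[OF z, of N 3] z by (intro add_mono) (simp_all)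
  also have "\<dots> \<le> 1 + 4 * z ^ 3" using z by simp
  finally show ?thesis by (simp add: zpow)
qed

text \<open>Induction over the primes of \<open>k\<close> not yet in \<open>S'\<close>. Once all of
  them are split off, F is prime to \<open>k\<close>, and its Gauss sum has the absolute value of
  that with frequency 1.\<close>

lemma aY_bound:
  assumes k: "k \<in> M" and "finite Qs"
  shows "Qs \<subseteq> pd k \<Longrightarrow> S' \<subseteq> \<P> \<Longrightarrow> pd k \<subseteq> Qs \<union> S' \<Longrightarrow> Qs \<inter> S' = {} \<Longrightarrow>
    aY S' k N \<le> (\<Prod>P\<in>Qs. 1 + 4 * q powr (- 3/2 * deg P)) * q powr (3/2 * N)"
  using assms(2)
proof (induct Qs arbitrary: S' N)
  case empty
  have "norm (GS k F) \<le> q powr (N / 2)" if F: "F \<in> MS {} S' N" for F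
  proof -
    have FM: "F \<in> M" "deg F = N" using F MS_M MS_deg by blast+
    have "cop k F"
    proof (subst cop_iff_primes)
      show "\<forall>P\<in>\<P>. P pdivides F \<longrightarrow> \<not> P pdivides k" using F empty MS_nd unfolding pd_def by blast
    qed (use k FM in simp_all)
    then have "norm (GS (k *. \<one>\<^sub>P) F) = norm (GS \<one>\<^sub>P F)"
      using GS_scale[OF FM(1) _ \<open>cop k F\<close>, of "\<one>\<^sub>P"] chi_norm[OF FM(1) \<open>cop k F\<close>] k by (simp add: norm_mult del: UP.r_one)
    then show ?thesis using GS_1_norm[OF FM(1)] FM k by simp
  qed
  then have "aY S' k N \<le> (\<Sum>F\<in>MS {} S' N. q powr (N / 2))" unfolding aY_def by (rule sum_mono)
  also have "\<dots> = card (MS {} S' N) * q powr (N / 2)" by simp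
  also have "\<dots> \<le> q powr N * q powr (N / 2)"
  proof (rule mult_right_mono)
    have "card (MS {} S' N) \<le> card (Mn N)" by (rule card_mono[OF _ subsetI], simp, rule MS_Mn)
    then have "card (MS {} S' N) \<le> qn ^ N" by (simp add: card_Mn)
    then have "real (card (MS {} S' N)) \<le> real (qn ^ N)" by (simp only: of_nat_le_iff)
    then show "real (card (MS {} S' N)) \<le> q powr N" using q_gt1 by (simp add: powr_realpow)
  qed simp
  also have "\<dots> = q powr (3/2 * N)" by (simp add: powr_add[symmetric])
  finally show ?case by simp
next
  case (insert P Qs)
  have P: "P \<in> \<P>" "P pdivides k" "P \<notin> S'" using insert(4,7) unfolding pd_def by blast+
  let ?W = "\<Prod>P\<in>Qs. 1 + 4 * q powr (- 3/2 * deg P)"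
  have W: "0 \<le> ?W" by (intro prod_nonneg) simp
  have "aY S' k N = (\<Sum>i\<in>II 0 P N. norm (GS k (P ^. i)) * aY (insert P S') k (N - i * deg P))"
    by (rule aY_split[OF P(1,3) insert(5)]) (use k in simp)
  also have "\<dots> \<le> (\<Sum>i\<in>II 0 P N. (norm (GS k (P ^. i)) * q powr (-3/2 * (i * deg P))) * (?W * q powr (3/2 * N)))"
  proof (rule sum_mono)
    fix i assume i: "i \<in> II 0 P N"
    have "aY (insert P S') k (N - i * deg P) \<le> ?W * q powr (3/2 * (N - i * deg P))"
      using insert(2,4-7) P by (intro insert(3)) blast+
    also have "\<dots> = q powr (-3/2 * (i * deg P)) * (?W * q powr (3/2 * N))"
      using i by (simp add: II_def of_nat_diff powr_add[symmetric] right_diff_distrib powr_diff powr_minus_divide flip: of_nat_mult)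
    finally show "norm (GS k (P ^. i)) * aY (insert P S') k (N - i * deg P) \<le> (norm (GS k (P ^. i)) * q powr (-3/2 * (i * deg P))) * (?W * q powr (3/2 * N))"
      by (simp only: mult.assoc) (rule mult_left_mono, simp_all)
  qed
  also have "\<dots> \<le> (1 + 4 * q powr (- 3/2 * deg P)) * (?W * q powr (3/2 * N))"
    unfolding sum_distrib_right[symmetric] using W by (intro mult_right_mono local_weight P k mult_nonneg_nonneg) simp_all
  also have "\<dots> = (\<Prod>P\<in>insert P Qs. 1 + 4 * q powr (- 3/2 * deg P)) * q powr (3/2 * N)"
    using insert by simp
  finally show ?case .
qed

text \<open>Square-root size for each of the q^N moduli; the local factors at the primes of
  \<open>k\<close> multiply to at most exp 4 by \<open>sum_primes_le\<close>.\<close>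

lemma A_trivial:
  assumes k: "k \<in> M" shows "norm (AY {} {} k N) \<le> exp 4 * q powr (3/2 * N)"
proof -
  have "norm (AY {} {} k N) \<le> aY {} k N" unfolding AY_def aY_def by (rule norm_sum)
  also have "\<dots> \<le> (\<Prod>P\<in>pd k. 1 + 4 * q powr (- 3/2 * deg P)) * q powr (3/2 * N)"
    using k finite_pd[OF k] by (intro aY_bound) simp_all
  also have "\<dots> \<le> exp 4 * q powr (3/2 * N)"
  proof (rule mult_right_mono)
    have "(\<Prod>P\<in>pd k. 1 + 4 * q powr (- 3/2 * deg P)) \<le> (\<Prod>P\<in>pd k. exp (4 * q powr (- 3/2 * deg P)))"
      by (intro prod_mono conjI exp_ge_add_one_self) simp
    also have "\<dots> = exp (4 * (\<Sum>P\<in>pd k. q powr (- 3/2 * deg P)))" using finite_pd[OF k] by (simp add: exp_sum sum_distrib_left)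
    also have "\<dots> \<le> exp 4" using sum_primes_le[OF finite_pd[OF k] pd_subset] by simp
    finally show "(\<Prod>P\<in>pd k. 1 + 4 * q powr (- 3/2 * deg P)) \<le> exp 4" .
  qed simp
  finally show ?thesis .
qed

section \<open>The functional equation\<close>

text \<open>\<open>vv u F a\<close> is \<open>e(u a'/F)\<close> with \<open>a'\<close> the inverse of \<open>a\<close> modulo \<open>F\<close>.\<close>

definition iv :: "'a list \<Rightarrow> 'a list \<Rightarrow> 'a list" where "iv F a = (SOME b. b \<in> C \<and> F pdivides (a *. b -. \<one>\<^sub>P))"
definition vv :: "'a list \<Rightarrow> 'a list \<Rightarrow> 'a list \<Rightarrow> complex" where "vv u F a = ee (u *. iv F a) F"

lemma cop_inv_dvd:
  assumes "a \<in> C" "F \<in> C" "x \<in> C" "y \<in> C" "a *. x +. F *. y = \<one>\<^sub>P" shows "F pdivides (a *. x -. \<one>\<^sub>P)"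
proof -
  have "a *. x -. (a *. x +. F *. y) = F *. (-. y)" using assms(1-4) by algebra
  then show ?thesis using assms by (intro dvdI[of "-. y"]) simp_all
qed
lemma iv: assumes "cop a F" shows "iv F a \<in> C" "F pdivides (a *. iv F a -. \<one>\<^sub>P)"
proof -
  obtain x y where "a \<in> C" "F \<in> C" "x \<in> C" "y \<in> C" "a *. x +. F *. y = \<one>\<^sub>P" using assms by (rule copE)
  then have "x \<in> C \<and> F pdivides (a *. x -. \<one>\<^sub>P)" using cop_inv_dvd by simp
  then have "iv F a \<in> C \<and> F pdivides (a *. iv F a -. \<one>\<^sub>P)" unfolding iv_def by (rule someI)
  then show "iv F a \<in> C" "F pdivides (a *. iv F a -. \<one>\<^sub>P)" by simp_all
qed
lemma inv_cop: assumes F: "F \<in> C" "a \<in> C" "b \<in> C" and d: "F pdivides (a *. b -. \<one>\<^sub>P)" shows "cop b F"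
proof -
  obtain y where y: "y \<in> C" "a *. b -. \<one>\<^sub>P = F *. y" using d unfolding dvd_iff by blast
  have "b *. a +. F *. (-. y) = a *. b -. F *. y" using y F by algebra
  also have "\<dots> = a *. b -. (a *. b -. \<one>\<^sub>P)" by (simp only: y)
  also have "\<dots> = \<one>\<^sub>P" using F by algebra
  finally show ?thesis using y F by (intro copI[of _ _ a "-. y"]) simp_all
qed
lemma inv_unique:
  assumes F: "F \<in> C" "a \<in> C" "b \<in> C" "b' \<in> C" and d: "F pdivides (a *. b -. \<one>\<^sub>P)" "F pdivides (a *. b' -. \<one>\<^sub>P)"
  shows "F pdivides (b -. b')"
proof -
  have "(a *. b -. \<one>\<^sub>P) -. (a *. b' -. \<one>\<^sub>P) = a *. (b -. b')" using F by algebra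
  then have e: "F pdivides (a *. (b -. b'))" using dvd_subI[OF F(1) d] by simp
  have "b *. a -. \<one>\<^sub>P = a *. b -. \<one>\<^sub>P" using F by algebra
  then have "cop a F" using inv_cop[OF F(1,3,2)] d by simp
  then have "cop F a" by (rule cop_symI)
  then show ?thesis using cop_dvd_mul[of F a "b -. b'"] e F by simp
qed
lemma vv_eq:
  assumes F: "F \<in> C" "F \<noteq> []" and u: "u \<in> C" and a: "cop a F" and b: "b \<in> C" "F pdivides (a *. b -. \<one>\<^sub>P)"
  shows "vv u F a = ee (u *. b) F"
proof -
  note i = iv[OF a] and aC = cop_C(1)[OF a]
  have "F pdivides (iv F a -. b)" by (rule inv_unique[OF F(1) aC i(1) b(1) i(2) b(2)])
  then have "F pdivides (u *. (iv F a -. b))" using F u i b by (intro dvd_mulI(2)) simp_all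
  moreover have "u *. (iv F a -. b) = u *. iv F a -. u *. b" using u i b by algebra
  ultimately show ?thesis unfolding vv_def using F u i b by (intro ee_cong) simp_all
qed
lemma vv_cong:
  assumes F: "F \<in> C" "F \<noteq> []" and u: "u \<in> C" and a: "cop a F" and b: "b \<in> C" "F pdivides (a -. b)"
  shows "vv u F a = vv u F b"
proof -
  have cb: "cop b F" by (rule cop_cong[OF a b])
  note i = iv[OF cb] and aC = cop_C(1)[OF a]
  have "F pdivides ((a -. b) *. iv F b +. (b *. iv F b -. \<one>\<^sub>P))"
    using F aC b i by (intro dvd_addI dvd_mulI(1)) simp_all
  moreover have "(a -. b) *. iv F b +. (b *. iv F b -. \<one>\<^sub>P) = a *. iv F b -. \<one>\<^sub>P" using aC b i by algebra
  ultimately show ?thesis using vv_eq[OF F u a i(1)] by (simp add: vv_def)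
qed
lemma vv_norm: "F \<in> C \<Longrightarrow> F \<noteq> [] \<Longrightarrow> u \<in> C \<Longrightarrow> cop a F \<Longrightarrow> norm (vv u F a) = 1"
  unfolding vv_def using iv(1) by (intro ee_norm) simp_all
lemma vv_neg: "F \<in> C \<Longrightarrow> F \<noteq> [] \<Longrightarrow> u \<in> C \<Longrightarrow> cop a F \<Longrightarrow> vv (-. u) F a = cnj (vv u F a)"
  unfolding vv_def using iv(1)[of a F] ee_neg[of "u *. iv F a" F] by (simp add: UP.l_minus)
lemma vv_scale:
  assumes F: "F \<in> C" "F \<noteq> []" and u: "u \<in> C" and c: "c \<in> Fs" and a: "cop a F"
  shows "vv u F ([c] *. a) = vv ([inv c] *. u) F a"
proof -
  note i = iv[OF a] and aC = cop_C(1)[OF a]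
  have c': "inv c \<in> Fs" by (rule inv_Fs[OF c])
  have cc: "[c] \<in> C" "[inv c] \<in> C" using const_Fs c c' by blast+
  have one: "[c] *. [inv c] = \<one>\<^sub>P" using c c' inv_nz[of c] by (simp add: const_mul pone_eq)
  have "cop ([c] *. a) F" using c F a by (intro cop_mul cop_const) simp_all
  moreover have "([c] *. a) *. ([inv c] *. iv F a) = ([c] *. [inv c]) *. (a *. iv F a)" using cc aC i by algebra
  then have "F pdivides (([c] *. a) *. ([inv c] *. iv F a) -. \<one>\<^sub>P)" using i aC by (simp add: one)
  ultimately have "vv u F ([c] *. a) = ee (u *. ([inv c] *. iv F a)) F" using cc i by (intro vv_eq F u) simp_all
  moreover have "u *. ([inv c] *. iv F a) = ([inv c] *. u) *. iv F a" using cc u i by algebra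
  ultimately show ?thesis by (simp add: vv_def)
qed

text \<open>Divide a x + F y = 1 by a F and multiply by u: x is an inverse of \<open>a\<close>
  modulo \<open>F\<close>, and y one of \<open>F\<close> modulo \<open>a\<close>.\<close>

lemma vv_recip:
  assumes F: "F \<in> M" "a \<in> M" and u: "u \<in> C" and c: "cop a F"
  shows "vv u F a * vv u a F = ee u (a *. F)"
proof -
  obtain x y where xy: "a \<in> C" "F \<in> C" "x \<in> C" "y \<in> C" "a *. x +. F *. y = \<one>\<^sub>P" using c by (rule copE)
  have xy': "F *. y +. a *. x = \<one>\<^sub>P" using xy by (simp add: UP.a_comm)
  have "vv u F a = ee (u *. x) F" by (rule vv_eq[OF xy(2) _ u c xy(3) cop_inv_dvd[OF xy]]) (use F in simp)
  also have "\<dots> = ee ((u *. x) *. a) (F *. a)" using F u xy by (intro ee_cancel[symmetric]) simp_all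
  finally have 1: "vv u F a = ee ((u *. x) *. a) (a *. F)" using xy by (simp add: UP.m_comm)
  have "vv u a F = ee (u *. y) a" by (rule vv_eq[OF xy(1) _ u cop_symI[OF c] xy(4) cop_inv_dvd[OF xy(2,1,4,3) xy']]) (use F in simp)
  also have "\<dots> = ee ((u *. y) *. F) (a *. F)" using F u xy by (intro ee_cancel[symmetric]) simp_all
  finally have 2: "vv u a F = ee ((u *. y) *. F) (a *. F)" .
  have "(u *. x) *. a +. (u *. y) *. F = u *. (a *. x +. F *. y)" using u xy(1-4) by algebra
  also have "\<dots> = u" unfolding xy(5) using u by simp
  finally have e: "(u *. x) *. a +. (u *. y) *. F = u" .
  show ?thesis unfolding 1 2 using e ee_add[of "(u *. x) *. a" "(u *. y) *. F" "a *. F"] u xy F by simp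
qed

lemma chi_inv: assumes F: "F \<in> M" and a: "a \<in> C" "b \<in> C" "F pdivides (a *. b -. \<one>\<^sub>P)" shows "cnj (chi F b) = chi F a"
proof -
  have cb: "cop b F" using inv_cop[of F a b] F a by simp
  have "chi F a * chi F b = chi F (a *. b)" using chi_mult F a by simp
  also have "\<dots> = chi F \<one>\<^sub>P" using F a by (intro chi_cong) simp_all
  also have "\<dots> = 1" using chi_recip[OF F one_M] by (simp add: chi_one)
  finally have 1: "chi F a * chi F b = 1" .
  moreover have "chi F b * cnj (chi F b) = 1" using chi_norm[OF F cb] by (metis complex_norm_square of_real_1 power_one)
  ultimately show ?thesis by (metis mult.assoc mult.commute mult.right_neutral)
qed

text \<open>Inversion is an involution of the units modulo \<open>F\<close> and turns
  \<open>chi F\<close> into its conjugate.\<close>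

lemma GS_inv:
  assumes F: "F \<in> M" and u: "u \<in> C"
  shows "GS u F = (\<Sum>b\<in>Pl (deg F). cnj (chi F b) * vv u F b)"
proof -
  define U where "U = {a \<in> Pl (deg F). cop a F}"
  define w where "w a = iv F a pmod F" for a
  have FC: "F \<in> C" "F \<noteq> []" using F by simp_all
  have w: "w a \<in> U" "F pdivides (a *. w a -. \<one>\<^sub>P)" "F pdivides (w a *. a -. \<one>\<^sub>P)" if a: "a \<in> U" for a
  proof -
    have c: "cop a F" using a by (simp add: U_def)
    note i = iv[OF c] and aC = cop_C(1)[OF c]
    have wC: "w a \<in> C" using i F by (simp add: w_def)
    have "F pdivides (iv F a -. w a)" unfolding w_def by (rule pmod_cong_self[OF i(1) FC(1)])
    then have "F pdivides ((a *. iv F a -. \<one>\<^sub>P) -. a *. (iv F a -. w a))" using FC aC i wC by (intro dvd_subI[OF FC(1) i(2)] dvd_mulI(2)) simp_all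
    moreover have "(a *. iv F a -. \<one>\<^sub>P) -. a *. (iv F a -. w a) = a *. w a -. \<one>\<^sub>P" using aC i wC by algebra
    ultimately show 1: "F pdivides (a *. w a -. \<one>\<^sub>P)" by simp
    then show "F pdivides (w a *. a -. \<one>\<^sub>P)" using aC wC by (simp add: UP.m_comm)
    have "cop (w a) F" using inv_cop[OF FC(1) aC wC 1] .
    then show "w a \<in> U" using pmod_Pl[OF i(1) F] by (simp add: U_def w_def)
  qed
  have UC: "a \<in> C" "cop a F" "a \<in> Pl (deg F)" if "a \<in> U" for a using that cop_C by (auto simp: U_def)
  have ww: "w (w a) = a" if a: "a \<in> U" for a
  proof -
    note b = w(1)[OF a]
    have "F pdivides (w (w a) -. a)"
      by (rule inv_unique[OF FC(1) UC(1)[OF b] UC(1)[OF w(1)[OF b]] UC(1)[OF a] w(2)[OF b] w(3)[OF a]])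
    then show ?thesis by (rule Pl_cong_eq[OF F UC(3)[OF w(1)[OF b]] UC(3)[OF a]])
  qed
  have "GS u F = (\<Sum>a\<in>U. chi F a * ee (a *. u) F)"
    unfolding GS_def
  proof (rule sum.mono_neutral_right)
    show "\<forall>a\<in>Pl (deg F) - U. chi F a * ee (a *. u) F = 0"
    proof
      fix a assume "a \<in> Pl (deg F) - U"
      then have "a \<in> C" "\<not> cop a F" by (auto simp: U_def)
      then show "chi F a * ee (a *. u) F = 0" using chi_zero[OF F, of a] by simp
    qed
  qed (auto simp: U_def)
  also have "\<dots> = (\<Sum>b\<in>U. cnj (chi F b) * vv u F b)"
  proof (rule sum.reindex_bij_witness[of _ w w])
    fix a assume a: "a \<in> U"
    show "w (w a) = a" by (rule ww[OF a])
    show "w (w a) = a" by (rule ww[OF a])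
    show "w a \<in> U" by (rule w(1)[OF a])
    show "w a \<in> U" by (rule w(1)[OF a])
    note b = w(1)[OF a]
    have "cnj (chi F (w a)) = chi F a" by (rule chi_inv[OF F UC(1)[OF a] UC(1)[OF b] w(2)[OF a]])
    moreover have "vv u F (w a) = ee (u *. a) F" by (rule vv_eq[OF FC u UC(2)[OF b] UC(1)[OF a] w(3)[OF a]])
    ultimately show "cnj (chi F (w a)) * vv u F (w a) = chi F a * ee (a *. u) F"
      using u UC(1)[OF a] by (simp add: UP.m_comm)
  qed
  also have "\<dots> = (\<Sum>b\<in>Pl (deg F). cnj (chi F b) * vv u F b)"
  proof (rule sum.mono_neutral_left)
    show "\<forall>a\<in>Pl (deg F) - U. cnj (chi F a) * vv u F a = 0"
    proof
      fix a assume "a \<in> Pl (deg F) - U"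
      then have "a \<in> C" "\<not> cop a F" by (auto simp: U_def)
      then show "cnj (chi F a) * vv u F a = 0" using chi_zero[OF F, of a] by simp
    qed
  qed (auto simp: U_def)
  finally show ?thesis .
qed

text \<open>The sum over F that remains for a fixed monic representative \<open>a\<close> of a
  class, after \<open>vv_recip\<close> has traded the inverse of \<open>a\<close> modulo F for the
  inverse of F modulo \<open>a\<close>.\<close>

definition EE :: "'a list \<Rightarrow> 'a list \<Rightarrow> nat \<Rightarrow> complex" where
  "EE u a N = (\<Sum>F\<in>Mn N. cnj (chi a F) * cnj (vv u a F) * ee u (a *. F))"

text \<open>Once \<open>ee u (a *. F)\<close> is constant, the rest is periodic in F modulo
  \<open>a\<close>, and by \<open>GS_inv\<close> a full period is again a Gauss sum.\<close>

lemma EE_complete: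
  assumes a: "a \<in> Mn j" and u: "u \<in> C" and N: "j \<le> N" and z: "\<And>F. F \<in> Mn N \<Longrightarrow> ee u (a *. F) = z"
  shows "EE u a N = z * of_nat qn ^ (N - j) * GS (-. u) a"
proof -
  have aM: "a \<in> M" "deg a = j" "a \<in> C" "a \<noteq> []" using a Mn_M[OF a] by (simp_all add: Mn_deg_eq)
  have eq: "cnj (chi a F) * cnj (vv u a F) = cnj (chi a F) * vv (-. u) a F" if "F \<in> C" for F
  proof (cases "cop F a")
    case True then show ?thesis using vv_neg[OF aM(3,4) u True] by simp
  next
    case False then show ?thesis using chi_zero[OF aM(1) that] by simp
  qed
  have per: "periodic a (\<lambda>F. cnj (chi a F) * vv (-. u) a F)"
    unfolding periodic_def
  proof (intro ballI impI)
    fix F F' assume F: "F \<in> C" "F' \<in> C" "a pdivides (F -. F')"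
    have "chi a F = chi a F'" by (rule chi_cong[OF aM(1) F])
    moreover have "vv (-. u) a F = vv (-. u) a F'" if "cop F a" using vv_cong[OF aM(3,4) _ that F(2,3), of "-. u"] u by simp
    ultimately show "cnj (chi a F) * vv (-. u) a F = cnj (chi a F') * vv (-. u) a F'"
      using chi_zero[OF aM(1) F(1)] by (cases "cop F a") simp_all
  qed
  have "EE u a N = z * (\<Sum>F\<in>Mn N. cnj (chi a F) * vv (-. u) a F)"
    unfolding EE_def sum_distrib_left
  proof (rule sum.cong[OF refl])
    fix F assume F: "F \<in> Mn N"
    show "cnj (chi a F) * cnj (vv u a F) * ee u (a *. F) = z * (cnj (chi a F) * vv (-. u) a F)"
      unfolding eq[OF Mn_C[OF F]] z[OF F] by (rule mult.commute)
  qed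
  also have "(\<Sum>F\<in>Mn N. cnj (chi a F) * vv (-. u) a F) = of_nat (qn ^ (N - j)) * GS (-. u) a"
    using sum_Mn_periodic[OF aM(1) per, of N] GS_inv[OF aM(1), of "-. u"] N u aM by simp
  finally show ?thesis by simp
qed

text \<open>Replacing \<open>F\<close> by \<open>F + h a\<close> with \<open>deg h = 2N - 1 - deg u\<close> multiplies every summand by \<open>\<psi>\<close> of a constant,
  because \<open>u/(aF) - u/(a(F + ha)) = uh/(F(F + ha))\<close>.\<close>

lemma EE_zero:
  assumes a: "a \<in> Mn j" and u: "u \<in> C" "length u = Suc K" and N: "K + 1 \<le> 2 * N" "j + N < K + 1"
  shows "EE u a N = 0"
proof -
  \<comment> \<open>With this degree of h the product \<open>u *. h\<close> has length 2 N, the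
    degree of the product of two moduli, so that \<open>ee\<close> reads its leading coefficient.
    The condition j + N < K + 1 keeps \<open>h *. a\<close> below degree N.\<close>
  define t where "t = 2 * N - 1 - K"
  have aM: "a \<in> M" "deg a = j" "a \<in> C" "a \<noteq> []" using a Mn_M[OF a] by (simp_all add: Mn_deg_eq)
  have une: "u \<noteq> []" using u by auto
  have hu: "hd u \<in> Fs" using u une by simp
  obtain x where x: "x \<in> Fs" "\<psi> (x \<otimes> hd u) \<noteq> 1" using psi_scale_nontriv[OF hu] by blast
  define h where "h = [x] *. X ^. t"
  have hC: "h \<in> C" "h \<noteq> []" "length h = Suc t" "hd h = x"
    using x const_Fs[OF x(1)] Xpow_length[of t] M_hd[OF Xpow_M, of t] M_C[OF Xpow_M, of t] M_ne[OF Xpow_M, of t] by (simp_all add: h_def hd_const_mul)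
  define w where "w = h *. a"
  have wC: "w \<in> C" using hC aM by (simp add: w_def)
  have wl: "length w \<le> N" using length_mul[OF hC(1) aM(3) hC(2) aM(4)] M_len[OF aM(1)] hC aM(2) N by (simp add: w_def t_def)
  have sh: "F +. w \<in> Mn N" "F -. w \<in> Mn N" if F: "F \<in> Mn N" for F
  proof -
    have FM: "F \<in> M" "F \<in> C" "length F = Suc N" using Mn_M[OF F] M_len[OF Mn_M[OF F]] by (simp_all add: Mn_deg_eq[OF F])
    have *: "F +. v \<in> Mn N" if v: "v \<in> C" "length v \<le> N" for v
    proof -
      have l: "length (F +. v) = Suc N" "hd (F +. v) = \<one>" using length_add_eq[OF FM(2) v(1)] hd_add_eq[OF FM(2) v(1)] v FM by simp_all
      have "F +. v \<noteq> []" using l(1) by auto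
      then have "F +. v \<in> M" using l FM v by (intro M_I) simp_all
      moreover then have "deg (F +. v) = N" using M_len[of "F +. v"] l by simp
      ultimately show ?thesis using Mn_deg by simp
    qed
    show "F +. w \<in> Mn N" by (rule *[OF wC wl])
    show "F -. w \<in> Mn N" unfolding UP.minus_eq using wC wl by (intro *) simp_all
  qed
  define f where "f F = cnj (chi a F) * cnj (vv u a F) * ee u (a *. F)" for F
  define z where "z = \<psi> (x \<otimes> hd u)"
  have f: "f F = f (F +. w) * z" if F: "F \<in> Mn N" for F
  proof -
    define F' where "F' = F +. w"
    have F': "F' \<in> Mn N" using sh[OF F] by (simp add: F'_def)
    note FM = Mn_M[OF F] Mn_M[OF F'] Mn_C[OF F] Mn_C[OF F'] Mn_deg_eq[OF F] Mn_deg_eq[OF F']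
    have "F -. F' = a *. (-. h)" unfolding F'_def w_def using FM hC aM by algebra
    then have d: "a pdivides (F -. F')" using hC by (intro dvdI[of "-. h"]) simp_all
    have c: "cnj (chi a F) * cnj (vv u a F) = cnj (chi a F') * cnj (vv u a F')"
    proof (cases "cop F a")
      case True
      then show ?thesis using vv_cong[OF aM(3,4) u(1) True FM(4) d] chi_cong[OF aM(1) FM(3,4) d] by simp
    next
      case False
      then show ?thesis using chi_zero[OF aM(1) FM(3)] chi_cong[OF aM(1) FM(3,4) d] by simp
    qed
    have 1: "ee u (a *. F) = ee (u *. F') (a *. F *. F')" using u aM FM by (intro ee_cancel[symmetric]) simp_all
    have "ee u (a *. F') = ee (u *. F) (a *. F' *. F)" using u aM FM by (intro ee_cancel[symmetric]) simp_all
    also have "a *. F' *. F = a *. F *. F'" using aM FM(3,4) by algebra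
    finally have 2: "ee u (a *. F') = ee (u *. F) (a *. F *. F')" .
    have "u *. F' = u *. F +. (u *. h) *. a" unfolding F'_def w_def using u(1) aM(3) FM(3) hC(1) by algebra
    then have 3: "ee (u *. F') (a *. F *. F') = ee (u *. F) (a *. F *. F') * ee ((u *. h) *. a) (a *. F *. F')"
      using ee_add[of "u *. F" "(u *. h) *. a" "a *. F *. F'"] u hC aM FM by simp
    have "a *. F *. F' = (F *. F') *. a" using aM FM(3,4) by algebra
    then have "ee ((u *. h) *. a) (a *. F *. F') = ee (u *. h) (F *. F')" using ee_cancel[of "u *. h" "F *. F'" a] u hC aM FM by simp
    also have "\<dots> = \<psi> (hd (u *. h) \<otimes> inv (hd (F *. F')))"
    proof (rule ee_top)
      have "length (u *. h) = 2 * N" using length_mul[OF u(1) hC(1) une hC(2)] u(2) hC(3) N by (simp add: t_def)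
      then show "length (u *. h) = deg (F *. F')" using FM by simp
    qed (use u une hC FM in simp_all)
    also have "\<dots> = z" using hd_mul[OF u(1) hC(1) une hC(2)] hC(4) FM x hu by (simp add: z_def m_comm)
    finally show ?thesis unfolding f_def F'_def[symmetric] c using 1 2 3 by simp
  qed
  have "(\<Sum>F\<in>Mn N. f F) = (\<Sum>F\<in>Mn N. f (F +. w) * z)" using f by (rule sum.cong[OF refl])
  also have "\<dots> = (\<Sum>F\<in>Mn N. f F * z)"
  proof (rule sum.reindex_bij_witness[of _ "\<lambda>F. F -. w" "\<lambda>F. F +. w"])
    fix F assume F: "F \<in> Mn N"
    show "F +. w -. w = F" "F -. w +. w = F" using Mn_C[OF F] wC by algebra+
    show "F +. w \<in> Mn N" "F -. w \<in> Mn N" using sh[OF F] by blast+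
  qed simp
  finally have "(\<Sum>F\<in>Mn N. f F) * (1 - z) = 0" by (simp only: sum_distrib_right[symmetric] right_diff_distrib) simp
  moreover have "z \<noteq> 1" using x by (simp add: z_def)
  ultimately have "(\<Sum>F\<in>Mn N. f F) = 0" by simp
  then show ?thesis by (simp add: EE_def f_def)
qed

abbreviation "AA k N \<equiv> AY {} {} k N"

lemma AA_eq: "AA k N = (\<Sum>F\<in>Mn N. GS k F)" by (simp add: AY_def MS_def)

lemma not_cop_nil: "F \<in> M \<Longrightarrow> 0 < deg F \<Longrightarrow> \<not> cop [] F"
proof
  assume F: "F \<in> M" "0 < deg F" and "cop [] F"
  then obtain x y where xy: "x \<in> C" "y \<in> C" "[] *. x +. F *. y = \<one>\<^sub>P" by (auto elim: copE)
  then have "F pdivides \<one>\<^sub>P" using F by (intro dvdI[of y]) simp_all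
  then show False using dvd_length(1)[of F "\<one>\<^sub>P"] F M_len[of F] by simp
qed

text \<open>Every nonzero residue is \<open>[c] *. a\<close> with \<open>a\<close> monic of degree j
  < N. Reciprocity exchanges the roles of \<open>a\<close> and F in the character, and F becomes the
  inner variable.\<close>

lemma AA_expand:
  assumes k: "k \<in> M" and N: "1 \<le> N"
  shows "AA k N = (\<Sum>j<N. \<Sum>c\<in>Fs. cnj (om c) ^ N * (\<Sum>a\<in>Mn j. EE ([inv c] *. k) a N))"
proof -
  have kC: "k \<in> C" using k by simp
  have trm: "cnj (chi F ([c] *. a)) * vv k F ([c] *. a) =
     cnj (om c) ^ N * (cnj (chi a F) * cnj (vv ([inv c] *. k) a F) * ee ([inv c] *. k) (a *. F))"
    if F: "F \<in> Mn N" and a: "a \<in> Mn j" and c: "c \<in> Fs" for F a c j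
  proof (cases "cop a F")
    case True
    note FM = Mn_M[OF F] Mn_M[OF a] Mn_C[OF F] Mn_C[OF a] Mn_deg_eq[OF F]
    have cC: "[c] \<in> C" "[inv c] \<in> C" using const_Fs[OF c] const_Fs[OF inv_Fs[OF c]] by blast+
    define u where "u = [inv c] *. k"
    have uC: "u \<in> C" using cC kC by (simp add: u_def)
    have "cop F a" using True by (rule cop_symI)
    then have n: "vv u a F * cnj (vv u a F) = 1" using vv_norm[of a u F] FM uC by (metis M_ne complex_norm_square of_real_1 power_one)
    have "vv u F a = (vv u F a * vv u a F) * cnj (vv u a F)" using n by (simp add: mult.assoc)
    also have "\<dots> = ee u (a *. F) * cnj (vv u a F)" using vv_recip[OF FM(1,2) uC True] by simp
    finally have v: "vv u F a = ee u (a *. F) * cnj (vv u a F)" .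
    have "vv k F ([c] *. a) = vv u F a" unfolding u_def using FM by (intro vv_scale kC c True) simp_all
    moreover have "chi F ([c] *. a) = om c ^ N * chi a F"
      using chi_mult[OF FM(1) cC(1) FM(4)] chi_const[OF FM(1) c] chi_recip[OF FM(1,2)] FM(5) by simp
    ultimately show ?thesis unfolding u_def[symmetric] v by simp
  next
    case False
    note FM = Mn_M[OF F] Mn_M[OF a] Mn_C[OF F] Mn_C[OF a] Mn_deg_eq[OF F]
    have cC: "[c] \<in> C" using const_Fs[OF c] .
    have "chi F a = 0" using chi_zero[OF FM(1,4)] False by simp
    then show ?thesis using chi_mult[OF FM(1) cC FM(4)] chi_recip[OF FM(1,2)] by simp
  qed
  have "AA k N = (\<Sum>F\<in>Mn N. \<Sum>j<N. \<Sum>a\<in>Mn j. \<Sum>c\<in>Fs. cnj (om c) ^ N * (cnj (chi a F) * cnj (vv ([inv c] *. k) a F) * ee ([inv c] *. k) (a *. F)))"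
    unfolding AA_eq
  proof (rule sum.cong[OF refl])
    fix F assume F: "F \<in> Mn N"
    note FM = Mn_M[OF F] Mn_deg_eq[OF F]
    have "chi F [] = 0" using chi_zero[OF FM(1), of "[]"] not_cop_nil[OF FM(1)] FM N by simp
    then have "GS k F = (\<Sum>j<N. \<Sum>a\<in>Mn j. \<Sum>c\<in>Fs. cnj (chi F ([c] *. a)) * vv k F ([c] *. a))"
      unfolding GS_inv[OF FM(1) kC] FM(2) sum_Pl_monic by simp
    also have "\<dots> = (\<Sum>j<N. \<Sum>a\<in>Mn j. \<Sum>c\<in>Fs. cnj (om c) ^ N * (cnj (chi a F) * cnj (vv ([inv c] *. k) a F) * ee ([inv c] *. k) (a *. F)))"
      by (intro sum.cong refl trm[OF F])
    finally show "GS k F = \<dots>" .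
  qed
  also have "\<dots> = (\<Sum>j<N. \<Sum>a\<in>Mn j. \<Sum>c\<in>Fs. \<Sum>F\<in>Mn N. cnj (om c) ^ N * (cnj (chi a F) * cnj (vv ([inv c] *. k) a F) * ee ([inv c] *. k) (a *. F)))"
    by (simp only: sum.swap[of _ _ "Mn N"])
  also have "\<dots> = (\<Sum>j<N. \<Sum>a\<in>Mn j. \<Sum>c\<in>Fs. cnj (om c) ^ N * EE ([inv c] *. k) a N)"
    by (simp only: EE_def sum_distrib_left)
  also have "\<dots> = (\<Sum>j<N. \<Sum>c\<in>Fs. cnj (om c) ^ N * (\<Sum>a\<in>Mn j. EE ([inv c] *. k) a N))"
    by (rule sum.cong[OF refl], subst sum.swap) (simp only: sum_distrib_left)
  finally show ?thesis .
qed

text \<open>The cases compare the degree j + N of \<open>a *. F\<close> with deg k + 1: the factor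
  \<open>ee\<close> is 1, or \<open>\<psi>\<close> of a constant, or it oscillates and the sum over
  F vanishes by \<open>EE_zero\<close>.\<close>

definition cf :: "nat \<Rightarrow> nat \<Rightarrow> nat \<Rightarrow> complex" where
  "cf K N j = (if K + 1 < j + N then sgn0 (N - j)
     else if j + N = K + 1 then (\<Sum>c\<in>Fs. cnj (om c) ^ N * \<psi> (inv c) * om c ^ j) else 0)"

text \<open>The inner sums are evaluated by \<open>EE_complete\<close> and \<open>EE_zero\<close>.
  The condition deg k + 1 <= 2 N says that the shift h in \<open>EE_zero\<close> has nonnegative
  degree.\<close>

lemma functional_equation:
  assumes k: "k \<in> M" and N: "1 \<le> N" "deg k + 1 \<le> 2 * N"
  shows "AA k N = (\<Sum>j<N. cf (deg k) N j * of_nat qn ^ (N - j) * AA k j)"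
  unfolding AA_expand[OF k N(1)]
proof (rule sum.cong[OF refl])
  fix j assume j: "j \<in> {..<N}"
  have kl: "k \<in> C" "k \<noteq> []" "length k = Suc (deg k)" "hd k = \<one>" using k M_len[OF k] by simp_all
  have u: "[inv c] *. k \<in> C" "[inv c] *. k \<noteq> []" "length ([inv c] *. k) = Suc (deg k)" "hd ([inv c] *. k) = inv c" 
    if c: "c \<in> Fs" for c 
    using inv_Fs[OF c] const_Fs[OF inv_Fs[OF c]] kl by (simp_all add: hd_const_mul)
  have GSu: "GS (-. ([inv c] *. k)) a = om c ^ j * GS k a" if c: "c \<in> Fs" and a: "a \<in> Mn j" for c a
  proof -
    have ic: "inv c \<in> Fs" "\<ominus> (inv c) \<in> Fs" "[inv c] \<in> C" using inv_Fs[OF c] neg_Fs const_Fs by blast+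
    have "-. [inv c] = [\<ominus> (inv c)]" using ic by (simp add: univ_poly_a_inv_def'[OF carrier_is_subring])
    then have "-. ([inv c] *. k) = [\<ominus> (inv c)] *. k" using ic(3) kl by (simp add: UP.l_minus[symmetric])
    moreover have "GS ([\<ominus> (inv c)] *. k) a = cnj (om (\<ominus> (inv c))) ^ j * GS k a" 
      using GS_const[OF Mn_M[OF a] kl(1) ic(2)] by (simp add: Mn_deg_eq[OF a])
    moreover have "cnj (om (\<ominus> (inv c))) = om c" using om_neg[OF ic(1)] om_inv[OF c] by simp
    ultimately show ?thesis by simp
  qed
  have dl: "deg (a *. F) = j + N" "a *. F \<in> C" "a *. F \<noteq> []" "hd (a *. F) = \<one>" if "a \<in> Mn j" "F \<in> Mn N" for a F
    using Mn_M[OF that(1)] Mn_M[OF that(2)] by (simp_all add: Mn_deg_eq[OF that(1)] Mn_deg_eq[OF that(2)])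
  consider "deg k + 1 < j + N" | "j + N = deg k + 1" | "j + N < deg k + 1" by linarith
  then show "(\<Sum>c\<in>Fs. cnj (om c) ^ N * (\<Sum>a\<in>Mn j. EE ([inv c] *. k) a N)) = cf (deg k) N j * of_nat qn ^ (N - j) * AA k j"
  proof cases
    case 1
    have E: "EE ([inv c] *. k) a N = om c ^ j * (of_nat qn ^ (N - j) * GS k a)" if c: "c \<in> Fs" and a: "a \<in> Mn j" for c a
    proof -
      have "EE ([inv c] *. k) a N = 1 * of_nat qn ^ (N - j) * GS (-. ([inv c] *. k)) a"
        using u[OF c] dl[OF a] 1 j by (intro EE_complete[OF a] ee_small) simp_all
      then show ?thesis by (simp add: GSu[OF c a])
    qed
    have o: "cnj (om c) ^ N * om c ^ j = cnj (om c) ^ (N - j)" if c: "c \<in> Fs" for c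
    proof -
      have "cnj (om c) * om c = 1" using om_norm[OF c] by (metis complex_norm_square mult.commute of_real_1 power_one)
      then have "(cnj (om c) * om c) ^ j = 1" by simp
      moreover have "cnj (om c) ^ N = cnj (om c) ^ (N - j) * cnj (om c) ^ j" using j by (simp flip: power_add)
      ultimately show ?thesis by (simp add: power_mult_distrib mult.assoc)
    qed
    have "(\<Sum>c\<in>Fs. cnj (om c) ^ N * (\<Sum>a\<in>Mn j. EE ([inv c] *. k) a N)) = (\<Sum>c\<in>Fs. cnj (om c) ^ N * (om c ^ j * (of_nat qn ^ (N - j) * AA k j)))"
      unfolding AA_eq sum_distrib_left by (intro sum.cong refl arg_cong[of _ _ "\<lambda>x. _ * x"] E)
    also have "\<dots> = (\<Sum>c\<in>Fs. cnj (om c) ^ (N - j)) * (of_nat qn ^ (N - j) * AA k j)"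
      unfolding sum_distrib_right by (intro sum.cong refl) (simp only: mult.assoc[symmetric] o)
    finally show ?thesis using 1 by (simp add: cf_def sum_cnj_om_pow)
  next
    case 2
    have E: "EE ([inv c] *. k) a N = \<psi> (inv c) * om c ^ j * (of_nat qn ^ (N - j) * GS k a)" if c: "c \<in> Fs" and a: "a \<in> Mn j" for c a
    proof -
      have "EE ([inv c] *. k) a N = \<psi> (inv c) * of_nat qn ^ (N - j) * GS (-. ([inv c] *. k)) a"
      proof (rule EE_complete[OF a u(1)[OF c]])
        fix F assume F: "F \<in> Mn N"
        have "ee ([inv c] *. k) (a *. F) = \<psi> (hd ([inv c] *. k) \<otimes> inv (hd (a *. F)))" 
          using u[OF c] dl[OF a F] 2 by (intro ee_top) simp_all
        then show "ee ([inv c] *. k) (a *. F) = \<psi> (inv c)" using u(4)[OF c] dl(4)[OF a F] inv_Fs[OF c] by simp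
      qed (use j in simp)
      then show ?thesis by (simp add: GSu[OF c a])
    qed
    have "(\<Sum>c\<in>Fs. cnj (om c) ^ N * (\<Sum>a\<in>Mn j. EE ([inv c] *. k) a N)) = (\<Sum>c\<in>Fs. cnj (om c) ^ N * (\<psi> (inv c) * om c ^ j * (of_nat qn ^ (N - j) * AA k j)))"
      unfolding AA_eq sum_distrib_left by (intro sum.cong refl arg_cong[of _ _ "\<lambda>x. _ * x"] E)
    also have "\<dots> = (\<Sum>c\<in>Fs. cnj (om c) ^ N * \<psi> (inv c) * om c ^ j) * (of_nat qn ^ (N - j) * AA k j)"
      unfolding sum_distrib_right by (intro sum.cong refl) (simp only: mult.assoc)
    finally show ?thesis using 2 by (simp add: cf_def)
  next
    case 3
    have "EE ([inv c] *. k) a N = 0" if c: "c \<in> Fs" and a: "a \<in> Mn j" for c a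
      using u[OF c] N(2) 3 by (intro EE_zero[OF a]) simp_all
    then show ?thesis using 3 by (simp add: cf_def)
  qed
qed

end

text \<open>17 is 1 + 16: the trivial bound at the start of the recursion, and the reserve for its
  accumulated errors in \<open>BB_ind\<close>.\<close>

definition C1 :: real where "C1 = 17 * exp 4"
lemma C1_pos: "0 < C1" "1 \<le> C1"
proof -
  show "0 < C1" by (simp add: C1_def)
  have "1 \<le> exp (4::real)" by simp
  then show "1 \<le> C1" unfolding C1_def by linarith
qed

section \<open>The recursion in N and its solution\<close>

context cubic_field begin

lemma cf_norm: "norm (cf K N j) \<le> q"
proof -
  have "norm (\<Sum>c\<in>Fs. cnj (om c) ^ N * \<psi> (inv c) * om c ^ j) \<le> (\<Sum>c\<in>Fs. 1)"
  proof (rule sum_norm_le)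
    fix c assume c: "c \<in> Fs"
    have "norm (\<psi> (inv c)) = 1" using inv_Fs[OF c] by (intro psi_norm) simp
    then show "norm (cnj (om c) ^ N * \<psi> (inv c) * om c ^ j) \<le> 1" using om_norm[OF c] by (simp add: norm_mult norm_power)
  qed
  also have "\<dots> \<le> q" by (simp add: card_Fs)
  finally have "norm (\<Sum>c\<in>Fs. cnj (om c) ^ N * \<psi> (inv c) * om c ^ j) \<le> q" .
  then show ?thesis using sgn0_norm[of "N - j"] by (simp add: cf_def)
qed

text \<open>The coefficient \<open>cf\<close> agrees with \<open>sgn0 (N - j)\<close> except for \<open>j \<le> deg k + 1 - N\<close>, so \<open>DD\<close> involves only short sums.\<close>

definition BB :: "'a list \<Rightarrow> nat \<Rightarrow> complex" where "BB k N = AA k N / of_nat qn ^ N"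
definition DD :: "'a list \<Rightarrow> nat \<Rightarrow> complex" where "DD k N = BB k N - (\<Sum>j<N. sgn0 (N - j) * BB k j)"

lemma BB_trivial: "k \<in> M \<Longrightarrow> norm (BB k N) \<le> exp 4 * q powr (N / 2)"
proof -
  assume k: "k \<in> M"
  have "norm (BB k N) = norm (AA k N) / q powr N" using q_gt1 by (simp add: BB_def norm_divide norm_power powr_realpow)
  also have "\<dots> \<le> exp 4 * q powr (3/2 * N) / q powr N" using A_trivial[OF k] by (intro divide_right_mono) simp_all
  also have "\<dots> = exp 4 * (q powr (3/2 * N) / q powr N)" by simp
  also have "\<dots> = exp 4 * q powr (N / 2)" unfolding powr_diff[symmetric] by simp
  finally show ?thesis .
qed

lemma DD_eq:
  assumes k: "k \<in> M" and N: "1 \<le> N" "deg k + 1 \<le> 2 * N"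
  shows "DD k N = (\<Sum>j<N. (cf (deg k) N j - sgn0 (N - j)) * BB k j)"
proof -
  have q: "complex_of_nat qn \<noteq> 0" using q_gt1 by simp
  have "BB k N = (\<Sum>j<N. cf (deg k) N j * BB k j)"
    unfolding BB_def[of k N] functional_equation[OF assms] sum_divide_distrib
  proof (rule sum.cong[OF refl])
    fix j assume "j \<in> {..<N}"
    then have "complex_of_nat qn ^ N = of_nat qn ^ (N - j) * of_nat qn ^ j" by (simp flip: power_add)
    then show "cf (deg k) N j * of_nat qn ^ (N - j) * AA k j / of_nat qn ^ N = cf (deg k) N j * BB k j" using q by (simp add: BB_def)
  qed
  then show ?thesis by (simp add: DD_def left_diff_distrib sum_subtractf)
qed

text \<open>Only the j up to J = deg k + 1 - N survive. Their coefficients are at most 2 q, the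
  terms at most exp 4 q^(j/2), and summing the geometric series costs another factor 2.\<close>

lemma DD_norm:
  assumes k: "k \<in> M" and N: "1 \<le> N" "deg k + 1 \<le> 2 * N"
  shows "norm (DD k N) \<le> 4 * exp 4 * q powr ((real (deg k) + 3 - N) / 2)"
proof (cases "N \<le> deg k + 1")
  case True
  define J where "J = deg k + 1 - N"
  have q1: "1 \<le> q" using q_gt1 by simp
  have "norm (DD k N) \<le> (\<Sum>j<N. if j \<le> J then 2 * q * (exp 4 * q powr (j / 2)) else 0)"
    unfolding DD_eq[OF assms]
  proof (rule sum_norm_le)
    fix j assume j: "j \<in> {..<N}"
    show "norm ((cf (deg k) N j - sgn0 (N - j)) * BB k j) \<le> (if j \<le> J then 2 * q * (exp 4 * q powr (j / 2)) else 0)"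
    proof (cases "j \<le> J")
      case True
      have "norm (cf (deg k) N j - sgn0 (N - j)) \<le> q + (q - 1)"
        by (rule order_trans[OF norm_triangle_ineq4 add_mono[OF cf_norm sgn0_norm]])
      then have "norm (cf (deg k) N j - sgn0 (N - j)) \<le> 2 * q" by linarith
      then have "norm (cf (deg k) N j - sgn0 (N - j)) * norm (BB k j) \<le> 2 * q * (exp 4 * q powr (j / 2))"
        using BB_trivial[OF k] by (intro mult_mono) simp_all
      then show ?thesis using True by (simp add: norm_mult)
    next
      case False
      then have "deg k + 1 < j + N" by (simp add: J_def)
      then show ?thesis using False by (simp add: cf_def)
    qed
  qed
  also have "\<dots> \<le> (\<Sum>j\<le>J. 2 * q * (exp 4 * q powr (j / 2)))"
  proof -
    have "(\<Sum>j<N. if j \<le> J then 2 * q * (exp 4 * q powr (j / 2)) else 0) = (\<Sum>j\<in>{j. j < N \<and> j \<le> J}. 2 * q * (exp 4 * q powr (j / 2)))"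
      by (simp add: sum.inter_filter[symmetric])
    also have "\<dots> \<le> (\<Sum>j\<le>J. 2 * q * (exp 4 * q powr (j / 2)))" by (rule sum_mono2) auto
    finally show ?thesis .
  qed
  also have "\<dots> = 2 * q * exp 4 * (\<Sum>j\<le>J. q powr (j / 2))" by (simp add: sum_distrib_left mult.assoc)
  also have "(\<Sum>j\<le>J. q powr (j / 2)) = (\<Sum>i\<le>J. q powr (J / 2) * (q powr (-1/2)) ^ i)"
  proof (rule sum.reindex_bij_witness[of _ "\<lambda>i. J - i" "\<lambda>i. J - i"])
    fix i assume "i \<in> {..J}"
    then show "q powr (J / 2) * (q powr (-1/2)) ^ (J - i) = q powr (i / 2)"
      unfolding q_powr_pow by (simp add: powr_add[symmetric] of_nat_diff field_simps)
  qed auto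
  also have "2 * q * exp 4 * \<dots> \<le> 2 * q * exp 4 * (q powr (J / 2) * 2)"
  proof -
    have "(\<Sum>i\<le>J. (q powr (-1/2)) ^ i) \<le> 2 * (q powr (-1/2)) ^ 0"
      using geom_le[of "q powr (-1/2)" J 0] q_half by (simp add: atMost_def)
    then show ?thesis unfolding sum_distrib_left[symmetric] using q1 by (intro mult_left_mono) simp_all
  qed
  also have "\<dots> = 4 * exp 4 * (q powr 1 * q powr (J / 2))" using q1 by simp
  also have "q powr 1 * q powr (J / 2) = q powr ((real (deg k) + 3 - N) / 2)" 
    unfolding powr_add[symmetric] using True by (simp add: J_def of_nat_diff field_simps)
  finally show ?thesis .
next
  case False
  have "DD k N = 0" unfolding DD_eq[OF assms] using False by (intro sum.neutral ballI) (simp add: cf_def)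
  then show ?thesis by simp
qed

text \<open>\<open>sgn0\<close> has period 3, so the sums in \<open>DD k (N + 3)\<close> and
  \<open>DD k N\<close> differ by the terms j = N, N + 1, N + 2, of which only j = N is nonzero,
  with weight q - 1.\<close>

lemma BB_step: "BB k (N + 3) = of_nat qn * BB k N + DD k (N + 3) - DD k N"
proof -
  have e: "N + 3 - N = 3" "N + 3 - Suc N = 2" "N + 3 - Suc (Suc N) = 1" "N + 3 = Suc (Suc (Suc N))" by arith+
  have s3: "(\<Sum>j<Suc (Suc (Suc N)). f j) = (\<Sum>j<N. f j) + f N + f (Suc N) + f (Suc (Suc N))" for f :: "nat \<Rightarrow> complex"
    by (simp only: sum.lessThan_Suc)
  have "(\<Sum>j<N+3. sgn0 (N + 3 - j) * BB k j) = (\<Sum>j<N. sgn0 (N + 3 - j) * BB k j) + sgn0 3 * BB k N + sgn0 2 * BB k (Suc N) + sgn0 1 * BB k (Suc (Suc N))"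
    using s3[of "\<lambda>j. sgn0 (N + 3 - j) * BB k j"] unfolding e(4)[symmetric] e(1-3) .
  also have "(\<Sum>j<N. sgn0 (N + 3 - j) * BB k j) = (\<Sum>j<N. sgn0 (N - j) * BB k j)"
  proof (rule sum.cong[OF refl])
    fix j assume "j \<in> {..<N}"
    then have "N + 3 - j = (N - j) + 3" by simp
    then have "(N + 3 - j) mod 3 = (N - j) mod 3" by (simp only: mod_add_self2)
    then show "sgn0 (N + 3 - j) * BB k j = sgn0 (N - j) * BB k j" by (simp add: sgn0_def)
  qed
  finally show ?thesis unfolding DD_def by (simp add: sgn0_def algebra_simps)
qed

text \<open>The second term on the left makes room for the errors \<open>DD\<close>, which decay by a factor \<open>q\<^bsup>5/2\<^esup>\<close> in each step.\<close>

lemma BB_ind: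
  assumes k: "k \<in> M"
  shows "1 \<le> N \<Longrightarrow> deg k + 1 \<le> 2 * N \<Longrightarrow>
    norm (BB k N) * q powr (- real N / 3) + 16 * exp 4 * q powr ((real (deg k) + 1) / 2 - 5 * real N / 6) \<le> 17 * exp 4 * q powr (deg k / 12 + 1/2)"
proof (induct N rule: less_induct)
  case (less N)
  define K where "K = real (deg k)"
  have K0: "0 \<le> K" by (simp add: K_def)
  show ?case
  proof (cases "2 * N \<le> deg k + 6")
    case True
    \<comment> \<open>The first three admissible N. Here q^(N/6), left by the trivial bound, is at
      most q^(deg k / 12 + 1/2); this is the origin of these exponents.\<close>
    then have N: "2 * real N \<le> K + 6" "K + 1 \<le> 2 * real N" using less by (simp_all add: K_def)
    have "norm (BB k N) * q powr (- real N / 3) \<le> exp 4 * q powr (N / 2) * q powr (- real N / 3)" using BB_trivial[OF k] by (intro mult_right_mono) simp_all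
    also have "\<dots> = exp 4 * q powr (N / 6)" by (simp add: powr_add[symmetric])
    also have "\<dots> \<le> exp 4 * q powr (K / 12 + 1/2)" using N by (intro mult_left_mono q_powr_le) simp_all
    finally have 1: "norm (BB k N) * q powr (- real N / 3) \<le> exp 4 * q powr (K / 12 + 1/2)" .
    have "(K + 1) / 2 - 5 * real N / 6 \<le> K / 12 + 1/2" using N by (simp add: field_simps)
    then have "16 * exp 4 * q powr ((K + 1) / 2 - 5 * real N / 6) \<le> 16 * exp 4 * q powr (K / 12 + 1/2)" by (intro mult_left_mono q_powr_le) simp_all
    then show ?thesis using 1 unfolding K_def by linarith
  next
    case False
    define L where "L = N - 3"
    have L: "N = L + 3" "L < N" "1 \<le> L" "deg k + 1 \<le> 2 * L" using False by (simp_all add: L_def)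
    have "norm (BB k N) \<le> norm (of_nat qn * BB k L + DD k N) + norm (DD k L)" unfolding L(1) BB_step by (rule norm_triangle_ineq4)
    also have "\<dots> \<le> q * norm (BB k L) + norm (DD k N) + norm (DD k L)" using norm_triangle_ineq[of "of_nat qn * BB k L" "DD k N"] by (simp add: norm_mult)
    also have "\<dots> \<le> q * norm (BB k L) + 4 * exp 4 * q powr ((K + 3 - N) / 2) + 4 * exp 4 * q powr ((K + 3 - L) / 2)"
      unfolding K_def using DD_norm[OF k, of N] DD_norm[OF k, of L] less L by (intro add_mono order_refl) simp_all
    also have "\<dots> \<le> q * norm (BB k L) + 8 * exp 4 * q powr ((K + 3 - L) / 2)"
    proof -
      have "q powr ((K + 3 - N) / 2) \<le> q powr ((K + 3 - L) / 2)" using L by (intro q_powr_le) simp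
      then have "4 * exp 4 * q powr ((K + 3 - N) / 2) \<le> 4 * exp 4 * q powr ((K + 3 - L) / 2)" by (intro mult_left_mono) simp_all
      then show ?thesis by linarith
    qed
    finally have "norm (BB k N) * q powr (- real N / 3) \<le> (q * norm (BB k L) + 8 * exp 4 * q powr ((K + 3 - L) / 2)) * q powr (- real N / 3)"
      by (rule mult_right_mono) simp
    also have "\<dots> = norm (BB k L) * (q powr 1 * q powr (- real N / 3)) + 8 * exp 4 * (q powr ((K + 3 - L) / 2) * q powr (- real N / 3))"
      using q_gt1 by (simp add: algebra_simps)
    also have "q powr 1 * q powr (- real N / 3) = q powr (- real L / 3)" unfolding powr_add[symmetric] by (simp add: L(1) diff_divide_distrib)
    also have "q powr ((K + 3 - L) / 2) * q powr (- real N / 3) = q powr ((K + 1) / 2 - 5 * real L / 6)"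
      unfolding powr_add[symmetric] by (rule arg_cong[of _ _ "\<lambda>x. q powr x"]) (simp add: L(1) field_simps)
    finally have 1: "norm (BB k N) * q powr (- real N / 3) \<le> norm (BB k L) * q powr (- real L / 3) + 8 * exp 4 * q powr ((K + 1) / 2 - 5 * real L / 6)" .
    have 2: "norm (BB k L) * q powr (- real L / 3) + 16 * exp 4 * q powr ((K + 1) / 2 - 5 * real L / 6) \<le> 17 * exp 4 * q powr (K / 12 + 1/2)"
      using less(1)[OF L(2-4)] unfolding K_def .
    \<comment> \<open>One step at least halves the reserve 16, which pays for the two errors of 4
      each.\<close>
    have "q powr ((K + 1) / 2 - 5 * real N / 6) = q powr (-5/2) * q powr ((K + 1) / 2 - 5 * real L / 6)"
      unfolding powr_add[symmetric] by (rule arg_cong[of _ _ "\<lambda>x. q powr x"]) (simp add: L(1) field_simps)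
    also have "\<dots> \<le> 1/2 * q powr ((K + 1) / 2 - 5 * real L / 6)"
    proof (rule mult_right_mono)
      have "q powr (-5/2) \<le> q powr (-1/2)" by (rule q_powr_le) simp
      then show "q powr (-5/2) \<le> 1/2" using q_half by linarith
    qed simp
    finally have "16 * exp 4 * q powr ((K + 1) / 2 - 5 * real N / 6) \<le> 16 * exp 4 * (1/2 * q powr ((K + 1) / 2 - 5 * real L / 6))" by (rule mult_left_mono) simp
    then show ?thesis using 1 2 unfolding K_def by linarith
  qed
qed

lemma AA_bound:
  assumes k: "k \<in> M" shows "norm (AA k N) \<le> C1 * q powr (4/3 * N + deg k / 12 + 1/2)"
proof -
  have "norm (BB k N) * q powr (- real N / 3) \<le> C1 * q powr (deg k / 12 + 1/2)"
  proof (cases "1 \<le> N \<and> deg k + 1 \<le> 2 * N")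
    case True
    moreover have "0 \<le> 16 * exp 4 * q powr ((real (deg k) + 1) / 2 - 5 * real N / 6)" by simp
    ultimately show ?thesis using BB_ind[OF k, of N] unfolding C1_def by linarith
  next
    case False
    \<comment> \<open>Below the range of the functional equation N is so small that the trivial
      bound suffices.\<close>
    then have N: "2 * real N \<le> deg k" by auto
    have "norm (BB k N) * q powr (- real N / 3) \<le> exp 4 * q powr (N / 2) * q powr (- real N / 3)" using BB_trivial[OF k] by (intro mult_right_mono) simp_all
    also have "\<dots> = exp 4 * q powr (N / 6)" by (simp add: powr_add[symmetric])
    also have "\<dots> \<le> C1 * q powr (deg k / 12 + 1/2)" using N by (intro mult_mono q_powr_le) (simp_all add: C1_def)
    finally show ?thesis .
  qed
  then have "norm (BB k N) * q powr (- real N / 3) * q powr (4/3 * N) \<le> C1 * q powr (deg k / 12 + 1/2) * q powr (4/3 * N)"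
    by (rule mult_right_mono) simp
  moreover have "norm (BB k N) * q powr (- real N / 3) * q powr (4/3 * N) = norm (AA k N)"
    using q_gt1 by (simp add: mult.assoc powr_add[symmetric] BB_def norm_divide norm_power powr_realpow)
  ultimately show ?thesis by (simp add: mult.assoc powr_add[symmetric] add_ac)
qed

section \<open>Local conditions\<close>

definition UU :: "'a list \<Rightarrow> nat \<Rightarrow> real" where "UU k N = C1 * q powr (4/3 * N + deg k / 12 + 1/2)"

lemma UU_nonneg [simp]: "0 \<le> UU k N" using C1_pos by (simp add: UU_def)

lemma q_powr_half: "a \<le> -1/2 \<Longrightarrow> q powr a \<le> 1/2" using q_powr_le[of a "-1/2"] q_half by linarith

text \<open>The exponent, in units of deg P, collects j + 1/2 from the Gauss sum, - 4/3 (j + 1) from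
  the smaller degree, and (r - j) / 12 from the changed frequency.\<close>

lemma local_weight_gauss:
  assumes P: "P \<in> \<P>" and k: "k0 \<in> M" "\<not> P pdivides k0" and N: "(j + 1) * deg P \<le> N"
  shows "norm (GS (P ^. j *. k0) (P ^. Suc j)) * UU (P ^. r *. k0) (N - Suc j * deg P)
     \<le> q powr ((real r - 5 * real j - 10) / 12 * deg P) * UU (P ^. j *. k0) N"
proof -
  have PM: "P \<in> M" using P by simp
  have "norm (GS (P ^. j *. k0) (P ^. Suc j)) * UU (P ^. r *. k0) (N - Suc j * deg P)
    \<le> q powr ((real j + 1/2) * deg P) * UU (P ^. r *. k0) (N - Suc j * deg P)"
    using GS_pp_top[OF P k] by (intro mult_right_mono) simp_all
  also have "\<dots> = C1 * (q powr ((real j + 1/2) * deg P) * q powr (4/3 * real (N - Suc j * deg P) + deg (P ^. r *. k0) / 12 + 1/2))"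
    by (simp add: UU_def)
  also have "q powr ((real j + 1/2) * deg P) * q powr (4/3 * real (N - Suc j * deg P) + deg (P ^. r *. k0) / 12 + 1/2)
     = q powr ((real r - 5 * real j - 10) / 12 * deg P) * q powr (4/3 * N + deg (P ^. j *. k0) / 12 + 1/2)"
  proof -
    have d: "deg (P ^. i *. k0) = i * deg P + deg k0" for i using PM k by simp
    have N': "real (N - Suc j * deg P) = real N - (real j + 1) * real (deg P)" using N by (simp add: of_nat_diff del: mult_Suc)
    show ?thesis unfolding powr_add[symmetric] d N' by (rule arg_cong[of _ _ "\<lambda>x. q powr x"]) (simp add: field_simps)
  qed
  finally show ?thesis by (simp add: UU_def mult_ac)
qed

text \<open>The exponent of \<open>P\<close> in \<open>k\<close> matters only modulo 3, so the splitting at \<open>P\<close> is a recursion in \<open>N\<close> that relates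
  \<open>j\<close> to \<open>2j + 1\<close> modulo 3.\<close>

lemma AY_S'_bound_aux:
  assumes P: "P \<in> \<P>" "P \<notin> T" and T: "T \<subseteq> \<P>" and k: "k0 \<in> M" "\<not> P pdivides k0"
    and G: "\<And>j N. norm (AY {} T (P ^. j *. k0) N) \<le> B * UU (P ^. j *. k0) N" and B: "0 \<le> B"
  shows "j \<le> 2 \<Longrightarrow> norm (AY {} (insert P T) (P ^. j *. k0) N) \<le> 2 * B * UU (P ^. j *. k0) N"
proof (induct N arbitrary: j rule: less_induct)
  case (less N)
  define H where "H i n = AY {} (insert P T) (P ^. i *. k0) n" for i n
  have PM: "P \<in> M" "P \<in> C" and kC: "k0 \<in> C" and p: "1 \<le> deg P" using P k deg_prime by simp_all
  \<comment> \<open>The exponent j + (j + 1) of \<open>P\<close> in the new frequency, modulo 3. For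
    j = 0, 1, 2 it is 1, 0, 2, and the worst exponent of \<open>local_weight_gauss\<close> is -
    9/12, at j = 0.\<close>
  define r where "r = (2 * j + 1) mod 3"
  have r: "r \<le> 2" "(real r - 5 * real j - 10) / 12 \<le> -3/4"
  proof -
    have "j = 0 \<or> j = 1 \<or> j = 2" using less by arith
    then show "r \<le> 2" "(real r - 5 * real j - 10) / 12 \<le> -3/4" by (auto simp: r_def)
  qed
  define t where "t = (if Suc j * deg P \<le> N then GS (P ^. j *. k0) (P ^. Suc j) * H r (N - Suc j * deg P) else 0)"
  have "AY {} T (P ^. j *. k0) N = (\<Sum>i\<in>II 0 P N. GS (P ^. j *. k0) (P ^. i) * AY {} (insert P T) (P ^. j *. k0 *. P ^. i) (N - i * deg P))"
    by (rule AY_split0) (use P T PM kC in simp_all)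
  also have "\<dots> = (\<Sum>i\<in>II 0 P N. (if i = 0 then H j N else 0) + (if i = Suc j then GS (P ^. j *. k0) (P ^. Suc j) * H r (N - Suc j * deg P) else 0))"
  proof (rule sum.cong[OF refl])
    fix i
    consider "i = 0" | "1 \<le> i" "i \<le> j" | "i = Suc j" | "j + 1 < i" by linarith
    then show "GS (P ^. j *. k0) (P ^. i) * AY {} (insert P T) (P ^. j *. k0 *. P ^. i) (N - i * deg P) = 
      (if i = 0 then H j N else 0) + (if i = Suc j then GS (P ^. j *. k0) (P ^. Suc j) * H r (N - Suc j * deg P) else 0)"
    proof cases
      case 1 then show ?thesis using PM kC by (simp add: GS_one H_def)
    next
      case 2
      then have "i mod 3 \<noteq> 0" using less(2) by auto
      then show ?thesis using GS_pp_mid[OF P(1) k(1), of i j] 2 by simp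
    next
      case 3
      have "P ^. j *. k0 *. P ^. i = k0 *. P ^. (j + i)" using PM kC by (simp only: UP.nat_pow_mult[symmetric]) (simp add: UP.m_ac)
      then have "AY {} (insert P T) (P ^. j *. k0 *. P ^. i) (N - i * deg P) = AY {} (insert P T) (k0 *. P ^. ((j + i) mod 3)) (N - i * deg P)"
        using AY_reduce[OF P(1) _ kC, of "insert P T"] by simp
      also have "(j + i) mod 3 = r" by (simp add: 3 r_def mult_2)
      also have "k0 *. P ^. r = P ^. r *. k0" using PM kC by (simp add: UP.m_comm)
      finally show ?thesis using 3 by (simp only: H_def) simp
    next
      case 4 then show ?thesis using GS_pp_big[OF P(1) k 4] by simp
    qed
  qed
  \<comment> \<open>So \<open>H j N\<close> is the sum without the condition at \<open>P\<close>
    minus a term with \<open>H\<close> at a smaller degree. The weight of that term is at most 1/2,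
    which closes the induction with the constant 2 B.\<close>
  also have "\<dots> = H j N + t"
    using finite_II[OF P(1), of 0 N] by (simp add: sum.distrib sum.delta t_def II_def)
  finally have HG: "H j N = AY {} T (P ^. j *. k0) N - t" by simp
  have "norm t \<le> B * UU (P ^. j *. k0) N"
  proof (cases "Suc j * deg P \<le> N")
    case True
    have "N - Suc j * deg P < N" using True p by (intro diff_less) (simp_all add: add_pos_nonneg)
    then have "norm (H r (N - Suc j * deg P)) \<le> 2 * B * UU (P ^. r *. k0) (N - Suc j * deg P)"
      unfolding H_def using less(1) r(1) by blast
    then have "norm (GS (P ^. j *. k0) (P ^. Suc j)) * norm (H r (N - Suc j * deg P))
      \<le> norm (GS (P ^. j *. k0) (P ^. Suc j)) * (2 * B * UU (P ^. r *. k0) (N - Suc j * deg P))" by (rule mult_left_mono) simp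
    also have "\<dots> = 2 * B * (norm (GS (P ^. j *. k0) (P ^. Suc j)) * UU (P ^. r *. k0) (N - Suc j * deg P))" by simp
    also have "\<dots> \<le> 2 * B * (q powr ((real r - 5 * real j - 10) / 12 * deg P) * UU (P ^. j *. k0) N)"
      using local_weight_gauss[OF P(1) k, of j N r] True B by (intro mult_left_mono) simp_all
    also have "\<dots> \<le> 2 * B * (1/2 * UU (P ^. j *. k0) N)"
    proof (intro mult_left_mono mult_right_mono q_powr_half)
      have "(real r - 5 * real j - 10) / 12 * deg P \<le> -3/4 * deg P" by (rule mult_right_mono[OF r(2)]) simp
      then show "(real r - 5 * real j - 10) / 12 * deg P \<le> -1/2" using p by linarith
    qed (use B in simp_all)
    finally show ?thesis using True by (simp add: t_def norm_mult del: mult_Suc UP.nat_pow_Suc)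
  next
    case False then show ?thesis using B by (simp add: t_def del: mult_Suc)
  qed
  then show ?case using norm_triangle_ineq4[of "AY {} T (P ^. j *. k0) N" t] G[of j N] HG by (simp add: H_def)
qed

lemma UU_mono: "deg k' \<le> deg k \<Longrightarrow> UU k' N \<le> UU k N"
  unfolding UU_def using C1_pos by (intro mult_left_mono q_powr_le) simp_all

lemma AY_S'_bound:
  assumes "finite S'"
  shows "S' \<subseteq> \<P> \<Longrightarrow> k \<in> M \<Longrightarrow> norm (AY {} S' k N) \<le> 2 ^ card S' * UU k N"
  using assms
proof (induct S' arbitrary: k N)
  case empty
  then show ?case using AA_bound[of k N] by (simp add: UU_def)
next
  case (insert P T)
  have P: "P \<in> \<P>" "P \<in> M" "P \<in> C" and T: "T \<subseteq> \<P>" using insert(4) by auto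
  obtain j k0 where jk: "k0 \<in> M" "k = P ^. j *. k0" "\<not> P pdivides k0" using prime_decomp[OF insert(5) P(1)] by metis
  have kC: "k0 \<in> C" using jk by simp
  have "AY {} (insert P T) k N = AY {} (insert P T) (k0 *. P ^. j) N" using jk P by (simp add: UP.m_comm)
  also have "\<dots> = AY {} (insert P T) (k0 *. P ^. (j mod 3)) N" by (rule AY_reduce) (use P jk in simp_all)
  also have "k0 *. P ^. (j mod 3) = P ^. (j mod 3) *. k0" using kC P by (simp add: UP.m_comm)
  finally have e: "AY {} (insert P T) k N = AY {} (insert P T) (P ^. (j mod 3) *. k0) N" .
  have "norm (AY {} (insert P T) (P ^. (j mod 3) *. k0) N) \<le> 2 * 2 ^ card T * UU (P ^. (j mod 3) *. k0) N"
  proof (rule AY_S'_bound_aux[OF P(1) insert(2) T jk(1,3)])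
    show "norm (AY {} T (P ^. j *. k0) N) \<le> 2 ^ card T * UU (P ^. j *. k0) N" for j N
      using P jk by (intro insert(3) T) simp
    show "j mod 3 \<le> 2" using mod_less_divisor[of 3 j] by linarith
  qed simp
  also have "\<dots> \<le> 2 * 2 ^ card T * UU k N"
  proof (intro mult_left_mono UU_mono)
    show "deg (P ^. (j mod 3) *. k0) \<le> deg k" using P jk by simp
  qed simp
  finally show ?case using insert e by simp
qed

text \<open>From 7^5 > 2^12.\<close>

lemma q_512: "q powr (-5/12) \<le> 1/2"
proof -
  have "(q powr (-5/12)) ^ 12 = q powr (-5)" by (simp add: q_powr_pow)
  also have "\<dots> \<le> 7 powr (-5)" using q_ge7 by (intro powr_mono2') simp_all
  also have "\<dots> \<le> (1/2 :: real) ^ 12" by (simp add: powr_minus_divide power_one_over)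
  finally show ?thesis by (subst (asm) power_mono_iff) simp_all
qed

text \<open>Let P^j exactly divide \<open>k\<close> and z = q^(-5/12 deg P). A multiple i >= 3 of 3
  up to j contributes at most z^i: - i/3 from the trivial Gauss sum bound against the smaller
  degree, and at most - i/12 from lowering the exponent of \<open>P\<close> in the frequency from j
  to j mod 3. The term i = j + 1 contributes at most z^3, and as z <= 1/2 the total is at most 3
  z^3.\<close>

lemma AY_S_bound_aux:
  assumes P: "P \<in> \<P>" "P \<notin> S" "P \<notin> S'" and S: "S \<subseteq> \<P>" "S' \<subseteq> \<P>" and k: "k \<in> M"
    and G: "\<And>k N. k \<in> M \<Longrightarrow> norm (AY S (insert P S') k N) \<le> B * UU k N" and B: "0 \<le> B"
  shows "norm (AY (insert P S) S' k N) \<le> 3 * B * q powr (-5/4 * deg P) * UU k N"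
proof -
  obtain j k0 where jk: "k0 \<in> M" "k = P ^. j *. k0" "\<not> P pdivides k0" using prime_decomp[OF k P(1)] by metis
  have PM: "P \<in> M" "P \<in> C" and kC: "k0 \<in> C" "k \<in> C" and p: "1 \<le> deg P" using P jk k deg_prime by simp_all
  define z where "z = q powr (-5/12 * deg P)"
  have z: "0 \<le> z" "z \<le> 1/2"
  proof -
    have "z \<le> q powr (-5/12)" unfolding z_def using p by (intro q_powr_le) simp
    then show "z \<le> 1/2" using q_512 by linarith
  qed (simp add: z_def)
  have zpow: "z ^ n = q powr (- (5 * n) / 12 * deg P)" for n by (simp only: z_def q_powr_pow) (simp add: mult_ac)
  have red: "norm (AY S (insert P S') (k *. P ^. i) n) \<le> B * UU (P ^. ((j + i) mod 3) *. k0) n" for i n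
  proof -
    have "k *. P ^. i = k0 *. P ^. (j + i)" using PM kC unfolding jk(2) by (simp only: UP.nat_pow_mult[symmetric]) (simp add: UP.m_ac)
    then have "AY S (insert P S') (k *. P ^. i) n = AY S (insert P S') (k0 *. P ^. ((j + i) mod 3)) n"
      using AY_reduce[OF P(1) _ kC(1), of "insert P S'"] by simp
    also have "k0 *. P ^. ((j + i) mod 3) = P ^. ((j + i) mod 3) *. k0" using PM kC by (simp add: UP.m_comm)
    finally show ?thesis using G[of "P ^. ((j + i) mod 3) *. k0" n] PM jk by simp
  qed
  have t: "norm (GS k (P ^. i) * AY S (insert P S') (k *. P ^. i) (N - i * deg P))
    \<le> B * UU k N * ((if 3 \<le> i then z ^ i else 0) + (if i = j + 1 then z ^ 3 else 0))" if i: "i \<in> II 2 P N" for i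
  proof -
    have i2: "2 \<le> i" "i * deg P \<le> N" using i by (simp_all add: II_def)
    have Bk: "0 \<le> B * UU k N" using B by simp
    consider "j + 1 < i" | "i = Suc j" | "i \<le> j" "i mod 3 \<noteq> 0" | "3 \<le> i" "i mod 3 = 0" "i \<le> j"
    proof -
      have "i mod 3 = 0 \<Longrightarrow> i = 0 \<or> 3 \<le> i" by presburger
      then show thesis using that i2 by linarith
    qed
    then show ?thesis
    proof cases
      case 1 then show ?thesis using GS_pp_big[OF P(1) jk(1,3) 1] z Bk by (simp add: jk(2))
    next
      case 2
      define r where "r = (j + i) mod 3"
      have "norm (GS k (P ^. i) * AY S (insert P S') (k *. P ^. i) (N - i * deg P))
        \<le> norm (GS k (P ^. i)) * (B * UU (P ^. r *. k0) (N - i * deg P))"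
        unfolding norm_mult r_def by (intro mult_left_mono red) simp
      also have "\<dots> = B * (norm (GS (P ^. j *. k0) (P ^. Suc j)) * UU (P ^. r *. k0) (N - Suc j * deg P))" 
        unfolding 2 jk(2) by (simp only: mult.left_commute)
      also have "\<dots> \<le> B * (q powr ((real r - 5 * real j - 10) / 12 * deg P) * UU k N)"
        using local_weight_gauss[OF P(1) jk(1,3), of j N r] i2 B unfolding jk(2) 2 by (intro mult_left_mono) simp_all
      also have "\<dots> \<le> B * (z ^ 3 * UU k N)"
      proof (intro mult_left_mono mult_right_mono B)
        \<comment> \<open>Here j >= 1 because i >= 2. The tight case is j = 1, where r = 0 and the
          exponent is exactly - 15/12.\<close>
        have "r < 3" by (simp add: r_def)
        moreover have "j = 1 \<Longrightarrow> r = 0" by (simp add: r_def 2)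
        ultimately have "real r \<le> 5 * real j - 5" using i2 2 by (cases "j = 1") auto
        then have "(real r - 5 * real j - 10) / 12 \<le> -15/12" by simp
        then have "(real r - 5 * real j - 10) / 12 * deg P \<le> -15/12 * deg P" by (rule mult_right_mono) simp
        then show "q powr ((real r - 5 * real j - 10) / 12 * deg P) \<le> z ^ 3" unfolding zpow by (intro q_powr_le) simp
      qed simp
      also have "\<dots> = B * UU k N * z ^ 3" by simp
      also have "\<dots> \<le> B * UU k N * ((if 3 \<le> i then z ^ i else 0) + (if i = j + 1 then z ^ 3 else 0))"
        using 2 z by (intro mult_left_mono[OF _ Bk]) simp
      finally show ?thesis .
    next
      case 3 then show ?thesis using GS_pp_mid[OF P(1) jk(1) 3] z Bk by (simp add: jk(2))
    next
      case 4
      define r where "r = (j + i) mod 3"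
      have rj: "r + i \<le> j" 
      proof -
        obtain t where t: "i = 3 * t" using 4(2) by auto
        have "r = j mod 3" unfolding r_def t by simp
        moreover have "j = 3 * (j div 3) + j mod 3" by simp
        moreover have "t \<le> j div 3" using 4(3) t by (simp add: less_eq_div_iff_mult_less_eq)
        ultimately show ?thesis using t by linarith
      qed
      have d: "deg (P ^. l *. k0) = l * deg P + deg k0" for l using PM jk by simp
      have N': "real (N - i * deg P) = real N - real i * real (deg P)" using i2 by (simp add: of_nat_diff)
      have "norm (GS k (P ^. i) * AY S (insert P S') (k *. P ^. i) (N - i * deg P))
        \<le> q powr (i * deg P) * (B * UU (P ^. r *. k0) (N - i * deg P))"
        unfolding norm_mult r_def by (intro mult_mono red GS_pp_trivial[OF P(1) kC(2)]) simp_all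
      also have "\<dots> = B * C1 * (q powr (i * deg P) * q powr (4/3 * real (N - i * deg P) + deg (P ^. r *. k0) / 12 + 1/2))" 
        by (simp add: UU_def)
      also have "\<dots> \<le> B * C1 * (z ^ i * q powr (4/3 * N + deg k / 12 + 1/2))"
      proof (rule mult_left_mono)
        show "0 \<le> B * C1" using B C1_pos by simp
        have "real (r + i) * deg P \<le> real j * deg P" using rj by (intro mult_right_mono) (simp_all only: of_nat_le_iff of_nat_0_le_iff)
        then show "q powr (i * deg P) * q powr (4/3 * real (N - i * deg P) + deg (P ^. r *. k0) / 12 + 1/2) \<le> z ^ i * q powr (4/3 * N + deg k / 12 + 1/2)" unfolding zpow powr_add[symmetric] d jk(2) N' by (intro q_powr_le) (simp add: field_simps)
      qed
      also have "B * C1 * (z ^ i * q powr (4/3 * N + deg k / 12 + 1/2)) = B * UU k N * z ^ i" by (simp add: UU_def)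
      also have "\<dots> \<le> B * UU k N * ((if 3 \<le> i then z ^ i else 0) + (if i = j + 1 then z ^ 3 else 0))"
        using 4 z by (intro mult_left_mono[OF _ Bk]) simp
      finally show ?thesis .
    qed
  qed
  have "norm (AY (insert P S) S' k N) \<le> (\<Sum>i\<in>II 2 P N. B * UU k N * ((if 3 \<le> i then z ^ i else 0) + (if i = j + 1 then z ^ 3 else 0)))"
    unfolding AY_split2[OF P S kC(2)] by (rule sum_norm_le) (rule t)
  also have "\<dots> \<le> (\<Sum>i\<in>{..N}. B * UU k N * ((if 3 \<le> i then z ^ i else 0) + (if i = j + 1 then z ^ 3 else 0)))"
    using II_subset[OF P(1)] z B by (intro sum_mono2) simp_all
  also have "\<dots> = B * UU k N * ((\<Sum>i | i \<le> N \<and> 3 \<le> i. z ^ i) + (\<Sum>i\<in>{..N}. if i = j + 1 then z ^ 3 else 0))"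
    by (simp only: sum_distrib_left[symmetric] sum.distrib sum.inter_filter[OF finite_atMost, symmetric] atMost_iff mem_Collect_eq conj_commute)
  also have "\<dots> \<le> B * UU k N * (2 * z ^ 3 + z ^ 3)" using geom_le[OF z, of N 3] z B by (intro mult_left_mono add_mono) simp_all
  also have "\<dots> = 3 * B * z ^ 3 * UU k N" by simp
  finally show ?thesis by (simp add: zpow)
qed

text \<open>6 is 3 for splitting a prime off \<open>S\<close> times 2 for the condition at this
  prime that enters \<open>S'\<close>.\<close>

lemma AY_bound:
  assumes "finite S"
  shows "S \<subseteq> \<P> \<Longrightarrow> S' \<subseteq> \<P> \<Longrightarrow> finite S' \<Longrightarrow> S \<inter> S' = {} \<Longrightarrow> k \<in> M \<Longrightarrow> 
     norm (AY S S' k N) \<le> 6 ^ card S * 2 ^ card S' * q powr (-5/4 * (\<Sum>P\<in>S. deg P)) * UU k N"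
  using assms
proof (induct S arbitrary: S' k N)
  case empty
  then show ?case using AY_S'_bound[of S' k N] q_gt1 by simp
next
  case (insert P S)
  have P: "P \<in> \<P>" "P \<notin> S" "P \<notin> S'" and S: "S \<subseteq> \<P>" "S' \<subseteq> \<P>" using insert(2,4,5,7) by blast+
  let ?B = "6 ^ card S * 2 ^ card (insert P S') * q powr (-5/4 * (\<Sum>P\<in>S. deg P))"
  have "norm (AY (insert P S) S' k N) \<le> 3 * ?B * q powr (-5/4 * deg P) * UU k N"
  proof (rule AY_S_bound_aux[OF P S insert(8)])
    fix k N assume "k \<in> M"
    then show "norm (AY S (insert P S') k N) \<le> ?B * UU k N"
      using insert(4-7) P by (intro insert(3)) simp_all
  qed simp
  also have "\<dots> = 6 ^ card (insert P S) * 2 ^ card S' * (q powr (-5/4 * deg P) * q powr (-5/4 * (\<Sum>P\<in>S. deg P))) * UU k N"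
    using insert P by simp
  also have "q powr (-5/4 * deg P) * q powr (-5/4 * (\<Sum>P\<in>S. deg P)) = q powr (-5/4 * (\<Sum>P\<in>insert P S. deg P))"
    using insert(1,2) by (simp add: powr_add[symmetric] distrib_left)
  finally show ?case .
qed

text \<open>If \<open>P\<close> does not divide the frequency, the Gauss sums modulo
  \<open>P ^. i\<close> with i >= 2 vanish. This confines the frequencies in \<open>rep1\<close> to
  multiples of \<open>rad S\<close>.\<close>

lemma AY_zero:
  assumes P: "P \<in> S" "P \<notin> S'" "\<not> P pdivides k" and S: "S \<subseteq> \<P>" "S' \<subseteq> \<P>" and k: "k \<in> M"
  shows "AY S S' k N = 0"
proof -
  have P': "P \<in> \<P>" "P \<notin> S - {P}" and S': "S - {P} \<subseteq> \<P>" and kC: "k \<in> C" and i: "insert P (S - {P}) = S" using P S k by auto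
  show ?thesis
    using AY_split2[OF P' P(2) S' S(2) kC, of N] unfolding i
  proof (rule trans)
    show "(\<Sum>i\<in>II 2 P N. GS k (P ^. i) * AY (S - {P}) (insert P S') (k *. P ^. i) (N - i * deg P)) = 0"
    proof (rule sum.neutral, rule ballI)
      fix i assume "i \<in> II 2 P N"
      then have "0 + 1 < i" by (simp add: II_def)
      then have "GS (P ^. (0::nat) *. k) (P ^. i) = 0" by (intro GS_pp_big[OF P'(1) k P(3)])
      then show "GS k (P ^. i) * AY (S - {P}) (insert P S') (k *. P ^. i) (N - i * deg P) = 0" using kC by simp
    qed
  qed
qed

end

section \<open>Sieving for squarefree polynomials\<close>

context fin_field begin

definition dg :: "'a list set \<Rightarrow> nat" where "dg S = (\<Sum>P\<in>S. deg P)"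
text \<open>A squarefree D of degree d is encoded by its set of primes: the Moebius function becomes
  \<open>(-1) ^ card S\<close>, and a loss of a constant factor per prime becomes a power with
  exponent \<open>card S\<close>.\<close>

definition PS :: "nat \<Rightarrow> 'a list set set" where "PS d = {S. finite S \<and> S \<subseteq> \<P> \<and> dg S = d}"
definition rad_of :: "'a list set \<Rightarrow> 'a list \<Rightarrow> bool" where
  "rad_of S D \<longleftrightarrow> D \<in> M \<and> deg D = dg S \<and> pd D = S \<and> 
     (\<forall>f\<in>C. D pdivides f \<longleftrightarrow> (\<forall>P\<in>S. P pdivides f)) \<and> (\<forall>f\<in>C. (D ^. 2) pdivides f \<longleftrightarrow> (\<forall>P\<in>S. (P ^. 2) pdivides f))"
definition rad :: "'a list set \<Rightarrow> 'a list" where "rad S = (SOME D. rad_of S D)"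

lemma cop_mul_dvd_iff: "cop a b \<Longrightarrow> f \<in> C \<Longrightarrow> (a *. b) pdivides f \<longleftrightarrow> a pdivides f \<and> b pdivides f"
proof -
  assume c: "cop a b" and f: "f \<in> C"
  note ab = cop_C[OF c]
  have "a pdivides (a *. b)" "b pdivides (a *. b)" using ab by (auto intro: dvd_mulI)
  then show ?thesis using dvd_trans[OF ab(1), of "a *. b" f] dvd_trans[OF ab(2), of "a *. b" f] cop_dvd_both[OF c f] by blast
qed

lemma rad_exists:
  assumes "finite S" shows "S \<subseteq> \<P> \<Longrightarrow> \<exists>D. rad_of S D"
  using assms
proof (induct S)
  case empty
  have "rad_of {} \<one>\<^sub>P" by (simp add: rad_of_def dg_def pd_one deg_one)
  then show ?case by blast
next
  case (insert P S)
  then obtain D where D: "rad_of S D" by auto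
  note D' = D[unfolded rad_of_def]
  have P: "P \<in> \<P>" "P \<in> M" "P \<in> C" using insert by simp_all
  have DM: "D \<in> M" "D \<in> C" using D' by simp_all
  have "\<not> P pdivides D" using D' insert(2) P unfolding pd_def by blast
  then have c: "cop P D" using bezout_prime[OF P(1) DM(2)] cop_symI by blast
  then have "cop (P ^. 2) D" by (rule cop_pow)
  then have "cop D (P ^. 2)" by (rule cop_symI)
  then have "cop (D ^. 2) (P ^. 2)" by (rule cop_pow)
  then have c2: "cop (P ^. 2) (D ^. 2)" by (rule cop_symI)
  have sq: "(P *. D) ^. 2 = P ^. 2 *. D ^. 2" using P DM by (simp add: UP.nat_pow_distrib)
  have "deg (P *. D) = dg (insert P S)" using D' P insert(1,2) by (simp add: dg_def)
  moreover have "pd (P *. D) = insert P S" using D' P by (simp add: pd_mul pd_prime)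
  moreover have "\<forall>f\<in>C. (P *. D) pdivides f \<longleftrightarrow> (\<forall>Q\<in>insert P S. Q pdivides f)" using D' cop_mul_dvd_iff[OF c] by simp
  moreover have "\<forall>f\<in>C. ((P *. D) ^. 2) pdivides f \<longleftrightarrow> (\<forall>Q\<in>insert P S. (Q ^. 2) pdivides f)"
    unfolding sq using D' cop_mul_dvd_iff[OF c2] by simp
  ultimately have "rad_of (insert P S) (P *. D)" using P DM unfolding rad_of_def by simp
  then show ?case by blast
qed

lemma rad_of_rad: "S \<in> PS d \<Longrightarrow> rad_of S (rad S)"
  unfolding rad_def by (rule someI_ex[OF rad_exists]) (simp_all add: PS_def)
lemma PS_D: "S \<in> PS d \<Longrightarrow> finite S" "S \<in> PS d \<Longrightarrow> S \<subseteq> \<P>" "S \<in> PS d \<Longrightarrow> dg S = d" by (simp_all add: PS_def)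
lemma rad_props:
  assumes "S \<in> PS d"
  shows "rad S \<in> M" "deg (rad S) = d" "pd (rad S) = S"
    "\<And>f. f \<in> C \<Longrightarrow> rad S pdivides f \<longleftrightarrow> (\<forall>P\<in>S. P pdivides f)"
    "\<And>f. f \<in> C \<Longrightarrow> (rad S ^. 2) pdivides f \<longleftrightarrow> (\<forall>P\<in>S. (P ^. 2) pdivides f)"
  using rad_of_rad[OF assms] PS_D(3)[OF assms] unfolding rad_of_def by simp_all
lemma PS_inj: "inj_on rad (PS d)" by (rule inj_onI) (metis rad_props(3))
lemma rad_Mn: "S \<in> PS d \<Longrightarrow> rad S \<in> Mn d" using Mn_deg rad_props(1,2) by simp
lemma finite_PS [simp]: "finite (PS d)"
  by (rule finite_imageD[OF finite_subset[of _ "Mn d"] PS_inj]) (auto simp: rad_Mn)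
lemma card_PS: "card (PS d) \<le> qn ^ d"
  unfolding card_Mn[symmetric] by (rule card_inj_on_le[OF PS_inj]) (auto simp: rad_Mn)
lemma card_PS_le: "real (card (PS d)) \<le> q ^ d"
proof -
  have "real (card (PS d)) \<le> real (qn ^ d)" using card_PS[of d] by (simp only: of_nat_le_iff)
  then show ?thesis by simp
qed
lemma PS_disjoint: "i \<noteq> j \<Longrightarrow> PS i \<inter> PS j = {}" by (auto simp: PS_def)

lemma sum_Pow_power:
  fixes x :: "'b::comm_ring_1"
  assumes "finite A" shows "(\<Sum>S\<in>Pow A. x ^ card S) = (x + 1) ^ card A"
  using prod_add[OF assms, of "\<lambda>_. x" "\<lambda>_. 1"] by simp

lemma sum_Pow_PS:
  fixes f :: "'a list set \<Rightarrow> 'b::comm_monoid_add"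
  assumes A: "finite A" "A \<subseteq> \<P>" "dg A \<le> L"
  shows "(\<Sum>S\<in>Pow A. f S) = (\<Sum>d\<le>L. \<Sum>S\<in>PS d. if S \<subseteq> A then f S else 0)"
proof -
  have "(\<Sum>d\<le>L. \<Sum>S\<in>PS d. if S \<subseteq> A then f S else 0) = (\<Sum>S\<in>(\<Union>d\<in>{..L}. PS d). if S \<subseteq> A then f S else 0)"
    by (rule sum.UNION_disjoint[symmetric]) (use PS_disjoint in auto)
  also have "\<dots> = (\<Sum>S | S \<in> (\<Union>d\<in>{..L}. PS d) \<and> S \<subseteq> A. f S)" by (rule sum.inter_filter[symmetric]) simp
  also have "{S. S \<in> (\<Union>d\<in>{..L}. PS d) \<and> S \<subseteq> A} = Pow A"
  proof
    show "Pow A \<subseteq> {S. S \<in> (\<Union>d\<in>{..L}. PS d) \<and> S \<subseteq> A}"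
    proof
      fix S assume S: "S \<in> Pow A"
      then have "finite S" "S \<subseteq> \<P>" using A finite_subset[of S A] by auto
      moreover have "dg S \<le> L" using S A sum_mono2[of A S deg] by (simp add: dg_def)
      ultimately have "dg S \<in> {..L}" "S \<in> PS (dg S)" by (simp_all add: PS_def)
      then show "S \<in> {S. S \<in> (\<Union>d\<in>{..L}. PS d) \<and> S \<subseteq> A}" using S by blast
    qed
  qed blast
  finally show ?thesis by (rule sym)
qed

text \<open>The alternating sum over the subsets of \<open>A F\<close> is 1 if this set is empty and
  0 otherwise. Sorting subsets by total degree makes the outer ranges independent of F.\<close>

lemma sieve:
  fixes \<phi> :: "'c \<Rightarrow> 'b::comm_ring_1"
  assumes X: "finite Z" and A: "\<And>F. F \<in> Z \<Longrightarrow> finite (A F) \<and> A F \<subseteq> \<P> \<and> dg (A F) \<le> L"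
  shows "(\<Sum>F | F \<in> Z \<and> A F = {}. \<phi> F) = (\<Sum>d\<le>L. \<Sum>S\<in>PS d. (-1) ^ card S * (\<Sum>F | F \<in> Z \<and> S \<subseteq> A F. \<phi> F))"
proof -
  have inner: "(\<Sum>d\<le>L. \<Sum>S\<in>PS d. if S \<subseteq> A F then (-1) ^ card S else 0) = (if A F = {} then 1 else 0 :: 'b)" if F: "F \<in> Z" for F
  proof -
    note AF = A[OF F]
    have "(\<Sum>d\<le>L. \<Sum>S\<in>PS d. if S \<subseteq> A F then (-1) ^ card S else 0) = (\<Sum>S\<in>Pow (A F). (-1) ^ card S :: 'b)"
      by (rule sum_Pow_PS[symmetric]) (use AF in simp_all)
    also have "(\<Sum>S\<in>Pow (A F). (-1) ^ card S) = (if A F = {} then 1 else 0 :: 'b)"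
      using sum_Pow_power[of "A F" "-1 :: 'b"] AF by (auto simp: card_gt_0_iff power_0_left)
    finally show ?thesis .
  qed
  have "(\<Sum>F | F \<in> Z \<and> A F = {}. \<phi> F) = (\<Sum>F\<in>Z. \<phi> F * (if A F = {} then 1 else 0))"
    by (subst sum.inter_filter[OF X]) (rule sum.cong, simp_all)
  also have "\<dots> = (\<Sum>F\<in>Z. \<Sum>d\<le>L. \<Sum>S\<in>PS d. \<phi> F * (if S \<subseteq> A F then (-1) ^ card S else 0))"
    by (rule sum.cong[OF refl]) (simp only: inner[symmetric] sum_distrib_left)
  also have "\<dots> = (\<Sum>d\<le>L. \<Sum>S\<in>PS d. \<Sum>F\<in>Z. \<phi> F * (if S \<subseteq> A F then (-1) ^ card S else 0))"
    by (simp only: sum.swap[of _ _ Z])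
  also have "\<dots> = (\<Sum>d\<le>L. \<Sum>S\<in>PS d. (-1) ^ card S * (\<Sum>F | F \<in> Z \<and> S \<subseteq> A F. \<phi> F))"
  proof (intro sum.cong refl)
    fix S
    show "(\<Sum>F\<in>Z. \<phi> F * (if S \<subseteq> A F then (-1) ^ card S else 0)) = (-1) ^ card S * (\<Sum>F | F \<in> Z \<and> S \<subseteq> A F. \<phi> F)"
      unfolding sum_distrib_left sum.inter_filter[OF X] by (rule sum.cong[OF refl]) simp
  qed
  finally show ?thesis .
qed

lemma dvd_multiples: 
  assumes E: "E \<in> M" 
  shows "{F \<in> Mn N. E pdivides F} = (if deg E \<le> N then (\<lambda>F. E *. F) ` Mn (N - deg E) else {})"
proof -
  have 1: "\<exists>G. G \<in> M \<and> F = E *. G \<and> deg E + deg G = N" if "F \<in> Mn N" "E pdivides F" for F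
  proof -
    have "F \<in> M" using Mn_M[OF that(1)] .
    from M_dvd_monic[OF E this that(2)] obtain G where G: "G \<in> M" "F = E *. G" .
    then show ?thesis using Mn_deg_eq[OF that(1)] E by (intro exI[of _ G]) simp
  qed
  show ?thesis
  proof (cases "deg E \<le> N")
    case True
    have "{F \<in> Mn N. E pdivides F} = (\<lambda>F. E *. F) ` Mn (N - deg E)"
    proof
      show "{F \<in> Mn N. E pdivides F} \<subseteq> (\<lambda>F. E *. F) ` Mn (N - deg E)"
      proof
        fix F assume "F \<in> {F \<in> Mn N. E pdivides F}"
        then obtain G where G: "G \<in> M" "F = E *. G" "deg E + deg G = N" using 1 by blast
        then have "G \<in> Mn (N - deg E)" using Mn_deg[OF G(1)] by simp
        then show "F \<in> (\<lambda>F. E *. F) ` Mn (N - deg E)" using G(2) by (rule image_eqI[rotated])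
      qed
      show "(\<lambda>F. E *. F) ` Mn (N - deg E) \<subseteq> {F \<in> Mn N. E pdivides F}"
      proof
        fix F assume "F \<in> (\<lambda>F. E *. F) ` Mn (N - deg E)"
        then obtain G where G: "G \<in> Mn (N - deg E)" "F = E *. G" by (rule imageE)
        then have "F \<in> Mn N" using Mn_M[OF G(1)] Mn_deg_eq[OF G(1)] E True by (subst Mn_deg) simp_all
        moreover have "E pdivides F" using G(2) Mn_C[OF G(1)] by (rule dvdI[rotated])
        ultimately show "F \<in> {F \<in> Mn N. E pdivides F}" by simp
      qed
    qed
    then show ?thesis using True by simp
  next
    case False
    then show ?thesis using 1 by fastforce
  qed
qed
lemma inj_mul_M: "E \<in> M \<Longrightarrow> inj_on (\<lambda>F. E *. F) (Mn n)"
  by (rule inj_onI) (use M_cancel Mn_C in blast)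
lemma card_multiples: "E \<in> M \<Longrightarrow> card {F \<in> Mn N. E pdivides F} = (if deg E \<le> N then qn ^ (N - deg E) else 0)"
  by (simp add: dvd_multiples card_image[OF inj_mul_M] card_Mn)

text \<open>The sum of the Moebius function over degree d, that is, the coefficient of u^d in the
  inverse 1 - q u of the zeta function; hence \<open>mob_eq\<close>.\<close>

definition mob :: "nat \<Rightarrow> real" where "mob d = (\<Sum>S\<in>PS d. (-1) ^ card S)"

lemma dg_pd_le: "F \<in> Mn N \<Longrightarrow> A \<subseteq> pd F \<Longrightarrow> finite A \<and> A \<subseteq> \<P> \<and> dg A \<le> N"
proof -
  assume F: "F \<in> Mn N" and A: "A \<subseteq> pd F"
  have FM: "F \<in> M" using Mn_M[OF F] .
  have fin: "finite A" "A \<subseteq> \<P>" using A finite_pd[OF FM] pd_subset finite_subset by blast+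
  then have PS: "A \<in> PS (dg A)" by (simp add: PS_def)
  have "rad A pdivides F" using rad_props(4)[OF PS, of F] A FM unfolding pd_def by auto
  then have "length (rad A) \<le> length F" using rad_props(1)[OF PS] FM by (intro dvd_length(1)) simp_all
  then show ?thesis using fin M_len[OF FM] M_len[OF rad_props(1)[OF PS]] rad_props(2)[OF PS] Mn_deg_eq[OF F] by simp
qed

text \<open>Sieve for the polynomials without any prime factor: only 1 remains.\<close>

lemma mob_sum: "(\<Sum>d\<le>n. mob d * q ^ (n - d)) = (if n = 0 then 1 else 0)"
proof -
  have "(\<Sum>F | F \<in> Mn n \<and> pd F = {}. 1) = (\<Sum>d\<le>n. \<Sum>S\<in>PS d. (-1) ^ card S * (\<Sum>F | F \<in> Mn n \<and> S \<subseteq> pd F. 1 :: real))"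
    by (rule sieve) (simp, rule dg_pd_le[OF _ order_refl], simp)
  also have "\<dots> = (\<Sum>d\<le>n. mob d * q ^ (n - d))"
    unfolding mob_def sum_distrib_right
  proof (intro sum.cong refl)
    fix d S assume d: "d \<in> {..n}" and S: "S \<in> PS d"
    have "{F. F \<in> Mn n \<and> S \<subseteq> pd F} = {F \<in> Mn n. rad S pdivides F}" 
    proof (rule Collect_cong, rule conj_cong[OF refl])
      fix F assume "F \<in> Mn n"
      then show "S \<subseteq> pd F \<longleftrightarrow> rad S pdivides F" using rad_props(4)[OF S Mn_C[of F n]] PS_D(2)[OF S] unfolding pd_def by auto
    qed
    then show "(-1) ^ card S * (\<Sum>F | F \<in> Mn n \<and> S \<subseteq> pd F. 1 :: real) = (-1) ^ card S * q ^ (n - d)"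
      using d by (simp add: card_multiples[OF rad_props(1)[OF S]] rad_props(2)[OF S])
  qed
  also have "(\<Sum>F | F \<in> Mn n \<and> pd F = {}. 1) = (if n = 0 then 1 else 0 :: real)"
  proof -
    have "{F. F \<in> Mn n \<and> pd F = {}} = (if n = 0 then {\<one>\<^sub>P} else {})"
    proof -
      have "F \<in> Mn n \<and> pd F = {} \<longleftrightarrow> F = \<one>\<^sub>P \<and> n = 0" for F
      proof
        assume F: "F \<in> Mn n \<and> pd F = {}"
        then have FM: "F \<in> M" by (blast intro: Mn_M)
        have "F = \<one>\<^sub>P"
        proof (rule ccontr)
          assume "F \<noteq> \<one>\<^sub>P"
          then obtain p where "p \<in> \<P>" "p pdivides F" using ex_prime_dvd[OF FM] by blast
          then show False using F unfolding pd_def by blast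
        qed
        then show "F = \<one>\<^sub>P \<and> n = 0" using F Mn_deg_eq[of F n] by (simp add: deg_one)
      next
        assume "F = \<one>\<^sub>P \<and> n = 0"
        then show "F \<in> Mn n \<and> pd F = {}" using Mn_deg[OF one_M, of 0] by (simp add: pd_one deg_one)
      qed
      then show ?thesis by auto
    qed
    then show ?thesis by simp
  qed
  finally show ?thesis by simp
qed

lemma mob_eq: "mob d = (if d = 0 then 1 else if d = 1 then - q else 0)"
proof (cases d)
  case 0 then show ?thesis using mob_sum[of 0] by simp
next
  case (Suc n)
  have "(\<Sum>i\<le>Suc n. mob i * q ^ (Suc n - i)) = mob (Suc n) + (\<Sum>i\<le>n. mob i * q ^ (Suc n - i))" by simp
  also have "(\<Sum>i\<le>n. mob i * q ^ (Suc n - i)) = q * (\<Sum>i\<le>n. mob i * q ^ (n - i))"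
    unfolding sum_distrib_left by (rule sum.cong[OF refl]) (simp add: Suc_diff_le)
  finally have "mob (Suc n) = - q * (if n = 0 then 1 else 0)" using mob_sum[of "Suc n"] mob_sum[of n] by simp
  then show ?thesis using Suc by simp
qed

section \<open>Squarefree polynomials prime to a given set\<close>

definition SF :: "nat \<Rightarrow> 'a list set" where "SF N = {F \<in> Mn N. \<forall>P\<in>\<P>. \<not> (P ^. 2) pdivides F}"
definition A2 :: "'a list \<Rightarrow> 'a list set" where "A2 F = {P \<in> \<P>. (P ^. 2) pdivides F}"

lemma A2_pd: "F \<in> M \<Longrightarrow> A2 F \<subseteq> pd F"
proof
  fix P assume F: "F \<in> M" and "P \<in> A2 F"
  then have P: "P \<in> \<P>" "(P ^. 2) pdivides F" by (simp_all add: A2_def)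
  have "P pdivides (P ^. 2)" using P(1) by (intro dvdI[of P]) (simp_all add: numeral_2_eq_2)
  then have "P pdivides F" using dvd_trans[of P "P ^. 2" F] P by simp
  then show "P \<in> pd F" using P unfolding pd_def by simp
qed
lemma finite_SF [simp]: "finite (SF N)" by (rule finite_subset[of _ "Mn N"]) (auto simp: SF_def)
lemma SF_Mn: "F \<in> SF N \<Longrightarrow> F \<in> Mn N" by (simp add: SF_def)
lemma SF_A2: "SF N = {F. F \<in> Mn N \<and> A2 F = {}}" by (auto simp: SF_def A2_def)
lemma MS_A2: "S \<subseteq> \<P> \<Longrightarrow> {F. F \<in> Mn N \<and> S \<subseteq> A2 F} = MS S {} N" by (auto simp: MS_def A2_def)

lemma sieve_SF:
  fixes \<phi> :: "'a list \<Rightarrow> 'b::comm_ring_1"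
  shows "(\<Sum>F\<in>SF N. \<phi> F) = (\<Sum>d\<le>N. \<Sum>S\<in>PS d. (-1) ^ card S * (\<Sum>F\<in>MS S {} N. \<phi> F))"
proof -
  have "(\<Sum>F | F \<in> Mn N \<and> A2 F = {}. \<phi> F) = (\<Sum>d\<le>N. \<Sum>S\<in>PS d. (-1) ^ card S * (\<Sum>F | F \<in> Mn N \<and> S \<subseteq> A2 F. \<phi> F))"
    by (rule sieve) (simp, rule dg_pd_le, simp, rule A2_pd, rule Mn_M)
  then show ?thesis unfolding SF_A2 by (simp add: MS_A2 PS_D(2))
qed

lemma MS_rad: 
  assumes S: "S \<in> PS d" 
  shows "MS S {} N = {F \<in> Mn N. (rad S ^. 2) pdivides F}"
  unfolding MS_def
proof (rule Collect_cong, rule conj_cong[OF refl])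
  fix F assume "F \<in> Mn N"
  then show "(\<forall>Q\<in>S. (Q ^. 2) pdivides F) \<and> (\<forall>Q\<in>{}. \<not> Q pdivides F) \<longleftrightarrow> (rad S ^. 2) pdivides F"
    using rad_props(5)[OF S Mn_C[of F N]] by simp
qed
lemma card_MS: "S \<in> PS d \<Longrightarrow> card (MS S {} N) = (if 2 * d \<le> N then qn ^ (N - 2 * d) else 0)"
  using card_multiples[of "rad S ^. 2" N] rad_props(1,2)[of S d] by (simp add: MS_rad)

lemma card_SF: "real (card (SF N)) = q ^ N - (if 2 \<le> N then q ^ (N - 1) else 0)"
proof -
  have "real (card (SF N)) = (\<Sum>F\<in>SF N. 1)" by simp
  also have "\<dots> = (\<Sum>d\<le>N. mob d * (if 2 * d \<le> N then q ^ (N - 2 * d) else 0))"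
    unfolding sieve_SF mob_def sum_distrib_right by (intro sum.cong refl) (simp add: card_MS)
  also have "\<dots> = (\<Sum>d\<in>{..N}. (if d = 0 then q ^ N else 0) + (if d = 1 then (if 2 \<le> N then - q * q ^ (N - 2) else 0) else 0))"
    by (intro sum.cong refl) (simp add: mob_eq)
  also have "\<dots> = q ^ N - (if 2 \<le> N then q * q ^ (N - 2) else 0)" by (simp add: sum.distrib)
  also have "\<dots> = q ^ N - (if 2 \<le> N then q ^ (N - 1) else 0)" 
  proof (cases "2 \<le> N")
    case True
    then have "N - 1 = Suc (N - 2)" by simp
    then show ?thesis using True by simp
  qed simp
  finally show ?thesis .
qed

definition sT :: "'a list set \<Rightarrow> nat \<Rightarrow> 'a list set" where "sT T N = {F \<in> SF N. \<forall>P\<in>T. \<not> P pdivides F}"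
text \<open>The density of the polynomials prime to \<open>T\<close> among the squarefree
  ones.\<close>

definition sig :: "'a list set \<Rightarrow> real" where "sig T = (\<Prod>P\<in>T. 1 / (1 + 1 / q ^ deg P))"

lemma finite_sT [simp]: "finite (sT T N)" by (rule finite_subset[of _ "SF N"]) (auto simp: sT_def)

text \<open>The multiples of \<open>P\<close> in \<open>sT T N\<close> are \<open>P *. G\<close>
  with G squarefree and prime to both \<open>P\<close> and \<open>T\<close>.\<close>

lemma sT_split:
  assumes P: "P \<in> \<P>" "P \<notin> T" and T: "T \<subseteq> \<P>"
  shows "card (sT T N) = card (sT (insert P T) N) + (if deg P \<le> N then card (sT (insert P T) (N - deg P)) else 0)"
proof -
  have PM: "P \<in> M" "P \<in> C" using P by simp_all
  let ?B = "{F \<in> sT T N. P pdivides F}"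
  have u: "sT T N = sT (insert P T) N \<union> ?B" "sT (insert P T) N \<inter> ?B = {}" by (auto simp: sT_def)
  have "card (sT T N) = card (sT (insert P T) N) + card ?B" by (subst u(1), rule card_Un_disjoint) (use u(2) in auto)
  moreover have "?B = (if deg P \<le> N then (\<lambda>F. P *. F) ` sT (insert P T) (N - deg P) else {})"
  proof -
    have key: "(P *. G) \<in> SF N \<and> (\<forall>Q\<in>T. \<not> Q pdivides (P *. G)) \<longleftrightarrow> G \<in> sT (insert P T) (N - deg P)"
      if G: "G \<in> Mn (N - deg P)" and N: "deg P \<le> N" for G
    proof -
      note GM = Mn_M[OF G] Mn_C[OF G] Mn_deg_eq[OF G]
      have 1: "P *. G \<in> Mn N" using GM PM N by (subst Mn_deg) simp_all
      have 2: "Q pdivides (P *. G) \<longleftrightarrow> Q pdivides G" if "Q \<in> \<P>" "Q \<noteq> P" for Q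
        using prime_dvd_mul_iff[OF that(1) PM(2) GM(2)] prime_dvd_prime[OF that(1) P(1)] that(2) by blast
      have 3: "(P ^. 2) pdivides (P *. G) \<longleftrightarrow> P pdivides G"
        using dvd_mul_cancel[of P G P] PM GM by (simp add: numeral_2_eq_2)
      have 4: "(Q ^. 2) pdivides (P *. G) \<longleftrightarrow> (Q ^. 2) pdivides G" if "Q \<in> \<P>" "Q \<noteq> P" for Q
      proof -
        have "cop (Q ^. 2) (P ^. 1)" using prime_pow_cop[OF that(1) P(1) that(2)] .
        then have "cop (Q ^. 2) P" using PM by simp
        moreover have "Q ^. 2 \<in> C" using that(1) by simp
        ultimately show ?thesis using cop_dvd_mul[of "Q ^. 2" P G] dvd_mulI(2)[of "Q ^. 2" G P] PM GM by blast
      qed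
      have "(\<forall>Q\<in>\<P>. \<not> (Q ^. 2) pdivides (P *. G)) \<longleftrightarrow> \<not> P pdivides G \<and> (\<forall>Q\<in>\<P>. \<not> (Q ^. 2) pdivides G)"
      proof
        assume a: "\<forall>Q\<in>\<P>. \<not> (Q ^. 2) pdivides (P *. G)"
        then have nP: "\<not> P pdivides G" using 3 P(1) by blast
        moreover have "\<not> (Q ^. 2) pdivides G" if Q: "Q \<in> \<P>" for Q
        proof (cases "Q = P")
          case True
          have "P pdivides (P ^. 2)" using P(1) by (intro dvdI[of P]) (simp_all add: numeral_2_eq_2)
          then show ?thesis using dvd_trans[of P "P ^. 2" G] PM nP True by blast
        next
          case False then show ?thesis using 4[OF Q False] a Q by blast
        qed
        ultimately show "\<not> P pdivides G \<and> (\<forall>Q\<in>\<P>. \<not> (Q ^. 2) pdivides G)" by blast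
      next
        assume a: "\<not> P pdivides G \<and> (\<forall>Q\<in>\<P>. \<not> (Q ^. 2) pdivides G)"
        show "\<forall>Q\<in>\<P>. \<not> (Q ^. 2) pdivides (P *. G)"
        proof
          fix Q assume Q: "Q \<in> \<P>"
          show "\<not> (Q ^. 2) pdivides (P *. G)"
            using 3 4[OF Q] a Q by (cases "Q = P") blast+
        qed
      qed
      moreover have "(\<forall>Q\<in>T. \<not> Q pdivides (P *. G)) \<longleftrightarrow> (\<forall>Q\<in>T. \<not> Q pdivides G)"
      proof (rule ball_cong[OF refl])
        fix Q assume "Q \<in> T"
        then have "Q \<in> \<P>" "Q \<noteq> P" using T P(2) by blast+
        then show "(\<not> Q pdivides (P *. G)) = (\<not> Q pdivides G)" using 2 by blast
      qed
      ultimately show ?thesis using 1 G by (auto simp: sT_def SF_def)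
    qed
    have "?B = {F \<in> {F \<in> Mn N. P pdivides F}. F \<in> SF N \<and> (\<forall>Q\<in>T. \<not> Q pdivides F)}" using SF_Mn by (auto simp: sT_def)
    also have "\<dots> = (if deg P \<le> N then (\<lambda>F. P *. F) ` {G \<in> Mn (N - deg P). (P *. G) \<in> SF N \<and> (\<forall>Q\<in>T. \<not> Q pdivides (P *. G))} else {})"
      unfolding dvd_multiples[OF PM(1)] by auto
    also have "\<dots> = (if deg P \<le> N then (\<lambda>F. P *. F) ` sT (insert P T) (N - deg P) else {})"
    proof (rule if_cong[OF refl _ refl])
      assume N: "deg P \<le> N"
      have "{G \<in> Mn (N - deg P). (P *. G) \<in> SF N \<and> (\<forall>Q\<in>T. \<not> Q pdivides (P *. G))} = {G \<in> Mn (N - deg P). G \<in> sT (insert P T) (N - deg P)}"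
        using key[OF _ N] by blast
      also have "\<dots> = sT (insert P T) (N - deg P)" by (auto simp: sT_def SF_def)
      finally show "(\<lambda>F. P *. F) ` {G \<in> Mn (N - deg P). (P *. G) \<in> SF N \<and> (\<forall>Q\<in>T. \<not> Q pdivides (P *. G))} = (\<lambda>F. P *. F) ` sT (insert P T) (N - deg P)" by simp
    qed
    finally show ?thesis .
  qed
  moreover have "card ((\<lambda>F. P *. F) ` sT (insert P T) (N - deg P)) = card (sT (insert P T) (N - deg P))"
    by (rule card_image, rule inj_on_subset[OF inj_mul_M[OF PM(1), of "N - deg P"]]) (auto simp: sT_def SF_def)
  ultimately show ?thesis by simp
qed

section \<open>Character sums over squarefree moduli\<close>

text \<open>A power of \<open>B + 1\<close> counts ordered decompositions of \<open>S\<close> into \<open>B + 1\<close> disjoint sets.\<close>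

lemma PS_weight: "(\<Sum>S\<in>PS d. (real B + 1) ^ card S) \<le> (real d + 1) ^ B * q ^ d"
proof (induct B arbitrary: d)
  case 0
  show ?case using card_PS_le[of d] by simp
next
  case (Suc B)
  define x where "x = real B + 1"
  have x: "0 \<le> x" by (simp add: x_def)
  \<comment> \<open>A pair of S and a subset T is encoded by the degree of T, by T and by its
    complement; the double sum becomes a convolution over the degree of T.\<close>
  define f where "f = (\<lambda>(S, T). (dg T, (T :: 'a list set), S - T))"
  let ?Z = "SIGMA S:PS d. Pow S"
  let ?W = "SIGMA e:{..d}. PS e \<times> PS (d - e)"
  have fin: "finite ?Z" using PS_D(1) by (intro finite_SigmaI) auto
  have "(\<Sum>S\<in>PS d. (real (Suc B) + 1) ^ card S) = (\<Sum>S\<in>PS d. \<Sum>T\<in>Pow S. x ^ card T)"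
    using PS_D(1) by (intro sum.cong refl) (simp add: sum_Pow_power x_def add_ac)
  also have "\<dots> = (\<Sum>(S, T)\<in>?Z. x ^ card T)" using PS_D(1) by (intro sum.Sigma) auto
  also have "\<dots> = (\<Sum>z\<in>?Z. (\<lambda>(e, T, U). x ^ card T) (f z))" by (rule sum.cong[OF refl]) (auto simp: f_def)
  also have "\<dots> = (\<Sum>z\<in>f ` ?Z. (\<lambda>(e, T, U). x ^ card T) z)"
  proof (rule sum.reindex_cong[OF _ refl refl, symmetric])
    show "inj_on f ?Z" by (rule inj_onI) (auto simp: f_def)
  qed
  also have "\<dots> \<le> (\<Sum>z\<in>?W. (\<lambda>(e, T, U). x ^ card T) z)"
  proof (rule sum_mono2)
    show "f ` ?Z \<subseteq> ?W"
    proof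
      fix z assume "z \<in> f ` ?Z"
      then obtain S T where ST: "S \<in> PS d" "T \<subseteq> S" "z = (dg T, T, S - T)" by (auto simp: f_def)
      note S = PS_D[OF ST(1)]
      have fT: "finite T" using S(1) ST(2) finite_subset by blast
      have "dg S = dg (S - T) + dg T" unfolding dg_def by (rule sum.subset_diff[OF ST(2) S(1)])
      then have "dg T \<le> d" "dg (S - T) = d - dg T" using S(3) by simp_all
      then show "z \<in> ?W" using ST S fT by (auto simp: PS_def)
    qed
    show "finite ?W" by (intro finite_SigmaI finite_cartesian_product) simp_all
  qed (use x in auto)
  also have "\<dots> = (\<Sum>e\<le>d. \<Sum>z\<in>PS e \<times> PS (d - e). case z of (T, U) \<Rightarrow> x ^ card T)"
    by (subst sum.Sigma) (simp_all add: split_beta)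
  also have "\<dots> = (\<Sum>e\<le>d. (\<Sum>T\<in>PS e. x ^ card T) * real (card (PS (d - e))))"
    by (simp add: sum.cartesian_product[symmetric] sum_distrib_left sum_distrib_right mult.commute)
  also have "\<dots> \<le> (\<Sum>e\<le>d. (real d + 1) ^ B * q ^ d)"
  proof (rule sum_mono)
    fix e assume e: "e \<in> {..d}"
    have "(\<Sum>T\<in>PS e. x ^ card T) * real (card (PS (d - e))) \<le> ((real e + 1) ^ B * q ^ e) * q ^ (d - e)"
      using Suc[of e] card_PS_le[of "d - e"] by (intro mult_mono) (simp_all add: x_def)
    also have "\<dots> = (real e + 1) ^ B * q ^ d" using e by (simp flip: power_add)
    also have "\<dots> \<le> (real d + 1) ^ B * q ^ d" using e by (intro mult_right_mono power_mono) simp_all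
    finally show "(\<Sum>T\<in>PS e. x ^ card T) * real (card (PS (d - e))) \<le> (real d + 1) ^ B * q ^ d" .
  qed
  also have "\<dots> = (real d + 1) ^ Suc B * q ^ d" by (simp add: algebra_simps)
  finally show ?case .
qed

end

context cubic_field begin

lemma sig_pos: "0 < sig T" and sig_le: "sig T \<le> 1"
proof -
  have q0: "0 < q" using q_gt1 by simp
  have p: "0 < 1 + 1 / q ^ deg P" for P using q0 by (intro add_pos_pos) simp_all
  show "0 < sig T" unfolding sig_def using p by (intro prod_pos) simp
  show "sig T \<le> 1" unfolding sig_def using p q0 by (intro prod_le_1 conjI) (simp_all add: divide_le_eq less_imp_le)
qed

text \<open>For the error e and p = deg P, \<open>sT_split\<close> says that e at
  \<open>insert P T\<close> and N is e at \<open>T\<close> and N minus q^(-p) times e at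
  \<open>insert P T\<close> and N - p. Measured against q^(-N/2), the recursive term has weight
  q^(-p/2) <= 1/2, so each prime costs at most a factor 2.\<close>

lemma sT_bound:
  assumes "finite T"
  shows "T \<subseteq> \<P> \<Longrightarrow> \<bar>card (sT T N) / q ^ N - (1 - 1 / q) * sig T\<bar> \<le> 2 ^ card T * q powr (- real N / 2)"
  using assms
proof (induct T arbitrary: N)
  case empty
  note q = q_gt1
  have "sT {} N = SF N" by (simp add: sT_def)
  then have "card (sT {} N) / q ^ N - (1 - 1 / q) * sig {} = (if 2 \<le> N then 0 else 1 / q)"
  proof -
    have "N = 0 \<or> N = 1 \<or> 2 \<le> N" by arith
    then show ?thesis
    proof (elim disjE)
      assume N: "2 \<le> N"
      then have "q ^ N = q * q ^ (N - 1)" by (cases N) simp_all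
      then show ?thesis using N q \<open>sT {} N = SF N\<close> by (simp add: card_SF sig_def diff_divide_distrib)
    qed (use q \<open>sT {} N = SF N\<close> in \<open>simp_all add: card_SF sig_def\<close>)
  qed
  moreover have "1 / q \<le> q powr (- real N / 2)" if "\<not> 2 \<le> N"
  proof -
    have "1 / q = q powr (-1)" using q by (simp add: powr_minus_divide)
    also have "\<dots> \<le> q powr (- real N / 2)" using that by (intro q_powr_le) simp
    finally show ?thesis .
  qed
  ultimately show ?case using q by simp
next
  case (insert P T)
  note q = q_gt1
  have P: "P \<in> \<P>" "P \<notin> T" and T: "T \<subseteq> \<P>" using insert by auto
  define p where "p = deg P"
  have p: "1 \<le> p" using deg_prime[OF P(1)] by (simp add: p_def)
  have qp: "0 < q ^ p" using q by simp
  then have "0 < 1 / q ^ p" by simp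
  then have qp1: "1 + 1 / q ^ p \<noteq> 0" by linarith
  have sg: "sig T = sig (insert P T) + sig (insert P T) / q ^ p"
  proof -
    have "sig (insert P T) = 1 / (1 + 1 / q ^ p) * sig T" using insert(1,2) by (simp add: sig_def p_def)
    then have "sig (insert P T) * (1 + 1 / q ^ p) = sig T" using qp1 by simp
    then show ?thesis by (simp add: distrib_left)
  qed
  define e where "e T N = card (sT T N) / q ^ N - (1 - 1 / q) * sig T" for T N
  have IH: "\<bar>e T N\<bar> \<le> 2 ^ card T * q powr (- real N / 2)" for N using insert(3)[OF T] by (simp add: e_def)
  have c: "2 ^ card (insert P T) = 2 * (2 :: real) ^ card T" using insert by simp
  have half: "q powr (- real p / 2) \<le> 1/2" using p by (intro q_powr_half) simp
  have qpp: "1 / q ^ p = q powr (- real p)" using q by (simp add: powr_minus_divide powr_realpow)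
  have "\<bar>e (insert P T) N\<bar> \<le> 2 * 2 ^ card T * q powr (- real N / 2)"
  proof (induct N rule: less_induct)
    case (less N)
    show ?case
    proof (cases "p \<le> N")
      case False
      then have "card (sT T N) = card (sT (insert P T) N)" using sT_split[OF P T, of N] by (simp add: p_def)
      then have "e (insert P T) N = e T N + (1 - 1 / q) * sig (insert P T) * (1 / q ^ p)" unfolding e_def sg by (simp add: distrib_left)
      moreover have "\<bar>(1 - 1 / q) * sig (insert P T) * (1 / q ^ p)\<bar> \<le> 1 * 1 * q powr (- real N / 2)"
      proof -
        have "(1 - 1 / q) * sig (insert P T) * (1 / q ^ p) \<le> 1 * 1 * q powr (- real N / 2)"
          unfolding qpp using q sig_le sig_pos[of "insert P T"] False by (intro mult_mono q_powr_le) (simp_all add: less_imp_le)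
        moreover have "0 \<le> (1 - 1 / q) * sig (insert P T) * (1 / q ^ p)" using q sig_pos[of "insert P T"] by simp
        ultimately show ?thesis by simp
      qed
      moreover have "1 * q powr (- real N / 2) \<le> 2 ^ card T * q powr (- real N / 2)" by (rule mult_right_mono) simp_all
      ultimately show ?thesis using IH[of N] by linarith
    next
      case True
      then have cs: "real (card (sT T N)) = real (card (sT (insert P T) N)) + real (card (sT (insert P T) (N - p)))" 
        using sT_split[OF P T, of N] by (simp add: p_def)
      have qN: "q ^ N = q ^ (N - p) * q ^ p" using True by (simp flip: power_add)
      have "e (insert P T) N = e T N - e (insert P T) (N - p) * (1 / q ^ p)"
        unfolding e_def sg cs add_divide_distrib using qp q by (simp add: qN field_simps)
      moreover have "\<bar>e (insert P T) (N - p) * (1 / q ^ p)\<bar> \<le> 2 ^ card T * q powr (- real N / 2)"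
      proof -
        have "\<bar>e (insert P T) (N - p) * (1 / q ^ p)\<bar> = \<bar>e (insert P T) (N - p)\<bar> * q powr (- real p)" unfolding qpp by (simp add: abs_mult)
        also have "\<dots> \<le> (2 * 2 ^ card T * q powr (- real (N - p) / 2)) * q powr (- real p)"
          using less[of "N - p"] True p by (intro mult_right_mono) simp_all
        also have "\<dots> = 2 * 2 ^ card T * (q powr (- real (N - p) / 2) * q powr (- real p))" by simp
        also have "q powr (- real (N - p) / 2) * q powr (- real p) = q powr (- real p / 2) * q powr (- real N / 2)"
          unfolding powr_add[symmetric] using True by (simp add: of_nat_diff field_simps)
        also have "2 * 2 ^ card T * \<dots> \<le> 2 * 2 ^ card T * (1/2 * q powr (- real N / 2))" using half by (intro mult_left_mono mult_right_mono) simp_all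
        finally show ?thesis by simp
      qed
      ultimately show ?thesis using IH[of N] by linarith
    qed
  qed
  then show ?case unfolding c e_def .
qed

section \<open>Character sums for a fixed square divisor\<close>

definition cubes :: "nat \<Rightarrow> 'a list set" where "cubes n = {f \<in> Mn n. \<exists>h\<in>M. f = h ^. 3}"
definition SS :: "'a list set \<Rightarrow> nat \<Rightarrow> nat \<Rightarrow> complex" where "SS S N n = (\<Sum>F\<in>MS S {} N. \<Sum>f\<in>Mn n. chi F f)"

lemma cubes_eq: "cubes n = (if n mod 3 = 0 then (\<lambda>h. h ^. 3) ` Mn (n div 3) else {})"
proof -
  have 1: "3 * deg h = n" if "h ^. 3 \<in> Mn n" "h \<in> M" for h
    using Mn_deg_eq[OF that(1)] that(2) by simp
  have 2: "h ^. 3 \<in> Mn n" if "h \<in> Mn (n div 3)" "n mod 3 = 0" for h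
  proof -
    have "h \<in> M" "deg h = n div 3" using Mn_M[OF that(1)] Mn_deg_eq[OF that(1)] by simp_all
    then show ?thesis using that(2) by (subst Mn_deg) auto
  qed
  show ?thesis
  proof (cases "n mod 3 = 0")
    case True
    have "cubes n = (\<lambda>h. h ^. 3) ` Mn (n div 3)"
    proof
      show "cubes n \<subseteq> (\<lambda>h. h ^. 3) ` Mn (n div 3)"
      proof
        fix f assume "f \<in> cubes n"
        then obtain h where h: "h \<in> M" "f = h ^. 3" "h ^. 3 \<in> Mn n" by (auto simp: cubes_def)
        then have "h \<in> Mn (n div 3)" using 1[OF h(3,1)] Mn_deg[OF h(1)] by auto
        then show "f \<in> (\<lambda>h. h ^. 3) ` Mn (n div 3)" using h(2) by blast
      qed
      show "(\<lambda>h. h ^. 3) ` Mn (n div 3) \<subseteq> cubes n" using 2[OF _ True] Mn_M unfolding cubes_def by blast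
    qed
    then show ?thesis using True by simp
  next
    case False
    have "f \<notin> cubes n" for f
    proof
      assume "f \<in> cubes n"
      then obtain h where h: "h \<in> M" "h ^. 3 \<in> Mn n" by (auto simp: cubes_def)
      then show False using 1[OF h(2,1)] False by auto
    qed
    then show ?thesis using False by auto
  qed
qed
lemma cubes_Mn: "cubes n \<subseteq> Mn n" by (auto simp: cubes_def)
lemma card_cubes: "card (cubes n) \<le> qn ^ (n div 3)"
  using card_image_le[of "Mn (n div 3)" "\<lambda>h. h ^. 3"] by (simp add: cubes_eq card_Mn)
lemma card_cubes_powr: "real (card (cubes n)) \<le> q powr (n / 3)"
proof -
  have "real (card (cubes n)) \<le> real (qn ^ (n div 3))" using card_cubes[of n] by (simp only: of_nat_le_iff)
  also have "\<dots> = q powr real (n div 3)" using q_gt1 by (simp add: powr_realpow)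
  also have "\<dots> \<le> q powr (n / 3)" by (intro q_powr_le) linarith
  finally show ?thesis .
qed
lemma noncube: "f \<in> Mn n \<Longrightarrow> f \<notin> cubes n \<Longrightarrow> h \<in> M \<Longrightarrow> f \<noteq> h ^. 3" by (auto simp: cubes_def)

lemma MS_image:
  assumes S: "S \<in> PS d" and N: "2 * d \<le> N"
  shows "MS S {} N = (\<lambda>F. (rad S ^. 2) *. F) ` Mn (N - 2 * d)" "inj_on (\<lambda>F. (rad S ^. 2) *. F) (Mn (N - 2 * d))"
  using dvd_multiples[of "rad S ^. 2" N] rad_props(1,2)[OF S] N inj_mul_M[of "rad S ^. 2"] by (simp_all add: MS_rad[OF S])
text \<open>Write F = D^2 F' with D = \<open>rad S\<close>; reciprocity then makes \<open>f\<close>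
  the modulus.\<close>

lemma sum_MS:
  assumes S: "S \<in> PS d" and N: "2 * d \<le> N" and f: "f \<in> M"
  shows "(\<Sum>F\<in>MS S {} N. chi F f) = chi (rad S) f ^ 2 * (\<Sum>F\<in>Mn (N - 2 * d). chi f F)"
  unfolding MS_image(1)[OF S N] sum.reindex[OF MS_image(2)[OF S N]] sum_distrib_left
proof (rule sum.cong[OF refl])
  fix F assume "F \<in> Mn (N - 2 * d)"
  then have "F \<in> M" by (rule Mn_M)
  then show "((\<lambda>F. chi F f) \<circ> (\<lambda>F. (rad S ^. 2) *. F)) F = chi (rad S) f ^ 2 * chi f F"
    using rad_props(1)[OF S] chi_recip[OF _ f, of F] by (simp add: chi_mul chi_pow)
qed

text \<open>The cofactor of D^2 has degree at least n, hence runs through full periods modulo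
  \<open>f\<close>, over which the nontrivial character \<open>chi f\<close> sums to 0.\<close>

lemma complete_zero:
  assumes S: "S \<in> PS d" and N: "2 * d + n \<le> N" and f: "f \<in> Mn n" "f \<notin> cubes n"
  shows "(\<Sum>F\<in>MS S {} N. chi F f) = 0"
proof -
  note fM = Mn_M[OF f(1)] Mn_deg_eq[OF f(1)]
  have "(\<Sum>F\<in>Mn (N - 2 * d). chi f F) = of_nat (qn ^ (N - 2 * d - deg f)) * (\<Sum>a\<in>Pl (deg f). chi f a)"
    using N fM by (intro sum_Mn_periodic chi_periodic) simp_all
  also have "\<dots> = 0" using sum_chi_zero[OF fM(1) noncube[OF f]] by simp
  finally show ?thesis using sum_MS[OF S _ fM(1), of N] N by simp
qed

lemma GS_nil: 
  assumes "f \<in> Mn n" shows "norm (GS [] f) \<le> (if f \<in> cubes n then q ^ n else 0)"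
proof (cases "f \<in> cubes n")
  case True then show ?thesis using GS_trivial[OF Mn_M[OF assms], of "[]"] by (simp add: Mn_deg_eq[OF assms])
next
  case False then show ?thesis using GS_dvd_zero[OF Mn_M[OF assms] noncube[OF assms False], of "[]"] Mn_C[OF assms] by simp
qed

text \<open>Poisson summation over \<open>f\<close> modulo \<open>F\<close>.\<close>

lemma rep1:
  fixes m :: nat
  assumes S: "S \<in> PS d" and N: "N mod 3 = 1" "N = n + m + 1"
  shows "norm (SS S N n) \<le> (if d \<le> m then 6 ^ card S * C1 * q powr (4/3 * real N + real m / 12 - 9/4 * real d) else 0)"
proof -
  note SP = PS_D[OF S]
  note q = q_gt1
  have F: "of_nat qn ^ (m + 1) * (\<Sum>f\<in>Mn n. chi F f) = tau N * (\<Sum>k\<in>Mn m. GS k F)" if F: "F \<in> MS S {} N" for F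
  proof -
    have FM: "F \<in> M" "F \<in> Mn N" "deg F = N" using F MS_M MS_Mn MS_deg by blast+
    \<comment> \<open>As N is 1 modulo 3, both the zero frequency and \<open>sgn0\<close> vanish.
      Only the frequencies of the top degree m remain.\<close>
    have "F \<notin> cubes N" using N by (simp add: cubes_eq)
    then have "GS [] F = 0" using GS_nil[OF FM(2)] by simp
    moreover have "sgn0 (deg F) = 0" using N by (simp add: sgn0_def FM(3))
    ultimately show ?thesis using chi_poisson[OF FM(1), of n] N(2) FM(3) by simp
  qed
  have "of_nat qn ^ (m + 1) * SS S N n = (\<Sum>F\<in>MS S {} N. tau N * (\<Sum>k\<in>Mn m. GS k F))"
    unfolding SS_def sum_distrib_left[of _ _ "MS S {} N"] using F by (rule sum.cong[OF refl])
  also have "\<dots> = tau N * (\<Sum>k\<in>Mn m. AY S {} k N)" unfolding AY_def sum_distrib_left[symmetric] by (subst sum.swap) (rule refl)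
  finally have "q ^ (m + 1) * norm (SS S N n) = norm (tau N) * norm (\<Sum>k\<in>Mn m. AY S {} k N)"
    using arg_cong[of _ _ norm] by (metis norm_mult norm_of_nat norm_power)
  also have "\<dots> \<le> q powr (1/2) * (\<Sum>k\<in>{k \<in> Mn m. rad S pdivides k}. 6 ^ card S * C1 * q powr (4/3 * real N + real m / 12 + 1/2 - 5/4 * real d))"
  proof (rule mult_mono)
    show "norm (tau N) \<le> q powr (1/2)" using tau_norm[of N] q by (simp add: powr_half_sqrt)
    have "norm (\<Sum>k\<in>Mn m. AY S {} k N) \<le> (\<Sum>k\<in>Mn m. if rad S pdivides k then 6 ^ card S * C1 * q powr (4/3 * real N + real m / 12 + 1/2 - 5/4 * real d) else 0)"
    proof (rule sum_norm_le)
      fix k assume k: "k \<in> Mn m"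
      note kM = Mn_M[OF k] Mn_deg_eq[OF k] Mn_C[OF k]
      show "norm (AY S {} k N) \<le> (if rad S pdivides k then 6 ^ card S * C1 * q powr (4/3 * real N + real m / 12 + 1/2 - 5/4 * real d) else 0)"
      proof (cases "rad S pdivides k")
        case True
        have "norm (AY S {} k N) \<le> 6 ^ card S * 2 ^ card ({} :: 'a list set) * q powr (-5/4 * (\<Sum>P\<in>S. deg P)) * UU k N"
          using AY_bound[OF SP(1,2), of "{}" k N] kM by simp
        also have "\<dots> = 6 ^ card S * C1 * (q powr (-5/4 * real d) * q powr (4/3 * real N + real m / 12 + 1/2))"
          using SP(3) by (simp add: UU_def kM(2) dg_def[symmetric] del: of_nat_sum)
        also have "q powr (-5/4 * real d) * q powr (4/3 * real N + real m / 12 + 1/2) = q powr (4/3 * real N + real m / 12 + 1/2 - 5/4 * real d)"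
          unfolding powr_add[symmetric] by (rule arg_cong[of _ _ "\<lambda>x. q powr x"]) simp
        finally show ?thesis using True by simp
      next
        case False
        then obtain P where "P \<in> S" "\<not> P pdivides k" using rad_props(4)[OF S kM(3)] by blast
        then have "AY S {} k N = 0" using SP kM by (intro AY_zero) simp_all
        then show ?thesis using False by simp
      qed
    qed
    also have "\<dots> = (\<Sum>k\<in>{k \<in> Mn m. rad S pdivides k}. 6 ^ card S * C1 * q powr (4/3 * real N + real m / 12 + 1/2 - 5/4 * real d))"
      by (rule sum.inter_filter[symmetric]) simp
    finally show "norm (\<Sum>k\<in>Mn m. AY S {} k N) \<le> (\<Sum>k\<in>{k \<in> Mn m. rad S pdivides k}. 6 ^ card S * C1 * q powr (4/3 * real N + real m / 12 + 1/2 - 5/4 * real d))" .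
  qed simp_all
  also have "\<dots> = (if d \<le> m then q ^ (m + 1) * (6 ^ card S * C1 * q powr (4/3 * real N + real m / 12 - 9/4 * real d)) else 0)"
  proof (cases "d \<le> m")
    case True
    have "real (card {k \<in> Mn m. rad S pdivides k}) = q powr (real m - real d)"
      using card_multiples[OF rad_props(1)[OF S], of m] rad_props(2)[OF S] True q by (simp add: powr_realpow[symmetric] of_nat_diff)
    then have "q powr (1/2) * (\<Sum>k\<in>{k \<in> Mn m. rad S pdivides k}. 6 ^ card S * C1 * q powr (4/3 * real N + real m / 12 + 1/2 - 5/4 * real d))
      = 6 ^ card S * C1 * (q powr (1/2) * q powr (real m - real d) * q powr (4/3 * real N + real m / 12 + 1/2 - 5/4 * real d))" by simp
    also have "q powr (1/2) * q powr (real m - real d) * q powr (4/3 * real N + real m / 12 + 1/2 - 5/4 * real d) = q powr (real (m + 1)) * q powr (4/3 * real N + real m / 12 - 9/4 * real d)"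
      unfolding powr_add[symmetric] by (rule arg_cong[of _ _ "\<lambda>x. q powr x"]) simp
    finally show ?thesis using True q by (simp add: powr_realpow[of q "m + 1", simplified])
  next
    case False
    then have "{k \<in> Mn m. rad S pdivides k} = {}"
      using dvd_multiples[OF rad_props(1)[OF S], of m] rad_props(2)[OF S] by simp
    then show ?thesis using False by simp
  qed
  also have "\<dots> = q ^ (m + 1) * (if d \<le> m then 6 ^ card S * C1 * q powr (4/3 * real N + real m / 12 - 9/4 * real d) else 0)" by simp
  finally show ?thesis by (rule mult_left_le_imp_le) (use q in simp)
qed

text \<open>There are q^i frequencies of degree i and each carries q^(i/12) from \<open>UU\<close>,
  hence 13/12; the factor q bounds \<open>sgn0\<close>.\<close>

lemma geom_up: fixes L :: nat shows "q * (\<Sum>i<L. q powr (13/12 * i)) \<le> 2 * q powr (13/12 * L)"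
proof (induct L)
  case (Suc L)
  have q: "7 \<le> q" by (rule q_ge7)
  have "q * (\<Sum>i<Suc L. q powr (13/12 * i)) \<le> (2 + q) * q powr (13/12 * L)" using Suc by (simp add: algebra_simps)
  also have "\<dots> \<le> (2 * q powr 1) * q powr (13/12 * L)" using q by (intro mult_right_mono) simp_all
  also have "\<dots> \<le> (2 * q powr (13/12)) * q powr (13/12 * L)" by (intro mult_right_mono mult_left_mono q_powr_le) simp_all
  also have "\<dots> = 2 * q powr (13/12 * Suc L)" by (simp add: powr_add[symmetric] distrib_left add_divide_distrib)
  finally show ?case .
qed simp

text \<open>Poisson summation over the cofactor of \<open>D\<^sup>2\<close> in \<open>F\<close>, modulo \<open>f\<close>.\<close>

lemma rep2:
  fixes m :: nat
  assumes S: "S \<in> PS d" and N: "2 * d \<le> N" "N < 2 * d + n" "N = n + m + 1"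
  shows "norm (SS S N n) \<le> q powr (n / 3 + real N - 2 * d) + 3 * 2 ^ card S * C1 * q powr (4/3 * n + (3 * real d - m - 2) / 12)"
proof -
  note SP = PS_D[OF S]
  define D where "D = rad S"
  have D: "D \<in> M" "D \<in> C" "deg D = d" "pd D = S" using rad_props(1-3)[OF S] by (simp_all add: D_def)
  note q = q_gt1
  define w where "w = n - (N - 2 * d)"
  have w: "1 \<le> w" "real w = 2 * real d - real m - 1" using N by (simp_all add: w_def of_nat_diff)
  have cop: "cop D f \<longleftrightarrow> (\<forall>P\<in>S. \<not> P pdivides f)" if "f \<in> M" for f
  proof -
    have "cop D f \<longleftrightarrow> cop f D" by (rule cop_sym)
    also have "\<dots> \<longleftrightarrow> (\<forall>P\<in>\<P>. P pdivides D \<longrightarrow> \<not> P pdivides f)" using cop_iff_primes[OF D(1), of f] that by simp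
    also have "\<dots> \<longleftrightarrow> (\<forall>P\<in>pd D. \<not> P pdivides f)" unfolding pd_def by blast
    finally show ?thesis unfolding D(4) .
  qed
  \<comment> \<open>By reciprocity \<open>chi D f ^ 2\<close> is the conjugate of
    \<open>chi f D\<close>, which moves D into the frequency. Its vanishing for f not prime to D
    becomes the local condition at \<open>S\<close>.\<close>
  have tw: "(\<Sum>f\<in>Mn n. chi D f ^ 2 * GS l f) = AY {} S (D *. l) n" if l: "l \<in> M" for l
  proof -
    have "(\<Sum>f\<in>Mn n. chi D f ^ 2 * GS l f) = (\<Sum>f\<in>Mn n. if \<forall>P\<in>S. \<not> P pdivides f then GS (D *. l) f else 0)"
    proof (rule sum.cong[OF refl])
      fix f assume "f \<in> Mn n"
      then have f: "f \<in> M" "f \<in> C" using Mn_M[of f n] by simp_all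
      show "chi D f ^ 2 * GS l f = (if \<forall>P\<in>S. \<not> P pdivides f then GS (D *. l) f else 0)"
      proof (cases "cop D f")
        case True
        have "chi D f ^ 2 = cnj (chi f D)" using chi_cnj[OF D(1) cop_symI[OF True]] chi_recip[OF D(1) f(1)] by simp
        then show ?thesis using GS_scale[OF f(1) _ True, of l] l cop[OF f(1)] True by simp
      next
        case False
        then have "\<not> cop f D" using cop_symI by blast
        then have "chi D f = 0" using chi_zero[OF D(1) f(2)] by simp
        moreover have "\<not> (\<forall>P\<in>S. \<not> P pdivides f)" using False cop[OF f(1)] by blast
        ultimately show ?thesis by (simp only: if_False) simp
      qed
    qed
    also have "\<dots> = (\<Sum>f\<in>{f \<in> Mn n. \<forall>P\<in>S. \<not> P pdivides f}. GS (D *. l) f)" by (rule sum.inter_filter[symmetric]) simp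
    finally show ?thesis by (simp add: AY_def MS_def)
  qed
  have "SS S N n = (\<Sum>f\<in>Mn n. chi D f ^ 2 * (\<Sum>F\<in>Mn (N - 2 * d). chi f F))"
    unfolding SS_def sum.swap[of _ "Mn n"] D_def by (rule sum.cong[OF refl]) (rule sum_MS[OF S N(1)], rule Mn_M)
  then have "of_nat qn ^ w * SS S N n = (\<Sum>f\<in>Mn n. chi D f ^ 2 * (of_nat qn ^ w * (\<Sum>F\<in>Mn (N - 2 * d). chi f F)))"
    by (simp only: sum_distrib_left mult.left_commute)
  also have "\<dots> = (\<Sum>f\<in>Mn n. chi D f ^ 2 * (GS [] f + sgn0 n * (\<Sum>i<w - 1. \<Sum>l\<in>Mn i. GS l f) + tau n * (\<Sum>l\<in>Mn (w - 1). GS l f)))"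
  proof (rule sum.cong[OF refl])
    fix f assume f: "f \<in> Mn n"
    have "of_nat qn ^ w * (\<Sum>F\<in>Mn (N - 2 * d). chi f F) = GS [] f + sgn0 n * (\<Sum>i<w - 1. \<Sum>l\<in>Mn i. GS l f) + tau n * (\<Sum>l\<in>Mn (w - 1). GS l f)"
      using chi_poisson[OF Mn_M[OF f], of "N - 2 * d"] w(1) unfolding Mn_deg_eq[OF f] w_def by simp
    then show "chi D f ^ 2 * (of_nat qn ^ w * (\<Sum>F\<in>Mn (N - 2 * d). chi f F)) = chi D f ^ 2 * (GS [] f + sgn0 n * (\<Sum>i<w - 1. \<Sum>l\<in>Mn i. GS l f) + tau n * (\<Sum>l\<in>Mn (w - 1). GS l f))"
      by (rule arg_cong)
  qed
  also have "\<dots> = (\<Sum>f\<in>Mn n. chi D f ^ 2 * GS [] f) + sgn0 n * (\<Sum>i<w - 1. \<Sum>l\<in>Mn i. \<Sum>f\<in>Mn n. chi D f ^ 2 * GS l f) + tau n * (\<Sum>l\<in>Mn (w - 1). \<Sum>f\<in>Mn n. chi D f ^ 2 * GS l f)"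
  proof -
    have 1: "(\<Sum>i<w - 1. \<Sum>l\<in>Mn i. \<Sum>f\<in>Mn n. chi D f ^ 2 * GS l f) = (\<Sum>f\<in>Mn n. \<Sum>i<w - 1. \<Sum>l\<in>Mn i. chi D f ^ 2 * GS l f)"
      unfolding sum.swap[of _ "{..<w - 1}" "Mn n"] by (intro sum.cong refl sum.swap)
    have 2: "(\<Sum>l\<in>Mn (w - 1). \<Sum>f\<in>Mn n. chi D f ^ 2 * GS l f) = (\<Sum>f\<in>Mn n. \<Sum>l\<in>Mn (w - 1). chi D f ^ 2 * GS l f)" by (rule sum.swap)
    show ?thesis unfolding 1 2 by (simp add: sum_distrib_left distrib_left sum.distrib mult_ac)
  qed
  also have "\<dots> = (\<Sum>f\<in>Mn n. chi D f ^ 2 * GS [] f) + sgn0 n * (\<Sum>i<w - 1. \<Sum>l\<in>Mn i. AY {} S (D *. l) n) + tau n * (\<Sum>l\<in>Mn (w - 1). AY {} S (D *. l) n)"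
  proof -
    have 1: "(\<Sum>l\<in>Mn i. \<Sum>f\<in>Mn n. chi D f ^ 2 * GS l f) = (\<Sum>l\<in>Mn i. AY {} S (D *. l) n)" for i
      by (rule sum.cong[OF refl]) (rule tw, rule Mn_M)
    show ?thesis unfolding 1 by (rule refl)
  qed
  finally have eq: "of_nat qn ^ w * SS S N n = \<dots>" .
  define V where "V = 2 ^ card S * C1 * q powr (4/3 * n + d / 12 + 1/2)"
  have V: "0 \<le> V" using C1_pos by (simp add: V_def)
  have Vi: "norm (\<Sum>l\<in>Mn i. AY {} S (D *. l) n) \<le> V * q powr (13/12 * i)" for i
  proof -
    have "norm (\<Sum>l\<in>Mn i. AY {} S (D *. l) n) \<le> (\<Sum>l\<in>Mn i. V * q powr (i / 12))"
    proof (rule sum_norm_le)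
      fix l assume l: "l \<in> Mn i"
      note lM = Mn_M[OF l] Mn_deg_eq[OF l]
      have "norm (AY {} S (D *. l) n) \<le> 2 ^ card S * UU (D *. l) n" using AY_S'_bound[OF SP(1,2)] D lM by simp
      also have "\<dots> = 2 ^ card S * C1 * q powr ((4/3 * n + d / 12 + 1/2) + i / 12)" using D lM by (simp add: UU_def add_divide_distrib add_ac)
      also have "\<dots> = V * q powr (i / 12)" unfolding V_def powr_add[of q _ "real i / 12"] by simp
      finally show "norm (AY {} S (D *. l) n) \<le> V * q powr (i / 12)" .
    qed
    also have "\<dots> = V * (q powr i * q powr (i / 12))" using q by (simp add: card_Mn powr_realpow)
    also have "q powr i * q powr (i / 12) = q powr (13/12 * i)" by (simp add: powr_add[symmetric])
    finally show ?thesis .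
  qed
  have n1: "norm (\<Sum>f\<in>Mn n. chi D f ^ 2 * GS [] f) \<le> q powr n * q powr (n / 3)"
  proof -
    have "norm (\<Sum>f\<in>Mn n. chi D f ^ 2 * GS [] f) \<le> (\<Sum>f\<in>Mn n. if f \<in> cubes n then q ^ n else 0)"
    proof (rule sum_norm_le)
      fix f assume f: "f \<in> Mn n"
      have "norm (chi D f) ^ 2 \<le> 1" using chi_norm_le[OF D(1) Mn_C[OF f]] by (intro power_le_one) simp_all
      then have "norm (chi D f) ^ 2 * norm (GS [] f) \<le> 1 * norm (GS [] f)" by (rule mult_right_mono) simp
      then show "norm (chi D f ^ 2 * GS [] f) \<le> (if f \<in> cubes n then q ^ n else 0)"
        unfolding norm_mult norm_power using GS_nil[OF f] by linarith
    qed
    also have "\<dots> = real (card (cubes n)) * q ^ n"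
    proof -
      have "{f \<in> Mn n. f \<in> cubes n} = cubes n" using cubes_Mn by blast
      then show ?thesis by (simp add: sum.inter_filter[symmetric])
    qed
    also have "\<dots> \<le> q powr (n / 3) * q powr n" using card_cubes_powr[of n] q by (intro mult_mono) (simp_all add: powr_realpow)
    finally show ?thesis by (simp add: mult.commute)
  qed
  have n2: "norm (sgn0 n * (\<Sum>i<w - 1. \<Sum>l\<in>Mn i. AY {} S (D *. l) n)) \<le> 2 * (V * q powr (13/12 * real (w - 1)))"
  proof -
    have "norm (sgn0 n * (\<Sum>i<w - 1. \<Sum>l\<in>Mn i. AY {} S (D *. l) n)) \<le> q * (\<Sum>i<w - 1. V * q powr (13/12 * i))"
      unfolding norm_mult
    proof (rule mult_mono)
      show "norm (sgn0 n) \<le> q" using sgn0_norm[of n] by linarith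
      show "norm (\<Sum>i<w - 1. \<Sum>l\<in>Mn i. AY {} S (D *. l) n) \<le> (\<Sum>i<w - 1. V * q powr (13/12 * i))" by (rule sum_norm_le) (rule Vi)
    qed (use q in simp_all)
    also have "\<dots> = V * (q * (\<Sum>i<w - 1. q powr (13/12 * i)))" by (simp add: sum_distrib_left mult_ac)
    also have "\<dots> \<le> V * (2 * q powr (13/12 * real (w - 1)))" by (rule mult_left_mono[OF geom_up V])
    finally show ?thesis by simp
  qed
  have n3: "norm (tau n * (\<Sum>l\<in>Mn (w - 1). AY {} S (D *. l) n)) \<le> q powr (1/2) * (V * q powr (13/12 * real (w - 1)))"
    unfolding norm_mult using tau_norm[of n] Vi[of "w - 1"] q by (intro mult_mono) (simp_all add: powr_half_sqrt)
  have "2 * (V * q powr (13/12 * real (w - 1))) \<le> 2 * q powr (1/2) * (V * q powr (13/12 * real (w - 1)))"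
  proof -
    have "q powr 0 \<le> q powr (1/2)" by (rule q_powr_le) simp
    then have "1 \<le> q powr (1/2)" using q by simp
    then have "1 * (V * q powr (13/12 * real (w - 1))) \<le> q powr (1/2) * (V * q powr (13/12 * real (w - 1)))" using V by (intro mult_right_mono) simp_all
    then show ?thesis by linarith
  qed
  then have "norm (of_nat qn ^ w * SS S N n) \<le> q powr n * q powr (n / 3) + 3 * q powr (1/2) * (V * q powr (13/12 * real (w - 1)))"
    unfolding eq using n1 n2 n3
    by (intro order_trans[OF norm_triangle_ineq] order_trans[OF add_right_mono[OF norm_triangle_ineq]]) linarith
  then have "q powr w * norm (SS S N n) \<le> q powr n * q powr (n / 3) + 3 * q powr (1/2) * (V * q powr (13/12 * real (w - 1)))"
    using q by (simp add: norm_mult norm_power powr_realpow)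
  then have "q powr (- real w) * (q powr w * norm (SS S N n)) \<le> q powr (- real w) * (q powr n * q powr (n / 3) + 3 * q powr (1/2) * (V * q powr (13/12 * real (w - 1))))"
    by (rule mult_left_mono) simp
  moreover have "q powr (- real w) * (q powr w * norm (SS S N n)) = norm (SS S N n)" using q by (simp add: mult.assoc[symmetric] powr_add[symmetric])
  moreover have "q powr (- real w) * (q powr n * q powr (n / 3) + 3 * q powr (1/2) * (V * q powr (13/12 * real (w - 1)))) =
    q powr (- real w) * q powr n * q powr (n / 3) + 3 * 2 ^ card S * C1 * (q powr (- real w) * q powr (1/2) * q powr (4/3 * n + d / 12 + 1/2) * q powr (13/12 * real (w - 1)))"
    by (simp add: V_def algebra_simps)
  moreover have "q powr (- real w) * q powr n * q powr (n / 3) = q powr (n / 3 + real N - 2 * d)"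
    unfolding powr_add[symmetric] by (rule arg_cong[of _ _ "\<lambda>x. q powr x"]) (simp add: w(2) N(3))
  moreover have "q powr (- real w) * q powr (1/2) * q powr (4/3 * n + d / 12 + 1/2) * q powr (13/12 * real (w - 1)) = q powr (4/3 * n + (3 * real d - m - 2) / 12)"
    unfolding powr_add[symmetric] using w by (intro arg_cong[of _ _ "\<lambda>x. q powr x"]) (simp add: of_nat_diff field_simps)
  ultimately show ?thesis by simp
qed

end

text \<open>4 + 3 C1 consists of 3 + 3 C1 from \<open>TT_noncube\<close> and 1 from
  \<open>TC_bound\<close>; the factor 2 comes from dividing by \<open>card (SF N)\<close>, which is
  at least q^N / 2.\<close>

definition C2 :: real where "C2 = 2 * (4 + 3 * C1)"
lemma C2_pos: "0 < C2" using C1_pos by (simp add: C2_def)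

context cubic_field begin

definition TT :: "nat \<Rightarrow> nat \<Rightarrow> complex" where "TT N n = (\<Sum>F\<in>SF N. \<Sum>f\<in>Mn n. chi F f)"
definition TC :: "nat \<Rightarrow> nat \<Rightarrow> complex" where "TC N n = (\<Sum>F\<in>SF N. \<Sum>f\<in>cubes n. chi F f)"
text \<open>After division by the number of F, the cubes of degree 3 k contribute
  \<open>aa k\<close> up to a small error.\<close>

definition aa :: "nat \<Rightarrow> real" where "aa k = (\<Sum>h\<in>Mn k. sig (pd h))"

text \<open>The two estimates balance at \<open>15 d = 9 m + 4\<close>.\<close>

lemma SS_bound:
  fixes g m :: nat
  assumes S: "S \<in> PS d" and N: "N = 3 * g + 1" "N = n + m + 1" and d: "m + 1 < 2 * d" "2 * d \<le> N"
  shows "norm (SS S N n) \<le> (if d \<le> m then 6 ^ card S * ((1 + 3 * C1) * q powr (real N - d + real g - 2/3 * m)) else 0)"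
proof (cases "d \<le> m")
  case False
  have "N mod 3 = 1" by (simp add: N(1))
  then show ?thesis using rep1[OF S _ N(2)] False by simp
next
  case True
  define E where "E = real N - d + real g - 2/3 * m"
  have n: "real n = 3 * real g - real m" "real N = 3 * real g + 1" using N by simp_all
  show ?thesis
  \<comment> \<open>For large d the decay in d of \<open>rep1\<close> suffices, for small d the
    short dual sum of \<open>rep2\<close>.\<close>
  proof (cases "9 * m + 4 \<le> 15 * d")
    case c: True
    then have c': "9 * real m + 4 \<le> 15 * real d" by linarith
    have "N mod 3 = 1" by (simp add: N(1))
    then have "norm (SS S N n) \<le> 6 ^ card S * C1 * q powr (4/3 * N + m / 12 - 9/4 * d)" using rep1[OF S _ N(2)] True by simp
    also have "\<dots> \<le> 6 ^ card S * (1 + 3 * C1) * q powr E"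
      unfolding E_def n using c' C1_pos by (intro mult_mono q_powr_le) (simp_all add: field_simps)
    finally show ?thesis using True by (simp add: E_def mult.assoc)
  next
    case False
    then have c': "15 * real d \<le> 9 * real m + 4" by linarith
    have "norm (SS S N n) \<le> q powr (n / 3 + real N - 2 * real d) + 3 * 2 ^ card S * C1 * q powr (4/3 * n + (3 * real d - m - 2) / 12)"
      using d N by (intro rep2[OF S]) simp_all
    also have "\<dots> \<le> 6 ^ card S * q powr E + 3 * 6 ^ card S * C1 * q powr E"
    proof (rule add_mono)
      have "q powr (n / 3 + real N - 2 * real d) \<le> q powr E" unfolding E_def n using d by (intro q_powr_le) (simp add: field_simps)
      also have "\<dots> \<le> 6 ^ card S * q powr E" using mult_right_mono[of 1 "6 ^ card S" "q powr E"] by simp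
      finally show "q powr (n / 3 + real N - 2 * real d) \<le> 6 ^ card S * q powr E" .
      show "3 * 2 ^ card S * C1 * q powr (4/3 * n + (3 * real d - m - 2) / 12) \<le> 3 * 6 ^ card S * C1 * q powr E"
        unfolding E_def n using c' C1_pos by (intro mult_mono q_powr_le power_mono) (simp_all add: field_simps)
    qed
    finally show ?thesis using True by (simp add: E_def algebra_simps)
  qed
qed

text \<open>The sieve is applied to the noncubes because complete sums vanish only for them. Poisson
  summation needs all f of degree n, so in the remaining range of d the cubes are subtracted again
  and bounded trivially. The weights \<open>6 ^ card S\<close> sum to at most (m + 1)^5 q^d by
  \<open>PS_weight\<close>, and the range d <= m gives the sixth power.\<close>

lemma TT_noncube:
  fixes g m :: nat
  assumes N: "N = 3 * g + 1" "N = n + m + 1"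
  shows "norm (TT N n - TC N n) \<le> (3 + 3 * C1) * (real m + 1) ^ 6 * (q powr N * q powr (real g - 2/3 * m))"
proof -
  note q = q_gt1
  define G where "G = q powr N * q powr (real g - 2/3 * m)"
  have G: "0 \<le> G" by (simp add: G_def)
  have n: "real n = 3 * real g - real m" "real N = 3 * real g + 1" using N by simp_all
  define RR where "RR S = (\<Sum>F\<in>MS S {} N. \<Sum>f\<in>Mn n - cubes n. chi F f)" for S
  define CC where "CC S = (\<Sum>F\<in>MS S {} N. \<Sum>f\<in>cubes n. chi F f)" for S
  have sub: "(\<Sum>f\<in>Mn n. chi F f) - (\<Sum>f\<in>cubes n. chi F f) = (\<Sum>f\<in>Mn n - cubes n. chi F f)" for F
    by (rule sum_diff[OF finite_Mn cubes_Mn, symmetric])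
  have "TT N n - TC N n = (\<Sum>F\<in>SF N. \<Sum>f\<in>Mn n - cubes n. chi F f)"
    unfolding TT_def TC_def sum_subtractf[symmetric] sub by (rule refl)
  also have "\<dots> = (\<Sum>d\<le>N. \<Sum>S\<in>PS d. (-1) ^ card S * RR S)" unfolding sieve_SF RR_def by (rule refl)
  finally have eq: "TT N n - TC N n = \<dots>" .
  have RC: "RR S = SS S N n - CC S" for S unfolding RR_def SS_def CC_def sum_subtractf[symmetric] sub by (rule refl)
  have R0: "RR S = 0" if "S \<in> PS d" "\<not> (m + 1 < 2 * d \<and> 2 * d \<le> N)" for S d
  proof (cases "2 * d \<le> N")
    case True
    then have "2 * d + n \<le> N" using that(2) N by linarith
    then have "(\<Sum>F\<in>MS S {} N. chi F f) = 0" if "f \<in> Mn n - cubes n" for f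
      using complete_zero[OF \<open>S \<in> PS d\<close>, of n N f] that by simp
    then show ?thesis unfolding RR_def by (subst sum.swap) simp
  next
    case False
    then have "MS S {} N = {}" using card_MS[OF that(1), of N] by simp
    then show ?thesis by (simp add: RR_def)
  qed
  have CCb: "norm (CC S) \<le> q powr N * q powr (n / 3) * (1 / q) ^ d * (1 / q) ^ d" if S: "S \<in> PS d" and d: "2 * d \<le> N" for S d
  proof -
    have "norm (CC S) \<le> (\<Sum>F\<in>MS S {} N. real (card (cubes n)))"
      unfolding CC_def
    proof (rule sum_norm_le)
      fix F assume "F \<in> MS S {} N"
      then have F: "F \<in> M" by (rule MS_M)
      have "norm (\<Sum>f\<in>cubes n. chi F f) \<le> (\<Sum>f\<in>cubes n. 1)"
        using chi_norm_le[OF F] cubes_Mn Mn_C by (intro sum_norm_le) blast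
      then show "norm (\<Sum>f\<in>cubes n. chi F f) \<le> real (card (cubes n))" by simp
    qed
    also have "\<dots> = q powr (real N - 2 * d) * real (card (cubes n))" using card_MS[OF S, of N] d q by (simp add: powr_realpow[symmetric] of_nat_diff)
    also have "\<dots> \<le> q powr (real N - 2 * d) * q powr (n / 3)" using card_cubes_powr by (intro mult_left_mono) simp_all
    also have "q powr (real N - 2 * d) = q powr N * ((1 / q) ^ d * (1 / q) ^ d)"
    proof -
      have "(1 / q) ^ d = q powr (- real d)" using q by (simp add: powr_minus_divide powr_realpow power_one_over)
      then show ?thesis by (simp add: powr_add[symmetric])
    qed
    finally show ?thesis by (simp add: mult_ac)
  qed
  \<comment> \<open>\<open>(m + 3) div 2\<close> is the least d with m + 1 < 2 d.\<close>
  have dterm: "norm (\<Sum>S\<in>PS d. (-1) ^ card S * RR S) \<le> (if d \<le> m then (real m + 1) ^ 5 * ((1 + 3 * C1) * G) else 0) + (if (m + 3) div 2 \<le> d then q powr N * q powr (n / 3) * (1 / q) ^ d else 0)" for d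
  proof (cases "m + 1 < 2 * d \<and> 2 * d \<le> N")
    case False
    then have "(\<Sum>S\<in>PS d. (-1) ^ card S * RR S) = 0" using R0 by (intro sum.neutral ballI) simp
    then show ?thesis using G C1_pos q by simp
  next
    case True
    have "norm (\<Sum>S\<in>PS d. (-1) ^ card S * RR S) \<le> (\<Sum>S\<in>PS d. norm (SS S N n) + norm (CC S))"
      unfolding RC by (intro sum_norm_le) (simp add: norm_mult norm_power norm_triangle_ineq4)
    also have "\<dots> = (\<Sum>S\<in>PS d. norm (SS S N n)) + (\<Sum>S\<in>PS d. norm (CC S))" by (rule sum.distrib)
    also have "\<dots> \<le> (if d \<le> m then (real m + 1) ^ 5 * ((1 + 3 * C1) * G) else 0) + q powr N * q powr (n / 3) * (1 / q) ^ d"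
    proof (rule add_mono)
      show "(\<Sum>S\<in>PS d. norm (SS S N n)) \<le> (if d \<le> m then (real m + 1) ^ 5 * ((1 + 3 * C1) * G) else 0)"
      proof (cases "d \<le> m")
        case dm: True
        define E where "E = (1 + 3 * C1) * q powr (real N - d + real g - 2/3 * m)"
        have E: "0 \<le> E" using C1_pos by (simp add: E_def)
        have "(\<Sum>S\<in>PS d. norm (SS S N n)) \<le> (\<Sum>S\<in>PS d. 6 ^ card S * E)"
          using SS_bound[OF _ N, of _ d] True dm by (intro sum_mono) (simp add: E_def)
        also have "\<dots> = (\<Sum>S\<in>PS d. (real 5 + 1) ^ card S) * E" by (simp add: sum_distrib_right)
        also have "\<dots> \<le> ((real d + 1) ^ 5 * q ^ d) * E" by (rule mult_right_mono[OF PS_weight E])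
        also have "\<dots> \<le> ((real m + 1) ^ 5 * q ^ d) * E" using dm E q by (intro mult_right_mono power_mono) simp_all
        also have "\<dots> = (real m + 1) ^ 5 * ((1 + 3 * C1) * (q powr d * q powr (real N - d + real g - 2/3 * m)))"
          using q by (simp add: E_def powr_realpow)
        also have "q powr d * q powr (real N - d + real g - 2/3 * m) = G"
          unfolding G_def powr_add[symmetric] by simp
        finally show ?thesis using dm by simp
      next
        case dm: False
        then have "SS S N n = 0" if "S \<in> PS d" for S using SS_bound[OF that N] True by simp
        then show ?thesis using dm by simp
      qed
      have "(\<Sum>S\<in>PS d. norm (CC S)) \<le> (\<Sum>S\<in>PS d. q powr N * q powr (n / 3) * (1 / q) ^ d * (1 / q) ^ d)"
        using CCb True by (intro sum_mono) blast
      also have "\<dots> = real (card (PS d)) * (1 / q) ^ d * (q powr N * q powr (n / 3) * (1 / q) ^ d)" by simp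
      also have "\<dots> \<le> 1 * (q powr N * q powr (n / 3) * (1 / q) ^ d)"
      proof (rule mult_right_mono)
        show "real (card (PS d)) * (1 / q) ^ d \<le> 1" using card_PS_le[of d] q by (simp add: power_one_over divide_le_eq)
      qed (use q in simp)
      finally show "(\<Sum>S\<in>PS d. norm (CC S)) \<le> q powr N * q powr (n / 3) * (1 / q) ^ d" by simp
    qed
    finally show ?thesis using True by auto
  qed
  have "norm (TT N n - TC N n) \<le> (\<Sum>d\<le>N. (if d \<le> m then (real m + 1) ^ 5 * ((1 + 3 * C1) * G) else 0) + (if (m + 3) div 2 \<le> d then q powr N * q powr (n / 3) * (1 / q) ^ d else 0))"
    unfolding eq by (rule sum_norm_le) (rule dterm)
  also have "\<dots> = (\<Sum>d\<le>N. if d \<le> m then (real m + 1) ^ 5 * ((1 + 3 * C1) * G) else 0) + q powr N * q powr (n / 3) * (\<Sum>d | d \<le> N \<and> (m + 3) div 2 \<le> d. (1 / q) ^ d)"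
  proof -
    have "(\<Sum>d\<le>N. if (m + 3) div 2 \<le> d then q powr N * q powr (n / 3) * (1 / q) ^ d else 0) = (\<Sum>d | d \<le> N \<and> (m + 3) div 2 \<le> d. q powr N * q powr (n / 3) * (1 / q) ^ d)"
      by (simp only: sum.inter_filter[OF finite_atMost, symmetric] atMost_iff)
    then show ?thesis by (simp only: sum.distrib sum_distrib_left)
  qed
  also have "\<dots> \<le> (real m + 1) * ((real m + 1) ^ 5 * ((1 + 3 * C1) * G)) + 2 * G"
  proof (rule add_mono)
    have "(\<Sum>d\<le>N. if d \<le> m then (real m + 1) ^ 5 * ((1 + 3 * C1) * G) else 0) = (\<Sum>d\<in>{d. d \<le> N \<and> d \<le> m}. (real m + 1) ^ 5 * ((1 + 3 * C1) * G))"
      by (simp only: sum.inter_filter[OF finite_atMost, symmetric] atMost_iff)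
    also have "{d. d \<le> N \<and> d \<le> m} = {..m}" using N(2) by auto
    finally show "(\<Sum>d\<le>N. if d \<le> m then (real m + 1) ^ 5 * ((1 + 3 * C1) * G) else 0) \<le> (real m + 1) * ((real m + 1) ^ 5 * ((1 + 3 * C1) * G))" by (simp add: add.commute)
    have "1 / q \<le> 1/2" using q_ge7 by (simp add: field_simps)
    then have "q powr N * q powr (n / 3) * (\<Sum>d | d \<le> N \<and> (m + 3) div 2 \<le> d. (1 / q) ^ d) \<le> q powr N * q powr (n / 3) * (2 * (1 / q) ^ ((m + 3) div 2))"
      using q by (intro mult_left_mono geom_le) simp_all
    also have "(1 / q) ^ ((m + 3) div 2) = q powr (- real ((m + 3) div 2))" using q by (simp add: powr_minus_divide powr_realpow power_one_over)
    also have "q powr N * q powr (n / 3) * (2 * q powr (- real ((m + 3) div 2))) = 2 * (q powr N * q powr (n / 3 - real ((m + 3) div 2)))"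
      using q by (simp add: powr_add powr_diff powr_minus_divide)
    also have "\<dots> \<le> 2 * G"
    proof -
      have "real m / 3 \<le> real ((m + 3) div 2)" by linarith
      then show ?thesis unfolding G_def n by (intro mult_left_mono q_powr_le) (simp_all add: field_simps)
    qed
    finally show "q powr N * q powr (n / 3) * (\<Sum>d | d \<le> N \<and> (m + 3) div 2 \<le> d. (1 / q) ^ d) \<le> 2 * G" .
  qed
  also have "\<dots> \<le> (real m + 1) ^ 6 * ((1 + 3 * C1) * G) + (real m + 1) ^ 6 * (2 * G)"
  proof (rule add_mono)
    show "(real m + 1) * ((real m + 1) ^ 5 * ((1 + 3 * C1) * G)) \<le> (real m + 1) ^ 6 * ((1 + 3 * C1) * G)"
      by (simp only: mult.assoc[symmetric] power_Suc[symmetric]) simp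
    have "1 ^ 6 \<le> (real m + 1) ^ 6" by (rule power_mono) simp_all
    then show "2 * G \<le> (real m + 1) ^ 6 * (2 * G)" using G mult_right_mono[of 1 "(real m + 1) ^ 6" "2 * G"] by simp
  qed
  also have "\<dots> = (3 + 3 * C1) * (real m + 1) ^ 6 * G" by (simp add: algebra_simps)
  finally show ?thesis by (simp add: G_def)
qed

lemma cube_inj: "h \<in> M \<Longrightarrow> h' \<in> M \<Longrightarrow> h ^. 3 = h' ^. 3 \<Longrightarrow> h = h'"
proof (induct h arbitrary: h' rule: monic_induct)
  case one
  have "deg (h' ^. 3) = 0" unfolding one(2)[symmetric] using deg_one by simp
  then have "deg h' = 0" using deg_pow[OF one(1), of 3] by simp
  then show ?case using deg_0_M one by blast
next
  case (mul p g)
  have p: "p \<in> M" "p \<in> C" using mul by simp_all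
  have "p pdivides ((p *. g) ^. 3)" using p mul by (intro dvdI[of "g *. (p *. g) ^. 2"]) (simp_all add: numeral_3_eq_3 numeral_2_eq_2 UP.m_ac)
  then have "p pdivides h'" using mul prime_dvd_pow[OF mul(1), of h' 3] by simp
  then obtain g' where g': "g' \<in> M" "h' = p *. g'" using M_dvd_monic[OF p(1) mul(4)] by blast
  have "p ^. 3 *. g ^. 3 = p ^. 3 *. g' ^. 3" using mul g' p by (simp only: UP.nat_pow_distrib[symmetric] M_C)
  then have "g ^. 3 = g' ^. 3" using M_cancel[of "p ^. 3"] p mul(2) g'(1) by simp
  then show ?case using mul(3)[OF g'(1)] g' by simp
qed

text \<open>\<open>chi F\<close> is 1 on the cube of a polynomial prime to F and 0 on the other
  cubes.\<close>

lemma TC_eq: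
  assumes "n mod 3 = 0" shows "TC N n = of_real (\<Sum>h\<in>Mn (n div 3). real (card (sT (pd h) N)))"
proof -
  have inj: "inj_on (\<lambda>h. h ^. 3) (Mn (n div 3))" by (rule inj_onI) (rule cube_inj, (erule Mn_M)+)
  have "TC N n = (\<Sum>F\<in>SF N. \<Sum>h\<in>Mn (n div 3). chi F (h ^. 3))"
    unfolding TC_def cubes_eq if_P[OF assms] sum.reindex[OF inj] by simp
  also have "\<dots> = (\<Sum>h\<in>Mn (n div 3). \<Sum>F\<in>SF N. chi F (h ^. 3))" by (rule sum.swap)
  also have "\<dots> = (\<Sum>h\<in>Mn (n div 3). of_nat (card (sT (pd h) N)))"
  proof (rule sum.cong[OF refl])
    fix h assume "h \<in> Mn (n div 3)"
    then have h: "h \<in> M" "h \<in> C" using Mn_M[of h] by simp_all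
    have "(\<Sum>F\<in>SF N. chi F (h ^. 3)) = (\<Sum>F\<in>SF N. if \<forall>P\<in>pd h. \<not> P pdivides F then 1 else 0)"
    proof (rule sum.cong[OF refl])
      fix F assume "F \<in> SF N"
      then have F: "F \<in> M" "F \<in> C" using Mn_M[OF SF_Mn[of F N]] by simp_all
      have c: "chi F (h ^. 3) = chi h F ^ 3" using chi_recip[OF F(1), of "h ^. 3"] chi_pow[OF h(1)] h by simp
      have "cop F h \<longleftrightarrow> (\<forall>P\<in>pd h. \<not> P pdivides F)" using cop_iff_primes[OF h(1) F(2)] unfolding pd_def by blast
      then show "chi F (h ^. 3) = (if \<forall>P\<in>pd h. \<not> P pdivides F then 1 else 0)"
        unfolding c using chi_cube[OF h(1), of F] chi_zero[OF h(1) F(2)] by (cases "cop F h") simp_all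
    qed
    also have "\<dots> = of_nat (card {F \<in> SF N. \<forall>P\<in>pd h. \<not> P pdivides F})" by (simp add: sum.inter_filter[symmetric])
    finally show "(\<Sum>F\<in>SF N. chi F (h ^. 3)) = of_nat (card (sT (pd h) N))" by (simp add: sT_def)
  qed
  finally show ?thesis by simp
qed

lemma card_pd_le: "h \<in> Mn k \<Longrightarrow> card (pd h) \<le> k"
proof -
  assume h: "h \<in> Mn k"
  have "card (pd h) = (\<Sum>P\<in>pd h. 1)" by simp
  also have "\<dots> \<le> dg (pd h)" unfolding dg_def using pd_subset deg_prime by (intro sum_mono) blast
  also have "\<dots> \<le> k" using dg_pd_le[OF h order_refl] by simp
  finally show ?thesis .
qed

text \<open>A polynomial of degree k has at most k primes and 2^k <= q^(k/2). Summed over q^k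
  polynomials, the relative error of \<open>sT_bound\<close> is q^(3k/2 - N/2), which is below the
  target because m = 3 g - 3 k.\<close>

lemma TC_bound:
  fixes g m :: nat
  assumes N: "N = 3 * g + 1" "N = n + m + 1"
  shows "norm (TC N n - (if n mod 3 = 0 then of_real (q ^ N * (1 - 1 / q) * aa (n div 3)) else 0)) \<le> q powr N * q powr (real g - 2/3 * m)"
proof (cases "n mod 3 = 0")
  case False
  then show ?thesis by (simp add: TC_def cubes_eq)
next
  case True
  define k where "k = n div 3"
  note q = q_gt1
  have n: "real n = 3 * real k" "real m = 3 * real g - 3 * real k" using True N by (auto simp: k_def)
  have two: "2 \<le> q powr (1/2)"
  proof -
    have "2 = 4 powr (1/2 :: real)" using powr_half_sqrt[of 4] by simp
    also have "\<dots> \<le> q powr (1/2)" using q_ge7 by (intro powr_mono2) simp_all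
    finally show ?thesis .
  qed
  have "norm (TC N n - of_real (q ^ N * (1 - 1 / q) * aa k)) = \<bar>\<Sum>h\<in>Mn k. real (card (sT (pd h) N)) - q ^ N * (1 - 1 / q) * sig (pd h)\<bar>"
    unfolding TC_eq[OF True] k_def[symmetric] of_real_diff[symmetric] norm_of_real aa_def sum_distrib_left sum_subtractf[symmetric] by (rule refl)
  also have "\<dots> \<le> (\<Sum>h\<in>Mn k. q powr N * ((q powr (1/2)) ^ k * q powr (- real N / 2)))"
  proof (rule order_trans[OF sum_abs sum_mono])
    fix h assume h: "h \<in> Mn k"
    have "real (card (sT (pd h) N)) - q ^ N * (1 - 1 / q) * sig (pd h) = q ^ N * (card (sT (pd h) N) / q ^ N - (1 - 1 / q) * sig (pd h))"
      using q by (simp add: right_diff_distrib)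
    then have "\<bar>real (card (sT (pd h) N)) - q ^ N * (1 - 1 / q) * sig (pd h)\<bar> = q powr N * \<bar>card (sT (pd h) N) / q ^ N - (1 - 1 / q) * sig (pd h)\<bar>"
      using q by (simp add: abs_mult powr_realpow)
    also have "\<dots> \<le> q powr N * (2 ^ card (pd h) * q powr (- real N / 2))"
      using sT_bound[OF finite_pd[OF Mn_M[OF h]] pd_subset] by (intro mult_left_mono) simp_all
    also have "\<dots> \<le> q powr N * ((q powr (1/2)) ^ k * q powr (- real N / 2))"
    proof (intro mult_left_mono mult_right_mono)
      have "2 ^ card (pd h) \<le> (2 :: real) ^ k" using card_pd_le[OF h] by (rule power_increasing) simp
      also have "\<dots> \<le> (q powr (1/2)) ^ k" using two by (rule power_mono) simp
      finally show "2 ^ card (pd h) \<le> (q powr (1/2)) ^ k" .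
    qed simp_all
    finally show "\<bar>real (card (sT (pd h) N)) - q ^ N * (1 - 1 / q) * sig (pd h)\<bar> \<le> q powr N * ((q powr (1/2)) ^ k * q powr (- real N / 2))" .
  qed
  also have "\<dots> = q powr k * (q powr N * (q powr (1/2 * k) * q powr (- real N / 2)))"
    using q by (simp add: card_Mn powr_realpow q_powr_pow)
  also have "\<dots> = q powr N * (q powr k * q powr (1/2 * k) * q powr (- real N / 2))" by (simp add: mult_ac)
  also have "\<dots> \<le> q powr N * q powr (real g - 2/3 * m)"
    unfolding powr_add[symmetric] n(2) N(1) using n by (intro mult_left_mono q_powr_le) (simp_all add: field_simps)
  finally show ?thesis using True by (simp add: k_def)
qed

lemma card_SF_ge:
  assumes "1 \<le> (g::nat)" shows "real (card (SF (3 * g + 1))) = q ^ (3 * g + 1) * (1 - 1 / q)" "q ^ (3 * g + 1) / 2 \<le> real (card (SF (3 * g + 1)))"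
proof -
  have q: "1 < q" "2 \<le> q" using q_gt1 q_ge7 by simp_all
  have "q ^ (3 * g + 1) = q * q ^ (3 * g)" by simp
  then show e: "real (card (SF (3 * g + 1))) = q ^ (3 * g + 1) * (1 - 1 / q)" using assms q by (simp add: card_SF right_diff_distrib)
  have "1/2 \<le> 1 - 1 / q" using q by (simp add: field_simps)
  then have "q ^ (3 * g + 1) * (1/2) \<le> q ^ (3 * g + 1) * (1 - 1 / q)" using q by (intro mult_left_mono) simp_all
  then show "q ^ (3 * g + 1) / 2 \<le> real (card (SF (3 * g + 1)))" unfolding e by simp
qed

lemma TT_bound:
  fixes g m :: nat
  assumes g: "1 \<le> g" and m: "n + m = 3 * g"
  shows "norm (TT (3 * g + 1) n / of_nat (card (SF (3 * g + 1))) - (if n mod 3 = 0 then of_real (aa (n div 3)) else 0)) \<le> C2 * (real m + 1) ^ 6 * q powr (real g - 2/3 * m)"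
proof -
  define N where "N = 3 * g + 1"
  have N: "N = 3 * g + 1" "N = n + m + 1" using m by (simp_all add: N_def)
  note q = q_gt1
  define H where "H = real (card (SF N))"
  have H: "H = q ^ N * (1 - 1 / q)" "q ^ N / 2 \<le> H" using card_SF_ge[OF g] by (simp_all add: H_def N_def)
  have H0: "0 < H" using H(2) q by (meson less_le_trans half_gt_zero zero_less_power less_trans zero_less_one)
  define G where "G = q powr (real g - 2/3 * m)"
  define A where "A = (if n mod 3 = 0 then of_real (q ^ N * (1 - 1 / q) * aa (n div 3)) else (0 :: complex))"
  have "1 ^ 6 \<le> (real m + 1) ^ 6" by (rule power_mono) simp_all
  then have one: "1 * (q powr N * G) \<le> (real m + 1) ^ 6 * (q powr N * G)" by (intro mult_right_mono) (simp_all add: G_def)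
  have "norm (TT N n - A) \<le> norm (TT N n - TC N n) + norm (TC N n - A)" using norm_triangle_ineq[of "TT N n - TC N n" "TC N n - A"] by simp
  also have "\<dots> \<le> (3 + 3 * C1) * (real m + 1) ^ 6 * (q powr N * G) + q powr N * G"
    using TT_noncube[OF N] TC_bound[OF N] unfolding A_def G_def by (rule add_mono)
  also have "\<dots> \<le> (4 + 3 * C1) * (real m + 1) ^ 6 * (q powr N * G)" using one by (simp add: algebra_simps)
  also have "\<dots> = (4 + 3 * C1) * (real m + 1) ^ 6 * G * q ^ N" using q by (simp add: powr_realpow)
  also have "\<dots> \<le> (4 + 3 * C1) * (real m + 1) ^ 6 * G * (2 * H)" using H(2) C1_pos by (intro mult_left_mono) (simp_all add: G_def)
  finally have "norm (TT N n - A) \<le> C2 * (real m + 1) ^ 6 * G * H" by (simp add: C2_def algebra_simps)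
  then have "norm (TT N n - A) / H \<le> C2 * (real m + 1) ^ 6 * G" using H0 by (simp add: divide_le_eq)
  moreover have "norm (TT N n - A) / H = norm ((TT N n - A) / of_real H)" using H0 by (simp add: norm_divide)
  moreover have "(TT N n - A) / of_real H = TT N n / of_nat (card (SF N)) - (if n mod 3 = 0 then of_real (aa (n div 3)) else 0)"
  proof -
    have "A = of_real H * (if n mod 3 = 0 then of_real (aa (n div 3)) else 0)" unfolding A_def H(1) by simp
    then show ?thesis using H0 by (simp add: diff_divide_distrib) (simp add: H_def)
  qed
  ultimately show ?thesis by (simp add: N_def G_def)
qed

end

section \<open>The main term\<close>

lemma sum_triangle:
  fixes f :: "nat \<Rightarrow> nat \<Rightarrow> 'b::comm_monoid_add"
  shows "(\<Sum>k\<le>n. \<Sum>j\<le>k. f j (k - j)) = (\<Sum>j\<le>n. \<Sum>i\<le>n - j. f j i)"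
proof (induct n)
  case (Suc n)
  have "(\<Sum>j\<le>Suc n. \<Sum>i\<le>Suc n - j. f j i) = (\<Sum>j\<le>n. (\<Sum>i\<le>n - j. f j i) + f j (Suc n - j)) + f (Suc n) 0"
    by (simp add: Suc_diff_le)
  also have "\<dots> = (\<Sum>k\<le>Suc n. \<Sum>j\<le>k. f j (k - j))" by (simp add: sum.distrib Suc add.assoc)
  finally show ?case by (rule sym)
qed simp

context cubic_field begin

text \<open>From 1 / (1 + 1/x) = 1 - 1/(x + 1), \<open>sig T\<close> is the sum of \<open>W\<close>
  over the subsets of T. The numbers \<open>eta j\<close> are the coefficients of the Euler product
  in \<open>M_main\<close> as a power series in v = q^(-3s).\<close>

definition W :: "'a list set \<Rightarrow> real" where "W S = (\<Prod>P\<in>S. - 1 / (q ^ deg P + 1))"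
definition eta :: "nat \<Rightarrow> real" where "eta j = (\<Sum>S\<in>PS j. W S)"
definition etas :: "real \<Rightarrow> real" where "etas v = (\<Sum>j. eta j * v ^ j)"

text \<open>Each term is at most q^(-j), and there are at most q^j sets.\<close>

lemma W_sum: "(\<Sum>S\<in>PS j. \<bar>W S\<bar>) \<le> 1"
proof -
  note q = q_gt1
  have "(\<Sum>S\<in>PS j. \<bar>W S\<bar>) \<le> (\<Sum>S\<in>PS j. (1 / q) ^ j)"
  proof (rule sum_mono)
    fix S assume S: "S \<in> PS j"
    have "\<bar>W S\<bar> = (\<Prod>P\<in>S. \<bar>- 1 / (q ^ deg P + 1)\<bar>)" unfolding W_def by (rule abs_prod)
    also have "\<dots> \<le> (\<Prod>P\<in>S. (1 / q) ^ deg P)"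
    proof (rule prod_mono, rule conjI)
      fix P
      have "0 < q ^ deg P" using q by simp
      then show "\<bar>- 1 / (q ^ deg P + 1)\<bar> \<le> (1 / q) ^ deg P" by (simp add: power_one_over frac_le)
    qed simp
    also have "\<dots> = (1 / q) ^ j" using PS_D(3)[OF S] by (simp only: power_sum[symmetric] dg_def)
    finally show "\<bar>W S\<bar> \<le> (1 / q) ^ j" .
  qed
  also have "\<dots> = real (card (PS j)) * (1 / q) ^ j" by simp
  also have "\<dots> \<le> q ^ j * (1 / q) ^ j"
    by (rule mult_right_mono[OF card_PS_le]) (use q in simp)
  also have "\<dots> = 1" using q by (simp add: power_one_over)
  finally show ?thesis .
qed
lemma eta_le: "\<bar>eta j\<bar> \<le> 1" unfolding eta_def by (rule order_trans[OF sum_abs W_sum])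

lemma sig_eq: "finite T \<Longrightarrow> sig T = (\<Sum>S\<in>Pow T. W S)"
proof -
  assume T: "finite T"
  have "1 / (1 + 1 / q ^ deg P) = - 1 / (q ^ deg P + 1) + 1" for P
  proof -
    have x: "0 < q ^ deg P" using q_gt1 by simp
    define x where "x = q ^ deg P"
    have "1 + 1 / x = (x + 1) / x" using x by (simp add: x_def field_simps)
    then show ?thesis using x unfolding x_def[symmetric] by (simp add: field_simps)
  qed
  then have "sig T = (\<Prod>P\<in>T. - 1 / (q ^ deg P + 1) + 1)" by (simp add: sig_def)
  then show ?thesis using prod_add[OF T, of "\<lambda>P. - 1 / (q ^ deg P + 1)" "\<lambda>_. 1"] by (simp add: W_def)
qed

text \<open>Expand \<open>sig (pd h)\<close> over subsets S and count the h divisible by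
  \<open>rad S\<close>; the result is a convolution with the powers of q.\<close>

lemma aa_eq: "aa k = (\<Sum>j\<le>k. eta j * q ^ (k - j))"
proof -
  have "aa k = (\<Sum>h\<in>Mn k. \<Sum>j\<le>k. \<Sum>S\<in>PS j. if S \<subseteq> pd h then W S else 0)"
    unfolding aa_def
  proof (rule sum.cong[OF refl])
    fix h assume h: "h \<in> Mn k"
    have "finite (pd h)" "pd h \<subseteq> \<P>" "dg (pd h) \<le> k" using dg_pd_le[OF h order_refl] by simp_all
    then show "sig (pd h) = (\<Sum>j\<le>k. \<Sum>S\<in>PS j. if S \<subseteq> pd h then W S else 0)" using sig_eq sum_Pow_PS by simp
  qed
  also have "\<dots> = (\<Sum>j\<le>k. \<Sum>S\<in>PS j. \<Sum>h\<in>Mn k. if S \<subseteq> pd h then W S else 0)" by (simp only: sum.swap[of _ _ "Mn k"])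
  also have "\<dots> = (\<Sum>j\<le>k. \<Sum>S\<in>PS j. W S * q ^ (k - j))"
  proof (intro sum.cong refl)
    fix j S assume j: "j \<in> {..k}" and S: "S \<in> PS j"
    have "{h \<in> Mn k. S \<subseteq> pd h} = {h \<in> Mn k. rad S pdivides h}"
    proof (rule Collect_cong, rule conj_cong[OF refl])
      fix F assume "F \<in> Mn k"
      then show "S \<subseteq> pd F \<longleftrightarrow> rad S pdivides F" using rad_props(4)[OF S Mn_C[of F k]] PS_D(2)[OF S] unfolding pd_def by auto
    qed
    then have "card {h \<in> Mn k. S \<subseteq> pd h} = qn ^ (k - j)" using card_multiples[OF rad_props(1)[OF S], of k] rad_props(2)[OF S] j by simp
    then show "(\<Sum>h\<in>Mn k. if S \<subseteq> pd h then W S else 0) = W S * q ^ (k - j)" by (simp add: sum.inter_filter[symmetric])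
  qed
  finally show ?thesis by (simp add: eta_def sum_distrib_right)
qed

lemma tail_bound:
  fixes c :: "nat \<Rightarrow> real"
  assumes v: "0 \<le> v" "v < 1" and c: "\<And>d. \<bar>c d\<bar> \<le> B" "\<And>d. d \<le> L \<Longrightarrow> c d = 0"
  shows "summable (\<lambda>d. c d * v ^ d)" "\<bar>\<Sum>d. c d * v ^ d\<bar> \<le> B * v ^ Suc L / (1 - v)"
proof -
  define h where "h d = (if d \<le> L then 0 else B * v ^ d)" for d
  have "(\<lambda>d. B * v ^ Suc L * v ^ d) sums (B * v ^ Suc L * (1 / (1 - v)))" using v by (intro sums_mult geometric_sums) simp
  moreover have "B * v ^ Suc L * v ^ d = h (d + Suc L)" for d by (simp add: h_def power_add)
  ultimately have "(\<lambda>d. h (d + Suc L)) sums (B * v ^ Suc L / (1 - v))" by simp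
  moreover have "(\<Sum>i<Suc L. h i) = 0" by (rule sum.neutral) (simp add: h_def)
  ultimately have h: "h sums (B * v ^ Suc L / (1 - v))" by (simp only: sums_iff_shift) simp
  have le: "norm (c d * v ^ d) \<le> h d" for d
    using c v by (simp add: h_def abs_mult mult_right_mono)
  show "summable (\<lambda>d. c d * v ^ d)" by (rule summable_comparison_test'[OF sums_summable[OF h], of 0]) (rule le)
  have "norm (\<Sum>d. c d * v ^ d) \<le> (\<Sum>d. h d)" by (rule norm_suminf_le[OF le sums_summable[OF h]])
  then show "\<bar>\<Sum>d. c d * v ^ d\<bar> \<le> B * v ^ Suc L / (1 - v)" using sums_unique[OF h] by simp
qed

lemma eta_summable: "0 \<le> v \<Longrightarrow> v < 1 \<Longrightarrow> summable (\<lambda>j. eta j * v ^ j)"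
  by (rule summable_comparison_test'[of "\<lambda>j. v ^ j" 0]) (simp_all add: summable_geometric abs_mult eta_le mult_left_le_one_le)

lemma etas_tail:
  assumes v: "0 \<le> v" "v < 1" shows "\<bar>etas v - (\<Sum>j\<le>g. eta j * v ^ j)\<bar> \<le> v ^ Suc g / (1 - v)"
proof -
  define c where "c d = (if d \<le> g then 0 else eta d)" for d
  have "etas v = (\<Sum>j. eta (j + Suc g) * v ^ (j + Suc g)) + (\<Sum>j<Suc g. eta j * v ^ j)"
    unfolding etas_def by (rule suminf_split_initial_segment[OF eta_summable[OF v]])
  moreover have "(\<Sum>j. c j * v ^ j) = (\<Sum>j. c (j + Suc g) * v ^ (j + Suc g)) + (\<Sum>j<Suc g. c j * v ^ j)"
    using v eta_le by (intro suminf_split_initial_segment tail_bound(1)[of v c 1 g]) (simp_all add: c_def)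
  moreover have "(\<Sum>j<Suc g. c j * v ^ j) = 0" by (rule sum.neutral) (simp add: c_def)
  ultimately have "etas v - (\<Sum>j\<le>g. eta j * v ^ j) = (\<Sum>j. c j * v ^ j)" by (simp add: c_def lessThan_Suc_atMost)
  then show ?thesis using tail_bound(2)[OF v, of c 1 g] eta_le by (simp add: c_def)
qed

lemma etas_le: assumes v: "0 \<le> v" "v < 1" shows "\<bar>etas v\<bar> \<le> 1 / (1 - v)"
proof -
  have "norm (\<Sum>j. eta j * v ^ j) \<le> (\<Sum>j. v ^ j)"
    using v by (intro norm_suminf_le summable_geometric) (simp_all add: abs_mult eta_le mult_left_le_one_le)
  also have "\<dots> = 1 / (1 - v)" using v by (intro suminf_geometric) simp
  finally show ?thesis by (simp add: etas_def)
qed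

text \<open>The product over a finite set containing all primes of degree at most L is a power
  series whose coefficients are at most 1 in absolute value and agree with \<open>eta\<close> up to
  L. The two series therefore differ by at most 2 v^(L+1) / (1 - v).\<close>

lemma euler_tendsto:
  assumes v: "0 \<le> v" "v < 1"
  shows "((\<lambda>A. \<Prod>P\<in>A. 1 - v ^ deg P / (q ^ deg P + 1)) \<longlongrightarrow> etas v) (finite_subsets_at_top \<P>)"
proof (rule tendstoI)
  fix e :: real assume e: "0 < e"
  have "(\<lambda>L. v ^ Suc L) \<longlonglongrightarrow> 0" using LIMSEQ_power_zero[of v] v by (simp add: LIMSEQ_Suc del: power_Suc)
  then have "(\<lambda>L. 2 * v ^ Suc L / (1 - v)) \<longlonglongrightarrow> 2 * 0 / (1 - v)" using v by (intro tendsto_intros) simp_all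
  then have "eventually (\<lambda>L. 2 * v ^ Suc L / (1 - v) < e) sequentially" using e by (intro order_tendstoD(2)) simp_all
  then obtain L where L: "2 * v ^ Suc L / (1 - v) < e" by (auto simp: eventually_sequentially)
  let ?Z = "{P \<in> \<P>. deg P \<le> L}"
  show "eventually (\<lambda>A. dist (\<Prod>P\<in>A. 1 - v ^ deg P / (q ^ deg P + 1)) (etas v) < e) (finite_subsets_at_top \<P>)"
    unfolding eventually_finite_subsets_at_top
  proof (intro exI[of _ ?Z] conjI allI impI)
    have "?Z \<subseteq> (\<Union>i\<in>{..L}. Mn i)"
    proof
      fix P assume "P \<in> ?Z"
      then have "P \<in> Mn (deg P)" "deg P \<in> {..L}" using Mn_deg_self by simp_all
      then show "P \<in> (\<Union>i\<in>{..L}. Mn i)" by (rule UN_I[rotated])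
    qed
    then show "finite ?Z" by (rule finite_subset) simp
    fix A assume "finite A \<and> ?Z \<subseteq> A \<and> A \<subseteq> \<P>"
    then have A: "finite A" "?Z \<subseteq> A" "A \<subseteq> \<P>" by simp_all
    define E where "E d = (\<Sum>S\<in>PS d. if S \<subseteq> A then W S else 0)" for d
    have E1: "\<bar>E d\<bar> \<le> 1" for d
    proof -
      have "\<bar>E d\<bar> \<le> (\<Sum>S\<in>PS d. \<bar>W S\<bar>)" unfolding E_def by (rule order_trans[OF sum_abs sum_mono]) simp
      then show ?thesis using W_sum by (rule order_trans)
    qed
    have EL: "E d = eta d" if d: "d \<le> L" for d
    proof -
      have "S \<subseteq> A" if S: "S \<in> PS d" for S
      proof
        fix P assume P: "P \<in> S"
        then have "deg P \<le> dg S" using PS_D[OF S] unfolding dg_def by (intro member_le_sum) simp_all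
        then have "P \<in> ?Z" using P PS_D[OF S] d by auto
        then show "P \<in> A" using A by blast
      qed
      then show ?thesis by (simp add: E_def eta_def)
    qed
    have E0: "E d = 0" if d: "d \<notin> {..dg A}" for d
    proof -
      have "\<not> S \<subseteq> A" if S: "S \<in> PS d" for S
      proof
        assume "S \<subseteq> A"
        then have "dg S \<le> dg A" unfolding dg_def using A by (intro sum_mono2) simp_all
        then show False using PS_D(3)[OF S] d by simp
      qed
      then show ?thesis by (simp add: E_def)
    qed
    have "(\<Prod>P\<in>A. 1 - v ^ deg P / (q ^ deg P + 1)) = (\<Prod>P\<in>A. v ^ deg P * (- 1 / (q ^ deg P + 1)) + 1)" by simp
    also have "\<dots> = (\<Sum>S\<in>Pow A. v ^ dg S * W S)"
      unfolding prod_add[OF A(1)] W_def dg_def by (simp add: power_sum prod.distrib[symmetric])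
    also have "\<dots> = (\<Sum>d\<le>dg A. \<Sum>S\<in>PS d. if S \<subseteq> A then v ^ dg S * W S else 0)" by (rule sum_Pow_PS[OF A(1,3) order_refl])
    also have "\<dots> = (\<Sum>d\<le>dg A. E d * v ^ d)"
      unfolding E_def sum_distrib_right by (intro sum.cong refl) (simp add: PS_D(3))
    also have "\<dots> = (\<Sum>d. E d * v ^ d)" using E0 by (intro suminf_finite[symmetric]) simp_all
    finally have pr: "(\<Prod>P\<in>A. 1 - v ^ deg P / (q ^ deg P + 1)) = (\<Sum>d. E d * v ^ d)" .
    have sE: "summable (\<lambda>d. E d * v ^ d)" by (rule summable_finite[of "{..dg A}"]) (simp_all add: E0)
    have "(\<Sum>d. E d * v ^ d) - etas v = (\<Sum>d. (E d - eta d) * v ^ d)"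
      unfolding etas_def left_diff_distrib by (rule suminf_diff[OF sE eta_summable[OF v]])
    moreover have "\<bar>\<Sum>d. (E d - eta d) * v ^ d\<bar> \<le> 2 * v ^ Suc L / (1 - v)"
    proof (rule tail_bound(2)[OF v])
      show "\<bar>E d - eta d\<bar> \<le> 2" for d using E1[of d] eta_le[of d] by linarith
    qed (simp add: EL)
    ultimately show "dist (\<Prod>P\<in>A. 1 - v ^ deg P / (q ^ deg P + 1)) (etas v) < e"
      unfolding pr dist_real_def using L by linarith
  qed simp
qed

lemma infprod_eq:
  assumes v: "0 \<le> v" "v < 1" and f: "\<And>P. P \<in> \<P> \<Longrightarrow> f P = 1 - v ^ deg P / (q ^ deg P + 1)"
  shows "infprod_on f \<P> = etas v"
proof -
  have "(prod f \<longlongrightarrow> etas v) (finite_subsets_at_top \<P>)"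
  proof (rule Lim_transform_eventually[OF euler_tendsto[OF v]])
    show "eventually (\<lambda>A. (\<Prod>P\<in>A. 1 - v ^ deg P / (q ^ deg P + 1)) = prod f A) (finite_subsets_at_top \<P>)"
      using f by (intro eventually_finite_subsets_at_top_weakI prod.cong refl) auto
  qed
  then show ?thesis unfolding infprod_on_def by (intro tendsto_Lim finite_subsets_at_top_neq_bot)
qed

section \<open>The constants of the statement and the partial sums of the main term\<close>

lemma poly_norm_eq: "P \<in> M \<Longrightarrow> poly_norm R P = q ^ deg P" by (simp add: poly_norm_def deg_def)

lemma M_main_eq:
  assumes s: "0 < s" shows "M_main R s = etas (q powr (-3 * s)) / (1 - q powr (1 - 3 * s))"
proof -
  note q = q_gt1
  have v: "0 \<le> q powr (-3 * s)" "q powr (-3 * s) < 1" using q s powr_less_mono[of "-3 * s" 0 q] by simp_all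
  have "infprod_on (\<lambda>P. 1 - 1 / (poly_norm R P powr (3 * s) * (poly_norm R P + 1))) \<P> = etas (q powr (-3 * s))"
  proof (rule infprod_eq[OF v])
    fix P assume "P \<in> \<P>"
    then have n: "poly_norm R P = q ^ deg P" by (simp add: poly_norm_eq)
    have "(q ^ deg P) powr (3 * s) = q powr (deg P * (3 * s))" using q by (simp add: powr_realpow[symmetric] powr_powr)
    also have "\<dots> = 1 / (q powr (-3 * s)) ^ deg P" unfolding q_powr_pow by (simp add: powr_minus_divide mult_ac)
    finally show "1 - 1 / (poly_norm R P powr (3 * s) * (poly_norm R P + 1)) = 1 - (q powr (-3 * s)) ^ deg P / (q ^ deg P + 1)"
      unfolding n by simp
  qed
  then show ?thesis by (simp add: M_main_def zeta_q_def)
qed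

lemma C_const_eq: "C_const R = etas (1 / q)"
proof -
  note q = q_gt1
  show ?thesis unfolding C_const_def
    using q by (intro infprod_eq) (simp_all add: poly_norm_eq power_one_over)
qed

lemma aa_sum: 
  assumes v: "v \<noteq> 0"
  shows "(\<Sum>k\<le>g. v ^ k * aa k) = (\<Sum>j\<le>g. eta j * v ^ j * (\<Sum>i\<le>g - j. (q * v) ^ i))"
proof -
  have "(\<Sum>k\<le>g. v ^ k * aa k) = (\<Sum>k\<le>g. \<Sum>j\<le>k. eta j * v ^ j * (q * v) ^ (k - j))"
  proof (rule sum.cong[OF refl])
    fix k
    have "v ^ k * aa k = (\<Sum>j\<le>k. v ^ k * (eta j * q ^ (k - j)))" unfolding aa_eq sum_distrib_left by (rule refl)
    also have "\<dots> = (\<Sum>j\<le>k. eta j * v ^ j * (q * v) ^ (k - j))"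
    proof (rule sum.cong[OF refl])
      fix j assume "j \<in> {..k}"
      then have "v ^ k = v ^ j * v ^ (k - j)" by (simp flip: power_add)
      then show "v ^ k * (eta j * q ^ (k - j)) = eta j * v ^ j * (q * v) ^ (k - j)" by (simp add: power_mult_distrib)
    qed
    finally show "v ^ k * aa k = (\<Sum>j\<le>k. eta j * v ^ j * (q * v) ^ (k - j))" .
  qed
  also have "\<dots> = (\<Sum>j\<le>g. \<Sum>i\<le>g - j. eta j * v ^ j * (q * v) ^ i)" by (rule sum_triangle)
  finally show ?thesis by (simp add: sum_distrib_left)
qed

text \<open>Let y = q^(1 - 3s). Summing the inner geometric series of \<open>aa_sum\<close> and
  multiplying by 1 - y leaves a partial sum of \<open>etas v\<close> and a remainder of size max(1,
  y) y^g. Dividing by 1 - y uniformly in q is possible because |1 - y| is at least max(1, y) (1 - u)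
  with u = 7^(-|1 - 3s|); this holds on both sides of s = 1/3.\<close>

lemma main_diff:
  assumes s: "0 < s" "s \<noteq> 1/3"
  shows "\<bar>(\<Sum>k\<le>g. (q powr (-3 * s)) ^ k * aa k) - M_main R s\<bar> 
    \<le> (2 + 1 / (1 - 7 powr (-3 * s))) / (1 - 7 powr (- \<bar>1 - 3 * s\<bar>)) * q powr ((1 - 3 * s) * g)"
proof -
  have q: "1 < q" "7 \<le> q" using q_gt1 q_ge7 by simp_all
  define v y w u where "v = q powr (-3 * s)" and "y = q powr (1 - 3 * s)" and "w = (7::real) powr (-3 * s)" and "u = (7::real) powr (- \<bar>1 - 3 * s\<bar>)"
  have v: "0 < v" "v \<le> w" "w < 1"
    using q s powr_less_mono[of "-3 * s" 0 "7::real"] by (simp_all add: v_def w_def powr_mono2')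
  have v1: "v < 1" using v by linarith
  have y: "0 < y" "q * v = y" using q powr_add[of q 1 "-3 * s"] by (simp_all add: y_def v_def)
  have u: "0 < u" "u < 1" using s powr_less_mono[of "- \<bar>1 - 3 * s\<bar>" 0 "7::real"] by (simp_all add: u_def)
  have vy: "v \<le> y" using y(2) q v by (simp flip: y(2))
  define Y where "Y = max 1 y"
  have Y: "1 \<le> Y" "y \<le> Y" by (simp_all add: Y_def)
  have lower: "Y * (1 - u) \<le> \<bar>1 - y\<bar>" and y1: "y \<noteq> 1"
  proof -
    have "Y * (1 - u) \<le> \<bar>1 - y\<bar> \<and> y \<noteq> 1"
    proof (cases "1 / 3 < s")
      case True
      have "y \<le> u" unfolding y_def u_def using True q by (simp add: powr_mono2')
      then show ?thesis using u by (simp add: Y_def max_def)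
    next
      case False
      then have s': "s < 1/3" using s by simp
      have "1 / y = q powr (- (1 - 3 * s))" by (simp add: y_def powr_minus_divide del: minus_diff_eq)
      also have "\<dots> \<le> 7 powr (- (1 - 3 * s))" using q s' by (intro powr_mono2') simp_all
      also have "\<dots> = u" using s' by (simp add: u_def)
      finally have yu: "1 / y \<le> u" .
      then have "1 \<le> u * y" using y(1) by (simp add: divide_le_eq)
      then have "y * (1 - u) \<le> y - 1" by (simp add: algebra_simps)
      moreover have "1 < y" using yu u y(1) by (metis divide_less_eq_1_pos le_less_trans linorder_not_less)
      ultimately show ?thesis by (simp add: Y_def)
    qed
    then show "Y * (1 - u) \<le> \<bar>1 - y\<bar>" "y \<noteq> 1" by simp_all
  qed
  define LHS where "LHS = (\<Sum>k\<le>g. v ^ k * aa k)"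
  have "(1 - y) * LHS = (\<Sum>j\<le>g. eta j * v ^ j * (1 - y ^ Suc (g - j)))"
    unfolding LHS_def aa_sum[OF less_imp_neq[OF v(1), symmetric]] y(2)
    by (subst sum_distrib_left) (intro sum.cong refl, simp only: sum_gp_basic[symmetric] mult.left_commute)
  also have "\<dots> = (\<Sum>j\<le>g. eta j * v ^ j) - (\<Sum>j\<le>g. eta j * v ^ j * y ^ Suc (g - j))" by (simp only: right_diff_distrib sum_subtractf mult_1_right)
  finally have L: "(1 - y) * LHS = \<dots>" .
  have Mm: "(1 - y) * M_main R s = etas v" using y1 by (simp add: M_main_eq[OF s(1)] v_def y_def)
  have b1: "\<bar>\<Sum>j\<le>g. eta j * v ^ j * y ^ Suc (g - j)\<bar> \<le> 2 * (Y * y ^ g)"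
  proof -
    have "\<bar>\<Sum>j\<le>g. eta j * v ^ j * y ^ Suc (g - j)\<bar> \<le> (\<Sum>j\<le>g. y ^ Suc g * (1 / q) ^ j)"
    proof (rule order_trans[OF sum_abs sum_mono])
      fix j assume j: "j \<in> {..g}"
      have e: "v ^ j * y ^ Suc (g - j) = y ^ Suc g * (1 / q) ^ j"
      proof -
        have "v = y * (1 / q)" using y(2) q by (simp flip: y(2))
        then have "v ^ j = y ^ j * (1 / q) ^ j" by (simp only: power_mult_distrib)
        moreover have "y ^ Suc g = y ^ j * y ^ Suc (g - j)" using j by (simp flip: power_add power_Suc)
        ultimately show ?thesis by (simp only: mult_ac)
      qed
      have nn: "0 \<le> v ^ j * y ^ Suc (g - j)" using v y by simp
      have "\<bar>eta j * v ^ j * y ^ Suc (g - j)\<bar> = \<bar>eta j\<bar> * (v ^ j * y ^ Suc (g - j))"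
        by (simp only: mult.assoc abs_mult[of "eta j"] abs_of_nonneg[OF nn])
      also have "\<dots> \<le> 1 * (v ^ j * y ^ Suc (g - j))" by (rule mult_right_mono[OF eta_le nn])
      finally show "\<bar>eta j * v ^ j * y ^ Suc (g - j)\<bar> \<le> y ^ Suc g * (1 / q) ^ j" unfolding e by simp
    qed
    also have "\<dots> = y ^ Suc g * (\<Sum>j\<le>g. (1 / q) ^ j)" by (rule sum_distrib_left[symmetric])
    also have "\<dots> \<le> y ^ Suc g * (2 * (1 / q) ^ 0)"
    proof (rule mult_left_mono)
      have "0 \<le> 1 / q" "1 / q \<le> 1/2" using q by (simp_all add: divide_le_eq)
      from geom_le[OF this, of g 0] show "(\<Sum>j\<le>g. (1 / q) ^ j) \<le> 2 * (1 / q) ^ 0" by (simp add: atMost_def)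
    qed (use y in simp)
    also have "\<dots> = 2 * (y * y ^ g)" by simp
    also have "\<dots> \<le> 2 * (Y * y ^ g)" using Y y by (intro mult_left_mono mult_right_mono) simp_all
    finally show ?thesis .
  qed
  have b2: "\<bar>etas v - (\<Sum>j\<le>g. eta j * v ^ j)\<bar> \<le> 1 / (1 - w) * (Y * y ^ g)"
  proof -
    have "\<bar>etas v - (\<Sum>j\<le>g. eta j * v ^ j)\<bar> \<le> v ^ Suc g / (1 - v)" using v v1 by (intro etas_tail) simp_all
    also have "\<dots> \<le> (Y * y ^ g) / (1 - w)"
    proof (rule frac_le)
      have "v ^ Suc g \<le> y ^ Suc g" using v vy by (intro power_mono) simp_all
      also have "\<dots> \<le> Y * y ^ g" using Y y by (simp add: mult_right_mono)
      finally show "v ^ Suc g \<le> Y * y ^ g" .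
    qed (use v Y y in simp_all)
    finally show ?thesis by simp
  qed
  have "(1 - y) * (LHS - M_main R s) = - (\<Sum>j\<le>g. eta j * v ^ j * y ^ Suc (g - j)) - (etas v - (\<Sum>j\<le>g. eta j * v ^ j))"
    using L Mm by (simp add: right_diff_distrib)
  then have "\<bar>1 - y\<bar> * \<bar>LHS - M_main R s\<bar> \<le> 2 * (Y * y ^ g) + 1 / (1 - w) * (Y * y ^ g)"
    unfolding abs_mult[symmetric] using b1 b2 by linarith
  then have "Y * (1 - u) * \<bar>LHS - M_main R s\<bar> \<le> Y * ((2 + 1 / (1 - w)) * y ^ g)"
    using mult_right_mono[OF lower, of "\<bar>LHS - M_main R s\<bar>"] by (simp add: algebra_simps)
  then have "(1 - u) * \<bar>LHS - M_main R s\<bar> \<le> (2 + 1 / (1 - w)) * y ^ g" using Y by simp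
  then have "\<bar>LHS - M_main R s\<bar> \<le> (2 + 1 / (1 - w)) / (1 - u) * y ^ g" using u by (simp add: field_simps)
  then show ?thesis unfolding LHS_def v_def w_def u_def y_def q_powr_pow .
qed

text \<open>At s = 1/3 the geometric ratio is 1 and the inner sum is g - j + 1. The part g gives C_q
  g up to the tail of \<open>etas\<close>, and the parts 1 - j stay bounded because their
  coefficients are at most q^(-j).\<close>

lemma third_diff: "\<bar>(\<Sum>k\<le>g. (1 / q) ^ k * aa k) - C_const R * real g\<bar> \<le> 5"
proof -
  have q: "1 < q" "7 \<le> q" using q_gt1 q_ge7 by simp_all
  define v where "v = 1 / q"
  have v: "0 < v" "v \<le> 1/2" "v < 1" "q * v = 1" using q by (simp_all add: v_def divide_le_eq)
  have e: "(\<Sum>k\<le>g. v ^ k * aa k) = (\<Sum>j\<le>g. eta j * v ^ j * (real g - real j + 1))"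
    unfolding aa_sum[OF less_imp_neq[OF v(1), symmetric]] v(4) by (intro sum.cong refl) (simp add: of_nat_diff)
  have d: "(\<Sum>k\<le>g. v ^ k * aa k) - C_const R * real g = (\<Sum>j\<le>g. eta j * v ^ j * (1 - real j)) - (etas v - (\<Sum>j\<le>g. eta j * v ^ j)) * real g"
  proof -
    have "(\<Sum>j\<le>g. eta j * v ^ j * (real g - real j + 1)) = (\<Sum>j\<le>g. eta j * v ^ j * (1 - real j)) + (\<Sum>j\<le>g. eta j * v ^ j) * real g"
      unfolding sum_distrib_right sum.distrib[symmetric] by (intro sum.cong refl) (simp add: algebra_simps)
    then show ?thesis unfolding e C_const_eq v_def[symmetric] by (simp add: left_diff_distrib)
  qed
  have b1: "\<bar>\<Sum>j\<le>g. eta j * v ^ j * (1 - real j)\<bar> \<le> 4"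
  proof -
    have "\<bar>\<Sum>j\<le>g. eta j * v ^ j * (1 - real j)\<bar> \<le> (\<Sum>j\<le>g. (1/2) ^ j * (1 + real j))"
    proof (rule order_trans[OF sum_abs sum_mono])
      fix j
      have "\<bar>eta j\<bar> * v ^ j * \<bar>1 - real j\<bar> \<le> 1 * (1/2) ^ j * (1 + real j)" 
        using eta_le[of j] v by (intro mult_mono power_mono) simp_all
      then show "\<bar>eta j * v ^ j * (1 - real j)\<bar> \<le> (1/2) ^ j * (1 + real j)" using v by (simp add: abs_mult)
    qed
    also have "\<dots> = 4 - (real g + 3) * (1/2) ^ g"
    proof (induct g)
      case (Suc g)
      show ?case unfolding sum.atMost_Suc Suc power_Suc of_nat_Suc by (simp add: field_simps)
    qed simp
    also have "\<dots> \<le> 4" by simp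
    finally show ?thesis .
  qed
  have b2: "\<bar>(etas v - (\<Sum>j\<le>g. eta j * v ^ j)) * real g\<bar> \<le> 1"
  proof -
    have "\<bar>etas v - (\<Sum>j\<le>g. eta j * v ^ j)\<bar> \<le> v ^ Suc g / (1 - v)" using v by (intro etas_tail) simp_all
    also have "\<dots> \<le> (1/2) ^ Suc g / (1/2)" using v by (intro frac_le power_mono) simp_all
    finally have "\<bar>etas v - (\<Sum>j\<le>g. eta j * v ^ j)\<bar> * real g \<le> (1/2) ^ g * real g" by (intro mult_right_mono) simp_all
    also have "\<dots> \<le> 1"
    proof -
      have "real g \<le> 2 ^ g" using less_exp[of g] by (metis less_imp_le of_nat_le_iff of_nat_numeral of_nat_power)
      then show ?thesis by (simp add: power_one_over divide_le_eq)
    qed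
    finally show ?thesis by (simp add: abs_mult)
  qed
  show ?thesis using b1 b2 unfolding v_def[symmetric] d by linarith
qed

lemma C_const_le: "\<bar>C_const R\<bar> \<le> 2"
proof -
  have q: "1 < q" "7 \<le> q" using q_gt1 q_ge7 by simp_all
  have "\<bar>etas (1 / q)\<bar> \<le> 1 / (1 - 1 / q)" using q by (intro etas_le) simp_all
  also have "\<dots> \<le> 2" using q by (simp add: field_simps)
  finally show ?thesis by (simp add: C_const_eq)
qed

text \<open>As deg P <= q^(deg P / 2), every finite partial sum is covered by
  \<open>sum_primes_le\<close>. For a family that is not summable \<open>infsum\<close> is 0 and the
  bounds hold as well.\<close>

lemma infsum_primes_le:
  fixes f :: "'a list \<Rightarrow> real"
  assumes f: "\<And>P. P \<in> \<P> \<Longrightarrow> 0 \<le> f P \<and> f P \<le> B * (deg P / (q ^ deg P)\<^sup>2)" and B: "0 \<le> B"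
  shows "0 \<le> (\<Sum>\<^sub>\<infinity>P\<in>\<P>. f P)" "(\<Sum>\<^sub>\<infinity>P\<in>\<P>. f P) \<le> B"
proof -
  note q = q_gt1
  show "0 \<le> (\<Sum>\<^sub>\<infinity>P\<in>\<P>. f P)" using f by (intro infsum_nonneg) simp
  have key: "deg P / (q ^ deg P)\<^sup>2 \<le> q powr (-3/2 * deg P)" for P
  proof -
    define d where "d = deg P"
    have "real d \<le> 2 ^ d" using less_exp[of d] by (metis less_imp_le of_nat_le_iff of_nat_numeral of_nat_power)
    then have "real d * (1/2) ^ d \<le> 1" by (simp add: power_one_over divide_le_eq)
    moreover have "(q powr (-1/2)) ^ d \<le> (1/2) ^ d" using q_half by (intro power_mono) simp_all
    then have "real d * (q powr (-1/2)) ^ d \<le> real d * (1/2) ^ d" by (rule mult_left_mono) simp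
    ultimately have 1: "real d * (q powr (-1/2)) ^ d \<le> 1" by linarith
    have "1 / (q ^ d)\<^sup>2 = (q powr (-1/2)) ^ d * q powr (-3/2 * d)"
      unfolding q_powr_pow powr_add[symmetric] using q by (simp add: powr_minus_divide powr_realpow[symmetric] powr_powr power2_eq_square powr_add[symmetric])
    then have "real d / (q ^ d)\<^sup>2 = (real d * (q powr (-1/2)) ^ d) * q powr (-3/2 * d)" by (metis mult.assoc times_divide_eq_right mult.right_neutral)
    also have "\<dots> \<le> 1 * q powr (-3/2 * d)" by (rule mult_right_mono[OF 1]) simp
    finally show ?thesis by (simp add: d_def)
  qed
  show "(\<Sum>\<^sub>\<infinity>P\<in>\<P>. f P) \<le> B"
  proof (cases "f summable_on \<P>")
    case True
    then show ?thesis
    proof (rule infsum_le_finite_sums)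
      fix F assume F: "finite F" "F \<subseteq> \<P>"
      have "sum f F \<le> (\<Sum>P\<in>F. B * q powr (-3/2 * deg P))"
      proof (rule sum_mono)
        fix P assume "P \<in> F"
        then have "f P \<le> B * (deg P / (q ^ deg P)\<^sup>2)" using f F by blast
        also have "\<dots> \<le> B * q powr (-3/2 * deg P)" by (rule mult_left_mono[OF key B])
        finally show "f P \<le> B * q powr (-3/2 * deg P)" .
      qed
      also have "\<dots> = B * (\<Sum>P\<in>F. q powr (-3/2 * deg P))" by (rule sum_distrib_left[symmetric])
      also have "\<dots> \<le> B * 1" by (rule mult_left_mono[OF sum_primes_le[OF F] B])
      finally show "sum f F \<le> B" by simp
    qed
  next
    case False
    then show ?thesis using B by (simp add: infsum_not_exists)
  qed
qed

text \<open>Together with \<open>C_const_le\<close> this makes C_q B_q bounded by an absolute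
  constant in \<open>moment_third\<close>.\<close>

lemma B_const_le: "\<bar>B_const R\<bar> \<le> 5"
proof -
  have q: "1 < q" "7 \<le> q" using q_gt1 q_ge7 by simp_all
  have x: "1 \<le> q ^ deg P" for P using q by simp
  have 1: "0 \<le> deg P / ((q ^ deg P)\<^sup>2 + q ^ deg P - 1) \<and> deg P / ((q ^ deg P)\<^sup>2 + q ^ deg P - 1) \<le> 1 * (deg P / (q ^ deg P)\<^sup>2)" for P
    using x[of P] q by (auto intro!: divide_nonneg_nonneg frac_le add_nonneg_nonneg simp: add_increasing)
  have 2: "0 \<le> deg P * ((q ^ deg P + 2) / ((q ^ deg P) ^ 3 + 2 * (q ^ deg P)\<^sup>2 - 1)) \<and> deg P * ((q ^ deg P + 2) / ((q ^ deg P) ^ 3 + 2 * (q ^ deg P)\<^sup>2 - 1)) \<le> 2 * (deg P / (q ^ deg P)\<^sup>2)" for P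
  proof -
    define y where "y = q ^ deg P"
    have y: "1 \<le> y" using x by (simp add: y_def)
    then have y3: "1 \<le> y ^ 3" "1 \<le> y\<^sup>2" by simp_all
    then have pos: "0 < y ^ 3 + 2 * y\<^sup>2 - 1" by linarith
    have "(y + 2) * y\<^sup>2 = y ^ 3 + 2 * y\<^sup>2" by (simp add: power3_eq_cube power2_eq_square algebra_simps)
    moreover have "a + 2 * b \<le> 2 * (a + 2 * b - 1)" if "1 \<le> a" "1 \<le> b" for a b :: real
      using that(1) mult_left_mono[OF that(2), of 2] by (simp add: algebra_simps)
    from this[OF y3] have "y ^ 3 + 2 * y\<^sup>2 \<le> 2 * (y ^ 3 + 2 * y\<^sup>2 - 1)" .
    ultimately have "(y + 2) * y\<^sup>2 \<le> 2 * (y ^ 3 + 2 * y\<^sup>2 - 1)" by (simp only:)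
    then have "(y + 2) / (y ^ 3 + 2 * y\<^sup>2 - 1) \<le> 2 / y\<^sup>2" using pos y3 by (simp add: divide_simps)
    then have "deg P * ((y + 2) / (y ^ 3 + 2 * y\<^sup>2 - 1)) \<le> deg P * (2 / y\<^sup>2)" by (rule mult_left_mono) simp
    moreover have "0 \<le> deg P * ((y + 2) / (y ^ 3 + 2 * y\<^sup>2 - 1))" using pos y by simp
    ultimately show ?thesis by (simp add: y_def mult.commute)
  qed
  have e1: "(\<Sum>\<^sub>\<infinity>P\<in>\<P>. real (Polynomials.degree P) / (poly_norm R P ^ 2 + poly_norm R P - 1)) = (\<Sum>\<^sub>\<infinity>P\<in>\<P>. deg P / ((q ^ deg P)\<^sup>2 + q ^ deg P - 1))"
    by (rule infsum_cong) (simp only: poly_norm_eq prime_M deg_def)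
  have e2: "(\<Sum>\<^sub>\<infinity>P\<in>\<P>. real (Polynomials.degree P) * ((poly_norm R P + 2) / (poly_norm R P ^ 3 + 2 * poly_norm R P ^ 2 - 1))) = (\<Sum>\<^sub>\<infinity>P\<in>\<P>. deg P * ((q ^ deg P + 2) / ((q ^ deg P) ^ 3 + 2 * (q ^ deg P)\<^sup>2 - 1)))"
    by (rule infsum_cong) (simp only: poly_norm_eq prime_M deg_def)
  note s1 = infsum_primes_le[of "\<lambda>P. deg P / ((q ^ deg P)\<^sup>2 + q ^ deg P - 1)" 1, OF 1 zero_le_one]
    and s2 = infsum_primes_le[of "\<lambda>P. deg P * ((q ^ deg P + 2) / ((q ^ deg P) ^ 3 + 2 * (q ^ deg P)\<^sup>2 - 1))" 2, OF 2 zero_le_numeral]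
  have "0 \<le> 1 / (q - 1)" "1 / (q - 1) \<le> 1" using q by (simp_all add: divide_le_eq)
  then show ?thesis unfolding B_const_def e1 e2 using s1 s2 by linarith
qed

section \<open>The family of characters\<close>

lemma SF_iff: "F \<in> M \<Longrightarrow> squarefree_poly R F \<longleftrightarrow> F \<in> SF (deg F)"
proof
  assume F: "F \<in> M" and s: "squarefree_poly R F"
  have "\<not> (P ^. 2) pdivides F" if P: "P \<in> \<P>" for P
  proof
    assume "(P ^. 2) pdivides F"
    then have "(P *. P) pdivides F" using P by (simp add: numeral_2_eq_2)
    then have "P \<in> Units (poly_ring R)" using s P unfolding squarefree_poly_def by simp
    then have "P = \<one>\<^sub>P" using M_units[of P] P by simp
    then show False using prime_not_dvd_one[OF P] P by simp
  qed
  then show "F \<in> SF (deg F)" using Mn_deg_self[OF F] by (simp add: SF_def)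
next
  assume F: "F \<in> M" and s: "F \<in> SF (deg F)"
  show "squarefree_poly R F"
    unfolding squarefree_poly_def
  proof (intro ballI impI)
    fix d assume d: "d \<in> C" "(d *. d) pdivides F"
    have dn: "d \<noteq> []"
    proof
      assume "d = []"
      then have "[] pdivides F" using d by simp
      then show False using F by simp
    qed
    obtain c f where cf: "c \<in> carrier R" "c \<noteq> \<zero>" "f \<in> M" "d = [c] *. f" "length f = length d" using monic_split[OF d(1) dn] by metis
    have "f = \<one>\<^sub>P"
    proof (rule ccontr)
      assume "f \<noteq> \<one>\<^sub>P"
      then obtain P where P: "P \<in> \<P>" "P pdivides f" using ex_prime_dvd[OF cf(3)] by blast
      then obtain e where e: "e \<in> C" "f = P *. e" unfolding dvd_iff by blast
      have c: "[c] \<in> C" "P \<in> C" using cf P by simp_all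
      have "d *. d = (P *. P) *. (([c] *. e) *. ([c] *. e))" unfolding cf(4) e(2) using c e(1) by algebra
      then have "(P *. P) pdivides (d *. d)" using c e(1) by (intro dvdI[of "([c] *. e) *. ([c] *. e)"]) simp_all
      then have "(P *. P) pdivides F" using dvd_trans[of "P *. P" "d *. d" F] d(2) c by simp
      then have "(P ^. 2) pdivides F" using c by (simp add: numeral_2_eq_2)
      then show False using s P(1) by (simp add: SF_def)
    qed
    then have "length d = 1" using cf(5) by simp
    then show "d \<in> Units (poly_ring R)" using d(1) dn by (simp add: units_iff)
  qed
qed

text \<open>A prime dividing the cofactor of \<open>rad (pd F)\<close> in \<open>F\<close> would
  divide \<open>F\<close> twice.\<close>

lemma SF_rad:
  assumes F: "F \<in> SF N" shows "pd F \<in> PS N" "F = rad (pd F)"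
proof -
  have FM: "F \<in> Mn N" "F \<in> M" "F \<in> C" using SF_Mn[OF F] Mn_M by simp_all
  have PS: "pd F \<in> PS (dg (pd F))" using finite_pd[OF FM(2)] pd_subset by (simp add: PS_def)
  note r = rad_props[OF PS]
  have "rad (pd F) pdivides F" using r(4)[OF FM(3)] unfolding pd_def by simp
  from M_dvd_monic[OF r(1) FM(2) this] obtain G where G: "G \<in> M" "F = rad (pd F) *. G" .
  have G1: "G = \<one>\<^sub>P"
  proof (rule ccontr)
    assume "G \<noteq> \<one>\<^sub>P"
    then obtain P where P: "P \<in> \<P>" "P pdivides G" using ex_prime_dvd[OF G(1)] by blast
    have PC: "P \<in> C" using P by simp
    have "P pdivides (rad (pd F) *. G)" using P G(1) r(1) by (intro dvd_mulI(2)) simp_all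
    then have "P pdivides F" by (simp only: G(2)[symmetric])
    then have "P \<in> pd (rad (pd F))" using P r(3) unfolding pd_def by simp
    then have "P pdivides rad (pd F)" unfolding pd_def by simp
    then obtain x where x: "x \<in> C" "rad (pd F) = P *. x" unfolding dvd_iff by blast
    obtain y where y: "y \<in> C" "G = P *. y" using P unfolding dvd_iff by blast
    have "F = P ^. 2 *. (x *. y)"
    proof -
      have "F = (P *. x) *. (P *. y)" using G(2) unfolding x(2)[symmetric] y(2)[symmetric] .
      also have "\<dots> = (P *. P) *. (x *. y)" using PC x(1) y(1) by algebra
      finally show ?thesis using PC by (simp add: numeral_2_eq_2)
    qed
    then have "(P ^. 2) pdivides F" using x y by (intro dvdI[of "x *. y"]) simp_all
    then show False using F P by (simp add: SF_def)
  qed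
  show e: "F = rad (pd F)" by (rule trans[OF G(2)[unfolded G1] UP.r_one[OF M_C[OF r(1)]]])
  have "deg F = dg (pd F)" using arg_cong[OF e, of deg] unfolding r(2) .
  then have "dg (pd F) = N" unfolding Mn_deg_eq[OF FM(1)] by (rule sym)
  then show "pd F \<in> PS N" using PS by simp
qed

text \<open>If a prime P of \<open>F\<close> did not divide \<open>n\<close>, the Chinese remainder
  theorem would give an argument that is 1 modulo \<open>n\<close> and modulo the cofactor of P in
  \<open>F\<close>, but a nonresidue modulo P.\<close>

lemma induced_dvd:
  assumes F: "F \<in> SF N" and n: "n \<in> M" and ind: "induced_modulus R (chi F) n"
  shows "F pdivides n"
proof -
  note r = SF_rad[OF F] and FM = Mn_M[OF SF_Mn[OF F]]
  have FC: "F \<in> C" using FM by simp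
  have "\<forall>P\<in>pd F. P pdivides n"
  proof (rule ballI, rule ccontr)
    fix P assume "P \<in> pd F" and nP: "\<not> P pdivides n"
    then have P: "P \<in> \<P>" "P pdivides F" unfolding pd_def by simp_all
    have PM: "P \<in> M" "P \<in> C" using P by simp_all
    from M_dvd_monic[OF PM(1) FM P(2)] obtain G where G: "G \<in> M" "F = P *. G" .
    have nG: "\<not> P pdivides G"
    proof
      assume "P pdivides G"
      then have "(P *. P) pdivides (P *. G)" using dvd_mul_cancel[of P G P] PM G by simp
      then have "(P ^. 2) pdivides F" using PM by (simp add: G(2) numeral_2_eq_2)
      then show False using F P by (simp add: SF_def)
    qed
    have "\<not> P pdivides (G *. n)" using prime_dvd_mul_iff[OF P(1)] nG nP G n by simp
    then have c: "cop P (G *. n)" using bezout_prime[OF P(1), of "G *. n"] cop_symI G n by simp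
    obtain b where b: "b \<in> C" "\<not> P pdivides b" "Gam P b \<noteq> 1" using exists_nonresidue[OF P(1)] by blast
    obtain a where a: "a \<in> C" "P pdivides (a -. b)" "(G *. n) pdivides (a -. \<one>\<^sub>P)" using crt[OF c b(1), of "\<one>\<^sub>P"] by auto
    have aG: "G pdivides (a -. \<one>\<^sub>P)" using dvd_trans[of G "G *. n"] a(3) dvd_mulI(1)[of G G n] G n by simp
    have an: "n pdivides (a -. \<one>\<^sub>P)" using dvd_trans[of n "G *. n"] a(3) dvd_mulI(2)[of n n G] G n by simp
    have "chi P a = chi P b" using PM a b by (intro chi_cong) simp_all
    also have "\<dots> = Gam P b" using P b by (simp add: chi_prime cr_eq)
    finally have 1: "chi P a \<noteq> 1" using b by simp
    have 2: "chi P a \<noteq> 0" 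
    proof -
      have "cop b P" using bezout_prime[OF P(1) b(1,2)] .
      then have "chi P b \<noteq> 0" using chi_zero[OF PM(1) b(1)] by simp
      then show ?thesis using \<open>chi P a = chi P b\<close> by simp
    qed
    have "chi G a = 1" using chi_cong[OF G(1) a(1) _ aG] chi_a_one[OF G(1)] by simp
    then have 3: "chi F a = chi P a" using G PM by (simp add: chi_mul)
    have "poly_cong R n a \<one>\<^sub>P" using an by (simp add: poly_cong_def)
    then have "chi F a \<noteq> 0 \<and> chi F \<one>\<^sub>P \<noteq> 0 \<and> poly_cong R n a \<one>\<^sub>P" using 2 3 chi_a_one[OF FM] by simp
    then have "chi F a = chi F \<one>\<^sub>P" using ind a(1) M_C[OF one_M] unfolding induced_modulus_def by blast
    then show False using 1 3 chi_a_one[OF FM] by simp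
  qed
  then have "rad (pd F) pdivides n" using rad_props(4)[OF r(1), of n] n by simp
  then show ?thesis by (subst r(2))
qed

text \<open>\<open>F\<close> is a modulus of its character and divides every other one, so a monic
  modulus of least degree is \<open>F\<close>.\<close>

lemma conductor_SF:
  assumes F: "F \<in> SF N" shows "conductor R (chi F) = F"
proof -
  have FM: "F \<in> M" "F \<in> C" using Mn_M[OF SF_Mn[OF F]] by simp_all
  let ?Q = "\<lambda>n. n \<in> M \<and> induced_modulus R (chi F) n"
  have "induced_modulus R (chi F) F"
    unfolding induced_modulus_def poly_cong_def using chi_cong[OF FM(1)] by blast
  then have "?Q F" using FM by simp
  from arg_min_nat_lemma[of ?Q F Polynomials.degree, OF this]
  have c: "?Q (conductor R (chi F))" "Polynomials.degree (conductor R (chi F)) \<le> Polynomials.degree F"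
    unfolding conductor_def using \<open>?Q F\<close> by blast+
  define c where "c = conductor R (chi F)"
  have cM: "c \<in> M" "deg c \<le> deg F" using c by (simp_all add: c_def deg_def)
  have "F pdivides c" using induced_dvd[OF F] c by (simp add: c_def)
  from M_dvd_monic[OF FM(1) cM(1) this] obtain h where h: "h \<in> M" "c = F *. h" .
  then have "deg h = 0" using cM FM by simp
  then have "h = \<one>\<^sub>P" using deg_0_M[OF h(1)] by simp
  then show ?thesis using h FM by (simp add: c_def[symmetric])
qed

lemma even_char_iff: "F \<in> M \<Longrightarrow> even_char R (chi F) \<longleftrightarrow> deg F mod 3 = 0"
proof -
  assume F: "F \<in> M"
  have e: "chi F (poly_of_const c) = om c ^ deg F" if "c \<in> Fs" for c
    using that chi_const[OF F that] poly_of_const_eq[of c] by simp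
  have "even_char R (chi F) \<longleftrightarrow> (\<forall>c\<in>Fs. om c ^ deg F = 1)" unfolding even_char_def using e by simp
  also have "\<dots> \<longleftrightarrow> deg F mod 3 = 0"
  proof
    assume a: "\<forall>c\<in>Fs. om c ^ deg F = 1"
    show "deg F mod 3 = 0"
    proof (rule ccontr)
      assume "deg F mod 3 \<noteq> 0"
      then have "(\<Sum>c\<in>Fs. om c ^ deg F) = 0" using sum_om_pow[of "deg F"] by simp
      moreover have "(\<Sum>c\<in>Fs. om c ^ deg F) = of_nat (card Fs)" using a by simp
      ultimately show False using one_Fs finite_Fs by (metis card_0_eq empty_iff of_nat_eq_0_iff)
    qed
  next
    assume "deg F mod 3 = 0"
    then show "\<forall>c\<in>Fs. om c ^ deg F = 1" using om_pow_mod[of _ "deg F"] by simp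
  qed
  finally show ?thesis .
qed

lemma family_eq: "cubic_family R \<Omega> (3 * g) = chi ` SF (3 * g + 1)"
proof -
  have genus: "char_genus R (chi F) = int (3 * g) \<longleftrightarrow> deg F = 3 * g + 1" if "F \<in> M" "squarefree_poly R F" for F
  proof -
    have "F \<in> SF (deg F)" using SF_iff that by simp
    then have "conductor R (chi F) = F" by (rule conductor_SF)
    then have "char_genus R (chi F) = int (deg F) - 2 + (if deg F mod 3 = 0 then 0 else 1)"
      unfolding char_genus_def even_char_iff[OF that(1)] deg_def by simp
    \<comment> \<open>An even character of this genus would need deg F = 3 g + 2, which is not a
      multiple of 3. So only the odd case, deg F = 3 g + 1, occurs.\<close>
    then show ?thesis by presburger
  qed
  show ?thesis
  proof
    show "cubic_family R \<Omega> (3 * g) \<subseteq> chi ` SF (3 * g + 1)"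
    proof
      fix x assume "x \<in> cubic_family R \<Omega> (3 * g)"
      then obtain F where F: "F \<in> M" "squarefree_poly R F" "x = chi F" "char_genus R (chi F) = int (3 * g)"
        unfolding cubic_family_def chi_def by blast
      then have "F \<in> SF (3 * g + 1)" using genus[OF F(1,2)] SF_iff[OF F(1)] by simp
      then show "x \<in> chi ` SF (3 * g + 1)" using F(3) by blast
    qed
    show "chi ` SF (3 * g + 1) \<subseteq> cubic_family R \<Omega> (3 * g)"
    proof
      fix x assume "x \<in> chi ` SF (3 * g + 1)"
      then obtain F where F: "F \<in> SF (3 * g + 1)" "x = chi F" by blast
      have FM: "F \<in> M" "deg F = 3 * g + 1" using Mn_M[OF SF_Mn[OF F(1)]] Mn_deg_eq[OF SF_Mn[OF F(1)]] by simp_all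
      then have "squarefree_poly R F" using SF_iff[OF FM(1)] F(1) by simp
      then show "x \<in> cubic_family R \<Omega> (3 * g)" using genus[OF FM(1)] FM F(2) unfolding cubic_family_def chi_def by blast
    qed
  qed
qed

text \<open>The family is a set of functions; recovering F as the conductor allows it to be indexed
  by squarefree polynomials without repetition.\<close>

lemma chi_inj: "inj_on chi (SF N)"
  by (rule inj_onI) (metis conductor_SF)

text \<open>From degree N on, the sums of \<open>chi F\<close> run over full periods and vanish,
  since a polynomial whose degree is not a multiple of 3 is no cube.\<close>

lemma dirichlet_L_SF:
  assumes F: "F \<in> SF N" and N: "N mod 3 \<noteq> 0"
  shows "dirichlet_L R s (chi F) = (\<Sum>n<N. of_real (q powr (- s * n)) * (\<Sum>f\<in>Mn n. chi F f))"
proof -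
  have FM: "F \<in> M" "deg F = N" using Mn_M[OF SF_Mn[OF F]] Mn_deg_eq[OF SF_Mn[OF F]] by simp_all
  note q = q_gt1
  have t: "(\<Sum>f | f \<in> M \<and> Polynomials.degree f = n. chi F f * complex_of_real (poly_norm R f powr (- s))) = of_real (q powr (- s * n)) * (\<Sum>f\<in>Mn n. chi F f)" for n
  proof -
    have "{f. f \<in> M \<and> Polynomials.degree f = n} = Mn n"
    proof (rule Set.set_eqI)
      fix f show "f \<in> {f. f \<in> M \<and> Polynomials.degree f = n} \<longleftrightarrow> f \<in> Mn n"
        using Mn_deg[of f n] Mn_M[of f n] unfolding deg_def by blast
    qed
    moreover have "poly_norm R f powr (- s) = q powr (- s * n)" if f: "f \<in> Mn n" for f
    proof -
      have "poly_norm R f = q powr n" using poly_norm_eq[OF Mn_M[OF f]] Mn_deg_eq[OF f] q by (simp add: powr_realpow)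
      then show ?thesis by (simp add: powr_powr mult.commute)
    qed
    ultimately show ?thesis by (simp add: sum_distrib_right[symmetric] mult.commute[of _ "sum (chi F) (Mn n)"])
  qed
  have z: "(\<Sum>f\<in>Mn n. chi F f) = 0" if n: "N \<le> n" for n
  proof -
    have nc: "F \<noteq> h ^. 3" if h: "h \<in> M" for h
    proof
      assume "F = h ^. 3"
      then have "N = 3 * deg h" using FM h by simp
      then show False using N by simp
    qed
    have "(\<Sum>f\<in>Mn n. chi F f) = of_nat (qn ^ (n - deg F)) * (\<Sum>a\<in>Pl (deg F). chi F a)"
      using n FM by (intro sum_Mn_periodic chi_periodic) simp_all
    then show ?thesis using sum_chi_zero[OF FM(1) nc] by simp
  qed
  have "dirichlet_L R s (chi F) = (\<Sum>n. of_real (q powr (- s * n)) * (\<Sum>f\<in>Mn n. chi F f))"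
    unfolding dirichlet_L_def t by (rule refl)
  also have "\<dots> = (\<Sum>n\<in>{..<N}. of_real (q powr (- s * n)) * (\<Sum>f\<in>Mn n. chi F f))"
    using z by (intro suminf_finite) simp_all
  finally show ?thesis .
qed

lemma first_moment_eq:
  "first_moment R \<Omega> g s = (\<Sum>n\<le>3 * g. of_real (q powr (- s * n)) * (TT (3 * g + 1) n / of_nat (card (SF (3 * g + 1)))))"
proof -
  let ?N = "3 * g + 1"
  have N: "?N mod 3 \<noteq> 0" by presburger
  have "(\<Sum>\<chi>\<in>cubic_family R \<Omega> (3 * g). dirichlet_L R s \<chi>) = (\<Sum>F\<in>SF ?N. dirichlet_L R s (chi F))"
    unfolding family_eq by (simp add: sum.reindex[OF chi_inj])
  also have "\<dots> = (\<Sum>F\<in>SF ?N. \<Sum>n<?N. of_real (q powr (- s * n)) * (\<Sum>f\<in>Mn n. chi F f))"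
    by (intro sum.cong refl dirichlet_L_SF[OF _ N])
  also have "\<dots> = (\<Sum>n<?N. of_real (q powr (- s * n)) * TT ?N n)"
    unfolding TT_def sum_distrib_left by (rule sum.swap)
  finally have e: "(\<Sum>\<chi>\<in>cubic_family R \<Omega> (3 * g). dirichlet_L R s \<chi>) = (\<Sum>n\<le>3 * g. of_real (q powr (- s * n)) * TT ?N n)"
    by (simp add: lessThan_Suc_atMost)
  have "card (cubic_family R \<Omega> (3 * g)) = card (SF ?N)" unfolding family_eq by (rule card_image[OF chi_inj])
  then show ?thesis unfolding first_moment_def e by (simp add: sum_distrib_left mult.commute)
qed

text \<open>With m = 3 g - n the factors q^(-s n) and q^(g - 2m/3) combine to q^((1-3s)g)
  q^((s-2/3)m).\<close>

lemma moment_diff: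
  assumes g: "1 \<le> g"
  shows "norm (first_moment R \<Omega> g s - of_real (\<Sum>k\<le>g. (q powr (- 3 * s)) ^ k * aa k))
    \<le> C2 * q powr ((1 - 3 * s) * g) * (\<Sum>m\<le>3 * g. (real m + 1) ^ 6 * q powr ((s - 2/3) * m))"
proof -
  let ?N = "3 * g + 1"
  define A where "A n = (if n mod 3 = 0 then of_real (aa (n div 3)) else (0 :: complex))" for n
  have m: "of_real (\<Sum>k\<le>g. (q powr (- 3 * s)) ^ k * aa k) = (\<Sum>n\<le>3 * g. of_real (q powr (- s * n)) * A n)"
  proof -
    have "(\<Sum>n\<le>3 * g. of_real (q powr (- s * n)) * A n) = (\<Sum>n\<in>(\<lambda>k. 3 * k) ` {..g}. of_real (q powr (- s * n)) * A n)"
    proof (rule sum.mono_neutral_right)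
      show "\<forall>n\<in>{..3 * g} - (\<lambda>k. 3 * k) ` {..g}. of_real (q powr (- s * n)) * A n = 0"
      proof
        fix n assume n: "n \<in> {..3 * g} - (\<lambda>k. 3 * k) ` {..g}"
        have "n mod 3 \<noteq> 0"
        proof
          assume "n mod 3 = 0"
          then obtain k where "n = 3 * k" by auto
          then show False using n by auto
        qed
        then show "of_real (q powr (- s * n)) * A n = 0" by (simp add: A_def)
      qed
    qed auto
    also have "\<dots> = (\<Sum>k\<le>g. of_real (q powr (- s * real (3 * k))) * A (3 * k))"
      by (subst sum.reindex) (auto intro: inj_onI)
    also have "\<dots> = (\<Sum>k\<le>g. of_real ((q powr (- 3 * s)) ^ k * aa k))"
    proof (rule sum.cong[OF refl])
      fix k
      have "q powr (- s * real (3 * k)) = (q powr (- 3 * s)) ^ k" unfolding q_powr_pow by (simp add: mult_ac)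
      then show "of_real (q powr (- s * real (3 * k))) * A (3 * k) = of_real ((q powr (- 3 * s)) ^ k * aa k)" by (simp add: A_def)
    qed
    finally show ?thesis by simp
  qed
  have "norm (first_moment R \<Omega> g s - of_real (\<Sum>k\<le>g. (q powr (- 3 * s)) ^ k * aa k)) 
    = norm (\<Sum>n\<le>3 * g. of_real (q powr (- s * n)) * (TT ?N n / of_nat (card (SF ?N)) - A n))"
    unfolding m first_moment_eq by (simp only: sum_subtractf[symmetric] right_diff_distrib)
  also have "\<dots> \<le> (\<Sum>n\<le>3 * g. q powr (- s * n) * (C2 * (real (3 * g - n) + 1) ^ 6 * q powr (real g - 2/3 * real (3 * g - n))))"
  proof (rule sum_norm_le)
    fix n assume "n \<in> {..3 * g}"
    then have "n + (3 * g - n) = 3 * g" by simp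
    from TT_bound[OF g this]
    show "norm (of_real (q powr (- s * n)) * (TT ?N n / of_nat (card (SF ?N)) - A n)) \<le> q powr (- s * n) * (C2 * (real (3 * g - n) + 1) ^ 6 * q powr (real g - 2/3 * real (3 * g - n)))"
      unfolding norm_mult A_def by (simp add: mult_left_mono)
  qed
  also have "\<dots> = (\<Sum>m\<le>3 * g. C2 * q powr ((1 - 3 * s) * g) * ((real m + 1) ^ 6 * q powr ((s - 2/3) * m)))"
  proof (rule sum.reindex_bij_witness[of _ "\<lambda>m. 3 * g - m" "\<lambda>n. 3 * g - n"])
    fix n assume n: "n \<in> {..3 * g}"
    have "q powr ((1 - 3 * s) * g) * q powr ((s - 2/3) * real (3 * g - n)) = q powr (- s * n) * q powr (real g - 2/3 * real (3 * g - n))"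
      unfolding powr_add[symmetric] using n by (intro arg_cong[of _ _ "\<lambda>x. q powr x"]) (simp add: of_nat_diff field_simps)
    then show "C2 * q powr ((1 - 3 * s) * g) * ((real (3 * g - n) + 1) ^ 6 * q powr ((s - 2/3) * real (3 * g - n)))
      = q powr (- s * n) * (C2 * (real (3 * g - n) + 1) ^ 6 * q powr (real g - 2/3 * real (3 * g - n)))"
      by (metis (no_types, lifting) mult.assoc mult.left_commute)
  qed auto
  finally show ?thesis by (simp only: sum_distrib_left)
qed

end

section \<open>The error term\<close>

text \<open>7 is 6 for the power of m + 1 and 1 for the number of terms. The choice of \<beta> makes
  the seventh power of \<open>exp (\<beta> * n)\<close> equal to the exponential on the right, and 1
  + x <= exp x does the rest.\<close>

lemma poly_exp_bound:
  fixes \<delta> :: real assumes "0 < \<delta>"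
  obtains K where "0 \<le> K" "\<And>n::nat. (3 * real n + 1) ^ 7 \<le> K * 7 powr (\<delta> * n)"
proof -
  define \<beta> where "\<beta> = \<delta> * ln 7 / 7"
  have b: "0 < \<beta>" using assms by (simp add: \<beta>_def)
  define c where "c = max 1 (3 / \<beta>)"
  have c: "1 \<le> c" "3 \<le> c * \<beta>" using b by (simp_all add: c_def max_def field_simps)
  have "(3 * real n + 1) ^ 7 \<le> c ^ 7 * 7 powr (\<delta> * n)" for n :: nat
  proof -
    have "3 * real n + 1 \<le> c * (1 + \<beta> * n)"
      using c(1) mult_right_mono[OF c(2), of "real n"] by (simp add: algebra_simps)
    also have "\<dots> \<le> c * exp (\<beta> * n)" using c by (intro mult_left_mono exp_ge_add_one_self) simp
    finally have "(3 * real n + 1) ^ 7 \<le> (c * exp (\<beta> * n)) ^ 7" by (rule power_mono) simp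
    also have "\<dots> = c ^ 7 * exp (\<beta> * n) ^ 7" by (rule power_mult_distrib)
    also have "exp (\<beta> * n) ^ 7 = 7 powr (\<delta> * n)" by (simp add: \<beta>_def powr_def exp_of_nat_mult[symmetric] mult_ac)
    finally show ?thesis .
  qed
  then show thesis using that[of "c ^ 7"] c by simp
qed

text \<open>One half of the decay pays for the polynomial, the other half is summed as a geometric
  series. Replacing q by 7 keeps the constant independent of q.\<close>

lemma poly_geometric_sum_bound:
  fixes \<delta> :: real assumes d: "0 < \<delta>"
  obtains K where "0 \<le> K" "\<And>q L. 7 \<le> q \<Longrightarrow> (\<Sum>m\<le>L. (real m + 1) ^ 6 * q powr (- \<delta> * m)) \<le> K"
proof -
  obtain K where K: "0 \<le> K" "\<And>n::nat. (3 * real n + 1) ^ 7 \<le> K * 7 powr (\<delta> / 2 * n)" using poly_exp_bound[of "\<delta> / 2"] d by auto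
  define z where "z = (7::real) powr (- \<delta> / 2)"
  have z: "0 < z" "z < 1" using d powr_less_mono[of "- \<delta> / 2" 0 "7::real"] by (simp_all add: z_def)
  have "(\<Sum>m\<le>L. (real m + 1) ^ 6 * q powr (- \<delta> * m)) \<le> K * (1 / (1 - z))" if q: "7 \<le> q" for q and L :: nat
  proof -
    have "(\<Sum>m\<le>L. (real m + 1) ^ 6 * q powr (- \<delta> * m)) \<le> (\<Sum>m\<le>L. K * z ^ m)"
    proof (rule sum_mono)
      fix m :: nat
      have "(real m + 1) ^ 6 \<le> (3 * real m + 1) ^ 6" by (rule power_mono) simp_all
      also have "\<dots> \<le> (3 * real m + 1) ^ 7" by (rule power_increasing) simp_all
      also have "\<dots> \<le> K * 7 powr (\<delta> / 2 * m)" by (rule K(2))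
      finally have 1: "(real m + 1) ^ 6 \<le> K * 7 powr (\<delta> / 2 * m)" .
      have "q powr (- \<delta> * m) \<le> 7 powr (- \<delta> * m)" using q d by (intro powr_mono2') simp_all
      with 1 have "(real m + 1) ^ 6 * q powr (- \<delta> * m) \<le> (K * 7 powr (\<delta> / 2 * m)) * 7 powr (- \<delta> * m)" using K(1) by (intro mult_mono) simp_all
      also have "\<dots> = K * z ^ m" by (simp add: z_def mult.assoc powr_add[symmetric] powr_power mult.commute[of \<delta>])
      finally show "(real m + 1) ^ 6 * q powr (- \<delta> * m) \<le> K * z ^ m" .
    qed
    also have "\<dots> = K * (\<Sum>m\<le>L. z ^ m)" by (rule sum_distrib_left[symmetric])
    also have "\<dots> \<le> K * (\<Sum>m. z ^ m)" using z K(1) by (intro mult_left_mono sum_le_suminf summable_geometric) simp_all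
    also have "\<dots> = K * (1 / (1 - z))" using z by (simp add: suminf_geometric)
    finally show ?thesis .
  qed
  then show thesis using that[of "K * (1 / (1 - z))"] K(1) z by simp
qed

definition error_terms :: "real \<Rightarrow> real \<Rightarrow> nat \<Rightarrow> real \<Rightarrow> real" where
  "error_terms q s g \<epsilon> = q powr (3 / 10 * (1 - 6 * s + \<epsilon>) * real g)
     + q powr (- (1 / 5) * (1 + 9 * s - 15 * \<epsilon>) * real g + 2 - 2 * s)
     + q powr ((1 - 3 * s) * real g) * E_err q s g"

lemma E_err_ge: 
  assumes "7 \<le> q" "1 \<le> g" shows "1 \<le> E_err q s g"
proof -
  have "s < 2 / 3 \<or> s = 2 / 3 \<or> 2 / 3 < s" by linarith
  then show ?thesis
  proof (elim disjE)
    assume s: "2 / 3 < s"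
    have "1 * 1 \<le> real g * q powr (6 / 5 * (3 * s - 2) * real g)"
      using assms s by (intro mult_mono ge_one_powr_ge_zero) simp_all
    then show ?thesis using s by (simp add: E_err_def)
  qed (use assms in \<open>simp_all add: E_err_def\<close>)
qed

lemma error_terms_ge: 
  assumes "7 \<le> q" "1 \<le> g" 
  shows "q powr ((1 - 3 * s) * real g) \<le> error_terms q s g \<epsilon>"
    "q powr ((1 - 3 * s) * real g) * E_err q s g \<le> error_terms q s g \<epsilon>"
    "q powr (3 / 10 * (1 - 6 * s + \<epsilon>) * real g) \<le> error_terms q s g \<epsilon>"
proof -
  have E: "1 \<le> E_err q s g" by (rule E_err_ge[OF assms])
  have "q powr ((1 - 3 * s) * real g) * 1 \<le> q powr ((1 - 3 * s) * real g) * E_err q s g" by (rule mult_left_mono[OF E]) simp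
  moreover show "q powr ((1 - 3 * s) * real g) * E_err q s g \<le> error_terms q s g \<epsilon>" by (simp add: error_terms_def)
  ultimately show "q powr ((1 - 3 * s) * real g) \<le> error_terms q s g \<epsilon>" by simp
  show "q powr (3 / 10 * (1 - 6 * s + \<epsilon>) * real g) \<le> error_terms q s g \<epsilon>" using E by (simp add: error_terms_def)
qed

text \<open>The sixth power of \<open>m\<close> is lost in the error terms: the sum is geometric for \<open>s < 2/3\<close>, the first error term is larger
  by a power of \<open>q\<^sup>g\<close> at \<open>s = 2/3\<close>, and the exponent \<open>6/5\<close> in \<open>E_err\<close> leaves room for \<open>s > 2/3\<close>.\<close>

lemma noncube_error_bound:
  assumes e: "0 < \<epsilon>"
  obtains K where "0 \<le> K" "\<And>q g. 7 \<le> q \<Longrightarrow> 1 \<le> g \<Longrightarrow> 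
    q powr ((1 - 3 * s) * real g) * (\<Sum>m\<le>3 * g. (real m + 1) ^ 6 * q powr ((s - 2/3) * m)) \<le> K * error_terms q s g \<epsilon>"
proof -
  have crude: "(\<Sum>m\<le>3 * g. (real m + 1) ^ 6 * q powr ((s - 2/3) * m)) \<le> (3 * real g + 1) ^ 7 * q powr ((3 * s - 2) * g)"
    if q: "7 \<le> q" and s: "2/3 \<le> s" for q and g :: nat
  proof -
    have "(\<Sum>m\<le>3 * g. (real m + 1) ^ 6 * q powr ((s - 2/3) * m)) \<le> (\<Sum>m\<le>3 * g. (3 * real g + 1) ^ 6 * q powr ((3 * s - 2) * g))"
    proof (intro sum_mono mult_mono power_mono)
      fix m assume "m \<in> {..3 * g}"
      then have m: "real m \<le> 3 * real g" by simp
      then have "(s - 2/3) * m \<le> (s - 2/3) * (3 * real g)" using s by (intro mult_left_mono) simp_all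
      then show "q powr ((s - 2/3) * m) \<le> q powr ((3 * s - 2) * g)" using q by (intro powr_mono) (simp_all add: algebra_simps)
    qed simp_all
    also have "\<dots> = (3 * real g + 1) * ((3 * real g + 1) ^ 6 * q powr ((3 * s - 2) * g))" by (simp add: add.commute)
    also have "\<dots> = (3 * real g + 1) ^ 7 * q powr ((3 * s - 2) * g)"
      by (simp only: mult.assoc[symmetric] power_Suc[symmetric]) simp
    finally show ?thesis .
  qed
  consider "s < 2/3" | "s = 2/3" | "2/3 < s" by linarith
  then show thesis
  proof cases
    case 1
    obtain K where K: "0 \<le> K" "\<And>q L. 7 \<le> q \<Longrightarrow> (\<Sum>m\<le>L. (real m + 1) ^ 6 * q powr (- (2/3 - s) * m)) \<le> K"
      using poly_geometric_sum_bound[of "2/3 - s"] 1 by auto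
    show thesis
    proof (rule that[OF K(1)])
      fix q g assume q: "7 \<le> (q::real)" "1 \<le> (g::nat)"
      have "q powr ((1 - 3 * s) * real g) * (\<Sum>m\<le>3 * g. (real m + 1) ^ 6 * q powr ((s - 2/3) * m)) \<le> q powr ((1 - 3 * s) * real g) * K"
        using K(2)[OF q(1), of "3 * g"] by (intro mult_left_mono) simp_all
      also have "\<dots> \<le> K * error_terms q s g \<epsilon>" using error_terms_ge(1)[OF q, of s \<epsilon>] K(1) by (simp add: mult.commute mult_left_mono)
      finally show "q powr ((1 - 3 * s) * real g) * (\<Sum>m\<le>3 * g. (real m + 1) ^ 6 * q powr ((s - 2/3) * m)) \<le> K * error_terms q s g \<epsilon>" .
    qed
  next
    case 2
    \<comment> \<open>At s = 2/3 the first error term has exponent greater than - 9g/10, while the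
      factor in front of the sum has exponent - g. The gap g/10 absorbs the polynomial.\<close>
    obtain K where K: "0 \<le> K" "\<And>n::nat. (3 * real n + 1) ^ 7 \<le> K * 7 powr (1/10 * n)" using poly_exp_bound[of "1/10"] by auto
    show thesis
    proof (rule that[OF K(1)])
      fix q g assume q: "7 \<le> (q::real)" "1 \<le> (g::nat)"
      have "(\<Sum>m\<le>3 * g. (real m + 1) ^ 6 * q powr ((s - 2/3) * m)) \<le> (3 * real g + 1) ^ 7" using crude[OF q(1), of g] q unfolding 2 by simp
      also have "\<dots> \<le> K * 7 powr (1/10 * g)" by (rule K(2))
      also have "\<dots> \<le> K * q powr (1/10 * g)" using q K(1) by (intro mult_left_mono powr_mono2) simp_all
      finally have "q powr ((1 - 3 * s) * real g) * (\<Sum>m\<le>3 * g. (real m + 1) ^ 6 * q powr ((s - 2/3) * m)) \<le> q powr ((1 - 3 * s) * real g) * (K * q powr (1/10 * g))"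
        by (rule mult_left_mono) simp
      also have "\<dots> = K * q powr (- 9/10 * g)"
      proof -
        have "(1 - 3 * s) * real g + 1/10 * real g = - 9/10 * real g" unfolding 2 by (simp add: field_simps)
        then show ?thesis by (simp only: mult.left_commute[of _ K] powr_add[symmetric])
      qed
      also have "\<dots> \<le> K * q powr (3 / 10 * (1 - 6 * s + \<epsilon>) * real g)"
        using 2 q e K(1) by (intro mult_left_mono powr_mono mult_right_mono) simp_all
      also have "\<dots> \<le> K * error_terms q s g \<epsilon>" by (rule mult_left_mono[OF error_terms_ge(3)[OF q] K(1)])
      finally show "q powr ((1 - 3 * s) * real g) * (\<Sum>m\<le>3 * g. (real m + 1) ^ 6 * q powr ((s - 2/3) * m)) \<le> K * error_terms q s g \<epsilon>" .
    qed
  next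
    case 3
    \<comment> \<open>From 1 + 1/5 = 6/5: the exponent (3s - 2) g of the largest term, enlarged by
      \<delta> g, is the one in \<open>E_err\<close>.\<close>
    define \<delta> where "\<delta> = (3 * s - 2) / 5"
    have d: "0 < \<delta>" using 3 by (simp add: \<delta>_def)
    obtain K where K: "0 \<le> K" "\<And>n::nat. (3 * real n + 1) ^ 7 \<le> K * 7 powr (\<delta> * n)" using poly_exp_bound[OF d] by auto
    show thesis
    proof (rule that[OF K(1)])
      fix q g assume q: "7 \<le> (q::real)" "1 \<le> (g::nat)"
      have "(\<Sum>m\<le>3 * g. (real m + 1) ^ 6 * q powr ((s - 2/3) * m)) \<le> (3 * real g + 1) ^ 7 * q powr ((3 * s - 2) * g)"
        using crude[OF q(1), of g] 3 by simp
      also have "\<dots> \<le> (K * q powr (\<delta> * g)) * q powr ((3 * s - 2) * g)"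
      proof (rule mult_right_mono)
        have "7 powr (\<delta> * g) \<le> q powr (\<delta> * g)" using q d by (intro powr_mono2) simp_all
        then show "(3 * real g + 1) ^ 7 \<le> K * q powr (\<delta> * g)" using K(2)[of g] mult_left_mono[OF _ K(1)] by (meson order_trans)
      qed simp
      also have "\<dots> = K * (1 * q powr (6 / 5 * (3 * s - 2) * real g))" by (simp add: mult.assoc powr_add[symmetric] \<delta>_def) (simp add: field_simps)
      also have "\<dots> \<le> K * (real g * q powr (6 / 5 * (3 * s - 2) * real g))" using q K(1) by (intro mult_left_mono mult_right_mono) simp_all
      also have "\<dots> = K * E_err q s g" using 3 by (simp add: E_err_def)
      finally have "q powr ((1 - 3 * s) * real g) * (\<Sum>m\<le>3 * g. (real m + 1) ^ 6 * q powr ((s - 2/3) * m)) \<le> q powr ((1 - 3 * s) * real g) * (K * E_err q s g)"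
        by (rule mult_left_mono) simp
      also have "\<dots> = K * (q powr ((1 - 3 * s) * real g) * E_err q s g)" by simp
      also have "\<dots> \<le> K * error_terms q s g \<epsilon>" by (rule mult_left_mono[OF error_terms_ge(2)[OF q] K(1)])
      finally show "q powr ((1 - 3 * s) * real g) * (\<Sum>m\<le>3 * g. (real m + 1) ^ 6 * q powr ((s - 2/3) * m)) \<le> K * error_terms q s g \<epsilon>" .
    qed
  qed
qed

definition main_const :: "real \<Rightarrow> real" where
  "main_const s = (2 + 1 / (1 - 7 powr (-3 * s))) / (1 - 7 powr (- \<bar>1 - 3 * s\<bar>))"

lemma main_const_nonneg: "0 < s \<Longrightarrow> s \<noteq> 1/3 \<Longrightarrow> 0 \<le> main_const s"
  using powr_less_mono[of "-3 * s" 0 "7::real"] powr_less_mono[of "- \<bar>1 - 3 * s\<bar>" 0 "7::real"]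
  by (auto simp: main_const_def intro!: divide_nonneg_nonneg add_nonneg_nonneg)

context cubic_field begin

lemma moment_asymp:
  assumes g: "1 \<le> g" and s: "0 < s" "s \<noteq> 1/3"
    and K: "q powr ((1 - 3 * s) * real g) * (\<Sum>m\<le>3 * g. (real m + 1) ^ 6 * q powr ((s - 2/3) * m)) \<le> K * error_terms q s g \<epsilon>"
  shows "norm (first_moment R \<Omega> g s - of_real (M_main R s)) \<le> (C2 * K + main_const s) * error_terms q s g \<epsilon>"
proof -
  define m where "m = (\<Sum>k\<le>g. (q powr (- 3 * s)) ^ k * aa k)"
  have "norm (first_moment R \<Omega> g s - of_real m) \<le> C2 * (q powr ((1 - 3 * s) * g) * (\<Sum>m\<le>3 * g. (real m + 1) ^ 6 * q powr ((s - 2/3) * m)))"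
    using moment_diff[OF g, of s] unfolding m_def by (simp only: mult.assoc)
  also have "\<dots> \<le> C2 * (K * error_terms q s g \<epsilon>)" using C2_pos by (intro mult_left_mono[OF K]) simp
  finally have 1: "norm (first_moment R \<Omega> g s - of_real m) \<le> C2 * (K * error_terms q s g \<epsilon>)" .
  have "\<bar>m - M_main R s\<bar> \<le> main_const s * q powr ((1 - 3 * s) * g)" using main_diff[OF s, of g] by (simp only: m_def main_const_def)
  also have "\<dots> \<le> main_const s * error_terms q s g \<epsilon>" by (rule mult_left_mono[OF error_terms_ge(1)[OF q_ge7 g] main_const_nonneg[OF s]])
  finally have "norm (complex_of_real m - of_real (M_main R s)) \<le> main_const s * error_terms q s g \<epsilon>" unfolding of_real_diff[symmetric] norm_of_real .
  then have "norm (first_moment R \<Omega> g s - of_real (M_main R s)) \<le> C2 * (K * error_terms q s g \<epsilon>) + main_const s * error_terms q s g \<epsilon>"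
    using 1 norm_triangle_ineq[of "first_moment R \<Omega> g s - of_real m" "of_real m - of_real (M_main R s)"] by simp
  then show ?thesis by (simp add: distrib_right)
qed

lemma moment_third:
  assumes g: "1 \<le> g" and K: "(\<Sum>m\<le>3 * g. (real m + 1) ^ 6 * q powr (- (1/3) * m)) \<le> K"
  shows "norm (first_moment R \<Omega> g (1/3) - of_real (C_const R * (real g + B_const R))) \<le> C2 * K + 15"
proof -
  note q = q_gt1
  define m where "m = (\<Sum>k\<le>g. (1 / q) ^ k * aa k)"
  have v: "q powr (- 3 * (1/3)) = 1 / q" using q by (simp add: powr_minus_divide)
  have "norm (first_moment R \<Omega> g (1/3) - of_real m) \<le> C2 * (\<Sum>m\<le>3 * g. (real m + 1) ^ 6 * q powr (- (1/3) * m))"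
    using moment_diff[OF g, of "1/3"] q unfolding v m_def by simp
  also have "\<dots> \<le> C2 * K" using C2_pos by (intro mult_left_mono[OF K]) simp
  finally have 1: "norm (first_moment R \<Omega> g (1/3) - of_real m) \<le> C2 * K" .
  \<comment> \<open>15 is 5 from \<open>third_diff\<close> plus 2 times 5 for C_q B_q.\<close>
  have "\<bar>C_const R * B_const R\<bar> \<le> 2 * 5" unfolding abs_mult by (intro mult_mono C_const_le B_const_le) simp_all
  then have "\<bar>m - C_const R * (real g + B_const R)\<bar> \<le> 15" using third_diff[of g] unfolding m_def distrib_left by linarith
  then have "norm (complex_of_real m - of_real (C_const R * (real g + B_const R))) \<le> 15" unfolding of_real_diff[symmetric] norm_of_real .
  then show ?thesis using 1 norm_triangle_ineq[of "first_moment R \<Omega> g (1/3) - of_real m" "of_real m - of_real (C_const R * (real g + B_const R))"] by simp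
qed

end

lemma cubic_field_exists:
  fixes R :: "'a ring"
  assumes "field R" "finite (carrier R)" "card (carrier R) mod 6 = 1" "cube_root_iso R \<Omega>"
  obtains \<psi> where "cubic_field R \<Omega> \<psi>"
proof -
  interpret F: fin_field R using assms by (simp add: fin_field_def fin_field_axioms_def)
  obtain \<psi> :: "'a \<Rightarrow> complex" where "(\<forall>x\<in>carrier R. \<forall>y\<in>carrier R. \<psi> (x \<oplus>\<^bsub>R\<^esub> y) = \<psi> x * \<psi> y)" "\<forall>x\<in>carrier R. norm (\<psi> x) = 1" "\<exists>x\<in>carrier R. \<psi> x \<noteq> 1"
    using F.exists_additive_character by blast
  then have "cubic_field R \<Omega> \<psi>" using assms F.fin_field_axioms by (simp add: cubic_field_def cubic_field_axioms_def)
  then show thesis by (rule that)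
qed

theorem theorem1p1:
  shows
    "(\<forall>\<epsilon>>0. \<forall>s::real. 0 < s \<and> s < 1 \<and> s \<noteq> 1 / 3 \<longrightarrow>
        (\<exists>K::real. \<forall>(R::'a ring) \<Omega> g.
           field R \<and> finite (carrier R) \<and> card (carrier R) mod 6 = 1 \<and>
           cube_root_iso R \<Omega> \<and> 1 \<le> g \<longrightarrow>
           (let q = real (card (carrier R)) in
             norm (first_moment R \<Omega> g s - complex_of_real (M_main R s))
             \<le> K * (q powr (3 / 10 * (1 - 6 * s + \<epsilon>) * real g)
                    + q powr (- (1 / 5) * (1 + 9 * s - 15 * \<epsilon>) * real g + 2 - 2 * s)
                    + q powr ((1 - 3 * s) * real g) * E_err q s g))))
     \<and>
     (\<exists>K::real. \<forall>(R::'a ring) \<Omega> g.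
        field R \<and> finite (carrier R) \<and> card (carrier R) mod 6 = 1 \<and>
        cube_root_iso R \<Omega> \<and> 2 \<le> g \<longrightarrow>
        norm (first_moment R \<Omega> g (1 / 3)
              - complex_of_real (C_const R * (real g + B_const R))) \<le> K)"
proof (intro conjI allI impI)
  fix \<epsilon> s :: real assume e: "0 < \<epsilon>" and s: "0 < s \<and> s < 1 \<and> s \<noteq> 1 / 3"
  obtain K where K: "0 \<le> K" "\<And>q g. 7 \<le> q \<Longrightarrow> 1 \<le> g \<Longrightarrow> 
    q powr ((1 - 3 * s) * real g) * (\<Sum>m\<le>3 * g. (real m + 1) ^ 6 * q powr ((s - 2/3) * m)) \<le> K * error_terms q s g \<epsilon>"
    using noncube_error_bound[OF e, of s] by auto
  show "\<exists>K::real. \<forall>(R::'a ring) \<Omega> g.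
           field R \<and> finite (carrier R) \<and> card (carrier R) mod 6 = 1 \<and>
           cube_root_iso R \<Omega> \<and> 1 \<le> g \<longrightarrow>
           (let q = real (card (carrier R)) in
             norm (first_moment R \<Omega> g s - complex_of_real (M_main R s))
             \<le> K * (q powr (3 / 10 * (1 - 6 * s + \<epsilon>) * real g)
                    + q powr (- (1 / 5) * (1 + 9 * s - 15 * \<epsilon>) * real g + 2 - 2 * s)
                    + q powr ((1 - 3 * s) * real g) * E_err q s g))"
  \<comment> \<open>The constant is fixed before the field: \<open>K\<close> serves all q >= 7, and
    \<open>main_const\<close> depends on s alone.\<close>
  proof (intro exI[of _ "C2 * K + main_const s"] allI impI)
    fix R :: "'a ring" and \<Omega> and g :: nat
    assume a: "field R \<and> finite (carrier R) \<and> card (carrier R) mod 6 = 1 \<and> cube_root_iso R \<Omega> \<and> 1 \<le> g"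
    then obtain \<psi> where "cubic_field R \<Omega> \<psi>" using cubic_field_exists by metis
    then interpret cubic_field R \<Omega> \<psi> .
    show "let q = real (card (carrier R)) in
             norm (first_moment R \<Omega> g s - complex_of_real (M_main R s))
             \<le> (C2 * K + main_const s) * (q powr (3 / 10 * (1 - 6 * s + \<epsilon>) * real g)
                    + q powr (- (1 / 5) * (1 + 9 * s - 15 * \<epsilon>) * real g + 2 - 2 * s)
                    + q powr ((1 - 3 * s) * real g) * E_err q s g)"
      using moment_asymp[of g s K \<epsilon>] K(2)[OF q_ge7, of g] a s unfolding Let_def error_terms_def by simp
  qed
next
  obtain K where K: "0 \<le> K" "\<And>q L. 7 \<le> q \<Longrightarrow> (\<Sum>m\<le>L. (real m + 1) ^ 6 * q powr (- (1/3) * m)) \<le> K"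
    using poly_geometric_sum_bound[of "1/3"] by auto
  show "\<exists>K::real. \<forall>(R::'a ring) \<Omega> g.
        field R \<and> finite (carrier R) \<and> card (carrier R) mod 6 = 1 \<and>
        cube_root_iso R \<Omega> \<and> 2 \<le> g \<longrightarrow>
        norm (first_moment R \<Omega> g (1 / 3)
              - complex_of_real (C_const R * (real g + B_const R))) \<le> K"
  proof (intro exI[of _ "C2 * K + 15"] allI impI)
    fix R :: "'a ring" and \<Omega> and g :: nat
    assume a: "field R \<and> finite (carrier R) \<and> card (carrier R) mod 6 = 1 \<and> cube_root_iso R \<Omega> \<and> 2 \<le> g"
    then obtain \<psi> where "cubic_field R \<Omega> \<psi>" using cubic_field_exists by metis
    then interpret cubic_field R \<Omega> \<psi> .
    show "norm (first_moment R \<Omega> g (1 / 3) - complex_of_real (C_const R * (real g + B_const R))) \<le> C2 * K + 15"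
      using moment_third[OF _ K(2)[OF q_ge7]] a by simp
  qed
qed

end
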